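(* Let $(g_1,g_1^{-1},g_2,g_2^{-1})$ be an H-M representative in $\mathrm{Ni}(G_1,\mathbf C_{3^4})$. Consider $\mathbf g^*=(g_1,ag_1^{-1}a,bg_2b,g_2^{-1})\in\mathrm{Ni}(G_1,\mathbf C_{3^4})$, where with no loss $a,b\in M\setminus V$. Let $\hat{\mathbf g}^*$ have as entries the unique lifts of the entries of $\mathbf g^*$ to elements of order 3 in $R$. Then the product $\Pi(\hat{\mathbf g}^* )=s(\mathbf g^* )$ of the entries equals $\hat a^{g_1^{-1}}\hat a\hat b\hat b^{g_2^{-1}}$. With no loss, take $\mathbf g^*$ as a representative of a given $\bar M_4$ orbit $O$. Then, if $O=O_1^+$: $$s(\mathbf g^* )=\hat a^{g_1^{-1}}\hat a\hat b\hat b^{g_2^{-1}}=+1,\text{ and }(a,b)\in M_3'\times M_3'\text{ or }M_5'\times M_5'.$$ The corresponding statement for $\mathbf g^*\in O_1^-$ is $$\hat a^{g_1^{-1}}\hat a\hat b\hat b^{g_2^{-1}}=-1,\text{ with }(a,b)\in M_3'\times M_5'\text{ or }M_5'\times M_3'.$$ An $\bar M_4$ orbit satisfying either of these two conditions contains 8 reduced classes of such $\mathbf g^*$.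
   Context: ${}_2\tilde A_5\to A_5$ is the universal 2-Frattini cover (largest profinite Frattini cover with pro-2 kernel $\ker_0$), $\ker_1$ the closed subgroup of $\ker_0$ generated by commutators and squares, $G_1={}_2\tilde A_5/\ker_1$, $M=\ker(G_1\to A_5)=\ker_0/\ker_1$. As an $A_5$ module, $M$ is $(\mathbb Z/2)^6/\langle(1,1,1,1,1,1)\rangle$, with $A_5$ permuting the six coordinates as the six cosets of a dihedral group $D_5$ of order 10. $V\subset M$ is the 4-dimensional image of vectors with even coordinate sum; $G_1/V\cong\mathrm{SL}_2(\mathbb Z/5)$. $M_3'$ (10 elements) and $M_5'$ (6 elements) are the subsets of $M\setminus V$ represented by vectors with exactly three, respectively exactly one, nonzero coordinates. For $m\in M$, $m^g=g^{-1}mg$. $R\to G_1$ is the central Frattini extension with kernel $\{\pm1\}\cong\mathbb Z/2$ given by $R={}_2\tilde A_5/\ker_1'$, where $\ker_0^*=\ker({}_2\tilde A_5\to\mathrm{SL}_2(\mathbb Z/5))$ and $\ker_1'$ is the closure of $(\ker_0,\ker_0^* )(\ker_0^* )^2$. Lifts to $R$ of elements of $M\setminus V$ have order 4, lifts of nontrivial elements of $V$ have order 2. $\hat a,\hat b$ are any lifts of $a,b$ to $R$, and $\hat a^{g}$ denotes conjugation of $\hat a$ by a lift of $g$ (well defined). $\mathrm{Ni}(G_1,\mathbf C_{3^4})=\{\mathbf g\in G_1^4:g_1g_2g_3g_4=1,\langle\mathbf g\rangle=G_1,g_i\text{ of order }3\}$; H-M representatives are elements of the form $(g_1,g_1^{-1},g_2,g_2^{-1})$.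 $H_4=\langle q_1,q_2,q_3\rangle$ acts on $\mathrm{Ni}(G_1,\mathbf C_{3^4})$ modulo conjugation by $G_1$ via $(\mathbf g)q_i=(\dots,g_ig_{i+1}g_i^{-1},g_i,\dots)$. With $\mathcal Q=\langle(q_1q_2q_3)^2,q_1q_3^{-1}\rangle\triangleleft H_4$, reduced classes are the orbits of $\mathcal Q$ on inner classes, and $\bar M_4=H_4/\mathcal Q$ acts on them. There are exactly two $\bar M_4$ orbits: $O_1^+$ contains H-M representatives, $O_1^-$ is the other.
   Formalization: For a fixed H-M representative, 8 reduced classes fails in O_1^- (some g* coincide under Q). Proved instead: exactly 8 reduced classes in O_1^+, exactly 8 inner classes in each orbit, and at least 8 reduced classes in each orbit over all H-M representatives. *)

theory Defs
  imports
    "HOL-Analysis.Analysis"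
    "HOL-Algebra.Sym_Groups"
    "HOL-Algebra.Group_Action"
    "HOL-Algebra.Product_Groups"
    "HOL-Algebra.Multiplicative_Group"
begin

section \<open>Profinite groups and the universal p-Frattini cover\<close>

definition topological_group :: "('a, 'm) monoid_scheme \<Rightarrow> 'a topology \<Rightarrow> bool" where
  "topological_group G T \<longleftrightarrow>
     group G \<and> topspace T = carrier G \<and>
     continuous_map (prod_topology T T) T (\<lambda>(x, y). x \<otimes>\<^bsub>G\<^esub> y) \<and>
     continuous_map T T (\<lambda>x. inv\<^bsub>G\<^esub> x)"

definition profinite_group :: "('a, 'm) monoid_scheme \<Rightarrow> 'a topology \<Rightarrow> bool" where
  "profinite_group G T \<longleftrightarrow>
     topological_group G T \<and> compact_space T \<and> Hausdorff_space T \<and>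
     (\<forall>S. connectedin T S \<longrightarrow> (\<exists>x. S \<subseteq> {x}))"

definition pro_p_group :: "nat \<Rightarrow> ('a, 'm) monoid_scheme \<Rightarrow> 'a topology \<Rightarrow> bool" where
  "pro_p_group p G T \<longleftrightarrow>
     profinite_group G T \<and>
     (\<forall>N. N \<lhd> G \<and> openin T N \<longrightarrow> (\<exists>k. card (rcosets\<^bsub>G\<^esub> N) = p ^ k))"

definition continuous_epi ::
  "('a, 'm) monoid_scheme \<Rightarrow> 'a topology \<Rightarrow> ('b, 'n) monoid_scheme \<Rightarrow> 'b topology \<Rightarrow> ('a \<Rightarrow> 'b) \<Rightarrow> bool"
where
  "continuous_epi G T H S f \<longleftrightarrow>
     f \<in> hom G H \<and> f ` carrier G = carrier H \<and> continuous_map T S f"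

text \<open>A Frattini cover of the finite (discrete) group \<open>A\<close> with pro-\<open>p\<close> kernel: no proper closed
  subgroup of \<open>H\<close> maps onto \<open>A\<close>.\<close>

definition p_frattini_cover ::
  "nat \<Rightarrow> ('a, 'm) monoid_scheme \<Rightarrow> ('h, 'n) monoid_scheme \<Rightarrow> 'h topology \<Rightarrow> ('h \<Rightarrow> 'a) \<Rightarrow> bool"
where
  "p_frattini_cover p A H T \<psi> \<longleftrightarrow>
     profinite_group H T \<and>
     continuous_epi H T A (discrete_topology (carrier A)) \<psi> \<and>
     (\<forall>C. subgroup C H \<and> closedin T C \<and> \<psi> ` C = carrier A \<longrightarrow> C = carrier H) \<and>
     pro_p_group p (H\<lparr>carrier := kernel H A \<psi>\<rparr>) (subtopology T (kernel H A \<psi>))"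

text \<open>The universal \<open>p\<close>-Frattini cover is the largest one: it maps onto every other one over \<open>A\<close>.
  A profinite Frattini cover of a finite group is topologically finitely generated, so it has
  at most the cardinality of the continuum. Hence every cover has a copy on a subset of the type
  \<^typ>\<open>nat set\<close>, and letting \<open>H\<close> range over that type loses nothing.\<close>

definition universal_p_frattini_cover ::
  "nat \<Rightarrow> ('a, 'm) monoid_scheme \<Rightarrow> ('h, 'n) monoid_scheme \<Rightarrow> 'h topology \<Rightarrow> ('h \<Rightarrow> 'a) \<Rightarrow> bool"
where
  "universal_p_frattini_cover p A P T \<phi> \<longleftrightarrow>
     p_frattini_cover p A P T \<phi> \<and>
     (\<forall>(H :: nat set monoid) S \<psi>. p_frattini_cover p A H S \<psi> \<longrightarrow>
        (\<exists>\<theta>. continuous_epi P T H S \<theta> \<and> (\<forall>x\<in>carrier P. \<psi> (\<theta> x) = \<phi> x)))"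

text \<open>The closed subgroup \<open>closure ((K, L) L\<^sup>2)\<close> generated by the commutators of \<open>K\<close> with \<open>L\<close> and the
  squares of \<open>L\<close>.\<close>

definition comm_sq_closure ::
  "('a, 'm) monoid_scheme \<Rightarrow> 'a topology \<Rightarrow> 'a set \<Rightarrow> 'a set \<Rightarrow> 'a set"
where
  "comm_sq_closure P T K L =
     T closure_of (generate P
       ({inv\<^bsub>P\<^esub> k \<otimes>\<^bsub>P\<^esub> inv\<^bsub>P\<^esub> l \<otimes>\<^bsub>P\<^esub> k \<otimes>\<^bsub>P\<^esub> l | k l. k \<in> K \<and> l \<in> L} \<union> {l \<otimes>\<^bsub>P\<^esub> l | l. l \<in> L}))"

definition SL2_Z5 :: "(5 ^ 2 ^ 2) monoid" where
  "SL2_Z5 = \<lparr>carrier = {A. det A = 1}, mult = (**), one = mat 1\<rparr>"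


section \<open>The permutation module on the six cosets of a dihedral group\<close>

definition dihedral_D5 :: "(nat \<Rightarrow> nat) set \<Rightarrow> bool" where
  "dihedral_D5 D \<longleftrightarrow>
     (\<exists>r\<in>carrier (alt_group 5). \<exists>s\<in>carrier (alt_group 5).
        group.ord (alt_group 5) r = 5 \<and> group.ord (alt_group 5) s = 2 \<and>
        s \<otimes>\<^bsub>alt_group 5\<^esub> r \<otimes>\<^bsub>alt_group 5\<^esub> inv\<^bsub>alt_group 5\<^esub> s = inv\<^bsub>alt_group 5\<^esub> r \<and>
        D = generate (alt_group 5) {r, s})"

definition coset_vectors :: "(nat \<Rightarrow> nat) set \<Rightarrow> ((nat \<Rightarrow> nat) set \<Rightarrow> int) monoid" where
  "coset_vectors D = product_group (rcosets\<^bsub>alt_group 5\<^esub> D) (\<lambda>_. integer_mod_group 2)"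

definition constant_vectors :: "(nat \<Rightarrow> nat) set \<Rightarrow> ((nat \<Rightarrow> nat) set \<Rightarrow> int) set" where
  "constant_vectors D =
     generate (coset_vectors D) {\<lambda>\<omega>\<in>rcosets\<^bsub>alt_group 5\<^esub> D. 1}"

definition weight :: "(nat \<Rightarrow> nat) set \<Rightarrow> ((nat \<Rightarrow> nat) set \<Rightarrow> int) \<Rightarrow> nat" where
  "weight D v = card {\<omega> \<in> rcosets\<^bsub>alt_group 5\<^esub> D. v \<omega> \<noteq> 0}"

text \<open>The right action on vectors that moves the coordinate at the coset \<open>D x\<close> to the coset
  \<open>D x g\<close>.\<close>

definition coset_act ::
  "(nat \<Rightarrow> nat) set \<Rightarrow> ((nat \<Rightarrow> nat) set \<Rightarrow> int) \<Rightarrow> (nat \<Rightarrow> nat) \<Rightarrow> (nat \<Rightarrow> nat) set \<Rightarrow> int"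
where
  "coset_act D v g =
     (\<lambda>\<omega>\<in>rcosets\<^bsub>alt_group 5\<^esub> D. v (\<omega> #>\<^bsub>alt_group 5\<^esub> inv\<^bsub>alt_group 5\<^esub> g))"

text \<open>The class of a vector modulo \<open>\<langle>(1,1,1,1,1,1)\<rangle>\<close>.\<close>

definition vec_class ::
  "(nat \<Rightarrow> nat) set \<Rightarrow> ((nat \<Rightarrow> nat) set \<Rightarrow> int) \<Rightarrow> ((nat \<Rightarrow> nat) set \<Rightarrow> int) set"
where
  "vec_class D v = constant_vectors D #>\<^bsub>coset_vectors D\<^esub> v"

definition conj_by :: "('g, 'm) monoid_scheme \<Rightarrow> 'g \<Rightarrow> 'g \<Rightarrow> 'g" where
  "conj_by G m g = inv\<^bsub>G\<^esub> g \<otimes>\<^bsub>G\<^esub> m \<otimes>\<^bsub>G\<^esub> g"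

text \<open>\<open>\<iota>\<close> identifies the normal subgroup \<open>M\<close> of \<open>G\<close>, with \<open>G\<close> acting on it by \<open>m\<^sup>g = g\<^sup>-\<^sup>1 m g\<close>
  through \<open>pr : G \<rightarrow> A\<^sub>5\<close>, with \<open>(\<int>/2)\<^sup>6/\<langle>(1,1,1,1,1,1)\<rangle>\<close>.\<close>

definition coset_module_iso ::
  "(nat \<Rightarrow> nat) set \<Rightarrow> ('g, 'm) monoid_scheme \<Rightarrow> ('g \<Rightarrow> nat \<Rightarrow> nat) \<Rightarrow> 'g set \<Rightarrow>
   (((nat \<Rightarrow> nat) set \<Rightarrow> int) set \<Rightarrow> 'g) \<Rightarrow> bool"
where
  "coset_module_iso D G pr M \<iota> \<longleftrightarrow>
     \<iota> \<in> iso (coset_vectors D Mod constant_vectors D) (G\<lparr>carrier := M\<rparr>) \<and>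
     (\<forall>v\<in>carrier (coset_vectors D). \<forall>g\<in>carrier G.
        \<iota> (vec_class D (coset_act D v (pr g))) = conj_by G (\<iota> (vec_class D v)) g)"


section \<open>Nielsen classes, braid action and reduced classes\<close>

type_synonym 'g quad = "'g \<times> 'g \<times> 'g \<times> 'g"

definition nielsen_C3_4 :: "('g, 'm) monoid_scheme \<Rightarrow> 'g quad set" where
  "nielsen_C3_4 G =
     {(g1, g2, g3, g4).
        {g1, g2, g3, g4} \<subseteq> {g \<in> carrier G. group.ord G g = 3} \<and>
        g1 \<otimes>\<^bsub>G\<^esub> g2 \<otimes>\<^bsub>G\<^esub> g3 \<otimes>\<^bsub>G\<^esub> g4 = \<one>\<^bsub>G\<^esub> \<and>
        generate G {g1, g2, g3, g4} = carrier G}"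

definition HM_tuple :: "('g, 'm) monoid_scheme \<Rightarrow> 'g \<Rightarrow> 'g \<Rightarrow> 'g quad" where
  "HM_tuple G g1 g2 = (g1, inv\<^bsub>G\<^esub> g1, g2, inv\<^bsub>G\<^esub> g2)"

definition inner_class :: "('g, 'm) monoid_scheme \<Rightarrow> 'g quad \<Rightarrow> 'g quad set" where
  "inner_class G = (\<lambda>(g1, g2, g3, g4).
     {(conj_by G g1 h, conj_by G g2 h, conj_by G g3 h, conj_by G g4 h) | h. h \<in> carrier G})"

definition inner_classes :: "('g, 'm) monoid_scheme \<Rightarrow> 'g quad set set" where
  "inner_classes G = inner_class G ` nielsen_C3_4 G"

definition twist1 :: "('g, 'm) monoid_scheme \<Rightarrow> 'g quad \<Rightarrow> 'g quad" where
  "twist1 G = (\<lambda>(g1, g2, g3, g4). (g1 \<otimes>\<^bsub>G\<^esub> g2 \<otimes>\<^bsub>G\<^esub> inv\<^bsub>G\<^esub> g1, g1, g3, g4))"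

definition twist2 :: "('g, 'm) monoid_scheme \<Rightarrow> 'g quad \<Rightarrow> 'g quad" where
  "twist2 G = (\<lambda>(g1, g2, g3, g4). (g1, g2 \<otimes>\<^bsub>G\<^esub> g3 \<otimes>\<^bsub>G\<^esub> inv\<^bsub>G\<^esub> g2, g2, g4))"

definition twist3 :: "('g, 'm) monoid_scheme \<Rightarrow> 'g quad \<Rightarrow> 'g quad" where
  "twist3 G = (\<lambda>(g1, g2, g3, g4). (g1, g2, g3 \<otimes>\<^bsub>G\<^esub> g4 \<otimes>\<^bsub>G\<^esub> inv\<^bsub>G\<^esub> g3, g3))"

abbreviation inner_perms :: "('g, 'm) monoid_scheme \<Rightarrow> ('g quad set \<Rightarrow> 'g quad set) monoid" where
  "inner_perms G \<equiv> BijGroup (inner_classes G)"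

definition on_inner ::
  "('g, 'm) monoid_scheme \<Rightarrow> ('g quad \<Rightarrow> 'g quad) \<Rightarrow> 'g quad set \<Rightarrow> 'g quad set"
where
  "on_inner G q = (\<lambda>c\<in>inner_classes G. q ` c)"

text \<open>\<open>H\<^sub>4\<close> enters only through the permutation group that it induces on the inner classes. Its action
  is a right action, whereas the product of \<^const>\<open>BijGroup\<close> is composition of functions, so
  words are written in reverse order.\<close>

definition H4 :: "('g, 'm) monoid_scheme \<Rightarrow> ('g quad set \<Rightarrow> 'g quad set) monoid" where
  "H4 G = (inner_perms G)\<lparr>carrier :=
     generate (inner_perms G) {on_inner G (twist1 G), on_inner G (twist2 G), on_inner G (twist3 G)}\<rparr>"

definition Q_group :: "('g, 'm) monoid_scheme \<Rightarrow> ('g quad set \<Rightarrow> 'g quad set) set" where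
  "Q_group G =
     (let q1 = on_inner G (twist1 G); q2 = on_inner G (twist2 G); q3 = on_inner G (twist3 G)
      in generate (inner_perms G)
           {(q3 \<otimes>\<^bsub>inner_perms G\<^esub> q2 \<otimes>\<^bsub>inner_perms G\<^esub> q1) [^]\<^bsub>inner_perms G\<^esub> (2::nat),
            inv\<^bsub>inner_perms G\<^esub> q3 \<otimes>\<^bsub>inner_perms G\<^esub> q1})"

definition reduced_class :: "('g, 'm) monoid_scheme \<Rightarrow> 'g quad \<Rightarrow> 'g quad set set" where
  "reduced_class G g = {h (inner_class G g) | h. h \<in> Q_group G}"

definition reduced_classes :: "('g, 'm) monoid_scheme \<Rightarrow> 'g quad set set set" where
  "reduced_classes G = reduced_class G ` nielsen_C3_4 G"

text \<open>All elements \<open>h\<close> of a coset \<open>C \<in> H\<^sub>4/Q\<close> send a given \<open>Q\<close>-orbit \<open>X\<close> to the same \<open>Q\<close>-orbit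
  \<open>h ` X\<close>.\<close>

definition M4_orbits :: "('g, 'm) monoid_scheme \<Rightarrow> 'g quad set set set set" where
  "M4_orbits G =
     Group_Action.orbits (H4 G Mod Q_group G) (reduced_classes G) (\<lambda>C X. \<Union>h\<in>C. h ` X)"


section \<open>Lifting to the central extension and the tuples under study\<close>

definition lifts :: "('r, 'n) monoid_scheme \<Rightarrow> ('r \<Rightarrow> 'g) \<Rightarrow> 'g \<Rightarrow> 'r set" where
  "lifts R \<pi> x = {y \<in> carrier R. \<pi> y = x}"

definition lift3 :: "('r, 'n) monoid_scheme \<Rightarrow> ('r \<Rightarrow> 'g) \<Rightarrow> 'g \<Rightarrow> 'r" where
  "lift3 R \<pi> x = (THE y. y \<in> lifts R \<pi> x \<and> group.ord R y = 3)"

definition lift_invariant :: "('r, 'n) monoid_scheme \<Rightarrow> ('r \<Rightarrow> 'g) \<Rightarrow> 'g quad \<Rightarrow> 'r" where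
  "lift_invariant R \<pi> = (\<lambda>(g1, g2, g3, g4).
     lift3 R \<pi> g1 \<otimes>\<^bsub>R\<^esub> lift3 R \<pi> g2 \<otimes>\<^bsub>R\<^esub> lift3 R \<pi> g3 \<otimes>\<^bsub>R\<^esub> lift3 R \<pi> g4)"

definition g_star :: "('g, 'm) monoid_scheme \<Rightarrow> 'g \<Rightarrow> 'g \<Rightarrow> 'g \<Rightarrow> 'g \<Rightarrow> 'g quad" where
  "g_star G g1 g2 a b =
     (g1, a \<otimes>\<^bsub>G\<^esub> inv\<^bsub>G\<^esub> g1 \<otimes>\<^bsub>G\<^esub> a, b \<otimes>\<^bsub>G\<^esub> g2 \<otimes>\<^bsub>G\<^esub> b, inv\<^bsub>G\<^esub> g2)"

definition HM_rep :: "('g, 'm) monoid_scheme \<Rightarrow> 'g \<Rightarrow> 'g \<Rightarrow> bool" where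
  "HM_rep G g1 g2 \<longleftrightarrow> HM_tuple G g1 g2 \<in> nielsen_C3_4 G"

text \<open>\<open>N\<close> is the set from which \<open>a\<close> and \<open>b\<close> are taken (it will be \<open>M - V\<close>).\<close>

definition g_star_in_Ni ::
  "('g, 'm) monoid_scheme \<Rightarrow> 'g set \<Rightarrow> 'g \<Rightarrow> 'g \<Rightarrow> 'g \<Rightarrow> 'g \<Rightarrow> bool"
where
  "g_star_in_Ni G N g1 g2 a b \<longleftrightarrow>
     HM_rep G g1 g2 \<and> a \<in> N \<and> b \<in> N \<and> g_star G g1 g2 a b \<in> nielsen_C3_4 G"

text \<open>The values of the expression built from lifts of \<open>a\<close>, \<open>b\<close>, \<open>g1\<^sup>-\<^sup>1\<close>, \<open>g2\<^sup>-\<^sup>1\<close>, over all choices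
  of the lifts; its being independent of the choices is not built in.\<close>

definition lift_products ::
  "('r, 'n) monoid_scheme \<Rightarrow> ('r \<Rightarrow> 'g) \<Rightarrow> ('g, 'm) monoid_scheme \<Rightarrow> 'g \<Rightarrow> 'g \<Rightarrow> 'g \<Rightarrow> 'g \<Rightarrow> 'r set"
where
  "lift_products R \<pi> G g1 g2 a b =
     {conj_by R ah k1 \<otimes>\<^bsub>R\<^esub> ah \<otimes>\<^bsub>R\<^esub> bh \<otimes>\<^bsub>R\<^esub> conj_by R bh k2 | ah bh k1 k2.
        ah \<in> lifts R \<pi> a \<and> bh \<in> lifts R \<pi> b \<and>
        k1 \<in> lifts R \<pi> (inv\<^bsub>G\<^esub> g1) \<and> k2 \<in> lifts R \<pi> (inv\<^bsub>G\<^esub> g2)}"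

end

theory Submission
  imports Defs
begin

text \<open>
  Write \<open>X\<close> for the six cosets and \<open>m S\<close> for the class of the vector with support \<open>S \<subseteq> X\<close>, so that
  \<open>m S = m (X - S)\<close>. Then \<open>M - V\<close> consists of the \<open>m S\<close> with \<open>|S|\<close> odd: six with \<open>|S| = 1\<close>, forming
  \<open>M\<^sub>5'\<close>, and ten with \<open>|S| = 3\<close>, forming \<open>M\<^sub>3'\<close>. Let \<open>z\<close> generate the kernel of \<open>R \<rightarrow> G\<^sub>1\<close>.

  \<^bold>\<open>The value of the invariant.\<close> A lift to \<open>R\<close> of the basis vector \<open>m {i}\<close> is fixed under conjugation by
  everything that fixes the point \<open>i\<close> (\<open>stabilizer_fixes_lift\<close>). Hence the basis vectors have lifts
  that \<open>R\<close> permutes as it permutes \<open>X\<close>. Let \<open>U S\<close> be the product of these lifts over \<open>S\<close>. Lifts of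
  \<open>M - V\<close> have square \<open>z\<close>, so \<open>U S U T = z\<^sup>k U (S \<triangle> T)\<close> with \<open>k = |S \<inter> T|\<close>, and \<open>U X = 1\<close> (\<open>U_X\<close>).
  For \<open>a = m A\<close> and \<open>b = m B\<close> the lift product therefore is \<open>z\<close> to the power
  \<open>|A\<^bsup>1/g\<^sub>1\<^esup> \<inter> A| + |B \<inter> B\<^bsup>1/g\<^sub>2\<^esup>|\<close>. An element of order three permutes \<open>X\<close> in two cycles of length
  three, and for a suitable choice between \<open>A\<close> and \<open>X - A\<close> the set meets its image in an odd number of
  points exactly when \<open>a \<in> M\<^sub>3'\<close> (\<open>inter_image_parity\<close>). So the invariant is \<open>1\<close> when \<open>a\<close>, \<open>b\<close> lie both
  in \<open>M\<^sub>3'\<close> or both in \<open>M\<^sub>5'\<close>, and \<open>z\<close> otherwise (\<open>lift_invariant_value\<close>).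

  \<^bold>\<open>The number of tuples.\<close> The tuple of \<open>(a, b)\<close> has product one exactly when
  \<open>a\<^bsup>1/g\<^sub>1\<^esup> a = b b\<^bsup>1/g\<^sub>2\<^esup>\<close>. Each side, as a function of \<open>a\<close> or of \<open>b\<close>, is a bijection from \<open>M - V\<close> onto \<open>V\<close>
  (\<open>tw_bij\<close>), so each of the sixteen \<open>a\<close> has one partner \<open>b\<close>. The pairs of singletons correspond to
  common edges of the two cycle decompositions of \<open>X\<close> given by \<open>g\<^sub>1\<close> and \<open>g\<^sub>2\<close>, and there are two of
  them (\<open>card_two_edges\<close>). Hence \<open>M\<^sub>5' \<times> M\<^sub>5'\<close>, \<open>M\<^sub>5' \<times> M\<^sub>3'\<close>, \<open>M\<^sub>3' \<times> M\<^sub>5'\<close> and \<open>M\<^sub>3' \<times> M\<^sub>3'\<close> contain 2, 4, 4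
  and 6 of the sixteen pairs: eight pairs have invariant \<open>1\<close> and eight have invariant \<open>z\<close>.

  \<^bold>\<open>Orbits and classes.\<close> Lifts of order three are unique, so braids and conjugation preserve the
  invariant and it is constant on the orbits of \<open>M\<^sub>4\<close>; it is \<open>1\<close> on tuples \<open>(g\<^sub>1, 1/g\<^sub>1, g\<^sub>2, 1/g\<^sub>2)\<close>. As
  both values occur and there are two orbits, the orbits are the two level sets (\<open>two_orbits\<close>). On
  inner classes \<open>Q\<close> acts through a Klein four-group generated by explicit moves (\<open>Q_group_subset\<close>).
  A coincidence between reduced classes of two tuples built from the same \<open>g\<^sub>1\<close>, \<open>g\<^sub>2\<close> forces invariant
  \<open>z\<close>, because \<open>(1/g\<^sub>2 g\<^sub>1)\<^sup>5\<close> is a basis vector, whose lifts have order four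
  (\<open>inverted_ratio_value\<close>). So the eight tuples with invariant \<open>1\<close> lie in eight reduced classes
  (\<open>card_matched_classes\<close>). With invariant \<open>z\<close> coincidences are not excluded for fixed \<open>g\<^sub>1\<close>, \<open>g\<^sub>2\<close>;
  letting \<open>g\<^sub>2\<close> run through its conjugates under \<open>V\<close> gives 128 tuples, at most eight in each reduced
  class (\<open>many_mixed_classes\<close>).

  \<^bold>\<open>The groups.\<close> The above uses only the properties of \<open>G\<^sub>1\<close>, \<open>R\<close> and the action on \<open>X\<close> that are
  collected in the locale \<open>six_point_cover\<close>. They follow from the map \<open>\<sigma>\<close> to \<open>SL\<^sub>2(\<int>/5)\<close>: counting
  orders gives \<open>\<sigma>(ker\<^sub>0) = \<plusminus>1\<close> and \<open>ker \<sigma> \<subseteq> ker\<^sub>0\<close> (\<open>card_two_quotients\<close>), so \<open>\<sigma>\<close> detects \<open>V\<close>. A trace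
  computation for two matrices of order three shows that their ratio \<open>W\<close> has \<open>W\<^sup>5 = -1\<close>, except in
  cases in which the images in \<open>A\<^sub>5\<close> generate a solvable group (\<open>mat5_ratio\<close>, \<open>generating_ratio\<close>). All
  remaining properties concern \<open>A\<^sub>5\<close> acting on the cosets of a dihedral subgroup.
\<close>

section \<open>Nielsen tuples up to conjugation\<close>

definition conj_quad :: "('g, 'm) monoid_scheme \<Rightarrow> 'g \<Rightarrow> 'g quad \<Rightarrow> 'g quad" where
  "conj_quad G h = (\<lambda>(a, b, c, d). (conj_by G a h, conj_by G b h, conj_by G c h, conj_by G d h))"

lemma inner_class_conj_quad: "inner_class G x = {conj_quad G h x | h. h \<in> carrier G}"
  by (simp add: inner_class_def conj_quad_def split: prod.splits)

context group
begin

lemma inv_mult_cancel [simp]: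
  assumes "x \<in> carrier G" "y \<in> carrier G"
  shows "inv x \<otimes> (x \<otimes> y) = y" "x \<otimes> (inv x \<otimes> y) = y"
  using assms by (simp_all flip: m_assoc)

lemma conj_by_closed [simp, intro]:
  "x \<in> carrier G \<Longrightarrow> h \<in> carrier G \<Longrightarrow> conj_by G x h \<in> carrier G"
  by (simp add: conj_by_def)

lemma conj_by_mult:
  assumes "x \<in> carrier G" "y \<in> carrier G" "h \<in> carrier G"
  shows "conj_by G (x \<otimes> y) h = conj_by G x h \<otimes> conj_by G y h"
  using assms by (simp add: conj_by_def m_assoc)

lemma conj_by_one_left [simp]: "h \<in> carrier G \<Longrightarrow> conj_by G \<one> h = \<one>"
  by (simp add: conj_by_def)

lemma conj_by_one [simp]: "x \<in> carrier G \<Longrightarrow> conj_by G x \<one> = x"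
  by (simp add: conj_by_def)

lemma conj_by_inv:
  assumes "x \<in> carrier G" "h \<in> carrier G"
  shows "conj_by G (inv x) h = inv (conj_by G x h)"
  using assms by (simp add: conj_by_def inv_mult_group m_assoc)

lemma conj_by_conj_by:
  assumes "x \<in> carrier G" "h \<in> carrier G" "k \<in> carrier G"
  shows "conj_by G (conj_by G x h) k = conj_by G x (h \<otimes> k)"
  using assms by (simp add: conj_by_def inv_mult_group m_assoc)

lemma conj_by_pow:
  assumes "x \<in> carrier G" "h \<in> carrier G"
  shows "conj_by G (x [^] (n::nat)) h = conj_by G x h [^] n"
  using assms by (induction n) (simp_all add: conj_by_mult)

lemma conj_by_inject:
  assumes "x \<in> carrier G" "y \<in> carrier G" "h \<in> carrier G"
  shows "conj_by G x h = conj_by G y h \<longleftrightarrow> x = y"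
  using assms by (auto simp: conj_by_def)

lemma ord_conj_by:
  assumes "x \<in> carrier G" "h \<in> carrier G"
  shows "ord (conj_by G x h) = ord x"
proof -
  have "conj_by G x h [^] n = \<one> \<longleftrightarrow> x [^] n = \<one>" for n :: nat
    using assms by (metis conj_by_inject conj_by_one_left conj_by_pow nat_pow_closed one_closed)
  then show ?thesis using assms
    by (metis conj_by_closed dvd_antisym pow_eq_id dvd_refl)
qed

lemma conj_by_commute:
  assumes "x \<in> carrier G" "h \<in> carrier G"
  shows "conj_by G x h = x \<longleftrightarrow> x \<otimes> h = h \<otimes> x"
  using assms by (simp add: conj_by_def) (metis inv_closed inv_solve_left m_assoc m_closed)

section \<open>Braids on Nielsen tuples\<close>

lemma nielsen_carrier:
  assumes "(a, b, c, d) \<in> nielsen_C3_4 G"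
  shows "a \<in> carrier G" "b \<in> carrier G" "c \<in> carrier G" "d \<in> carrier G"
  using assms by (auto simp: nielsen_C3_4_def)

lemma conj_quad_conj_quad:
  assumes "x \<in> carrier G \<times> carrier G \<times> carrier G \<times> carrier G" "h \<in> carrier G" "k \<in> carrier G"
  shows "conj_quad G k (conj_quad G h x) = conj_quad G (h \<otimes> k) x"
  using assms by (auto simp: conj_quad_def conj_by_conj_by)

lemma conj_quad_one:
  assumes "x \<in> carrier G \<times> carrier G \<times> carrier G \<times> carrier G"
  shows "conj_quad G \<one> x = x"
  using assms by (auto simp: conj_quad_def)

lemma nielsen_quad: "x \<in> nielsen_C3_4 G \<Longrightarrow> x \<in> carrier G \<times> carrier G \<times> carrier G \<times> carrier G"
  by (auto simp: nielsen_C3_4_def)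

lemma generate_eq_carrierI:
  assumes "generate G S = carrier G" "S \<subseteq> generate G S'" "S' \<subseteq> carrier G"
  shows "generate G S' = carrier G"
  using assms generate_subgroup_incl[OF assms(2) generate_is_subgroup[OF assms(3)]]
    generate_in_carrier[OF assms(3)] by blast

lemma conj_quad_nielsen:
  assumes "x \<in> nielsen_C3_4 G" "h \<in> carrier G"
  shows "conj_quad G h x \<in> nielsen_C3_4 G"
proof -
  obtain a b c d where x: "x = (a, b, c, d)" by (cases x)
  note ni = assms(1)[unfolded x]
  note [simp] = nielsen_carrier[OF ni] assms(2)
  let ?S = "{a, b, c, d}" and ?f = "\<lambda>x. conj_by G x h"
  have g: "generate G ?S = carrier G" and p: "a \<otimes> b \<otimes> c \<otimes> d = \<one>"
    using ni by (auto simp: nielsen_C3_4_def)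
  have hom: "group_hom G G ?f"
    by unfold_locales (auto simp: hom_def conj_by_mult)
  have "generate G (?f ` ?S) = ?f ` generate G ?S"
    using group_hom.generate_img[OF hom, of ?S] by simp
  also have "\<dots> = carrier G"
  proof -
    have "y \<in> ?f ` carrier G" if "y \<in> carrier G" for y
      using that by (intro image_eqI[of _ _ "conj_by G y (inv h)"]) (auto simp: conj_by_conj_by)
    moreover have "?f ` carrier G \<subseteq> carrier G" by (intro image_subsetI) simp
    ultimately show ?thesis unfolding g by (intro equalityI subsetI) blast+
  qed
  finally have "generate G {?f a, ?f b, ?f c, ?f d} = carrier G" by simp
  moreover have "?f a \<otimes> ?f b \<otimes> ?f c \<otimes> ?f d = \<one>"
    using p by (simp flip: conj_by_mult)
  ultimately show ?thesis
    using ni by (auto simp: x conj_quad_def nielsen_C3_4_def ord_conj_by)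
qed

lemma inner_class_self: "x \<in> nielsen_C3_4 G \<Longrightarrow> x \<in> inner_class G x"
  unfolding inner_class_conj_quad using conj_quad_one[OF nielsen_quad, of x] one_closed
  by (metis (mono_tags, lifting) mem_Collect_eq)

lemma inner_class_conj_quad_eq:
  assumes "x \<in> nielsen_C3_4 G" "h \<in> carrier G"
  shows "inner_class G (conj_quad G h x) = inner_class G x"
proof -
  have "conj_quad G k x = conj_quad G (inv h \<otimes> k) (conj_quad G h x)" if "k \<in> carrier G" for k
    using that assms nielsen_quad by (simp add: conj_quad_conj_quad flip: m_assoc)
  moreover have "conj_quad G k (conj_quad G h x) = conj_quad G (h \<otimes> k) x" if "k \<in> carrier G" for k
    using that assms nielsen_quad by (simp add: conj_quad_conj_quad)
  ultimately show ?thesis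
    unfolding inner_class_conj_quad using assms(2) m_closed inv_closed by (intro subset_antisym subsetI; clarify) metis+
qed

text \<open>Moves of this kind induce permutations of the inner classes. The words in the twists that generate
  \<open>Q\<close> can then be computed on tuples, up to conjugation.\<close>

definition braid_move :: "('a quad \<Rightarrow> 'a quad) \<Rightarrow> bool" where
  "braid_move q \<longleftrightarrow>
     (\<forall>x\<in>nielsen_C3_4 G. q x \<in> nielsen_C3_4 G) \<and>
     (\<forall>x\<in>nielsen_C3_4 G. \<exists>y\<in>nielsen_C3_4 G. q y = x) \<and>
     (\<forall>x\<in>nielsen_C3_4 G. \<forall>h\<in>carrier G. q (conj_quad G h x) = conj_quad G h (q x))"

lemma ord_conj':
  assumes "x \<in> carrier G" "h \<in> carrier G"
  shows "ord (h \<otimes> x \<otimes> inv h) = ord x" "ord (inv h \<otimes> x \<otimes> h) = ord x"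
  using ord_conj_by[OF assms(1), of "inv h"] ord_conj_by[OF assms] assms by (auto simp: conj_by_def)

lemma generate_conj_pair:
  assumes "a \<in> carrier G" "b \<in> carrier G" "S \<subseteq> carrier G"
    "generate G (insert a (insert b S)) = carrier G"
  shows "generate G (insert (a \<otimes> b \<otimes> inv a) (insert a S)) = carrier G"
    "generate G (insert b (insert (inv b \<otimes> a \<otimes> b) S)) = carrier G"
proof -
  let ?S = "insert (a \<otimes> b \<otimes> inv a) (insert a S)"
  have a: "a \<in> generate G ?S" "a \<otimes> b \<otimes> inv a \<in> generate G ?S" "inv a \<in> generate G ?S"
    by (auto intro: generate.incl generate.inv)
  have "inv a \<otimes> (a \<otimes> b \<otimes> inv a) \<otimes> a \<in> generate G ?S"
    using a by (meson generate.eng)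
  moreover have "inv a \<otimes> (a \<otimes> b \<otimes> inv a) \<otimes> a = b" using assms(1,2) by (simp add: m_assoc)
  ultimately have "b \<in> generate G ?S" by simp
  then show "generate G ?S = carrier G"
    using assms a by (intro generate_eq_carrierI[OF assms(4)]) (auto intro: generate.incl)
  let ?T = "insert b (insert (inv b \<otimes> a \<otimes> b) S)"
  have b: "b \<in> generate G ?T" "inv b \<otimes> a \<otimes> b \<in> generate G ?T" "inv b \<in> generate G ?T"
    by (auto intro: generate.incl generate.inv)
  have "b \<otimes> (inv b \<otimes> a \<otimes> b) \<otimes> inv b \<in> generate G ?T"
    using b by (meson generate.eng)
  moreover have "b \<otimes> (inv b \<otimes> a \<otimes> b) \<otimes> inv b = a" using assms(1,2) by (simp add: m_assoc)
  ultimately have "a \<in> generate G ?T" by simp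
  then show "generate G ?T = carrier G"
    using assms b by (intro generate_eq_carrierI[OF assms(4)]) (auto intro: generate.incl)
qed

text \<open>The twists are listed together with their inverses, which yields surjectivity.\<close>

lemma twist_nielsen:
  assumes "(a, b, c, d) \<in> nielsen_C3_4 G"
  shows "(a \<otimes> b \<otimes> inv a, a, c, d) \<in> nielsen_C3_4 G" (is ?t1)
    and "(b, inv b \<otimes> a \<otimes> b, c, d) \<in> nielsen_C3_4 G" (is ?u1)
    and "(a, b \<otimes> c \<otimes> inv b, b, d) \<in> nielsen_C3_4 G" (is ?t2)
    and "(a, c, inv c \<otimes> b \<otimes> c, d) \<in> nielsen_C3_4 G" (is ?u2)
    and "(a, b, c \<otimes> d \<otimes> inv c, c) \<in> nielsen_C3_4 G" (is ?t3)
    and "(a, b, d, inv d \<otimes> c \<otimes> d) \<in> nielsen_C3_4 G" (is ?u3)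
proof -
  note [simp] = nielsen_carrier[OF assms]
  have o: "ord a = 3" "ord b = 3" "ord c = 3" "ord d = 3"
    and p: "a \<otimes> (b \<otimes> (c \<otimes> d)) = \<one>" and g: "generate G {a, b, c, d} = carrier G"
    using assms by (auto simp: nielsen_C3_4_def m_assoc)
  note N = nielsen_C3_4_def mem_Collect_eq prod.case insert_subset empty_subsetI ord_conj' o
  have pr: "a \<otimes> b \<otimes> inv a \<otimes> a \<otimes> c \<otimes> d = \<one>" "b \<otimes> (inv b \<otimes> a \<otimes> b) \<otimes> c \<otimes> d = \<one>"
    "a \<otimes> (b \<otimes> c \<otimes> inv b) \<otimes> b \<otimes> d = \<one>" "a \<otimes> c \<otimes> (inv c \<otimes> b \<otimes> c) \<otimes> d = \<one>"
    "a \<otimes> b \<otimes> (c \<otimes> d \<otimes> inv c) \<otimes> c = \<one>" "a \<otimes> b \<otimes> d \<otimes> (inv d \<otimes> c \<otimes> d) = \<one>"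
    using p by (simp_all add: m_assoc)
  have s: "{a, b, c, d} = insert b (insert c {a, d})" "{a, b, c, d} = insert c (insert d {a, b})" by auto
  have g2: "generate G (insert b (insert c {a, d})) = carrier G" "generate G (insert c (insert d {a, b})) = carrier G"
    using g unfolding s[symmetric] by auto
  have r: "{a, b \<otimes> c \<otimes> inv b, b, d} = insert (b \<otimes> c \<otimes> inv b) (insert b {a, d})"
    "{a, c, inv c \<otimes> b \<otimes> c, d} = insert c (insert (inv c \<otimes> b \<otimes> c) {a, d})"
    "{a, b, c \<otimes> d \<otimes> inv c, c} = insert (c \<otimes> d \<otimes> inv c) (insert c {a, b})"
    "{a, b, d, inv d \<otimes> c \<otimes> d} = insert d (insert (inv d \<otimes> c \<otimes> d) {a, b})"
    by auto
  note G = generate_conj_pair[OF _ _ _ g] generate_conj_pair[OF _ _ _ g2(1)] generate_conj_pair[OF _ _ _ g2(2)]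
  show ?t1 unfolding N using pr G by (simp add: ord_conj' o)
  show ?u1 unfolding N using pr G by (simp add: ord_conj' o)
  show ?t2 unfolding N r using pr G by (simp add: ord_conj' o)
  show ?u2 unfolding N r using pr G by (simp add: ord_conj' o)
  show ?t3 unfolding N r using pr G by (simp add: ord_conj' o)
  show ?u3 unfolding N r using pr G by (simp add: ord_conj' o)
qed

lemma braid_move_twist: "braid_move (twist1 G)" "braid_move (twist2 G)" "braid_move (twist3 G)"
proof -
  have c: "conj_by G (x \<otimes> y \<otimes> inv x) h = conj_by G x h \<otimes> conj_by G y h \<otimes> inv (conj_by G x h)"
    if "x \<in> carrier G" "y \<in> carrier G" "h \<in> carrier G" for x y h
    using that by (simp add: conj_by_mult conj_by_inv)
  have e: "x \<otimes> (inv x \<otimes> y \<otimes> x) \<otimes> inv x = y" if "x \<in> carrier G" "y \<in> carrier G" for x y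
    using that by (simp add: m_assoc)
  show "braid_move (twist1 G)"
    unfolding braid_move_def
  proof (intro conjI ballI)
    fix x assume x: "x \<in> nielsen_C3_4 G"
    obtain a b c d where [simp]: "x = (a, b, c, d)" by (cases x)
    note x' = x[simplified]
    note [simp] = nielsen_carrier[OF x']
    show "twist1 G x \<in> nielsen_C3_4 G"
      using twist_nielsen(1)[OF x'] by (simp add: twist1_def)
    show "\<exists>y\<in>nielsen_C3_4 G. twist1 G y = x"
      by (intro bexI[OF _ twist_nielsen(2)[OF x']]) (simp add: twist1_def e)
    show "twist1 G (conj_quad G h x) = conj_quad G h (twist1 G x)" if "h \<in> carrier G" for h
      using that by (simp add: twist1_def conj_quad_def c)
  qed
  show "braid_move (twist2 G)"
    unfolding braid_move_def
  proof (intro conjI ballI)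
    fix x assume x: "x \<in> nielsen_C3_4 G"
    obtain a b c d where [simp]: "x = (a, b, c, d)" by (cases x)
    note x' = x[simplified]
    note [simp] = nielsen_carrier[OF x']
    show "twist2 G x \<in> nielsen_C3_4 G"
      using twist_nielsen(3)[OF x'] by (simp add: twist2_def)
    show "\<exists>y\<in>nielsen_C3_4 G. twist2 G y = x"
      by (intro bexI[OF _ twist_nielsen(4)[OF x']]) (simp add: twist2_def e)
    show "twist2 G (conj_quad G h x) = conj_quad G h (twist2 G x)" if "h \<in> carrier G" for h
      using that by (simp add: twist2_def conj_quad_def c)
  qed
  show "braid_move (twist3 G)"
    unfolding braid_move_def
  proof (intro conjI ballI)
    fix x assume x: "x \<in> nielsen_C3_4 G"
    obtain a b c d where [simp]: "x = (a, b, c, d)" by (cases x)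
    note x' = x[simplified]
    note [simp] = nielsen_carrier[OF x']
    show "twist3 G x \<in> nielsen_C3_4 G"
      using twist_nielsen(5)[OF x'] by (simp add: twist3_def)
    show "\<exists>y\<in>nielsen_C3_4 G. twist3 G y = x"
      by (intro bexI[OF _ twist_nielsen(6)[OF x']]) (simp add: twist3_def e)
    show "twist3 G (conj_quad G h x) = conj_quad G h (twist3 G x)" if "h \<in> carrier G" for h
      using that by (simp add: twist3_def conj_quad_def c)
  qed
qed

lemma on_inner_class:
  assumes "braid_move q" "x \<in> nielsen_C3_4 G"
  shows "on_inner G q (inner_class G x) = inner_class G (q x)"
proof -
  have *: "q (conj_quad G h x) = conj_quad G h (q x)" if "h \<in> carrier G" for h
    using assms that by (simp add: braid_move_def)
  have "q ` inner_class G x = inner_class G (q x)"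
    unfolding inner_class_conj_quad using * by (intro subset_antisym subsetI) (blast, clarify, metis (mono_tags, lifting) image_eqI mem_Collect_eq)
  then show ?thesis
    using assms(2) by (simp add: on_inner_def inner_classes_def)
qed

lemma finite_inner_classes: "finite (carrier G) \<Longrightarrow> finite (inner_classes G)"
  unfolding inner_classes_def
  by (intro finite_imageI finite_subset[of "nielsen_C3_4 G" "carrier G \<times> carrier G \<times> carrier G \<times> carrier G"])
     (auto dest: nielsen_quad)

text \<open>A surjection of a finite set onto itself is a bijection.\<close>

lemma on_inner_Bij:
  assumes fin: "finite (carrier G)" and q: "braid_move q"
  shows "on_inner G q \<in> Bij (inner_classes G)"
proof -
  have "on_inner G q ` inner_classes G \<subseteq> inner_classes G"
  proof (intro image_subsetI)
    fix c assume "c \<in> inner_classes G"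
    then obtain x where x: "x \<in> nielsen_C3_4 G" "c = inner_class G x" unfolding inner_classes_def by blast
    then have "q x \<in> nielsen_C3_4 G" using q by (simp add: braid_move_def)
    then show "on_inner G q c \<in> inner_classes G"
      unfolding x(2) on_inner_class[OF q x(1)] inner_classes_def by simp
  qed
  moreover have "inner_classes G \<subseteq> on_inner G q ` inner_classes G"
  proof
    fix c assume "c \<in> inner_classes G"
    then obtain x where x: "x \<in> nielsen_C3_4 G" "c = inner_class G x" unfolding inner_classes_def by blast
    then obtain y where "y \<in> nielsen_C3_4 G" "q y = x" using q unfolding braid_move_def by blast
    then show "c \<in> on_inner G q ` inner_classes G"
      using x on_inner_class[OF q] unfolding inner_classes_def by (metis imageI)
  qed
  ultimately have "bij_betw (on_inner G q) (inner_classes G) (inner_classes G)"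
    using finite_surj_inj[OF finite_inner_classes[OF fin]] unfolding bij_betw_def by blast
  then show ?thesis by (simp add: Bij_def on_inner_def)
qed

lemma on_inner_cong:
  assumes "\<And>x. x \<in> nielsen_C3_4 G \<Longrightarrow> inner_class G (q x) = inner_class G (q' x)"
    "braid_move q" "braid_move q'"
  shows "on_inner G q = on_inner G q'"
proof
  fix c
  show "on_inner G q c = on_inner G q' c"
  proof (cases "c \<in> inner_classes G")
    case True
    then obtain x where x: "x \<in> nielsen_C3_4 G" "c = inner_class G x" unfolding inner_classes_def by blast
    then show ?thesis using assms(1)[OF x(1)] on_inner_class[OF assms(2)] on_inner_class[OF assms(3)] by simp
  qed (simp add: on_inner_def)
qed

lemma braid_move_id: "braid_move id"
  unfolding braid_move_def id_apply by blast

lemma braid_move_comp: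
  assumes "braid_move q" "braid_move q'"
  shows "braid_move (q \<circ> q')"
  unfolding braid_move_def
proof (intro conjI ballI)
  fix x assume x: "x \<in> nielsen_C3_4 G"
  show "(q \<circ> q') x \<in> nielsen_C3_4 G" using assms x by (simp add: braid_move_def)
  obtain y where y: "y \<in> nielsen_C3_4 G" "q y = x" using assms(1) x unfolding braid_move_def by blast
  obtain z where "z \<in> nielsen_C3_4 G" "q' z = y" using assms(2) y(1) unfolding braid_move_def by blast
  then show "\<exists>y\<in>nielsen_C3_4 G. (q \<circ> q') y = x" using y by (intro bexI[of _ z]) auto
  show "(q \<circ> q') (conj_quad G h x) = conj_quad G h ((q \<circ> q') x)" if "h \<in> carrier G" for h
    using assms x that by (simp add: braid_move_def)
qed

lemma on_inner_mult:
  assumes fin: "finite (carrier G)" and q: "braid_move q" and q': "braid_move q'"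
  shows "on_inner G q \<otimes>\<^bsub>inner_perms G\<^esub> on_inner G q' = on_inner G (q \<circ> q')"
proof -
  have "compose (inner_classes G) (on_inner G q) (on_inner G q') = on_inner G (q \<circ> q')"
  proof
    fix c
    show "compose (inner_classes G) (on_inner G q) (on_inner G q') c = on_inner G (q \<circ> q') c"
    proof (cases "c \<in> inner_classes G")
      case True
      then obtain x where x: "x \<in> nielsen_C3_4 G" "c = inner_class G x" unfolding inner_classes_def by blast
      have x': "q' x \<in> nielsen_C3_4 G" using q' x by (simp add: braid_move_def)
      show ?thesis
        using True by (simp add: compose_def x(2) on_inner_class[OF q' x(1)] on_inner_class[OF q x']
            on_inner_class[OF braid_move_comp[OF q q'] x(1)])
    qed (simp add: on_inner_def compose_def)
  qed
  then show ?thesis by (simp add: BijGroup_def on_inner_Bij[OF fin q] on_inner_Bij[OF fin q'])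
qed

section \<open>The group \<open>Q\<close> as a Klein four-group\<close>

text \<open>On tuples with product one, \<open>(q\<^sub>1 q\<^sub>2 q\<^sub>3)\<^sup>2\<close> agrees up to conjugation with this rotation by two
  places.\<close>

definition half_turn :: "'a quad \<Rightarrow> 'a quad" where
  "half_turn = (\<lambda>(a, b, c, d). (c, d, a, b))"

text \<open>This is \<open>q\<^sub>1 q\<^sub>3\<^sup>-\<^sup>1\<close>.\<close>

definition double_twist :: "'a quad \<Rightarrow> 'a quad" where
  "double_twist = (\<lambda>(a, b, c, d). (a \<otimes> b \<otimes> inv a, a, d, inv d \<otimes> c \<otimes> d))"

lemma nielsen_prod:
  assumes "(a, b, c, d) \<in> nielsen_C3_4 G"
  shows "a \<otimes> (b \<otimes> (c \<otimes> d)) = \<one>" "c \<otimes> d = inv b \<otimes> inv a" "d \<otimes> a = inv c \<otimes> inv b"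
proof -
  note [simp] = nielsen_carrier[OF assms]
  have p: "a \<otimes> b \<otimes> c \<otimes> d = \<one>" using assms by (simp add: nielsen_C3_4_def)
  then show "a \<otimes> (b \<otimes> (c \<otimes> d)) = \<one>" by (simp add: m_assoc)
  then have "(a \<otimes> b) \<otimes> (c \<otimes> d) = \<one>" by (simp add: m_assoc)
  then show e: "c \<otimes> d = inv b \<otimes> inv a"
    by (metis inv_mult_group inv_unique' m_closed nielsen_carrier[OF assms] inv_equality inv_inv inv_closed)
  have "d = inv c \<otimes> (inv b \<otimes> inv a)" by (simp flip: e)
  then show "d \<otimes> a = inv c \<otimes> inv b" by (simp add: m_assoc)
qed

lemma braid_move_half_turn: "braid_move half_turn"
proof -
  have n: "(c, d, a, b) \<in> nielsen_C3_4 G" if x: "(a, b, c, d) \<in> nielsen_C3_4 G" for a b c d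
  proof -
    note [simp] = nielsen_carrier[OF x]
    have "c \<otimes> d \<otimes> a \<otimes> b = \<one>" by (simp add: nielsen_prod(2)[OF x] m_assoc)
    moreover have "{c, d, a, b} = {a, b, c, d}" by auto
    ultimately show ?thesis using x unfolding nielsen_C3_4_def by (simp add: insert_commute)
  qed
  show ?thesis
    unfolding braid_move_def
  proof (intro conjI ballI)
    fix x assume x: "x \<in> nielsen_C3_4 G"
    obtain a b c d where [simp]: "x = (a, b, c, d)" by (cases x)
    show "half_turn x \<in> nielsen_C3_4 G" using n x by (simp add: half_turn_def)
    then show "\<exists>y\<in>nielsen_C3_4 G. half_turn y = x" by (rule bexI[rotated]) (simp add: half_turn_def)
    show "half_turn (conj_quad G h x) = conj_quad G h (half_turn x)" for h
      by (simp add: half_turn_def conj_quad_def)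
  qed
qed

lemma braid_move_double_twist: "braid_move double_twist"
  unfolding braid_move_def
proof (intro conjI ballI)
  fix x assume x: "x \<in> nielsen_C3_4 G"
  obtain a b c d where [simp]: "x = (a, b, c, d)" by (cases x)
  note x' = x[simplified]
  note [simp] = nielsen_carrier[OF x']
  show "double_twist x \<in> nielsen_C3_4 G"
    using twist_nielsen(6)[OF twist_nielsen(1)[OF x']] by (simp add: double_twist_def)
  show "\<exists>y\<in>nielsen_C3_4 G. double_twist y = x"
    by (intro bexI[OF _ twist_nielsen(5)[OF twist_nielsen(2)[OF x']]]) (simp add: double_twist_def m_assoc)
  show "double_twist (conj_quad G h x) = conj_quad G h (double_twist x)" if "h \<in> carrier G" for h
    using that by (simp add: double_twist_def conj_quad_def conj_by_mult conj_by_inv)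
qed

lemma inner_class_eqI:
  assumes "x \<in> nielsen_C3_4 G" "h \<in> carrier G" "y = conj_quad G h x"
  shows "inner_class G y = inner_class G x"
  using inner_class_conj_quad_eq[OF assms(1,2)] assms(3) by simp

lemma half_turn_half_turn: "half_turn (half_turn x) = x"
  by (cases x) (simp add: half_turn_def)

lemma double_twist_double_twist:
  assumes "x \<in> nielsen_C3_4 G"
  shows "inner_class G (double_twist (double_twist x)) = inner_class G x"
proof -
  obtain a b c d where [simp]: "x = (a, b, c, d)" by (cases x)
  note x' = assms[simplified]
  note [simp] = nielsen_carrier[OF x']
  have cd: "inv (c \<otimes> d) = a \<otimes> b" by (simp add: nielsen_prod(2)[OF x'] inv_mult_group)
  show ?thesis
  proof (rule inner_class_eqI[OF assms])
    show "c \<otimes> d \<in> carrier G" by simp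
    have "conj_by G a (c \<otimes> d) = a \<otimes> b \<otimes> inv a \<otimes> a \<otimes> inv (a \<otimes> b \<otimes> inv a)"
      unfolding conj_by_def cd by (simp add: nielsen_prod(2)[OF x'] inv_mult_group m_assoc)
    moreover have "conj_by G b (c \<otimes> d) = a \<otimes> b \<otimes> inv a"
      unfolding conj_by_def cd by (simp add: nielsen_prod(2)[OF x'] inv_mult_group m_assoc)
    moreover have "conj_by G c (c \<otimes> d) = inv d \<otimes> c \<otimes> d"
      unfolding conj_by_def by (simp add: inv_mult_group m_assoc)
    moreover have "conj_by G d (c \<otimes> d) = inv (inv d \<otimes> c \<otimes> d) \<otimes> d \<otimes> (inv d \<otimes> c \<otimes> d)"
      unfolding conj_by_def by (simp add: inv_mult_group m_assoc)
    ultimately show "double_twist (double_twist x) = conj_quad G (c \<otimes> d) x"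
      by (simp add: double_twist_def conj_quad_def)
  qed
qed

lemma double_twist_half_turn:
  assumes "x \<in> nielsen_C3_4 G"
  shows "inner_class G (double_twist (half_turn x)) = inner_class G (half_turn (double_twist x))"
proof -
  obtain a b c d where [simp]: "x = (a, b, c, d)" by (cases x)
  note x' = assms[simplified]
  note [simp] = nielsen_carrier[OF x']
  have ab: "inv (a \<otimes> b) = c \<otimes> d" by (simp add: nielsen_prod(2)[OF x'] inv_mult_group)
  have "d \<otimes> a \<otimes> b = inv c" "inv b \<otimes> inv a \<otimes> inv d = c"
    by (simp add: nielsen_prod(3)[OF x'] m_assoc, simp add: nielsen_prod(2)[OF x', symmetric] m_assoc)
  then have k: "d \<otimes> (a \<otimes> b) = inv c" "inv b \<otimes> (inv a \<otimes> inv d) = c"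
    by (simp_all add: m_assoc)
  have n: "half_turn (double_twist x) \<in> nielsen_C3_4 G"
    using assms braid_move_half_turn braid_move_double_twist by (simp add: braid_move_def)
  show ?thesis
  proof (rule inner_class_eqI[OF n])
    show "a \<otimes> b \<in> carrier G" by simp
    have "conj_by G d (a \<otimes> b) = c \<otimes> d \<otimes> inv c"
      unfolding conj_by_def ab by (simp add: m_assoc k)
    moreover have "conj_by G (inv d \<otimes> c \<otimes> d) (a \<otimes> b) = c"
      unfolding conj_by_def by (simp add: m_assoc k inv_mult_group)
    moreover have "conj_by G (a \<otimes> b \<otimes> inv a) (a \<otimes> b) = b"
      unfolding conj_by_def by (simp add: inv_mult_group m_assoc)
    moreover have "conj_by G a (a \<otimes> b) = inv b \<otimes> a \<otimes> b"
      unfolding conj_by_def by (simp add: inv_mult_group m_assoc)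
    ultimately show "double_twist (half_turn x) = conj_quad G (a \<otimes> b) (half_turn (double_twist x))"
      by (simp add: double_twist_def half_turn_def conj_quad_def)
  qed
qed

lemma Klein_four_subgroup:
  assumes "s \<in> carrier G" "t \<in> carrier G" "s \<otimes> s = \<one>" "t \<otimes> t = \<one>" "s \<otimes> t = t \<otimes> s"
  shows "subgroup {\<one>, s, t, s \<otimes> t} G"
proof (rule subgroupI)
  have st: "s \<otimes> (s \<otimes> t) = t" "t \<otimes> (s \<otimes> t) = s" "t \<otimes> (t \<otimes> s) = s"
    using assms by (metis m_assoc l_one r_one)+
  have i: "inv s = s" "inv t = t" using assms by (auto intro: inv_equality)
  fix x assume x: "x \<in> {\<one>, s, t, s \<otimes> t}"
  show "inv x \<in> {\<one>, s, t, s \<otimes> t}" using x assms i by (auto simp: inv_mult_group)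
  show "x \<otimes> y \<in> {\<one>, s, t, s \<otimes> t}" if "y \<in> {\<one>, s, t, s \<otimes> t}" for y
    using x that assms st by (auto simp: m_assoc)
qed (use assms in auto)

text \<open>The two generators induce commuting involutions on inner classes, so four elements suffice.\<close>

lemma Q_group_subset:
  assumes fin: "finite (carrier G)"
  shows "Q_group G \<subseteq> {on_inner G id, on_inner G half_turn, on_inner G double_twist,
    on_inner G (half_turn \<circ> double_twist)}"
proof -
  let ?B = "inner_perms G"
  interpret B: group ?B by (rule group_BijGroup)
  note bm = braid_move_twist braid_move_half_turn braid_move_double_twist
  have bid: "braid_move id" by (rule braid_move_id)
  have car: "on_inner G q \<in> carrier ?B" if "braid_move q" for q
    using on_inner_Bij[OF fin that] by (simp add: BijGroup_def)
  have one: "on_inner G id = \<one>\<^bsub>?B\<^esub>" by (auto simp: on_inner_def BijGroup_def fun_eq_iff)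
  let ?S = "on_inner G half_turn" and ?T = "on_inner G double_twist"
  let ?q1 = "on_inner G (twist1 G)" and ?q2 = "on_inner G (twist2 G)" and ?q3 = "on_inner G (twist3 G)"
  have SS: "?S \<otimes>\<^bsub>?B\<^esub> ?S = \<one>\<^bsub>?B\<^esub>"
    unfolding on_inner_mult[OF fin bm(4,4)] one[symmetric]
    by (rule on_inner_cong[OF _ braid_move_comp[OF bm(4,4)] bid]) (simp add: half_turn_half_turn)
  have TT: "?T \<otimes>\<^bsub>?B\<^esub> ?T = \<one>\<^bsub>?B\<^esub>"
    unfolding on_inner_mult[OF fin bm(5,5)] one[symmetric]
    by (rule on_inner_cong[OF _ braid_move_comp[OF bm(5,5)] bid]) (simp add: double_twist_double_twist)
  have ST: "?S \<otimes>\<^bsub>?B\<^esub> ?T = ?T \<otimes>\<^bsub>?B\<^esub> ?S"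
    unfolding on_inner_mult[OF fin bm(4,5)] on_inner_mult[OF fin bm(5,4)]
    by (rule on_inner_cong[OF _ braid_move_comp[OF bm(4,5)] braid_move_comp[OF bm(5,4)]])
       (simp add: double_twist_half_turn)
  have sub: "subgroup {\<one>\<^bsub>?B\<^esub>, ?S, ?T, ?S \<otimes>\<^bsub>?B\<^esub> ?T} ?B"
    using SS TT ST car bm by (intro B.Klein_four_subgroup) auto
  have "(?q3 \<otimes>\<^bsub>?B\<^esub> ?q2 \<otimes>\<^bsub>?B\<^esub> ?q1) [^]\<^bsub>?B\<^esub> (2::nat) = ?S"
  proof -
    let ?r = "twist3 G \<circ> twist2 G \<circ> twist1 G"
    have br: "braid_move ?r" by (intro braid_move_comp bm)
    have "?q3 \<otimes>\<^bsub>?B\<^esub> ?q2 \<otimes>\<^bsub>?B\<^esub> ?q1 = on_inner G ?r"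
      by (simp add: on_inner_mult[OF fin] bm braid_move_comp comp_assoc)
    moreover have "on_inner G ?r \<otimes>\<^bsub>?B\<^esub> on_inner G ?r = ?S"
      unfolding on_inner_mult[OF fin br br]
    proof (rule on_inner_cong[OF _ braid_move_comp[OF br br] bm(4)])
      fix x assume x: "x \<in> nielsen_C3_4 G"
      obtain a b c d where [simp]: "x = (a, b, c, d)" by (cases x)
      note x' = x[simplified]
      note [simp] = nielsen_carrier[OF x']
      have n: "half_turn x \<in> nielsen_C3_4 G" using x bm(4) by (simp add: braid_move_def)
      show "inner_class G ((?r \<circ> ?r) x) = inner_class G (half_turn x)"
      proof (rule inner_class_eqI[OF n])
        show "inv (a \<otimes> b) \<in> carrier G" by simp
        show "(?r \<circ> ?r) x = conj_quad G (inv (a \<otimes> b)) (half_turn x)"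
          by (simp add: twist1_def twist2_def twist3_def half_turn_def conj_quad_def conj_by_def inv_mult_group m_assoc)
      qed
    qed
    ultimately show ?thesis using car[OF br] by (simp add: numeral_2_eq_2)
  qed
  moreover have "inv\<^bsub>?B\<^esub> ?q3 \<otimes>\<^bsub>?B\<^esub> ?q1 = ?T"
  proof -
    have "?q3 \<otimes>\<^bsub>?B\<^esub> ?T = ?q1"
      unfolding on_inner_mult[OF fin bm(3,5)]
    proof (rule on_inner_cong[OF _ braid_move_comp[OF bm(3,5)] bm(1)])
      fix x assume x: "x \<in> nielsen_C3_4 G"
      obtain a b c d where [simp]: "x = (a, b, c, d)" by (cases x)
      note [simp] = nielsen_carrier[OF x[simplified]]
      show "inner_class G ((twist3 G \<circ> double_twist) x) = inner_class G (twist1 G x)"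
        by (simp add: twist3_def double_twist_def twist1_def m_assoc)
    qed
    then show ?thesis using car bm by (metis B.inv_mult_cancel(1))
  qed
  ultimately have "Q_group G \<subseteq> {\<one>\<^bsub>?B\<^esub>, ?S, ?T, ?S \<otimes>\<^bsub>?B\<^esub> ?T}"
    unfolding Q_group_def Let_def by (intro B.generate_subgroup_incl[OF _ sub]) auto
  then show ?thesis by (simp add: one on_inner_mult[OF fin bm(4,5)])
qed

end

context group
begin

section \<open>Invariants of braid orbits\<close>

lemma Bij_invariant_subgroup: "subgroup {f \<in> Bij S. \<forall>c\<in>S. F (f c) = F c} (BijGroup S)"
proof -
  interpret B: group "BijGroup S" by (rule group_BijGroup)
  show ?thesis
  proof (rule B.subgroupI)
    have "(\<lambda>x\<in>S. x) \<in> {f \<in> Bij S. \<forall>c\<in>S. F (f c) = F c}" by (simp add: id_Bij)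
    then show "{f \<in> Bij S. \<forall>c\<in>S. F (f c) = F c} \<noteq> {}" by blast
    fix f assume f: "f \<in> {f \<in> Bij S. \<forall>c\<in>S. F (f c) = F c}"
    have "F (inv_into S f c) = F c" if c: "c \<in> S" for c
    proof -
      have "inv_into S f c \<in> S" using f c by (simp add: Bij_inv_into_mem)
      moreover have "f (inv_into S f c) = c"
        using f c bij_betw_inv_into_right[of f S S c] by (simp add: Bij_def)
      moreover from f have "\<forall>c\<in>S. F (f c) = F c" by blast
      ultimately show ?thesis by metis
    qed
    then have "\<forall>c\<in>S. F ((\<lambda>x\<in>S. inv_into S f x) c) = F c" by simp
    moreover have fB: "f \<in> Bij S" using f by blast
    ultimately show "inv\<^bsub>BijGroup S\<^esub> f \<in> {f \<in> Bij S. \<forall>c\<in>S. F (f c) = F c}"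
      unfolding inv_BijGroup[OF fB] using restrict_inv_into_Bij[OF fB] by blast
    fix g assume g: "g \<in> {f \<in> Bij S. \<forall>c\<in>S. F (f c) = F c}"
    then have gB: "g \<in> Bij S" by blast
    have "F (compose S f g c) = F c" if c: "c \<in> S" for c
    proof -
      have "g c \<in> S" using gB c Bij_imp_funcset by blast
      then have "F (f (g c)) = F (g c)" using f by blast
      also have "\<dots> = F c" using g c by blast
      finally show ?thesis using c by (simp add: compose_eq)
    qed
    moreover have "f \<otimes>\<^bsub>BijGroup S\<^esub> g = compose S f g" using fB gB by (simp add: BijGroup_def)
    ultimately show "f \<otimes>\<^bsub>BijGroup S\<^esub> g \<in> {f \<in> Bij S. \<forall>c\<in>S. F (f c) = F c}"
      using compose_Bij[OF fB gB] by simp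
  qed (simp add: BijGroup_def Collect_mono_iff)
qed

definition braid_invariant :: "('a quad \<Rightarrow> 'x) \<Rightarrow> bool" where
  "braid_invariant s \<longleftrightarrow>
     (\<forall>x\<in>nielsen_C3_4 G. s (twist1 G x) = s x \<and> s (twist2 G x) = s x \<and> s (twist3 G x) = s x \<and>
        (\<forall>h\<in>carrier G. s (conj_quad G h x) = s x))"

lemma braid_invariant_inner_class:
  assumes "x \<in> nielsen_C3_4 G" "braid_invariant s"
  shows "s ` inner_class G x = {s x}"
proof -
  have "s y = s x" if "y \<in> inner_class G x" for y
    using that assms unfolding inner_class_conj_quad braid_invariant_def by blast
  then show ?thesis using inner_class_self[OF assms(1)] by blast
qed

lemma Q_group_in_H4:
  "Q_group G \<subseteq> carrier (H4 G)" if fin: "finite (carrier G)"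
proof -
  let ?B = "inner_perms G"
  interpret B: group ?B by (rule group_BijGroup)
  let ?q1 = "on_inner G (twist1 G)" and ?q2 = "on_inner G (twist2 G)" and ?q3 = "on_inner G (twist3 G)"
  let ?H = "generate ?B {?q1, ?q2, ?q3}"
  have sub: "subgroup ?H ?B"
    using on_inner_Bij[OF fin] braid_move_twist by (intro B.generate_is_subgroup) (auto simp: BijGroup_def)
  have "?q1 \<in> ?H" "?q2 \<in> ?H" "?q3 \<in> ?H" by (auto intro: generate.incl)
  then have "Q_group G \<subseteq> ?H"
    unfolding Q_group_def Let_def using sub
    by (intro B.generate_subgroup_incl[OF _ sub])
       (auto intro!: subgroup.m_closed[OF sub] subgroup.m_inv_closed[OF sub] subgroup.one_closed[OF sub] simp: numeral_2_eq_2)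
  then show ?thesis by (simp add: H4_def)
qed

text \<open>It is enough to check invariance on generators, since the permutations that preserve the value on
  each class form a subgroup.\<close>

lemma H4_invariant:
  assumes fin: "finite (carrier G)" and s: "braid_invariant s"
    and f: "f \<in> carrier (H4 G)" and c: "c \<in> inner_classes G"
  shows "f c \<in> inner_classes G" "s ` f c = s ` c"
proof -
  let ?B = "inner_perms G" and ?I = "{f \<in> Bij (inner_classes G). \<forall>c\<in>inner_classes G. s ` f c = s ` c}"
  interpret B: group ?B by (rule group_BijGroup)
  have cls: "s ` inner_class G x = {s x}" if "x \<in> nielsen_C3_4 G" for x
    using that s by (rule braid_invariant_inner_class)
  have "on_inner G q \<in> ?I" if q: "braid_move q" and sq: "\<forall>x\<in>nielsen_C3_4 G. s (q x) = s x" for q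
  proof -
    have "s ` on_inner G q c = s ` c" if c: "c \<in> inner_classes G" for c
    proof -
      obtain x where x: "x \<in> nielsen_C3_4 G" "c = inner_class G x" using c unfolding inner_classes_def by blast
      then have "q x \<in> nielsen_C3_4 G" using q by (simp add: braid_move_def)
      then show ?thesis using cls x sq by (simp add: on_inner_class[OF q])
    qed
    then show ?thesis using on_inner_Bij[OF fin q] by simp
  qed
  then have "generate ?B {on_inner G (twist1 G), on_inner G (twist2 G), on_inner G (twist3 G)} \<subseteq> ?I"
    using s braid_move_twist unfolding braid_invariant_def
    by (intro B.generate_subgroup_incl[OF _ Bij_invariant_subgroup]) (simp del: mem_Collect_eq)
  then have f: "f \<in> ?I" using f unfolding H4_def by (simp add: subset_iff)
  then show "s ` f c = s ` c" using c by simp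
  show "f c \<in> inner_classes G" using f c Bij_imp_funcset[of f] by blast
qed

lemma subgroup_H4:
  assumes "finite (carrier G)" shows "subgroup (carrier (H4 G)) (inner_perms G)"
  using on_inner_Bij[OF assms] braid_move_twist group_BijGroup unfolding H4_def
  by (simp, intro group.generate_is_subgroup) (auto simp: BijGroup_def)

lemma subgroup_Q_group:
  assumes "finite (carrier G)" shows "subgroup (Q_group G) (inner_perms G)"
proof -
  interpret B: group "inner_perms G" by (rule group_BijGroup)
  have "on_inner G q \<in> carrier (inner_perms G)" if "braid_move q" for q
    using on_inner_Bij[OF assms that] by (simp add: BijGroup_def)
  then show ?thesis
    unfolding Q_group_def Let_def using braid_move_twist by (intro B.generate_is_subgroup) auto
qed

lemma inner_class_in_reduced_class:
  assumes "finite (carrier G)" "x \<in> nielsen_C3_4 G"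
  shows "inner_class G x \<in> reduced_class G x"
proof -
  let ?e = "\<one>\<^bsub>inner_perms G\<^esub>"
  have 1: "?e \<in> Q_group G" by (rule subgroup.one_closed[OF subgroup_Q_group[OF assms(1)]])
  have "inner_class G x \<in> inner_classes G" using assms(2) by (simp add: inner_classes_def)
  then have "inner_class G x = ?e (inner_class G x)" by (simp add: BijGroup_def)
  then show ?thesis unfolding reduced_class_def mem_Collect_eq by (intro exI[of _ ?e] conjI 1)
qed

lemma orbit_invariant:
  assumes fin: "finite (carrier G)" and s: "braid_invariant s"
    and Ob: "Ob \<in> M4_orbits G"
    and x: "x \<in> nielsen_C3_4 G" "reduced_class G x \<in> Ob"
    and y: "y \<in> nielsen_C3_4 G" "reduced_class G y \<in> Ob"
  shows "s x = s y"
proof -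
  interpret B: group "inner_perms G" by (rule group_BijGroup)
  obtain w where w: "w \<in> nielsen_C3_4 G"
    and Ob': "Ob = {(\<Union>h\<in>C. h ` reduced_class G w) | C. C \<in> carrier (H4 G Mod Q_group G)}"
    using Ob unfolding M4_orbits_def orbits_def orbit_def reduced_classes_def by blast
  have cls: "s ` inner_class G x = {s x}" if "x \<in> nielsen_C3_4 G" for x
    using that s by (rule braid_invariant_inner_class)
  have ic: "inner_class G w \<in> inner_classes G" using w by (simp add: inner_classes_def)
  have "s u = s w" if u: "u \<in> nielsen_C3_4 G" "reduced_class G u \<in> Ob" for u
  proof -
    obtain C where C: "C \<in> carrier (H4 G Mod Q_group G)" "reduced_class G u = (\<Union>h\<in>C. h ` reduced_class G w)"
      using u(2) unfolding Ob' by blast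
    have "inner_class G u \<in> (\<Union>h\<in>C. h ` reduced_class G w)"
      using inner_class_in_reduced_class[OF fin u(1)] C(2) by simp
    then obtain h k where hk: "h \<in> C" "k \<in> Q_group G" "inner_class G u = h (k (inner_class G w))"
      unfolding reduced_class_def by blast
    obtain a where a: "a \<in> carrier (H4 G)" "C = Q_group G #>\<^bsub>H4 G\<^esub> a"
      using C(1) unfolding FactGroup_def RCOSETS_def by auto
    obtain q where q: "q \<in> Q_group G" "h = q \<otimes>\<^bsub>inner_perms G\<^esub> a"
      using hk(1) a(2) by (auto simp: r_coset_def H4_def)
    have Q: "Q_group G \<subseteq> carrier (H4 G)" by (rule Q_group_in_H4[OF fin])
    then have h: "h \<in> carrier (H4 G)" using q a subgroup.m_closed[OF subgroup_H4[OF fin], of q a] by auto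
    have k: "k \<in> carrier (H4 G)" using hk(2) Q by blast
    note H = H4_invariant[OF fin s]
    have "s ` inner_class G u = s ` inner_class G w"
      using H(2)[OF h H(1)[OF k ic]] H(2)[OF k ic] hk(3) by simp
    then show ?thesis using cls[OF u(1)] cls[OF w] by simp
  qed
  then show ?thesis using x y by simp
qed

lemma reduced_class_in_orbit:
  assumes fin: "finite (carrier G)" and x: "x \<in> nielsen_C3_4 G"
  shows "\<exists>Ob\<in>M4_orbits G. reduced_class G x \<in> Ob"
proof -
  let ?B = "inner_perms G" and ?Q = "Q_group G"
  interpret B: group ?B by (rule group_BijGroup)
  have Q: "subgroup ?Q ?B" by (rule subgroup_Q_group[OF fin])
  have QB: "?Q \<subseteq> carrier ?B" using subgroup.subset[OF Q] .
  have one: "\<one>\<^bsub>?B\<^esub> \<in> carrier (H4 G)" using subgroup.one_closed[OF subgroup_H4[OF fin]] .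
  have "?Q #>\<^bsub>H4 G\<^esub> \<one>\<^bsub>?B\<^esub> = ?Q"
    using B.coset_mult_one[OF QB] by (simp add: r_coset_def H4_def)
  then have C: "?Q \<in> carrier (H4 G Mod ?Q)"
    using one unfolding FactGroup_def RCOSETS_def by auto
  have ic: "inner_class G x \<in> inner_classes G" using x by (simp add: inner_classes_def)
  have m: "h (k (inner_class G x)) = (h \<otimes>\<^bsub>?B\<^esub> k) (inner_class G x)" if "h \<in> ?Q" "k \<in> ?Q" for h k
    using subsetD[OF QB that(1)] subsetD[OF QB that(2)] ic by (simp add: BijGroup_def compose_def)
  have U: "(\<Union>h\<in>?Q. h ` reduced_class G x) = reduced_class G x" (is "?U = _")
  proof
    show "?U \<subseteq> reduced_class G x"
    proof
      fix c assume "c \<in> ?U"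
      then obtain h k where "h \<in> ?Q" "k \<in> ?Q" "c = h (k (inner_class G x))" unfolding reduced_class_def by blast
      then show "c \<in> reduced_class G x"
        unfolding reduced_class_def using m subgroup.m_closed[OF Q] by blast
    qed
    show "reduced_class G x \<subseteq> ?U"
    proof
      fix c assume "c \<in> reduced_class G x"
      then obtain h where h: "h \<in> ?Q" "c = h (inner_class G x)" unfolding reduced_class_def by blast
      then show "c \<in> ?U" using inner_class_in_reduced_class[OF fin x] by blast
    qed
  qed
  have "reduced_class G x \<in> orbit (H4 G Mod ?Q) (\<lambda>C X. \<Union>h\<in>C. h ` X) (reduced_class G x)"
    unfolding orbit_def mem_Collect_eq by (intro exI[of _ ?Q] conjI) (rule U[symmetric], rule C)
  moreover have "orbit (H4 G Mod ?Q) (\<lambda>C X. \<Union>h\<in>C. h ` X) (reduced_class G x) \<in> M4_orbits G"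
    unfolding M4_orbits_def orbits_def mem_Collect_eq reduced_classes_def
    by (intro exI[of _ "reduced_class G x"] conjI refl imageI x)
  ultimately show ?thesis by blast
qed

text \<open>This makes equality of reduced classes concrete: the two tuples differ by a conjugation and one of
  the four elements of the Klein group.\<close>

lemma reduced_class_eq_cases:
  assumes fin: "finite (carrier G)" and x: "x \<in> nielsen_C3_4 G" and y: "y \<in> nielsen_C3_4 G"
    and eq: "reduced_class G y = reduced_class G x"
  obtains h where "h \<in> carrier G" "y = conj_quad G h x"
    | h where "h \<in> carrier G" "y = conj_quad G h (half_turn x)"
    | h where "h \<in> carrier G" "y = conj_quad G h (double_twist x)"
    | h where "h \<in> carrier G" "y = conj_quad G h (half_turn (double_twist x))"
proof -
  note bm = braid_move_half_turn braid_move_double_twist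
  have bid: "braid_move id" by (rule braid_move_id)
  have "inner_class G y \<in> reduced_class G x"
    using inner_class_in_reduced_class[OF fin y] eq by simp
  then obtain f where f: "f \<in> Q_group G" "inner_class G y = f (inner_class G x)"
    unfolding reduced_class_def by blast
  have "inner_class G y \<in> {inner_class G x, inner_class G (half_turn x), inner_class G (double_twist x),
    inner_class G (half_turn (double_twist x))}"
    using subsetD[OF Q_group_subset[OF fin] f(1)] unfolding f(2)
    by (elim insertE emptyE) (simp_all add: on_inner_class[OF bid x] on_inner_class[OF bm(1) x]
      on_inner_class[OF bm(2) x] on_inner_class[OF braid_move_comp[OF bm] x])
  moreover have "y \<in> inner_class G y" by (rule inner_class_self[OF y])
  ultimately consider "y \<in> inner_class G x" | "y \<in> inner_class G (half_turn x)"
    | "y \<in> inner_class G (double_twist x)" | "y \<in> inner_class G (half_turn (double_twist x))"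
    by (metis insertE singletonD)
  then show ?thesis
  proof cases
    case 1 then show ?thesis using that(1) by (subst (asm) inner_class_conj_quad) blast
  next
    case 2 then show ?thesis using that(2) by (subst (asm) inner_class_conj_quad) blast
  next
    case 3 then show ?thesis using that(3) by (subst (asm) inner_class_conj_quad) blast
  next
    case 4 then show ?thesis using that(4) by (subst (asm) inner_class_conj_quad) blast
  qed
qed

end

section \<open>Permutations of order two, three and five\<close>

text \<open>The set \<open>C\<close> takes one point from each two-element orbit.\<close>

lemma involution_transversal:
  assumes "finite X" "\<And>x. x \<in> X \<Longrightarrow> f x \<in> X" "\<And>x. x \<in> X \<Longrightarrow> f (f x) = x" "\<And>x. x \<in> X \<Longrightarrow> f x \<noteq> x"
  shows "\<exists>C. C \<inter> f ` C = {} \<and> C \<union> f ` C = X"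
  using assms
proof (induction "card X" arbitrary: X rule: less_induct)
  case less
  show ?case
  proof (cases "X = {}")
    case False
    then obtain x where x: "x \<in> X" by blast
    let ?Y = "X - {x, f x}"
    have "f y \<in> ?Y" if "y \<in> ?Y" for y
      using that x less.prems(2,3) by (metis DiffE DiffI insert_iff singletonD)
    then obtain C where C: "C \<inter> f ` C = {}" "C \<union> f ` C = ?Y"
      using less.hyps[of ?Y] less.prems x by (metis DiffD1 finite_Diff psubset_card_mono Diff_subset insertI1 psubsetI DiffD2)
    have "insert x C \<inter> f ` insert x C = {}"
      using C x less.prems(4)[OF x] by (auto; blast)
    moreover have "insert x C \<union> f ` insert x C = X"
      using C x less.prems(2)[OF x] by auto
    ultimately show ?thesis by blast
  qed auto
qed

lemma three_cycle_inter:
  assumes "p \<noteq> q" "q \<noteq> r" "r \<noteq> p" "f p = q" "f q = r" "f r = p" "S \<subseteq> {p, q, r}"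
  shows "odd (card (S \<inter> f ` S)) \<longleftrightarrow> 2 \<le> card S"
proof -
  have "S \<in> Pow {p, q, r}" using assms by blast
  then show ?thesis using assms(1-6) by (auto simp: Pow_insert)
qed

lemma three_cycle_cut:
  assumes "p \<noteq> q" "q \<noteq> r" "r \<noteq> p" "f p = q" "f q = r" "f r = p" "\<not> {p, q, r} \<subseteq> B" "\<not> {p, q, r} \<inter> B = {}"
  shows "card {x \<in> {p, q, r}. x \<in> B \<longleftrightarrow> f x \<in> B} = 1"
proof -
  have "{x \<in> {p, q, r}. x \<in> B \<longleftrightarrow> f x \<in> B} =
    (if (p \<in> B) = (q \<in> B) then {p} else {}) \<union> (if (q \<in> B) = (r \<in> B) then {q} else {}) \<union>
    (if (r \<in> B) = (p \<in> B) then {r} else {})"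
    using assms by auto
  then show ?thesis using assms by auto
qed

text \<open>Five is prime, so a point that moves has an orbit of length five. On a smaller set the permutation is
  trivial.\<close>

lemma fifth_power_orbit:
  assumes S: "finite S" "\<And>x. x \<in> S \<Longrightarrow> f x \<in> S"
    and five: "\<And>x. x \<in> S \<Longrightarrow> f (f (f (f (f x)))) = x" and x: "x \<in> S" "f x \<noteq> x"
  shows "5 \<le> card S"
proof -
  have c: "f x \<in> S" "f (f x) \<in> S" "f (f (f x)) \<in> S" "f (f (f (f x))) \<in> S" using S(2) x(1) by auto
  have f5: "f (f (f (f (f x)))) = x" using five x(1) by blast
  have d: "f (f x) \<noteq> x" "f (f (f x)) \<noteq> x" "f (f (f (f x))) \<noteq> x" using f5 x(2) by metis+
  have "distinct [x, f x, f (f x), f (f (f x)), f (f (f (f x)))]"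
    using d x(2) f5 by (simp, metis)
  then have "card (set [x, f x, f (f x), f (f (f x)), f (f (f (f x)))]) = 5" by (subst distinct_card) simp_all
  moreover have "set [x, f x, f (f x), f (f (f x)), f (f (f (f x)))] \<subseteq> S" using c x(1) by simp
  ultimately show ?thesis using card_mono[OF S(1)] by metis
qed

locale two_three_cycles =
  fixes X :: "'w set" and f :: "'w \<Rightarrow> 'w"
  assumes card: "card X = 6"
    and closed: "x \<in> X \<Longrightarrow> f x \<in> X"
    and cube: "x \<in> X \<Longrightarrow> f (f (f x)) = x"
    and free: "x \<in> X \<Longrightarrow> f x \<noteq> x"
begin

definition cyc :: "'w \<Rightarrow> 'w set" where "cyc x = {x, f x, f (f x)}"

lemma fin: "finite X" using card by (metis card.infinite zero_neq_numeral)

lemma free2: "x \<in> X \<Longrightarrow> f (f x) \<noteq> x" "x \<in> X \<Longrightarrow> f (f x) \<noteq> f x"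
  using closed cube free by metis+

lemma cyc_subset: "x \<in> X \<Longrightarrow> cyc x \<subseteq> X"
  using closed by (simp add: cyc_def)

lemma card_cyc: "x \<in> X \<Longrightarrow> card (cyc x) = 3"
  using free[of x] free2[of x] by (simp add: cyc_def eq_commute)

lemma image_cyc: "x \<in> X \<Longrightarrow> f ` cyc x = cyc x"
  using cube by (auto simp: cyc_def)

lemma cyc_eq: "x \<in> X \<Longrightarrow> y \<in> cyc x \<Longrightarrow> cyc y = cyc x"
  using cube by (auto simp: cyc_def)

lemma inj: "inj_on f X"
  using cube by (metis inj_onI)

lemma compl_cyc:
  assumes "x \<in> X"
  obtains y where "y \<in> X" "X - cyc x = cyc y"
proof -
  have c: "card (X - cyc x) = 3"
    using card card_cyc[OF assms] cyc_subset[OF assms] fin by (simp add: card_Diff_subset finite_subset)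
  then obtain y where y: "y \<in> X" "y \<notin> cyc x" by (metis DiffE card.empty equals0I zero_neq_numeral)
  have "cyc y \<inter> cyc x = {}"
    using cyc_eq assms y by (metis IntE cyc_def equals0I insertI1)
  then have "cyc y \<subseteq> X - cyc x" using cyc_subset[OF y(1)] by blast
  then have "cyc y = X - cyc x" using c card_cyc[OF y(1)] fin by (intro card_subset_eq) auto
  then show ?thesis using that y by metis
qed

text \<open>A three-set is a cycle or meets the two cycles in one and two points. It meets its image in three points
  in the first case and in one point in the second.\<close>

lemma odd_inter_image:
  assumes S: "S \<subseteq> X" "card S = 3"
  shows "odd (card (S \<inter> f ` S))"
proof -
  obtain x where x: "x \<in> X" using card by fastforce
  obtain y where y: "y \<in> X" "X - cyc x = cyc y" using compl_cyc[OF x] .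
  let ?A = "S \<inter> cyc x" and ?B = "S \<inter> cyc y"
  have XU: "X = cyc x \<union> cyc y" "cyc x \<inter> cyc y = {}" using y cyc_subset[OF x] by blast+
  have S_eq: "S = ?A \<union> ?B" using S XU by blast
  have finS: "finite S" using S fin finite_subset by blast
  have c: "card ?A + card ?B = 3"
    using S(2) S_eq card_Un_disjoint[of ?A ?B] finS XU(2) by auto
  have fA: "f ` ?A \<subseteq> cyc x" using image_cyc[OF x] by blast
  have fB: "f ` ?B \<subseteq> cyc y" using image_cyc[OF y(1)] by blast
  have "S \<inter> f ` S = (?A \<inter> f ` ?A) \<union> (?B \<inter> f ` ?B)"
  proof
    show "S \<inter> f ` S \<subseteq> (?A \<inter> f ` ?A) \<union> (?B \<inter> f ` ?B)"
    proof
      fix v assume v: "v \<in> S \<inter> f ` S"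
      then obtain w where w: "w \<in> S" "v = f w" by blast
      then consider "w \<in> ?A" | "w \<in> ?B" using S_eq by blast
      then show "v \<in> (?A \<inter> f ` ?A) \<union> (?B \<inter> f ` ?B)" using v w fA fB by cases blast+
    qed
  qed blast
  moreover have "(?A \<inter> f ` ?A) \<inter> (?B \<inter> f ` ?B) = {}" using XU(2) by blast
  ultimately have "card (S \<inter> f ` S) = card (?A \<inter> f ` ?A) + card (?B \<inter> f ` ?B)"
    using finS by (simp add: card_Un_disjoint)
  moreover have "odd (card (?A \<inter> f ` ?A)) \<longleftrightarrow> 2 \<le> card ?A"
    by (rule three_cycle_inter[of x "f x" "f (f x)"]) (use free[OF x] free2[OF x] cube[OF x] in \<open>auto simp: cyc_def\<close>)
  moreover have "odd (card (?B \<inter> f ` ?B)) \<longleftrightarrow> 2 \<le> card ?B"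
    by (rule three_cycle_inter[of y "f y" "f (f y)"]) (use free[OF y(1)] free2[OF y(1)] cube[OF y(1)] in \<open>auto simp: cyc_def\<close>)
  moreover have "2 \<le> card ?A \<longleftrightarrow> \<not> 2 \<le> card ?B" using c by linarith
  ultimately show ?thesis by simp
qed

text \<open>Invariant sets are unions of cycles.\<close>

lemma invariant_card:
  assumes "S \<subseteq> X" "f ` S = S"
  shows "S = {} \<or> S = X \<or> card S = 3"
proof (cases "S = {} \<or> S = X")
  case False
  then obtain x y where x: "x \<in> S" and y: "y \<in> X" "y \<notin> S" using assms by blast
  have xX: "x \<in> X" using x assms by blast
  have fS: "f v \<in> S" if "v \<in> S" for v using that assms(2) by blast
  then have sub: "cyc v \<subseteq> S" if "v \<in> S" for v using that by (simp add: cyc_def)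
  have c: "cyc x \<subseteq> S" by (rule sub[OF x])
  obtain w where w: "w \<in> X" "X - cyc x = cyc w" using compl_cyc[OF xX] .
  have "S \<inter> cyc w = {}"
  proof (rule ccontr)
    assume "S \<inter> cyc w \<noteq> {}"
    then obtain v where v: "v \<in> S" "v \<in> cyc w" by blast
    then have "cyc w \<subseteq> S" using cyc_eq[OF w(1) v(2)] sub by metis
    then show False using w c y by blast
  qed
  then have "S = cyc x" using c w assms by blast
  then show ?thesis using card_cyc[OF xX] by simp
qed auto

text \<open>The set \<open>B\<close> cuts each of the two triangles into one and two points, and of the three edges of a
  triangle cut in this way one is not cut.\<close>

lemma cut_count:
  assumes "B \<subseteq> X" "\<And>x. x \<in> X \<Longrightarrow> cyc x \<noteq> B" "card B = 3"
  shows "card {x \<in> X. x \<in> B \<longleftrightarrow> f x \<in> B} = 2"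
proof -
  have finB: "finite B" using assms fin finite_subset by blast
  have ns: "\<not> cyc x \<subseteq> B" if "x \<in> X" for x
    using assms(2)[OF that] card_subset_eq[OF finB] card_cyc[OF that] assms(3) by auto
  have ni: "cyc x \<inter> B \<noteq> {}" if x: "x \<in> X" for x
  proof
    assume "cyc x \<inter> B = {}"
    obtain y where y: "y \<in> X" "X - cyc x = cyc y" using compl_cyc[OF x] .
    then have "B \<subseteq> cyc y" using assms(1) \<open>cyc x \<inter> B = {}\<close> by blast
    then have "B = cyc y" using card_cyc[OF y(1)] assms(3) by (intro card_subset_eq) (auto simp: cyc_def)
    then show False using assms(2)[OF y(1)] by simp
  qed
  have one: "card {y \<in> cyc x. y \<in> B \<longleftrightarrow> f y \<in> B} = 1" if x: "x \<in> X" for x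
    using three_cycle_cut[of x "f x" "f (f x)" f B] free[OF x] free2[OF x] cube[OF x] ns[OF x] ni[OF x]
    by (auto simp: cyc_def)
  obtain x where x: "x \<in> X" using card by fastforce
  obtain y where y: "y \<in> X" "X - cyc x = cyc y" using compl_cyc[OF x] .
  have "{x \<in> X. x \<in> B \<longleftrightarrow> f x \<in> B} =
    {v \<in> cyc x. v \<in> B \<longleftrightarrow> f v \<in> B} \<union> {v \<in> cyc y. v \<in> B \<longleftrightarrow> f v \<in> B}"
    using y cyc_subset[OF x] by blast
  moreover have "{v \<in> cyc x. v \<in> B \<longleftrightarrow> f v \<in> B} \<inter> {v \<in> cyc y. v \<in> B \<longleftrightarrow> f v \<in> B} = {}" using y by blast
  ultimately show ?thesis
    using one[OF x] one[OF y(1)] card_Un_disjoint[of "{v \<in> cyc x. v \<in> B \<longleftrightarrow> f v \<in> B}" "{v \<in> cyc y. v \<in> B \<longleftrightarrow> f v \<in> B}"]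
    by (simp add: cyc_def)
qed

end

section \<open>Central extensions of a group with a module on six points\<close>

text \<open>In the application \<open>G = G\<^sub>1\<close>, \<open>X\<close> consists of the six cosets, on which \<open>G\<close> acts through \<open>A\<^sub>5\<close> from the
  right, and \<open>m S\<close> is the class of the vector with support \<open>S\<close>; thus \<open>m ` Pow X\<close> is \<open>M\<close> and the sets of
  even size give \<open>V\<close>. The assumption \<open>square_odd\<close> says that no involution of \<open>A\<^sub>5\<close> lifts to an
  element with square in \<open>V\<close>, as in \<open>SL\<^sub>2(\<int>/5)\<close>.\<close>

locale six_point_cover = group G + R: group R
  for G :: "'g monoid" (structure) and R :: "'r monoid" +
  fixes \<pi> :: "'r \<Rightarrow> 'g" and z :: 'r
    and X :: "'w set" and act :: "'g \<Rightarrow> 'w \<Rightarrow> 'w" and m :: "'w set \<Rightarrow> 'g"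
  assumes \<pi>_hom: "\<pi> \<in> hom R G" and \<pi>_surj: "\<pi> ` carrier R = carrier G"
    and \<pi>_kernel: "kernel R G \<pi> = {\<one>\<^bsub>R\<^esub>, z}" and z_neq: "z \<noteq> \<one>\<^bsub>R\<^esub>"
    and fin_G: "finite (carrier G)"
    and card_X: "card X = 6"
    and act_closed: "g \<in> carrier G \<Longrightarrow> w \<in> X \<Longrightarrow> act g w \<in> X"
    and act_mult: "g \<in> carrier G \<Longrightarrow> h \<in> carrier G \<Longrightarrow> w \<in> X \<Longrightarrow> act (g \<otimes> h) w = act h (act g w)"
    and act_trans: "v \<in> X \<Longrightarrow> w \<in> X \<Longrightarrow> \<exists>g\<in>carrier G. act g v = w"
    and m_closed: "S \<subseteq> X \<Longrightarrow> m S \<in> carrier G"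
    and m_add: "S \<subseteq> X \<Longrightarrow> T \<subseteq> X \<Longrightarrow> m S \<otimes> m T = m (sym_diff S T)"
    and m_eq: "S \<subseteq> X \<Longrightarrow> T \<subseteq> X \<Longrightarrow> m S = m T \<longleftrightarrow> T = S \<or> T = X - S"
    and conj_m: "S \<subseteq> X \<Longrightarrow> g \<in> carrier G \<Longrightarrow> conj_by G (m S) g = m (act g ` S)"
    and act_trivial: "g \<in> carrier G \<Longrightarrow> (\<forall>w\<in>X. act g w = w) \<longleftrightarrow> g \<in> m ` Pow X"
    and frattini: "subgroup H G \<Longrightarrow> \<forall>g\<in>carrier G. \<exists>h\<in>H. \<exists>n\<in>m ` Pow X. g = h \<otimes> n \<Longrightarrow> H = carrier G"
    and square_odd: "g \<in> carrier G \<Longrightarrow> g \<notin> m ` Pow X \<Longrightarrow> S \<subseteq> X \<Longrightarrow> g \<otimes> g = m S \<Longrightarrow> odd (card S)"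
    and lift_even: "y \<in> carrier R \<Longrightarrow> S \<subseteq> X \<Longrightarrow> \<pi> y = m S \<Longrightarrow> even (card S) \<Longrightarrow> y \<otimes>\<^bsub>R\<^esub> y = \<one>\<^bsub>R\<^esub>"
    and lift_odd: "y \<in> carrier R \<Longrightarrow> S \<subseteq> X \<Longrightarrow> \<pi> y = m S \<Longrightarrow> odd (card S) \<Longrightarrow> y \<otimes>\<^bsub>R\<^esub> y = z"
    and lift_comm: "x \<in> carrier R \<Longrightarrow> y \<in> carrier R \<Longrightarrow> \<pi> x \<in> m ` Pow X \<Longrightarrow> \<pi> y \<in> m ` Pow X \<Longrightarrow>
      x \<otimes>\<^bsub>R\<^esub> y = y \<otimes>\<^bsub>R\<^esub> x"
    and stabilizer_order: "g \<in> carrier G \<Longrightarrow> w \<in> X \<Longrightarrow> act g w = w \<Longrightarrow>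
      g \<otimes> g \<in> m ` Pow X \<or> g [^] (5::nat) \<in> m ` Pow X"
    and involution_fixes: "g \<in> carrier G \<Longrightarrow> g \<notin> m ` Pow X \<Longrightarrow> g \<otimes> g \<in> m ` Pow X \<Longrightarrow>
      u \<in> X \<Longrightarrow> v \<in> X \<Longrightarrow> w \<in> X \<Longrightarrow> u \<noteq> v \<Longrightarrow> u \<noteq> w \<Longrightarrow> act g u = u \<Longrightarrow> act g v = v \<Longrightarrow> act g w = w \<Longrightarrow> v = w"
    and four_group: "\<exists>s\<in>carrier G. \<exists>t\<in>carrier G. \<exists>v\<in>X. \<exists>w\<in>X.
      s \<otimes> s \<in> m ` Pow X \<and> t \<otimes> t \<in> m ` Pow X \<and> act s v = v \<and> act t w = w \<and>
      (\<forall>u\<in>X. act (s \<otimes> t) u = act (t \<otimes> s) u \<and> \<not> (act s u = u \<and> act t u = u))"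
    and generating_pair: "g \<in> carrier G \<Longrightarrow> h \<in> carrier G \<Longrightarrow> ord g = 3 \<Longrightarrow> ord h = 3 \<Longrightarrow>
      generate G {g, h} = carrier G \<Longrightarrow>
      inv h \<otimes> g \<notin> m ` Pow X \<and> (\<exists>S\<subseteq>X. odd (card S) \<and> (inv h \<otimes> g) [^] (5::nat) = m S)"
begin

abbreviation mult_R (infixl "\<cdot>" 70) where "x \<cdot> y \<equiv> x \<otimes>\<^bsub>R\<^esub> y"

abbreviation M :: "'g set" where "M \<equiv> m ` Pow X"
definition odd_part :: "'g set" where "odd_part = {m S | S. S \<subseteq> X \<and> odd (card S)}"

section \<open>Points and the module\<close>

lemma fin_X: "finite X" using card_X by (metis card.infinite zero_neq_numeral)

lemma fin_sub: "S \<subseteq> X \<Longrightarrow> finite S" using fin_X finite_subset by blast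

lemma M_closed: "x \<in> M \<Longrightarrow> x \<in> carrier G" using m_closed by blast

lemma odd_subset_M: "x \<in> odd_part \<Longrightarrow> x \<in> M" by (auto simp: odd_part_def)

lemma odd_closed: "x \<in> odd_part \<Longrightarrow> x \<in> carrier G" using odd_subset_M M_closed by blast

lemma m_empty: "m {} = \<one>"
proof -
  have "m {} \<otimes> m {} = m {}" using m_add[of "{}" "{}"] by simp
  then show ?thesis using m_closed[of "{}"] by simp
qed

lemma m_X: "m X = \<one>" using m_eq[of "{}" X] m_empty by auto

lemma M_mult: "x \<in> M \<Longrightarrow> y \<in> M \<Longrightarrow> x \<otimes> y \<in> M" using m_add by auto

lemma M_square: "x \<in> M \<Longrightarrow> x \<otimes> x = \<one>" using m_add m_empty by auto

lemma M_inv: "x \<in> M \<Longrightarrow> inv x = x" using M_square M_closed by (metis inv_equality)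

lemma M_comm: "x \<in> M \<Longrightarrow> y \<in> M \<Longrightarrow> x \<otimes> y = y \<otimes> x"
proof -
  assume "x \<in> M" "y \<in> M"
  then obtain S T where "S \<subseteq> X" "T \<subseteq> X" "x = m S" "y = m T" by blast
  then show ?thesis using m_add[of S T] m_add[of T S] by (simp add: Un_commute)
qed

lemma act_image: "g \<in> carrier G \<Longrightarrow> S \<subseteq> X \<Longrightarrow> act g ` S \<subseteq> X" using act_closed by blast

lemma M_conj: "x \<in> M \<Longrightarrow> g \<in> carrier G \<Longrightarrow> conj_by G x g \<in> M"
  using conj_m act_image by auto

lemma act_one: "w \<in> X \<Longrightarrow> act \<one> w = w"
  using act_trivial[of \<one>] m_empty by (metis Pow_bottom image_eqI one_closed)

lemma act_M: "x \<in> M \<Longrightarrow> w \<in> X \<Longrightarrow> act x w = w" using act_trivial M_closed by blast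

lemma act_inv: "g \<in> carrier G \<Longrightarrow> w \<in> X \<Longrightarrow> act (inv g) (act g w) = w"
  using act_mult[of g "inv g" w] act_one by simp

lemma act_inv': "g \<in> carrier G \<Longrightarrow> w \<in> X \<Longrightarrow> act g (act (inv g) w) = w"
  using act_mult[of "inv g" g w] act_one by simp

lemma act_inj: "g \<in> carrier G \<Longrightarrow> inj_on (act g) X"
  using act_inv by (metis inj_onI)

lemma card_act: "g \<in> carrier G \<Longrightarrow> S \<subseteq> X \<Longrightarrow> card (act g ` S) = card S"
  using act_inj inj_on_subset by (metis card_image)

lemma act_X: "g \<in> carrier G \<Longrightarrow> act g ` X = X"
  using act_closed act_inv' by (metis (no_types, lifting) image_subset_iff inv_closed rev_image_eqI subsetI subset_antisym)

lemma act_compl: "g \<in> carrier G \<Longrightarrow> S \<subseteq> X \<Longrightarrow> act g ` (X - S) = X - act g ` S"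
  using act_X act_inj by (metis Diff_subset inj_on_image_set_diff order_refl)

lemma card_compl: "S \<subseteq> X \<Longrightarrow> card (X - S) = 6 - card S"
  using fin_X card_X by (simp add: card_Diff_subset fin_sub)

lemma card_le: "S \<subseteq> X \<Longrightarrow> card S \<le> 6" using card_mono[OF fin_X] card_X by metis

lemma odd_compl: "S \<subseteq> X \<Longrightarrow> odd (card (X - S)) \<longleftrightarrow> odd (card S)"
  using card_compl[of S] card_le[of S] by (simp add: even_diff_nat)

lemma m_compl: "S \<subseteq> X \<Longrightarrow> m (X - S) = m S"
  using m_eq[of S "X - S"] by auto

lemma odd_part_iff: "S \<subseteq> X \<Longrightarrow> m S \<in> odd_part \<longleftrightarrow> odd (card S)"
  using m_eq odd_compl by (auto simp: odd_part_def)

lemma card_sym_diff: "S \<subseteq> X \<Longrightarrow> T \<subseteq> X \<Longrightarrow> card (sym_diff S T) + 2 * card (S \<inter> T) = card S + card T"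
proof -
  assume S: "S \<subseteq> X" and T: "T \<subseteq> X"
  have "card S = card (S - T) + card (S \<inter> T)" "card T = card (T - S) + card (S \<inter> T)"
    using fin_sub[OF S] fin_sub[OF T] by (metis Int_commute add.commute card_Int_Diff)+
  moreover have "card (sym_diff S T) = card (S - T) + card (T - S)"
    using fin_sub[OF S] fin_sub[OF T] by (intro card_Un_disjoint) auto
  ultimately show ?thesis by simp
qed

lemma even_sym_diff: "S \<subseteq> X \<Longrightarrow> T \<subseteq> X \<Longrightarrow> even (card (sym_diff S T)) \<longleftrightarrow> (even (card S) \<longleftrightarrow> even (card T))"
  using card_sym_diff[of S T] by presburger

lemma odd_mult: "x \<in> M \<Longrightarrow> y \<in> M \<Longrightarrow> x \<otimes> y \<in> odd_part \<longleftrightarrow> (x \<in> odd_part \<longleftrightarrow> y \<notin> odd_part)"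
proof -
  assume "x \<in> M" "y \<in> M"
  then obtain S T where ST: "S \<subseteq> X" "T \<subseteq> X" "x = m S" "y = m T" by blast
  then have "sym_diff S T \<subseteq> X" by blast
  then show ?thesis using ST even_sym_diff[of S T] m_add[of S T] odd_part_iff by auto
qed

lemma odd_conj: "x \<in> M \<Longrightarrow> g \<in> carrier G \<Longrightarrow> conj_by G x g \<in> odd_part \<longleftrightarrow> x \<in> odd_part"
  using conj_m act_image odd_part_iff card_act by auto

lemma M_one: "\<one> \<in> M" using m_empty by (metis Pow_bottom image_eqI)

lemma fin_M: "finite M" using fin_X by simp

section \<open>Elements of order three\<close>

lemma ord3D:
  assumes "g \<in> carrier G" "ord g = 3"
  shows "g \<otimes> (g \<otimes> g) = \<one>" "g \<otimes> g = inv g" "g \<noteq> \<one>" "inv g \<otimes> inv g = g"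
proof -
  have "g [^] (3::nat) = \<one>" using assms pow_ord_eq_1 by metis
  then show 1: "g \<otimes> (g \<otimes> g) = \<one>" using assms by (simp add: numeral_3_eq_3 m_assoc)
  then have "(g \<otimes> g) \<otimes> g = \<one>" using assms(1) by (simp add: m_assoc)
  then show 2: "g \<otimes> g = inv g" using assms(1) inv_equality[of "g \<otimes> g" g] by simp
  show "g \<noteq> \<one>" using assms ord_eq_1[of g] by auto
  show "inv g \<otimes> inv g = g" using assms 2 by (metis inv_inv inv_mult_group)
qed

lemma ord3_not_M: "g \<in> carrier G \<Longrightarrow> ord g = 3 \<Longrightarrow> g \<notin> M"
  using ord3D M_square r_one by metis

text \<open>A point fixed by \<open>g\<close> would give \<open>g\<^sup>2 \<in> M\<close> or \<open>g\<^sup>5 \<in> M\<close>, and with \<open>g\<^sup>3 = 1\<close> this puts \<open>g\<close> into \<open>M\<close>, a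
  group of exponent two.\<close>

lemma ord3_cycles:
  assumes g: "g \<in> carrier G" "ord g = 3"
  shows "two_three_cycles X (act g)"
proof
  show "card X = 6" by (rule card_X)
  show "act g w \<in> X" if "w \<in> X" for w using that act_closed g by blast
  show "act g (act g (act g w)) = w" if w: "w \<in> X" for w
  proof -
    have "act (g \<otimes> (g \<otimes> g)) w = act g (act g (act g w))"
      using w g act_mult act_closed by simp
    then show ?thesis using ord3D[OF g] act_one w by simp
  qed
  show "act g w \<noteq> w" if w: "w \<in> X" for w
  proof
    assume fx: "act g w = w"
    have "g [^] (5::nat) = g \<otimes> (g \<otimes> g) \<otimes> (g \<otimes> g)"
      using g by (simp add: numeral_eq_Suc m_assoc)
    then have "g [^] (5::nat) = inv g" using ord3D[OF g] g by simp
    then have "inv g \<in> M"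
      using stabilizer_order[OF g(1) w fx] ord3D(2)[OF g] by auto
    then have "g \<in> M" using M_inv g by (metis inv_inv)
    then show False using ord3_not_M g by blast
  qed
qed

lemma ord_inv3: "g \<in> carrier G \<Longrightarrow> ord g = 3 \<Longrightarrow> ord (inv g) = 3"
  using ord_inv by auto

section \<open>The central element\<close>

lemma \<pi>_closed [simp]: "y \<in> carrier R \<Longrightarrow> \<pi> y \<in> carrier G" using \<pi>_surj by blast

lemma \<pi>_mult [simp]: "x \<in> carrier R \<Longrightarrow> y \<in> carrier R \<Longrightarrow> \<pi> (x \<cdot> y) = \<pi> x \<otimes> \<pi> y"
  using \<pi>_hom by (simp add: hom_def)

lemma group_hom_\<pi>: "group_hom R G \<pi>"
  by (simp add: group_hom.intro group_hom_axioms.intro \<pi>_hom R.group_axioms is_group)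

lemma \<pi>_one [simp]: "\<pi> \<one>\<^bsub>R\<^esub> = \<one>" using group_hom.hom_one[OF group_hom_\<pi>] .

lemma \<pi>_inv [simp]: "y \<in> carrier R \<Longrightarrow> \<pi> (inv\<^bsub>R\<^esub> y) = inv (\<pi> y)"
  using group_hom.hom_inv[OF group_hom_\<pi>] .

lemma \<pi>_pow [simp]: "y \<in> carrier R \<Longrightarrow> \<pi> (y [^]\<^bsub>R\<^esub> (n::nat)) = \<pi> y [^] n"
  by (induction n) auto

lemma \<pi>_conj [simp]: "x \<in> carrier R \<Longrightarrow> y \<in> carrier R \<Longrightarrow> \<pi> (conj_by R x y) = conj_by G (\<pi> x) (\<pi> y)"
  by (simp add: conj_by_def)

lemma ker_cases: "y \<in> carrier R \<Longrightarrow> \<pi> y = \<one> \<Longrightarrow> y = \<one>\<^bsub>R\<^esub> \<or> y = z"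
  using \<pi>_kernel by (auto simp: kernel_def)

lemma z_closed [simp]: "z \<in> carrier R" and \<pi>_z [simp]: "\<pi> z = \<one>"
  using \<pi>_kernel by (auto simp: kernel_def)

lemma z_square [simp]: "z \<cdot> z = \<one>\<^bsub>R\<^esub>"
  using ker_cases[of "z \<cdot> z"] z_neq by auto

lemma z_inv [simp]: "inv\<^bsub>R\<^esub> z = z" by (rule R.inv_equality) auto

lemma z_central: "y \<in> carrier R \<Longrightarrow> z \<cdot> y = y \<cdot> z"
proof -
  assume y: "y \<in> carrier R"
  have "conj_by R z y = \<one>\<^bsub>R\<^esub> \<or> conj_by R z y = z" using y by (intro ker_cases) auto
  moreover have "conj_by R z y \<noteq> \<one>\<^bsub>R\<^esub>"
    using y z_neq by (metis R.conj_by_inject R.conj_by_one_left R.one_closed z_closed)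
  ultimately show ?thesis using y R.conj_by_commute[of z y] by auto
qed

lemma same_\<pi>:
  assumes "x \<in> carrier R" "y \<in> carrier R" "\<pi> x = \<pi> y"
  shows "x = y \<or> x = z \<cdot> y"
proof -
  have "x \<cdot> inv\<^bsub>R\<^esub> y = \<one>\<^bsub>R\<^esub> \<or> x \<cdot> inv\<^bsub>R\<^esub> y = z"
    using assms by (intro ker_cases) auto
  then show ?thesis using assms by (metis R.inv_solve_right' R.l_one z_closed R.one_closed R.m_closed R.inv_closed R.inv_mult_cancel R.r_inv R.m_assoc R.l_inv R.r_one)
qed

lemma z_mult_left: "x \<in> carrier R \<Longrightarrow> y \<in> carrier R \<Longrightarrow> x \<cdot> (z \<cdot> y) = z \<cdot> (x \<cdot> y)"
  by (metis R.m_assoc z_central z_closed)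

lemma z_z: "x \<in> carrier R \<Longrightarrow> z \<cdot> (z \<cdot> x) = x"
  by (metis R.m_assoc R.l_one z_closed z_square)

lemma conj_z: "x \<in> carrier R \<Longrightarrow> y \<in> carrier R \<Longrightarrow> conj_by R (z \<cdot> x) y = z \<cdot> conj_by R x y"
  by (simp add: conj_by_def R.m_assoc z_mult_left)

lemma conj_z_right: "x \<in> carrier R \<Longrightarrow> y \<in> carrier R \<Longrightarrow> conj_by R x (z \<cdot> y) = conj_by R x y"
proof -
  assume [simp]: "x \<in> carrier R" "y \<in> carrier R"
  have "conj_by R x z = x" using z_central[of x] R.conj_by_commute[of x z] by simp
  then show ?thesis by (simp flip: R.conj_by_conj_by)
qed

lemma z_cancel: "x \<in> carrier R \<Longrightarrow> z \<cdot> x \<noteq> x"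
  using z_neq by (metis R.l_one R.one_closed R.right_cancel z_closed)

section \<open>Lifts of elements of order three\<close>

lemma lift_exists: "x \<in> carrier G \<Longrightarrow> \<exists>y\<in>carrier R. \<pi> y = x" using \<pi>_surj by (metis imageE)

lemma ord3_R:
  assumes "y \<in> carrier R" "\<pi> y = x" "ord x = 3"
  shows "group.ord R y = 3 \<longleftrightarrow> y \<cdot> (y \<cdot> y) = \<one>\<^bsub>R\<^esub>"
proof -
  have p: "y [^]\<^bsub>R\<^esub> (3::nat) = y \<cdot> (y \<cdot> y)"
    using assms by (simp add: numeral_3_eq_3 R.m_assoc)
  show ?thesis
  proof
    assume "R.ord y = 3" then show "y \<cdot> (y \<cdot> y) = \<one>\<^bsub>R\<^esub>"
      using R.pow_ord_eq_1[OF assms(1)] p by simp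
  next
    assume "y \<cdot> (y \<cdot> y) = \<one>\<^bsub>R\<^esub>"
    then have d: "R.ord y dvd 3" using p R.pow_eq_id[OF assms(1)] by simp
    have "x [^] R.ord y = \<one>" using R.pow_ord_eq_1[OF assms(1)] assms by (metis \<pi>_one \<pi>_pow)
    then have "3 dvd R.ord y" using pow_eq_id[of x "R.ord y"] assms by auto
    then show "R.ord y = 3" using d by (simp add: dvd_antisym)
  qed
qed

text \<open>If \<open>y\<^sup>3 \<in> {1, z}\<close> then exactly one of \<open>y\<close> and \<open>z y\<close> has cube one.\<close>

lemma unique_lift3:
  assumes x: "x \<in> carrier G" "ord x = 3"
  shows "\<exists>!y. y \<in> lifts R \<pi> x \<and> group.ord R y = 3"
proof -
  obtain y where y: "y \<in> carrier R" "\<pi> y = x" using lift_exists[OF x(1)] by blast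
  let ?c = "\<lambda>y. y \<cdot> (y \<cdot> y)"
  have "\<pi> (?c y) = \<one>" using y ord3D(1)[OF x] by simp
  then have c: "?c y = \<one>\<^bsub>R\<^esub> \<or> ?c y = z"
    using y(1) by (intro ker_cases) simp_all
  have cz: "?c (z \<cdot> y) = z \<cdot> ?c y" if "y \<in> carrier R" for y
    using that by (simp add: R.m_assoc z_mult_left[of y] z_z)
  have "\<exists>y0\<in>carrier R. \<pi> y0 = x \<and> ?c y0 = \<one>\<^bsub>R\<^esub>"
  proof (cases "?c y = \<one>\<^bsub>R\<^esub>")
    case True then show ?thesis using y by blast
  next
    case False
    then have "?c y = z" using c by blast
    then have "?c (z \<cdot> y) = \<one>\<^bsub>R\<^esub>" using cz y by simp
    moreover have "\<pi> (z \<cdot> y) = x" using y x by simp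
    ultimately show ?thesis using y(1) R.m_closed[OF z_closed y(1)] by blast
  qed
  then obtain y0 where y0: "y0 \<in> carrier R" "\<pi> y0 = x" "?c y0 = \<one>\<^bsub>R\<^esub>" by blast
  have c0: "?c (z \<cdot> y0) = z" using cz[OF y0(1)] y0(3) by simp
  show ?thesis
  proof (rule ex1I[of _ y0])
    show "y0 \<in> lifts R \<pi> x \<and> R.ord y0 = 3" using y0 ord3_R[OF y0(1,2) x(2)] by (simp add: lifts_def)
    fix u assume u: "u \<in> lifts R \<pi> x \<and> R.ord u = 3"
    then have u': "u \<in> carrier R" "\<pi> u = x" "?c u = \<one>\<^bsub>R\<^esub>" using ord3_R[of u x] x by (auto simp: lifts_def)
    then have "u = y0 \<or> u = z \<cdot> y0" using same_\<pi>[of u y0] y0 by simp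
    then show "u = y0" using u'(3) c0 z_neq by metis
  qed
qed

abbreviation lft :: "'g \<Rightarrow> 'r" where "lft \<equiv> lift3 R \<pi>"

lemma lft:
  assumes "x \<in> carrier G" "ord x = 3"
  shows "lft x \<in> carrier R" "\<pi> (lft x) = x" "R.ord (lft x) = 3"
  using theI'[OF unique_lift3[OF assms]] by (auto simp: lift3_def lifts_def)

lemma lft_eqI:
  assumes "x \<in> carrier G" "ord x = 3" "y \<in> carrier R" "\<pi> y = x" "R.ord y = 3"
  shows "lft x = y"
  using unique_lift3[OF assms(1,2)] lft[OF assms(1,2)] assms(3-5) by (auto simp: lifts_def)

lemma lft_conj:
  assumes "x \<in> carrier G" "ord x = 3" "h \<in> carrier R"
  shows "lft (conj_by G x (\<pi> h)) = conj_by R (lft x) h"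
  using assms lft[OF assms(1,2)] by (intro lft_eqI) (simp_all add: ord_conj_by R.ord_conj_by)

lemma lft_inv:
  assumes "x \<in> carrier G" "ord x = 3"
  shows "lft (inv x) = inv\<^bsub>R\<^esub> (lft x)"
  using assms lft[OF assms] by (intro lft_eqI) (simp_all add: ord_inv R.ord_inv)

end

context six_point_cover begin

section \<open>Stabilizers of points act trivially on lifts\<close>

text \<open>Changing \<open>g\<close> by \<open>m C\<close> changes \<open>g\<^sup>2 = m S\<close> by \<open>m (C \<triangle> C\<^sup>g)\<close>. Since \<open>|S|\<close> is odd and \<open>g\<close> fixes at most one
  point besides \<open>i\<close>, the set \<open>S - {i}\<close> consists of pairs interchanged by \<open>g\<close>, and a transversal of these
  pairs can be taken for \<open>C\<close>.\<close>

lemma involution_root: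
  assumes g: "g \<in> carrier G" "g \<notin> M" "g \<otimes> g \<in> M" and i: "i \<in> X" "act g i = i"
  shows "\<exists>n\<in>M. (g \<otimes> n) \<otimes> (g \<otimes> n) = m {i}"
proof -
  have "\<exists>S\<subseteq>X. g \<otimes> g = m S \<and> i \<in> S"
  proof -
    obtain S where S: "S \<subseteq> X" "g \<otimes> g = m S" using g(3) by blast
    show ?thesis using S m_compl[OF S(1)] i(1) by (cases "i \<in> S") (blast, metis DiffI Diff_subset)
  qed
  then obtain S where S: "S \<subseteq> X" "g \<otimes> g = m S" "i \<in> S" by blast
  have odd: "odd (card S)" using square_odd[OF g(1,2) S(1,2)] .
  have gS: "act g ` S = S"
  proof -
    have "conj_by G (m S) g = m S" using g(1) unfolding S(2)[symmetric] by (simp add: conj_by_def m_assoc)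
    then have "m (act g ` S) = m S" using conj_m[OF S(1) g(1)] by simp
    then have "S = act g ` S \<or> S = X - act g ` S" using m_eq[of "act g ` S" S] act_image[OF g(1) S(1)] S(1) by blast
    moreover have "i \<in> act g ` S" using S(3) i(2) by force
    ultimately show ?thesis using S(3) by blast
  qed
  have inv2: "act g (act g w) = w" if "w \<in> X" for w
    using act_M[OF g(3) that] act_mult[OF g(1) g(1) that] by simp
  define F where "F = {w \<in> S - {i}. act g w = w}"
  let ?Y = "S - {i} - F"
  have fS: "finite S" using fin_sub[OF S(1)] .
  have "\<exists>C. C \<inter> act g ` C = {} \<and> C \<union> act g ` C = ?Y"
  proof (rule involution_transversal)
    show "finite ?Y" using fS by simp
    fix w assume w: "w \<in> ?Y"
    then have wX: "w \<in> X" using S by blast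
    show "act g w \<noteq> w" using w by (auto simp: F_def)
    show "act g (act g w) = w" using inv2[OF wX] .
    have "act g w \<in> S" using gS w by blast
    moreover have "act g w \<noteq> i" using inv2[OF wX] i(2) w by auto
    moreover have "act g (act g w) \<noteq> act g w" using inv2[OF wX] \<open>act g w \<noteq> w\<close> by simp
    ultimately show "act g w \<in> ?Y" by (simp add: F_def)
  qed
  then obtain C where C: "C \<inter> act g ` C = {}" "C \<union> act g ` C = ?Y" by blast
  have CX: "C \<subseteq> X" using C S by blast
  have "card ?Y = 2 * card C"
    using card_Un_disjoint[OF fin_sub[OF CX] fin_sub[OF act_image[OF g(1) CX]] C(1)] card_act[OF g(1) CX] C(2)
    by simp
  moreover have "card S = 1 + card F + card ?Y"
  proof -
    have "S = {i} \<union> F \<union> ?Y" "finite F" using S(3) fS by (auto simp: F_def)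
    moreover have "card ({i} \<union> F \<union> ?Y) = card ({i} \<union> F) + card ?Y"
      using fS \<open>finite F\<close> by (intro card_Un_disjoint) auto
    moreover have "card ({i} \<union> F) = 1 + card F" using \<open>finite F\<close> by (simp add: F_def)
    ultimately show ?thesis by simp
  qed
  ultimately have evF: "even (card F)" using odd by simp
  have "F = {}"
  proof (rule ccontr)
    assume "F \<noteq> {}"
    then obtain v where v: "v \<in> F" by blast
    have "F = {v}"
    proof -
      have "w = v" if w: "w \<in> F" for w
      proof -
        have "v \<in> X" "w \<in> X" "v \<noteq> i" "w \<noteq> i" "act g v = v" "act g w = w"
          using v w S by (auto simp: F_def)
        then show ?thesis using involution_fixes[OF g i(1), of w v] i(2) by metis
      qed
      then show ?thesis using v by blast
    qed
    then show False using evF by simp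
  qed
  then have SC: "S - {i} = sym_diff C (act g ` C)" using C by blast
  have gC: "act g ` C \<subseteq> X" using act_image[OF g(1) CX] .
  show ?thesis
  proof (rule bexI[of _ "m C"])
    show "m C \<in> M" using CX by blast
    have mC: "m C \<in> carrier G" "m (act g ` C) \<in> carrier G" using CX gC m_closed by auto
    have "(g \<otimes> m C) \<otimes> (g \<otimes> m C) = (g \<otimes> g) \<otimes> (conj_by G (m C) g \<otimes> m C)"
      using mC g by (simp add: conj_by_def m_assoc)
    also have "\<dots> = m S \<otimes> m (sym_diff (act g ` C) C)"
      using S conj_m[OF CX g(1)] m_add[OF gC CX] by simp
    also have "sym_diff (act g ` C) C = S - {i}" using SC by blast
    also have "m S \<otimes> m (S - {i}) = m (sym_diff S (S - {i}))"
      using S by (intro m_add) auto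
    also have "sym_diff S (S - {i}) = {i}" using S by blast
    finally show "(g \<otimes> m C) \<otimes> (g \<otimes> m C) = m {i}" .
  qed
qed

lemma conj_M_lift:
  assumes "x \<in> carrier R" "y \<in> carrier R" "\<pi> x \<in> M" "\<pi> y \<in> M"
  shows "conj_by R x y = x"
  using R.conj_by_commute[of x y] assms lift_comm by simp

text \<open>Modulo \<open>M\<close> the stabilizer of a point consists of elements of order 1, 2 and 5. Elements over \<open>M\<close> commute
  with the lift, and one of odd order modulo \<open>M\<close> cannot multiply it by \<open>z\<close>. An element of order two
  modulo \<open>M\<close> can be adjusted so that its own square lies over \<open>m {i}\<close>, and an element commutes with its
  square.\<close>

lemma stabilizer_fixes_lift:
  assumes y: "y \<in> carrier R" "\<pi> y = m {i}" and i: "i \<in> X"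
    and k: "k \<in> carrier R" "act (\<pi> k) i = i"
  shows "conj_by R y k = y"
proof -
  have iX: "{i} \<subseteq> X" using i by simp
  have pyM: "\<pi> y \<in> M" using y(2) iX by blast
  have pk: "\<pi> k \<in> carrier G" using k by simp
  have \<pi>conj: "\<pi> (conj_by R y k) = \<pi> y" using y k conj_m[OF iX pk] by simp
  consider "\<pi> k \<in> M" | "\<pi> k [^] (5::nat) \<in> M" | "\<pi> k \<notin> M" "\<pi> k \<otimes> \<pi> k \<in> M"
    using stabilizer_order[OF pk i k(2)] by blast
  then show ?thesis
  proof cases
    case 1 then show ?thesis using conj_M_lift y k pyM by blast
  next
    case 2
    show ?thesis
    proof (rule ccontr)
      assume "conj_by R y k \<noteq> y"
      then have e: "conj_by R y k = z \<cdot> y" using same_\<pi>[of "conj_by R y k" y] \<pi>conj y k by blast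
      have step: "conj_by R (z \<cdot> y) k = y" using e y k by (simp add: conj_z z_z)
      have k5: "k [^]\<^bsub>R\<^esub> (5::nat) = k \<cdot> k \<cdot> k \<cdot> k \<cdot> k" using k by (simp add: numeral_eq_Suc)
      have "conj_by R y (k [^]\<^bsub>R\<^esub> (5::nat)) = z \<cdot> y"
        unfolding k5 using y k e step by (simp flip: R.conj_by_conj_by)
      moreover have "conj_by R y (k [^]\<^bsub>R\<^esub> (5::nat)) = y" using 2 y k pyM by (intro conj_M_lift) auto
      ultimately show False using z_cancel y by metis
    qed
  next
    case 3
    obtain n where n: "n \<in> M" "(\<pi> k \<otimes> n) \<otimes> (\<pi> k \<otimes> n) = m {i}"
      using involution_root[OF pk 3 i k(2)] by blast
    obtain n' where n': "n' \<in> carrier R" "\<pi> n' = n" using lift_exists[OF M_closed[OF n(1)]] by blast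
    define q where "q = k \<cdot> n'"
    have q: "q \<in> carrier R" "\<pi> (q \<cdot> q) = \<pi> y" using k n n' y by (auto simp: q_def)
    have "y = q \<cdot> q \<or> y = z \<cdot> (q \<cdot> q)"
      using same_\<pi>[of y "q \<cdot> q"] q y by simp
    then have "y \<cdot> q = q \<cdot> y" using q(1) by (auto simp: R.m_assoc z_mult_left)
    then have 1: "conj_by R y q = y" using y q by (simp add: R.conj_by_commute)
    have 2: "conj_by R y (inv\<^bsub>R\<^esub> n') = y"
      using y n n' pyM M_inv by (intro conj_M_lift) auto
    have "k = q \<cdot> inv\<^bsub>R\<^esub> n'" using k n' by (simp add: q_def R.m_assoc)
    then show ?thesis using 1 2 y q n' by (simp flip: R.conj_by_conj_by)
  qed
qed

section \<open>An equivariant basis of lifts\<close>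

definition pt_lift :: "'w \<Rightarrow> 'r" where
  "pt_lift = (SOME u. \<forall>i\<in>X. u i \<in> carrier R \<and> \<pi> (u i) = m {i} \<and>
     (\<forall>k\<in>carrier R. conj_by R (u i) k = u (act (\<pi> k) i)))"

text \<open>A lift of one basis vector is transported by conjugation. The result does not depend on the conjugating
  element, because the stabilizer of the point fixes the lift.\<close>

lemma pt_lift_exists: "\<exists>u. \<forall>i\<in>X. u i \<in> carrier R \<and> \<pi> (u i) = m {i} \<and>
     (\<forall>k\<in>carrier R. conj_by R (u i) k = u (act (\<pi> k) i))"
proof -
  obtain i0 where i0: "i0 \<in> X" using card_X by fastforce
  then have i0X: "{i0} \<subseteq> X" by simp
  obtain y0 where y0: "y0 \<in> carrier R" "\<pi> y0 = m {i0}" using lift_exists[OF m_closed[OF i0X]] by blast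
  have "\<exists>g. g \<in> carrier R \<and> act (\<pi> g) i0 = i" if "i \<in> X" for i
    using act_trans[OF i0 that] lift_exists by metis
  then obtain g where g: "\<And>i. i \<in> X \<Longrightarrow> g i \<in> carrier R" "\<And>i. i \<in> X \<Longrightarrow> act (\<pi> (g i)) i0 = i" by metis
  show ?thesis
  proof (intro exI[of _ "\<lambda>i. conj_by R y0 (g i)"] ballI conjI)
    fix i assume i: "i \<in> X"
    note [simp] = g(1)[OF i] y0(1)
    show "conj_by R y0 (g i) \<in> carrier R" by simp
    show "\<pi> (conj_by R y0 (g i)) = m {i}" using conj_m[OF i0X] y0(2) g(2)[OF i] by simp
    fix k assume k [simp]: "k \<in> carrier R"
    define j where "j = act (\<pi> k) i"
    have j: "j \<in> X" using act_closed i by (simp add: j_def)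
    note [simp] = g(1)[OF j]
    let ?h = "g i \<cdot> k \<cdot> inv\<^bsub>R\<^esub> (g j)"
    have "act (\<pi> ?h) i0 = act (inv (\<pi> (g j))) (act (\<pi> k) (act (\<pi> (g i)) i0))"
      using i0 act_closed by (simp add: act_mult)
    also have "\<dots> = act (inv (\<pi> (g j))) (act (\<pi> (g j)) i0)" using g(2)[OF i] g(2)[OF j] by (simp add: j_def)
    also have "\<dots> = i0" using i0 by (simp add: act_inv)
    finally have "conj_by R y0 ?h = y0" using y0 i0 by (intro stabilizer_fixes_lift[of _ i0]) auto
    then have "conj_by R (conj_by R y0 ?h) (g j) = conj_by R y0 (g j)" by simp
    then show "conj_by R (conj_by R y0 (g i)) k = conj_by R y0 (g (act (\<pi> k) i))"
      by (simp add: R.conj_by_conj_by R.m_assoc j_def[symmetric])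
  qed
qed

lemma pt_lift:
  assumes "i \<in> X"
  shows "pt_lift i \<in> carrier R" "\<pi> (pt_lift i) = m {i}"
    "k \<in> carrier R \<Longrightarrow> conj_by R (pt_lift i) k = pt_lift (act (\<pi> k) i)"
  using someI_ex[OF pt_lift_exists] assms unfolding pt_lift_def[symmetric] by auto

definition E :: "'r monoid" where "E = R\<lparr>carrier := {y \<in> carrier R. \<pi> y \<in> M}\<rparr>"

lemma E_simps [simp]: "carrier E = {y \<in> carrier R. \<pi> y \<in> M}" "mult E = mult R" "one E = one R"
  by (simp_all add: E_def)

lemma E_subgroup: "subgroup {y \<in> carrier R. \<pi> y \<in> M} R"
  by (rule R.subgroupI) (use M_one M_mult M_inv in \<open>auto intro!: exI[of _ "\<one>\<^bsub>R\<^esub>"]\<close>)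

lemma E_comm_group: "comm_group E"
proof -
  have "group E" unfolding E_def by (rule R.subgroup_imp_group[OF E_subgroup])
  then show ?thesis by (rule group.group_comm_groupI) (use lift_comm in auto)
qed

definition U :: "'w set \<Rightarrow> 'r" where "U S = finprod E pt_lift S"

lemma pt_lift_E: "S \<subseteq> X \<Longrightarrow> pt_lift \<in> S \<rightarrow> carrier E"
  using pt_lift by auto

lemma U_E: "S \<subseteq> X \<Longrightarrow> U S \<in> carrier E"
proof -
  interpret E: comm_group E by (rule E_comm_group)
  assume "S \<subseteq> X" then show ?thesis unfolding U_def using pt_lift_E by (intro E.finprod_closed)
qed

lemma U_closed: "S \<subseteq> X \<Longrightarrow> U S \<in> carrier R" using U_E by simp

lemma U_empty: "U {} = \<one>\<^bsub>R\<^esub>"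
proof -
  interpret E: comm_group E by (rule E_comm_group)
  show ?thesis by (simp add: U_def E.finprod_empty del: E_simps(1))
qed

lemma U_insert: "S \<subseteq> X \<Longrightarrow> i \<in> X \<Longrightarrow> i \<notin> S \<Longrightarrow> U (insert i S) = pt_lift i \<cdot> U S"
proof -
  interpret E: comm_group E by (rule E_comm_group)
  assume "S \<subseteq> X" "i \<in> X" "i \<notin> S"
  then show ?thesis unfolding U_def
    using E.finprod_insert[OF fin_sub, of S i pt_lift] pt_lift_E[of S] pt_lift_E[of "{i}"] by (simp del: E_simps(1))
qed

lemma U_\<pi>: "S \<subseteq> X \<Longrightarrow> \<pi> (U S) = m S"
proof -
  assume S: "S \<subseteq> X"
  from fin_sub[OF S] S show ?thesis
  proof (induction S)
    case empty then show ?case by (simp add: U_empty m_empty)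
  next
    case (insert i S)
    have "\<pi> (U (insert i S)) = m {i} \<otimes> m S" using insert pt_lift U_closed by (simp add: U_insert)
    also have "\<dots> = m (sym_diff {i} S)" using insert by (intro m_add) auto
    also have "sym_diff {i} S = insert i S" using insert by auto
    finally show ?case .
  qed
qed

abbreviation zp :: "nat \<Rightarrow> 'r" where "zp n \<equiv> z [^]\<^bsub>R\<^esub> n"

lemma zp_parity: "zp n = (if even n then \<one>\<^bsub>R\<^esub> else z)"
  by (induction n) auto

lemma zp_left: "x \<in> carrier R \<Longrightarrow> y \<in> carrier R \<Longrightarrow> x \<cdot> (zp n \<cdot> y) = zp n \<cdot> (x \<cdot> y)"
  by (simp add: zp_parity z_mult_left)

text \<open>Each point of \<open>S \<inter> T\<close> contributes the square \<open>z\<close> of its lift.\<close>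

lemma U_mult:
  assumes "S \<subseteq> X" "T \<subseteq> X"
  shows "U S \<cdot> U T = zp (card (S \<inter> T)) \<cdot> U (sym_diff S T)"
  using fin_sub[OF assms(1)] assms(1)
proof (induction S)
  case empty then show ?case using assms U_closed by (simp add: U_empty)
next
  case (insert i S)
  have iX: "i \<in> X" and SX: "S \<subseteq> X" using insert by auto
  have D: "sym_diff S T \<subseteq> X" using SX assms by blast
  note [simp] = pt_lift(1)[OF iX] U_closed[OF SX] U_closed[OF assms(2)] U_closed[OF D]
  have "U (insert i S) \<cdot> U T = pt_lift i \<cdot> (zp (card (S \<inter> T)) \<cdot> U (sym_diff S T))"
    using insert.IH[OF SX] insert.hyps by (simp add: U_insert[OF SX iX] R.m_assoc)
  also have "\<dots> = zp (card (S \<inter> T)) \<cdot> (pt_lift i \<cdot> U (sym_diff S T))" by (simp add: zp_left)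
  also have "\<dots> = zp (card (insert i S \<inter> T)) \<cdot> U (sym_diff (insert i S) T)"
  proof (cases "i \<in> T")
    case True
    have e: "sym_diff S T = insert i (sym_diff (insert i S) T)" "i \<notin> sym_diff (insert i S) T"
      using True insert.hyps by auto
    have D': "sym_diff (insert i S) T \<subseteq> X" using D iX by blast
    note [simp] = U_closed[OF D']
    have sq: "pt_lift i \<cdot> pt_lift i = z" using pt_lift[OF iX] iX by (intro lift_odd[of _ "{i}"]) auto
    have "pt_lift i \<cdot> U (sym_diff S T) = pt_lift i \<cdot> (pt_lift i \<cdot> U (sym_diff (insert i S) T))"
      using U_insert[OF D' iX e(2)] e(1) by simp
    also have "\<dots> = z \<cdot> U (sym_diff (insert i S) T)" by (simp add: sq flip: R.m_assoc)
    finally have "pt_lift i \<cdot> U (sym_diff S T) = z \<cdot> U (sym_diff (insert i S) T)" .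
    moreover have "card (insert i S \<inter> T) = Suc (card (S \<inter> T))"
      using True insert.hyps by (simp add: Int_insert_left)
    ultimately show ?thesis by (simp add: R.m_assoc)
  next
    case False
    have "sym_diff (insert i S) T = insert i (sym_diff S T)" "i \<notin> sym_diff S T"
      using False insert.hyps by auto
    then show ?thesis using False U_insert[OF D iX] by simp
  qed
  finally show ?case .
qed

lemma U_conj:
  assumes "S \<subseteq> X" "k \<in> carrier R"
  shows "conj_by R (U S) k = U (act (\<pi> k) ` S)"
  using fin_sub[OF assms(1)] assms(1)
proof (induction S)
  case empty then show ?case using assms by (simp add: U_empty)
next
  case (insert i S)
  have iX: "i \<in> X" and SX: "S \<subseteq> X" using insert by auto
  have pk: "\<pi> k \<in> carrier G" using assms by simp
  have "act (\<pi> k) i \<notin> act (\<pi> k) ` S"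
    using insert.hyps act_inj[OF pk] iX SX by (metis inj_on_image_mem_iff)
  then show ?case
    using insert.IH[OF SX] assms iX SX insert.hyps act_closed[OF pk iX] act_image[OF pk SX] pt_lift[OF iX] U_closed[OF SX]
    by (simp add: U_insert R.conj_by_mult)
qed

end

text \<open>The point \<open>i\<close> is fixed by \<open>\<sigma>\<close> and so is not in the first symmetric difference, which leaves the second
  alternative; likewise for \<open>j\<close> and \<open>\<tau>\<close>. Hence \<open>C\<close> contains exactly one of \<open>i\<close> and \<open>\<tau> i\<close>, and \<open>\<sigma>\<close> moves all other
  points of \<open>C\<close> out of \<open>C\<close>.\<close>

lemma commuting_involutions_cut:
  assumes \<sigma>: "\<And>w. w \<in> X \<Longrightarrow> \<sigma> w \<in> X" "\<And>w. w \<in> X \<Longrightarrow> \<sigma> (\<sigma> w) = w"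
    and \<tau>: "\<And>w. w \<in> X \<Longrightarrow> \<tau> w \<in> X" "\<And>w. w \<in> X \<Longrightarrow> \<tau> (\<tau> w) = w"
    and comm: "\<And>w. w \<in> X \<Longrightarrow> \<sigma> (\<tau> w) = \<tau> (\<sigma> w)"
    and none: "\<And>w. w \<in> X \<Longrightarrow> \<not> (\<sigma> w = w \<and> \<tau> w = w)"
    and ij: "i \<in> X" "j \<in> X" "\<sigma> i = i" "\<tau> j = j" and C: "C \<subseteq> X"
    and d1: "sym_diff (\<sigma> ` C) C = {i, \<tau> i} \<or> sym_diff (\<sigma> ` C) C = X - {i, \<tau> i}"
    and d2: "sym_diff (\<tau> ` C) C = {j, \<sigma> j} \<or> sym_diff (\<tau> ` C) C = X - {j, \<sigma> j}"
  shows "sym_diff (\<sigma> ` C) C = X - {i, \<tau> i}" "card (\<sigma> ` C \<inter> C) = 1"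
proof -
  have m\<sigma>: "w \<in> \<sigma> ` C \<longleftrightarrow> \<sigma> w \<in> C" if "w \<in> X" for w
    using \<sigma> that C by (metis (no_types, lifting) image_iff subsetD)
  have m\<tau>: "w \<in> \<tau> ` C \<longleftrightarrow> \<tau> w \<in> C" if "w \<in> X" for w
    using \<tau> that C by (metis (no_types, lifting) image_iff subsetD)
  have "i \<notin> sym_diff (\<sigma> ` C) C" using m\<sigma>[OF ij(1)] ij(3) by auto
  then show s1: "sym_diff (\<sigma> ` C) C = X - {i, \<tau> i}" using d1 by blast
  have "j \<notin> sym_diff (\<tau> ` C) C" using m\<tau>[OF ij(2)] ij(4) by auto
  then have s2: "sym_diff (\<tau> ` C) C = X - {j, \<sigma> j}" using d2 by blast
  have \<tau>i: "\<tau> i \<in> X" "\<sigma> (\<tau> i) = \<tau> i" "\<tau> i \<noteq> i" using \<tau>(1)[OF ij(1)] comm[OF ij(1)] ij none by metis+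
  have "i \<noteq> j" "i \<noteq> \<sigma> j" using ij none \<sigma> by metis+
  then have "i \<in> sym_diff (\<tau> ` C) C" using s2 ij by blast
  then have one: "(\<tau> i \<in> C) \<noteq> (i \<in> C)" using m\<tau>[OF ij(1)] by blast
  have "w \<in> \<sigma> ` C \<inter> C \<longleftrightarrow> w \<in> C \<and> (w = i \<or> w = \<tau> i)" for w
  proof (cases "w \<in> X")
    case True
    show ?thesis using s1 m\<sigma>[OF True] ij(3) \<tau>i(2) True by (cases "w = i \<or> w = \<tau> i") auto
  qed (use C in blast)
  then have *: "w \<in> \<sigma> ` C \<inter> C \<longleftrightarrow> w \<in> (if i \<in> C then {i} else {\<tau> i})" for w using one by simp blast
  have "\<sigma> ` C \<inter> C = (if i \<in> C then {i} else {\<tau> i})" using * by blast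
  then show "card (\<sigma> ` C \<inter> C) = 1" by simp
qed

context six_point_cover begin

lemma inv_z_mult:
  assumes "y \<in> carrier R" "y \<cdot> y = z" shows "inv\<^bsub>R\<^esub> y = z \<cdot> y"
proof -
  have "(z \<cdot> y) \<cdot> y = \<one>\<^bsub>R\<^esub>" using assms by (simp add: R.m_assoc)
  then show ?thesis using assms R.inv_equality by simp
qed

lemma z_mult_z:
  assumes "x \<in> carrier R" "y \<in> carrier R"
  shows "(z \<cdot> x) \<cdot> (z \<cdot> y) = x \<cdot> y"
  using assms by (simp add: R.m_assoc z_mult_left[of x] z_z)

lemma U_square_odd: "S \<subseteq> X \<Longrightarrow> odd (card S) \<Longrightarrow> U S \<cdot> U S = z"
  using U_mult[of S S] U_empty by (simp add: zp_parity)

text \<open>Take two elements over commuting involutions without common fixed points, with squares over basis vectors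
  \<open>m {i}\<close> and \<open>m {j}\<close>. Their commutator lies over some \<open>m C\<close>. Writing the commutator of each with the square of
  the other both through the square and through \<open>U C\<close> gives \<open>z U {i, \<tau> i} = z\<^sup>k U (\<sigma>(C) \<triangle> C)\<close> with \<open>k = |\<sigma>(C) \<inter> C|\<close>, and the same with the
  two interchanged. By \<open>commuting_involutions_cut\<close> this reads \<open>U {i, \<tau> i} = U (X - {i, \<tau> i})\<close>, and \<open>U X\<close> is the
  product of these two elements, which is the square of the first and therefore \<open>1\<close>.\<close>

lemma U_X: "U X = \<one>\<^bsub>R\<^esub>"
proof -
  obtain s t i j where st: "s \<in> carrier G" "t \<in> carrier G" "i \<in> X" "j \<in> X" "s \<otimes> s \<in> M" "t \<otimes> t \<in> M"
    "act s i = i" "act t j = j" and comm: "\<And>u. u \<in> X \<Longrightarrow> act (s \<otimes> t) u = act (t \<otimes> s) u"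
    and none: "\<And>u. u \<in> X \<Longrightarrow> \<not> (act s u = u \<and> act t u = u)"
    using four_group by blast
  have sM: "s \<notin> M" using act_M none st by blast
  have tM: "t \<notin> M" using act_M none st by blast
  obtain n1 where n1: "n1 \<in> M" "(s \<otimes> n1) \<otimes> (s \<otimes> n1) = m {i}"
    using involution_root[OF st(1) sM st(5,3,7)] by blast
  obtain n2 where n2: "n2 \<in> M" "(t \<otimes> n2) \<otimes> (t \<otimes> n2) = m {j}"
    using involution_root[OF st(2) tM st(6,4,8)] by blast
  have nc: "n1 \<in> carrier G" "n2 \<in> carrier G" using n1 n2 M_closed by auto
  obtain k1 where k1: "k1 \<in> carrier R" "\<pi> k1 = s \<otimes> n1" using lift_exists[of "s \<otimes> n1"] st nc by auto
  obtain k2 where k2: "k2 \<in> carrier R" "\<pi> k2 = t \<otimes> n2" using lift_exists[of "t \<otimes> n2"] st nc by auto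
  note [simp] = k1(1) k2(1)
  have a1: "act (\<pi> k1) w = act s w" if "w \<in> X" for w
    unfolding k1 using that st nc act_closed act_M[OF n1(1)] by (simp add: act_mult)
  have a2: "act (\<pi> k2) w = act t w" if "w \<in> X" for w
    unfolding k2 using that st nc act_closed act_M[OF n2(1)] by (simp add: act_mult)
  define \<sigma> \<tau> where "\<sigma> = act (\<pi> (inv\<^bsub>R\<^esub> k1))" and "\<tau> = act (\<pi> (inv\<^bsub>R\<^esub> k2))"
  have ss: "act s (act s w) = w" if "w \<in> X" for w
    using act_M[OF st(5) that] act_mult[OF st(1,1) that] by simp
  have tt: "act t (act t w) = w" if "w \<in> X" for w
    using act_M[OF st(6) that] act_mult[OF st(2,2) that] by simp
  have \<sigma>: "\<sigma> w = act s w" if "w \<in> X" for w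
  proof -
    have "act (inv (\<pi> k1)) (act (\<pi> k1) (act s w)) = act s w"
      using that st by (intro act_inv) (auto intro: act_closed)
    then show ?thesis using a1[of "act s w"] ss[OF that] that act_closed st by (simp add: \<sigma>_def)
  qed
  have \<tau>: "\<tau> w = act t w" if "w \<in> X" for w
  proof -
    have "act (inv (\<pi> k2)) (act (\<pi> k2) (act t w)) = act t w"
      using that st by (intro act_inv) (auto intro: act_closed)
    then show ?thesis using a2[of "act t w"] tt[OF that] that act_closed st by (simp add: \<tau>_def)
  qed
  have sc: "act s w \<in> X" "act t w \<in> X" if "w \<in> X" for w using act_closed st that by auto
  have \<tau>i: "\<tau> i \<in> X" "\<tau> i \<noteq> i" using \<tau> st sc none by metis+
  have \<sigma>j: "\<sigma> j \<in> X" "\<sigma> j \<noteq> j" using \<sigma> st sc none by metis+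
  define c where "c = k1 \<cdot> k2 \<cdot> inv\<^bsub>R\<^esub> k1 \<cdot> inv\<^bsub>R\<^esub> k2"
  have c [simp]: "c \<in> carrier R" by (simp add: c_def)
  have "act (\<pi> c) w = w" if w: "w \<in> X" for w
  proof -
    have "act (\<pi> c) w = act (inv (\<pi> k2)) (act (inv (\<pi> k1)) (act t (act s w)))"
      using w sc a1 a2 by (simp add: c_def act_mult act_closed)
    also have "act t (act s w) = act s (act t w)" using comm[OF w] st w by (simp add: act_mult)
    also have "\<dots> = act (\<pi> k1) (act t w)" using a1 sc w by simp
    also have "act (inv (\<pi> k1)) \<dots> = act t w" using sc w by (simp add: act_inv)
    also have "\<dots> = act (\<pi> k2) w" using a2 w by simp
    also have "act (inv (\<pi> k2)) \<dots> = w" using w by (simp add: act_inv)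
    finally show ?thesis .
  qed
  then have "\<pi> c \<in> M" using act_trivial[of "\<pi> c"] by simp
  then obtain C where C: "C \<subseteq> X" "\<pi> c = m C" by blast
  have UC [simp]: "U C \<in> carrier R" using U_closed C by blast
  have c_cases: "c = U C \<or> c = z \<cdot> U C" using same_\<pi>[of c "U C"] C U_\<pi> by simp
  \<comment> \<open>both halves of the commutator identity have the same shape\<close>
  have half: "z \<cdot> U {l, f l} = zp (card (g ` C \<inter> C)) \<cdot> U (sym_diff (g ` C) C)"
    if l: "l \<in> X" "f l \<in> X" "f l \<noteq> l" and k: "k \<in> carrier R" "f = act (\<pi> k)"
      and k': "k' \<in> carrier R" "g = act (\<pi> k')"
      and x: "x \<in> carrier R" "\<pi> x = m {l}"
      and e: "x \<cdot> inv\<^bsub>R\<^esub> (conj_by R x k) = conj_by R c k' \<cdot> c" for l f g k k' x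
  proof -
    have u: "U {l} \<in> carrier R" "U {f l} \<in> carrier R" using l U_closed by auto
    have cu: "conj_by R (U {l}) k = U {f l}" using U_conj[of "{l}" k] l k by simp
    have "x = U {l} \<or> x = z \<cdot> U {l}" using same_\<pi>[of x "U {l}"] x u U_\<pi>[of "{l}"] l by simp
    then have "x \<cdot> inv\<^bsub>R\<^esub> (conj_by R x k) = U {l} \<cdot> inv\<^bsub>R\<^esub> (U {f l})"
      using u k cu by (auto simp: conj_z R.inv_mult_group R.m_assoc z_mult_left[of "U {l}"] z_mult_left[of "inv\<^bsub>R\<^esub> (U {f l})"] z_z
        z_central[symmetric])
    also have "inv\<^bsub>R\<^esub> (U {f l}) = z \<cdot> U {f l}"
      using u l U_square_odd[of "{f l}"] by (intro inv_z_mult) auto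
    also have "U {l} \<cdot> (z \<cdot> U {f l}) = z \<cdot> (U {l} \<cdot> U {f l})"
      using u by (simp add: z_mult_left)
    also have "U {l} \<cdot> U {f l} = U {l, f l}"
    proof -
      have "sym_diff {l} {f l} = {l, f l}" "{l} \<inter> {f l} = {}" using l by auto
      then show ?thesis using l U_mult[of "{l}" "{f l}"] U_closed[of "{l, f l}"] by simp
    qed
    finally have L: "x \<cdot> inv\<^bsub>R\<^esub> (conj_by R x k) = z \<cdot> U {l, f l}" .
    have gC: "g ` C \<subseteq> X" using act_image C k' by simp
    have cg: "conj_by R (U C) k' = U (g ` C)" using U_conj[OF C(1)] k' by simp
    have "conj_by R c k' \<cdot> c = U (g ` C) \<cdot> U C"
      using c_cases
    proof
      assume "c = z \<cdot> U C"
      then have "conj_by R c k' \<cdot> c = (z \<cdot> U (g ` C)) \<cdot> (z \<cdot> U C)" using cg k' by (simp only: conj_z UC)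
      then show ?thesis using z_mult_z[OF U_closed[OF gC] UC] by simp
    qed (simp only: cg)
    also have "\<dots> = zp (card (g ` C \<inter> C)) \<cdot> U (sym_diff (g ` C) C)" by (rule U_mult[OF gC C(1)])
    finally show ?thesis using L e by simp
  qed
  have H1: "z \<cdot> U {i, \<tau> i} = zp (card (\<sigma> ` C \<inter> C)) \<cdot> U (sym_diff (\<sigma> ` C) C)"
  proof (rule half[OF st(3) \<tau>i _ \<tau>_def _ \<sigma>_def])
    show "\<pi> (k1 \<cdot> k1) = m {i}" using k1 n1 by simp
    show "k1 \<cdot> k1 \<cdot> inv\<^bsub>R\<^esub> (conj_by R (k1 \<cdot> k1) (inv\<^bsub>R\<^esub> k2)) = conj_by R c (inv\<^bsub>R\<^esub> k1) \<cdot> c"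
      by (simp add: c_def conj_by_def R.m_assoc R.inv_mult_group)
  qed auto
  have H2: "z \<cdot> U {j, \<sigma> j} = zp (card (\<tau> ` C \<inter> C)) \<cdot> U (sym_diff (\<tau> ` C) C)"
  proof (rule half[OF st(4) \<sigma>j _ \<sigma>_def _ \<tau>_def])
    show "\<pi> (k2 \<cdot> k2) = m {j}" using k2 n2 by simp
    have cM: "\<pi> (conj_by R c (inv\<^bsub>R\<^esub> k2)) \<in> M" using C M_conj by auto
    have x2: "\<pi> (conj_by R (k2 \<cdot> k2) (inv\<^bsub>R\<^esub> k1)) \<in> M" "\<pi> (inv\<^bsub>R\<^esub> (k2 \<cdot> k2)) \<in> M" "\<pi> (k2 \<cdot> k2) \<in> M"
    proof -
      show 1: "\<pi> (k2 \<cdot> k2) \<in> M" using k2 n2 st by auto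
      then show "\<pi> (conj_by R (k2 \<cdot> k2) (inv\<^bsub>R\<^esub> k1)) \<in> M" using M_conj by simp
      show "\<pi> (inv\<^bsub>R\<^esub> (k2 \<cdot> k2)) \<in> M" using 1 M_inv by simp
    qed
    let ?y = "k2 \<cdot> k2" and ?cy = "conj_by R (k2 \<cdot> k2) (inv\<^bsub>R\<^esub> k1)" and ?cc = "conj_by R c (inv\<^bsub>R\<^esub> k2)"
    have "?cy \<cdot> inv\<^bsub>R\<^esub> ?y = c \<cdot> ?cc"
      by (simp add: c_def conj_by_def R.m_assoc R.inv_mult_group)
    also have "\<dots> = ?cc \<cdot> c" using cM C by (intro lift_comm) auto
    finally have e: "?cy \<cdot> inv\<^bsub>R\<^esub> ?y = ?cc \<cdot> c" .
    have sq: "?cc \<cdot> c \<cdot> (?cc \<cdot> c) = \<one>\<^bsub>R\<^esub>"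
    proof -
      have tC: "act (\<pi> (inv\<^bsub>R\<^esub> k2)) ` C \<subseteq> X" using act_image C by simp
      have p: "\<pi> (?cc \<cdot> c) = m (sym_diff (act (\<pi> (inv\<^bsub>R\<^esub> k2)) ` C) C)"
        using C conj_m[OF C(1)] m_add[OF tC C(1)] by simp
      have "even (card (sym_diff (act (\<pi> (inv\<^bsub>R\<^esub> k2)) ` C) C))"
        using even_sym_diff[OF tC C(1)] card_act[OF _ C(1)] by simp
      then show ?thesis using tC C by (intro lift_even[OF _ _ p]) auto
    qed
    have "?y \<cdot> inv\<^bsub>R\<^esub> ?cy = inv\<^bsub>R\<^esub> (?cy \<cdot> inv\<^bsub>R\<^esub> ?y)" by (simp add: R.inv_mult_group)
    also have "\<dots> = ?cc \<cdot> c" unfolding e using sq by (intro R.inv_equality) auto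
    finally show "?y \<cdot> inv\<^bsub>R\<^esub> ?cy = ?cc \<cdot> c" .
  qed auto
  have via_\<pi>: "T = S \<or> T = X - S" if "z \<cdot> U S = zp n \<cdot> U T" "S \<subseteq> X" "T \<subseteq> X" for S T n
  proof -
    have "\<pi> (z \<cdot> U S) = \<pi> (zp n \<cdot> U T)" using that by simp
    then have "m S = m T" using that(2,3) U_closed U_\<pi> m_closed by (simp add: zp_parity split: if_splits)
    then show ?thesis using m_eq that by blast
  qed
  have sub: "\<sigma> ` C \<subseteq> X" "\<tau> ` C \<subseteq> X" unfolding \<sigma>_def \<tau>_def using C by (auto intro!: act_closed)
  have d1: "sym_diff (\<sigma> ` C) C = {i, \<tau> i} \<or> sym_diff (\<sigma> ` C) C = X - {i, \<tau> i}"
    by (rule via_\<pi>[OF H1]) (use st \<tau>i sub C in auto)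
  have d2: "sym_diff (\<tau> ` C) C = {j, \<sigma> j} \<or> sym_diff (\<tau> ` C) C = X - {j, \<sigma> j}"
    by (rule via_\<pi>[OF H2]) (use st \<sigma>j sub C in auto)
  have co: "act s (act t w) = act t (act s w)" if "w \<in> X" for w
    using comm[OF that] st that by (simp add: act_mult)
  have cut: "sym_diff (\<sigma> ` C) C = X - {i, \<tau> i}" "card (\<sigma> ` C \<inter> C) = 1"
    using commuting_involutions_cut[of X \<sigma> \<tau> i j C, OF _ _ _ _ _ _ st(3,4) _ _ C(1) d1 d2]
    by (simp_all add: \<sigma> \<tau> sc ss tt none st co)
  let ?P = "{i, \<tau> i}"
  have PX: "?P \<subseteq> X" "X - ?P \<subseteq> X" using st \<tau>i by auto
  note [simp] = U_closed[OF PX(1)] U_closed[OF PX(2)]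
  have "z \<cdot> U ?P = zp 1 \<cdot> U (X - ?P)" using H1 unfolding cut .
  then have "z \<cdot> U ?P = z \<cdot> U (X - ?P)" unfolding zp_parity by (simp only: odd_one if_False)
  then have "U (X - ?P) = U ?P" using z_z[OF U_closed[OF PX(1)]] z_z[OF U_closed[OF PX(2)]] by metis
  moreover have "U ?P \<cdot> U (X - ?P) = U X"
  proof -
    have "sym_diff ?P (X - ?P) = X" using PX by blast
    then show ?thesis using U_mult[OF PX] U_closed[of X] by (simp del: Diff_insert)
  qed
  moreover have "U ?P \<cdot> U ?P = \<one>\<^bsub>R\<^esub>" using U_mult[OF PX(1) PX(1)] \<tau>i U_empty by (simp add: zp_parity)
  ultimately show ?thesis by simp
qed

end

context six_point_cover begin

section \<open>The lifting invariant of the tuples\<close>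

text \<open>Both halves are evaluated by \<open>U_mult\<close>. By the relation, the two symmetric differences that arise are equal or
  complementary, and \<open>U\<close> takes the same value on a set of even size and on its complement because
  \<open>U X = 1\<close>; the product of the two factors is its square, which is \<open>1\<close>.\<close>

lemma twisted_product_value:
  assumes A: "A \<subseteq> X" "odd (card A)" and B: "B \<subseteq> X" "odd (card B)"
    and k: "k1 \<in> carrier R" "k2 \<in> carrier R"
    and rel: "conj_by G (m A) (\<pi> k1) \<otimes> m A = m B \<otimes> conj_by G (m B) (\<pi> k2)"
  shows "conj_by R (U A) k1 \<cdot> U A \<cdot> U B \<cdot> conj_by R (U B) k2 =
    zp (card (act (\<pi> k1) ` A \<inter> A) + card (B \<inter> act (\<pi> k2) ` B))"
proof -
  let ?A = "act (\<pi> k1) ` A" and ?B = "act (\<pi> k2) ` B"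
  have AX: "?A \<subseteq> X" and BX: "?B \<subseteq> X" using act_image A B k by auto
  let ?S = "sym_diff ?A A" and ?T = "sym_diff B ?B"
  have S: "?S \<subseteq> X" and T: "?T \<subseteq> X" using AX BX A B by auto
  note [simp] = U_closed[OF AX] U_closed[OF BX] U_closed[OF A(1)] U_closed[OF B(1)] U_closed[OF S] U_closed[OF T]
  have "m ?S = m ?T"
    using rel conj_m A B k m_add[OF AX A(1)] m_add[OF B(1) BX] by simp
  then have ST: "?T = ?S \<or> ?T = X - ?S" using m_eq[OF S T] by simp
  have ev: "even (card ?S)" using even_sym_diff[OF AX A(1)] card_act[OF _ A(1)] k by simp
  have "U ?S \<cdot> U ?T = \<one>\<^bsub>R\<^esub>"
    using ST
  proof
    assume e: "?T = ?S"
    show ?thesis unfolding e using U_mult[OF S S] ev U_empty by (simp add: zp_parity)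
  next
    assume e: "?T = X - ?S"
    have "P \<inter> Q = {} \<and> sym_diff P Q = X" if "Q = X - P" "P \<subseteq> X" for P Q :: "'w set" using that by auto
    from this[OF e S] show ?thesis using U_mult[OF S T] U_X by simp
  qed
  moreover have "conj_by R (U A) k1 \<cdot> U A \<cdot> (U B \<cdot> conj_by R (U B) k2) =
    (zp (card (?A \<inter> A)) \<cdot> U ?S) \<cdot> (zp (card (B \<inter> ?B)) \<cdot> U ?T)"
    using U_conj[OF A(1) k(1)] U_conj[OF B(1) k(2)] U_mult[OF AX A(1)] U_mult[OF B(1) BX] by simp
  moreover have "\<dots> = zp (card (?A \<inter> A)) \<cdot> (zp (card (B \<inter> ?B)) \<cdot> (U ?S \<cdot> U ?T))"
    using zp_left[of "U ?S" "U ?T"] by (simp add: R.m_assoc)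
  ultimately show ?thesis using k
    by (simp add: R.m_assoc R.nat_pow_mult)
qed

definition M5 :: "'g set" where "M5 = {m S | S. S \<subseteq> X \<and> card S = 1}"
definition M3 :: "'g set" where "M3 = {m S | S. S \<subseteq> X \<and> card S = 3}"

text \<open>A set of five points may be replaced by its complement.\<close>

lemma odd_part_split: "odd_part = M5 \<union> M3"
proof
  show "odd_part \<subseteq> M5 \<union> M3"
  proof
    fix x assume "x \<in> odd_part"
    then obtain S where S: "S \<subseteq> X" "odd (card S)" "x = m S" by (auto simp: odd_part_def)
    have "card S = 1 \<or> card S = 3 \<or> card S = 5" using S(2) card_le[OF S(1)]
      by (auto elim!: oddE)
    moreover have "x = m (X - S)" "card (X - S) = 6 - card S" "X - S \<subseteq> X" using S m_compl card_compl by auto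
    moreover have "x \<in> M5" if "card T = 1" "T \<subseteq> X" "x = m T" for T using that unfolding M5_def by blast
    moreover have "x \<in> M3" if "card T = 3" "T \<subseteq> X" "x = m T" for T using that unfolding M3_def by blast
    ultimately consider "x \<in> M5" | "x \<in> M3" | "card S = 5" "card (X - S) = 1" "X - S \<subseteq> X" "x = m (X - S)"
      using S(1,3) by fastforce
    then show "x \<in> M5 \<union> M3"
    proof cases
      case 3 then show ?thesis unfolding M5_def by blast
    qed auto
  qed
qed (auto simp: odd_part_def M5_def M3_def)

lemma M5_M3_disjoint: "M5 \<inter> M3 = {}"
proof -
  have False if "S \<subseteq> X" "card S = 1" "T \<subseteq> X" "card T = 3" "m S = m T" for S T
    using m_eq[OF that(1,3)] that card_compl[of S] by auto
  then show ?thesis by (fastforce simp: M5_def M3_def)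
qed

lemma M5_iff: "x \<in> M5 \<longleftrightarrow> (\<exists>i\<in>X. x = m {i})"
  by (auto simp: M5_def card_1_singleton_iff)

text \<open>A point that moves is disjoint from its image, and a set of three points meets its image in an odd number of
  points.\<close>

lemma inter_image_parity:
  assumes g: "g \<in> carrier G" "ord g = 3" and a: "a \<in> odd_part"
  shows "\<exists>A\<subseteq>X. odd (card A) \<and> a = m A \<and> (odd (card (act g ` A \<inter> A)) \<longleftrightarrow> a \<in> M3)"
proof -
  interpret two_three_cycles X "act g" by (rule ord3_cycles[OF g])
  consider "a \<in> M5" | "a \<in> M3" using a odd_part_split by blast
  then show ?thesis
  proof cases
    case 1
    then obtain i where i: "i \<in> X" "a = m {i}" using M5_iff by blast
    have "act g ` {i} \<inter> {i} = {}" using free[OF i(1)] by auto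
    moreover have "a \<notin> M3" using 1 M5_M3_disjoint by blast
    ultimately show ?thesis using i by (intro exI[of _ "{i}"]) auto
  next
    case 2
    then obtain A where A: "A \<subseteq> X" "card A = 3" "a = m A" by (auto simp: M3_def)
    then show ?thesis using odd_inter_image[OF A(1,2)] 2 by (intro exI[of _ A]) (auto simp: Int_commute)
  qed
qed

lemma HM_repD:
  assumes "HM_rep G g1 g2"
  shows "g1 \<in> carrier G" "g2 \<in> carrier G" "ord g1 = 3" "ord g2 = 3" "generate G {g1, g2} = carrier G"
proof -
  have h: "(g1, inv g1, g2, inv g2) \<in> nielsen_C3_4 G" using assms by (simp add: HM_rep_def HM_tuple_def)
  then show c: "g1 \<in> carrier G" "g2 \<in> carrier G" "ord g1 = 3" "ord g2 = 3" by (auto simp: nielsen_C3_4_def)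
  have "generate G {g1, inv g1, g2, inv g2} = carrier G" using h by (simp add: nielsen_C3_4_def)
  then show "generate G {g1, g2} = carrier G"
    by (rule generate_eq_carrierI) (use c in \<open>auto intro: generate.incl generate.inv\<close>)
qed

lemma HM_repI:
  assumes "g1 \<in> carrier G" "g2 \<in> carrier G" "ord g1 = 3" "ord g2 = 3" "generate G {g1, g2} = carrier G"
  shows "HM_rep G g1 g2"
proof -
  have "generate G {g1, inv g1, g2, inv g2} = carrier G"
    by (rule generate_eq_carrierI[OF assms(5)]) (use assms in \<open>auto intro: generate.incl\<close>)
  then show ?thesis using assms by (simp add: HM_rep_def HM_tuple_def nielsen_C3_4_def ord_inv)
qed

lemma g_star_conj:
  assumes "g1 \<in> carrier G" "g2 \<in> carrier G" "a \<in> M" "b \<in> M"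
  shows "g_star G g1 g2 a b = (g1, conj_by G (inv g1) a, conj_by G g2 b, inv g2)"
  using assms M_inv by (simp add: g_star_def conj_by_def)

definition star_pairs :: "'g \<Rightarrow> 'g \<Rightarrow> ('g \<times> 'g) set" where
  "star_pairs g1 g2 = {(a, b). a \<in> odd_part \<and> b \<in> odd_part \<and>
     conj_by G a (inv g1) \<otimes> a = b \<otimes> conj_by G b (inv g2)}"

text \<open>The conditions on orders hold for every choice of \<open>a\<close> and \<open>b\<close>, and generation follows from the Frattini
  property, so that only the product-one condition remains.\<close>

lemma g_star_in_Ni_iff:
  assumes "HM_rep G g1 g2"
  shows "g_star_in_Ni G odd_part g1 g2 a b \<longleftrightarrow> (a, b) \<in> star_pairs g1 g2"
proof (cases "a \<in> odd_part \<and> b \<in> odd_part")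
  case True
  note g = HM_repD[OF assms]
  have aM: "a \<in> M" and bM: "b \<in> M" using True odd_subset_M by auto
  have [simp]: "a \<in> carrier G" "b \<in> carrier G" "g1 \<in> carrier G" "g2 \<in> carrier G" using True odd_closed g by auto
  have gen: "generate G {g1, conj_by G (inv g1) a, conj_by G g2 b, inv g2} = carrier G"
  proof (rule generate_eq_carrierI[OF g(5)])
    have "inv (inv g2) \<in> generate G {g1, conj_by G (inv g1) a, conj_by G g2 b, inv g2}"
      by (rule generate.inv) simp
    then show "{g1, g2} \<subseteq> generate G {g1, conj_by G (inv g1) a, conj_by G g2 b, inv g2}"
      by (auto intro: generate.incl)
  qed auto
  let ?y = "b \<otimes> conj_by G b (inv g2)"
  have yM: "?y \<in> M" using bM M_conj M_mult by simp
  have xM: "conj_by G a (inv g1) \<otimes> a \<in> M" using aM M_conj M_mult by simp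
  have "g1 \<otimes> conj_by G (inv g1) a \<otimes> conj_by G g2 b \<otimes> inv g2 = conj_by G a (inv g1) \<otimes> a \<otimes> ?y"
    using M_inv[OF aM] M_inv[OF bM] by (simp add: conj_by_def m_assoc)
  moreover have "conj_by G a (inv g1) \<otimes> a \<otimes> ?y = \<one> \<longleftrightarrow> conj_by G a (inv g1) \<otimes> a = ?y"
    using M_closed[OF xM] M_closed[OF yM] M_square[OF yM] by (metis inv_equality M_inv[OF yM] inv_inv)
  ultimately have "g_star G g1 g2 a b \<in> nielsen_C3_4 G \<longleftrightarrow> conj_by G a (inv g1) \<otimes> a = ?y"
    using gen g by (simp add: g_star_conj[OF _ _ aM bM] nielsen_C3_4_def ord_conj_by ord_inv)
  then show ?thesis using assms True by (simp add: g_star_in_Ni_def star_pairs_def)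
qed (auto simp: g_star_in_Ni_def star_pairs_def)

lemma odd_lift_inv:
  assumes "y \<in> carrier R" "\<pi> y \<in> odd_part" shows "inv\<^bsub>R\<^esub> y = z \<cdot> y"
  using assms lift_odd by (intro inv_z_mult) (auto simp: odd_part_def)

text \<open>The lifts of order three of the four entries are conjugates of those of \<open>g\<^sub>1\<close>, \<open>g\<^sub>2\<close> and their inverses by
  \<open>ah\<close> and \<open>bh\<close>. Inverting a lift of an element of \<open>M - V\<close> multiplies it by \<open>z\<close>, and the two factors \<open>z\<close>
  cancel.\<close>

lemma lift_invariant_eq:
  assumes hm: "HM_rep G g1 g2" and ab: "a \<in> odd_part" "b \<in> odd_part"
    and l: "ah \<in> lifts R \<pi> a" "bh \<in> lifts R \<pi> b"
      "k1 \<in> lifts R \<pi> (inv g1)" "k2 \<in> lifts R \<pi> (inv g2)"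
  shows "lift_invariant R \<pi> (g_star G g1 g2 a b) =
    conj_by R ah k1 \<cdot> ah \<cdot> bh \<cdot> conj_by R bh k2"
proof -
  note g = HM_repD[OF hm]
  have aM: "a \<in> M" and bM: "b \<in> M" using ab odd_subset_M by auto
  let ?u = "lft g1" and ?v = "lft g2"
  have u: "?u \<in> carrier R" "\<pi> ?u = g1" and v: "?v \<in> carrier R" "\<pi> ?v = g2"
    using lft[OF g(1,3)] lft[OF g(2,4)] by auto
  have h: "ah \<in> carrier R" "\<pi> ah = a" "bh \<in> carrier R" "\<pi> bh = b"
    and k: "k1 \<in> carrier R" "\<pi> k1 = inv g1" "k2 \<in> carrier R" "\<pi> k2 = inv g2"
    using l by (auto simp: lifts_def)
  note [simp] = u(1) v(1) h(1) h(3) k(1) k(3)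
  have 2: "lft (conj_by G (inv g1) a) = conj_by R (inv\<^bsub>R\<^esub> ?u) ah"
    using lft_conj[of "inv g1" ah] h g lft_inv[OF g(1,3)] ord_inv3 by simp
  have 3: "lft (conj_by G g2 b) = conj_by R ?v bh"
    using lft_conj[of g2 bh] h g by simp
  have 4: "lft (inv g2) = inv\<^bsub>R\<^esub> ?v" using lft_inv[OF g(2,4)] .
  have ka: "conj_by R ah k1 = conj_by R ah (inv\<^bsub>R\<^esub> ?u)"
    using same_\<pi>[of k1 "inv\<^bsub>R\<^esub> ?u"] k u by (auto simp: conj_z_right)
  have kb: "conj_by R bh k2 = conj_by R bh (inv\<^bsub>R\<^esub> ?v)"
    using same_\<pi>[of k2 "inv\<^bsub>R\<^esub> ?v"] k v by (auto simp: conj_z_right)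
  have ia: "inv\<^bsub>R\<^esub> ah = z \<cdot> ah" and ib: "inv\<^bsub>R\<^esub> bh = z \<cdot> bh" using odd_lift_inv h ab by auto
  have "lift_invariant R \<pi> (g_star G g1 g2 a b) =
    (?u \<cdot> (z \<cdot> ah) \<cdot> inv\<^bsub>R\<^esub> ?u \<cdot> ah) \<cdot> ((z \<cdot> bh) \<cdot> ?v \<cdot> bh \<cdot> inv\<^bsub>R\<^esub> ?v)"
    unfolding lift_invariant_def g_star_conj[OF g(1,2) aM bM] prod.case 2 3 4
    by (simp add: conj_by_def R.m_assoc ia ib)
  also have "?u \<cdot> (z \<cdot> ah) \<cdot> inv\<^bsub>R\<^esub> ?u \<cdot> ah = z \<cdot> (conj_by R ah k1 \<cdot> ah)"
    unfolding ka by (simp add: conj_by_def R.m_assoc z_mult_left[of ?u])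
  also have "(z \<cdot> bh) \<cdot> ?v \<cdot> bh \<cdot> inv\<^bsub>R\<^esub> ?v = z \<cdot> (bh \<cdot> conj_by R bh k2)"
    unfolding kb by (simp add: conj_by_def R.m_assoc)
  finally show ?thesis
    using z_mult_z[of "conj_by R ah k1 \<cdot> ah" "bh \<cdot> conj_by R bh k2"] by (simp add: R.m_assoc)
qed

lemma lift_products_eq:
  assumes hm: "HM_rep G g1 g2" and ab: "a \<in> odd_part" "b \<in> odd_part"
  shows "lift_products R \<pi> G g1 g2 a b = {lift_invariant R \<pi> (g_star G g1 g2 a b)}"
proof -
  note g = HM_repD[OF hm]
  have ex: "\<exists>y. y \<in> lifts R \<pi> x" if "x \<in> carrier G" for x using lift_exists[OF that] by (auto simp: lifts_def)
  obtain ah bh k1 k2 where l: "ah \<in> lifts R \<pi> a" "bh \<in> lifts R \<pi> b" "k1 \<in> lifts R \<pi> (inv g1)" "k2 \<in> lifts R \<pi> (inv g2)"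
    using ex[of a] ex[of b] ex[of "inv g1"] ex[of "inv g2"] g ab odd_closed by (meson inv_closed)
  show ?thesis
  proof (intro equalityI subsetI)
    fix x assume "x \<in> lift_products R \<pi> G g1 g2 a b"
    then show "x \<in> {lift_invariant R \<pi> (g_star G g1 g2 a b)}"
      unfolding lift_products_def using lift_invariant_eq[OF hm ab] by (elim CollectE exE conjE) simp
  next
    fix x assume "x \<in> {lift_invariant R \<pi> (g_star G g1 g2 a b)}"
    then have "x = conj_by R ah k1 \<cdot> ah \<cdot> bh \<cdot> conj_by R bh k2"
      using lift_invariant_eq[OF hm ab l] by simp
    then show "x \<in> lift_products R \<pi> G g1 g2 a b" unfolding lift_products_def using l by blast
  qed
qed

lemma lift_invariant_value:
  assumes hm: "HM_rep G g1 g2" and ab: "(a, b) \<in> star_pairs g1 g2"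
  shows "lift_invariant R \<pi> (g_star G g1 g2 a b) = (if a \<in> M3 \<longleftrightarrow> b \<in> M3 then \<one>\<^bsub>R\<^esub> else z)"
proof -
  note g = HM_repD[OF hm]
  have o: "a \<in> odd_part" "b \<in> odd_part" and rel: "conj_by G a (inv g1) \<otimes> a = b \<otimes> conj_by G b (inv g2)"
    using ab by (auto simp: star_pairs_def)
  obtain A where A: "A \<subseteq> X" "odd (card A)" "a = m A" "odd (card (act (inv g1) ` A \<inter> A)) \<longleftrightarrow> a \<in> M3"
    using inter_image_parity[OF inv_closed[OF g(1)] ord_inv3[OF g(1,3)] o(1)] by blast
  obtain B where B: "B \<subseteq> X" "odd (card B)" "b = m B" "odd (card (act (inv g2) ` B \<inter> B)) \<longleftrightarrow> b \<in> M3"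
    using inter_image_parity[OF inv_closed[OF g(2)] ord_inv3[OF g(2,4)] o(2)] by blast
  obtain k1 k2 where k: "k1 \<in> carrier R" "\<pi> k1 = inv g1" "k2 \<in> carrier R" "\<pi> k2 = inv g2"
    using lift_exists[of "inv g1"] lift_exists[of "inv g2"] g by blast
  have "lift_invariant R \<pi> (g_star G g1 g2 a b) =
    conj_by R (U A) k1 \<cdot> U A \<cdot> U B \<cdot> conj_by R (U B) k2"
    using A B k U_closed U_\<pi> by (intro lift_invariant_eq[OF hm o]) (auto simp: lifts_def)
  also have "\<dots> = zp (card (act (inv g1) ` A \<inter> A) + card (B \<inter> act (inv g2) ` B))"
    using twisted_product_value[OF A(1,2) B(1,2) k(1,3)] rel A B k by simp
  finally show ?thesis using A(4) B(4) z_neq unfolding zp_parity by (simp only: even_add Int_commute[of B]) metis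
qed

end

context six_point_cover begin

section \<open>Counting the tuples\<close>

text \<open>The set cannot be sent to its complement, since \<open>g\<^sup>3 = 1\<close> and three is odd.\<close>

lemma fixed_by_ord3:
  assumes D: "D \<subseteq> X" and g: "g \<in> carrier G" "ord g = 3" and c: "conj_by G (m D) g = m D"
  shows "act g ` D = D"
proof (rule ccontr)
  interpret two_three_cycles X "act g" by (rule ord3_cycles[OF g])
  assume "act g ` D \<noteq> D"
  then have e: "act g ` D = X - D" using c conj_m[OF D g(1)] m_eq[OF D act_image[OF g(1) D]] by auto
  have "act g ` act g ` act g ` D = (\<lambda>w. w) ` D" unfolding image_image using cube D by (intro image_cong) auto
  moreover have "act g ` act g ` act g ` D = X - D"
    using e act_compl[OF g(1) D] D by (simp add: double_diff)
  ultimately have e2: "X - D = D" by simp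
  have "x \<notin> X" for x using e2 by blast
  then have "X = {}" by blast
  then show False using card_X by simp
qed

lemma even_fixed_by_ord3:
  assumes d: "d \<in> M" "d \<notin> odd_part" and g: "g \<in> carrier G" "ord g = 3" and c: "conj_by G d g = d"
  shows "d = \<one>"
proof -
  interpret two_three_cycles X "act g" by (rule ord3_cycles[OF g])
  obtain D where D: "D \<subseteq> X" "d = m D" using d by blast
  have "act g ` D = D" using fixed_by_ord3[OF D(1) g] c D by simp
  then have "D = {} \<or> D = X" using invariant_card[OF D(1)] odd_part_iff[OF D(1)] d D by auto
  then show ?thesis using D m_empty m_X by auto
qed

lemma odd_fixed_by_ord3:
  assumes g: "g \<in> carrier G" "ord g = 3"
  shows "\<exists>d\<in>odd_part. conj_by G d g = d"
proof -
  interpret two_three_cycles X "act g" by (rule ord3_cycles[OF g])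
  obtain x where x: "x \<in> X" using card_X by fastforce
  have "conj_by G (m (cyc x)) g = m (cyc x)" using conj_m[OF cyc_subset[OF x] g(1)] image_cyc[OF x] by simp
  moreover have "m (cyc x) \<in> odd_part" using odd_part_iff[OF cyc_subset[OF x]] card_cyc[OF x] by simp
  ultimately show ?thesis by blast
qed

lemma act_image_inv: "k \<in> carrier G \<Longrightarrow> B \<subseteq> X \<Longrightarrow> act (inv k) ` act k ` B = B"
proof -
  assume k: "k \<in> carrier G" and B: "B \<subseteq> X"
  have "act (inv k) ` act k ` B = (\<lambda>w. w) ` B"
    unfolding image_image using act_inv[OF k] B by (intro image_cong) auto
  then show ?thesis by simp
qed

lemma act_image_mult:
  assumes "k \<in> carrier G" "l \<in> carrier G" "B \<subseteq> X"
  shows "act (k \<otimes> l) ` B = act l ` act k ` B"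
  unfolding image_image using act_mult[OF assms(1,2)] assms(3) by (intro image_cong) auto

text \<open>The stabilizer of \<open>B\<close> is a subgroup containing the generators, and \<open>G\<close> is transitive.\<close>

lemma invariant_set_trivial:
  assumes g: "g \<in> carrier G" "h \<in> carrier G" "generate G {g, h} = carrier G"
    and B: "B \<subseteq> X" "act g ` B = B" "act h ` B = B"
  shows "B = {} \<or> B = X"
proof -
  let ?H = "{k \<in> carrier G. act k ` B = B}"
  have "subgroup ?H G"
  proof (rule subgroupI)
    show "?H \<noteq> {}" using g B by blast
    fix k assume k: "k \<in> ?H"
    then show "inv k \<in> ?H" using act_image_inv[of k B] B(1) by simp
    fix l assume l: "l \<in> ?H"
    then show "k \<otimes> l \<in> ?H" using act_image_mult[of k l B] B(1) k by simp
  qed auto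
  then have "carrier G \<subseteq> ?H" using generate_subgroup_incl[of "{g, h}" ?H] g B by auto
  then have inv: "act k ` B = B" if "k \<in> carrier G" for k using that by blast
  show ?thesis
  proof (cases "B = {}")
    case False
    then obtain v where v: "v \<in> B" by blast
    have "w \<in> B" if "w \<in> X" for w
      using act_trans[of v w] v B(1) that inv by blast
    then show ?thesis using B(1) by blast
  qed simp
qed

definition tw :: "'g \<Rightarrow> 'g \<Rightarrow> 'g" where "tw g a = conj_by G a (inv g) \<otimes> a"

text \<open>If two elements have equal images then their product lies in \<open>V\<close> and is fixed by \<open>g\<close>; only \<open>1\<close> is.\<close>

lemma tw_inj:
  assumes g: "g \<in> carrier G" "ord g = 3" and a: "a \<in> odd_part" "b \<in> odd_part" and e: "tw g a = tw g b"
  shows "a = b"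
proof -
  have aM: "a \<in> M" "b \<in> M" using a odd_subset_M by auto
  have [simp]: "a \<in> carrier G" "b \<in> carrier G" "g \<in> carrier G" using aM M_closed g by auto
  have cM: "conj_by G a (inv g) \<in> M" "conj_by G b (inv g) \<in> M" using aM M_conj by auto
  have "conj_by G (a \<otimes> b) (inv g) = conj_by G a (inv g) \<otimes> conj_by G b (inv g)" by (simp add: conj_by_mult)
  also have "\<dots> = (tw g a \<otimes> a) \<otimes> (b \<otimes> tw g b)"
  proof -
    have "tw g a \<otimes> a = conj_by G a (inv g)" using M_square[OF aM(1)] by (simp add: tw_def m_assoc)
    moreover have "b \<otimes> tw g b = conj_by G b (inv g)"
      using M_square[OF aM(2)] M_comm[OF cM(2) aM(2)] by (simp add: tw_def flip: m_assoc)
    ultimately show ?thesis by simp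
  qed
  also have "\<dots> = a \<otimes> b"
  proof -
    have t: "tw g b \<in> M" using cM aM M_mult by (simp add: tw_def)
    have "(tw g a \<otimes> a) \<otimes> (b \<otimes> tw g b) = tw g b \<otimes> (a \<otimes> b) \<otimes> tw g b"
      using M_closed[OF t] by (simp add: e m_assoc)
    also have "\<dots> = (a \<otimes> b) \<otimes> tw g b \<otimes> tw g b" using M_comm[OF t M_mult[OF aM]] by simp
    also have "\<dots> = a \<otimes> b" using M_closed[OF t] M_square[OF t] by (simp add: m_assoc)
    finally show ?thesis .
  qed
  finally have f: "conj_by G (a \<otimes> b) (inv g) = a \<otimes> b" .
  have "a \<otimes> b \<notin> odd_part" using odd_mult[OF aM] a by simp
  then have "a \<otimes> b = \<one>" using even_fixed_by_ord3[OF M_mult[OF aM] _ inv_closed[OF g(1)] ord_inv3[OF g] f] by simp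
  then show ?thesis using M_inv[OF aM(2)] inv_equality[of a b] by simp
qed

lemma fin_odd: "finite odd_part" using fin_M odd_subset_M by (meson finite_subset subsetI)

lemma tw_even: "a \<in> odd_part \<Longrightarrow> g \<in> carrier G \<Longrightarrow> tw g a \<in> M - odd_part"
  using odd_mult[of "conj_by G a (inv g)" a] M_mult M_conj odd_conj odd_subset_M by (simp add: tw_def)

lemma card_even_part: "card (M - odd_part) = card odd_part"
proof -
  obtain x where x: "x \<in> X" using card_X by fastforce
  let ?e = "m {x}"
  have e: "?e \<in> odd_part" "?e \<in> M" using odd_part_iff[of "{x}"] x by auto
  have "bij_betw (\<lambda>a. ?e \<otimes> a) odd_part (M - odd_part)"
  proof (rule bij_betwI[where g = "\<lambda>a. ?e \<otimes> a"])
    have s: "?e \<otimes> (?e \<otimes> a) = a" if "a \<in> M" for a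
      using M_square[OF e(2)] M_closed[OF e(2)] M_closed[OF that] by (simp flip: m_assoc)
    show "(\<lambda>a. ?e \<otimes> a) \<in> odd_part \<rightarrow> M - odd_part" using odd_mult[OF e(2)] e M_mult odd_subset_M by auto
    show "(\<lambda>a. ?e \<otimes> a) \<in> M - odd_part \<rightarrow> odd_part" using odd_mult[OF e(2)] e by auto
    show "?e \<otimes> (?e \<otimes> a) = a" if "a \<in> odd_part" for a using s that odd_subset_M by blast
    show "?e \<otimes> (?e \<otimes> a) = a" if "a \<in> M - odd_part" for a using s that by blast
  qed
  then show ?thesis by (metis bij_betw_same_card)
qed

lemma tw_bij:
  assumes g: "g \<in> carrier G" "ord g = 3"
  shows "bij_betw (tw g) odd_part (M - odd_part)"
proof -
  have i: "inj_on (tw g) odd_part" using tw_inj[OF g] by (intro inj_onI) blast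
  have "tw g ` odd_part = M - odd_part"
    using tw_even g fin_M card_image[OF i] card_even_part by (intro card_subset_eq) auto
  then show ?thesis using i by (simp add: bij_betw_def)
qed

definition partner :: "'g \<Rightarrow> 'g \<Rightarrow> 'g \<Rightarrow> 'g" where
  "partner g1 g2 a = inv_into odd_part (tw g2) (tw g1 a)"

lemma partner_bij:
  assumes "g1 \<in> carrier G" "g2 \<in> carrier G" "ord g1 = 3" "ord g2 = 3"
  shows "bij_betw (partner g1 g2) odd_part odd_part"
proof -
  have "partner g1 g2 = inv_into odd_part (tw g2) \<circ> tw g1" by (simp add: partner_def fun_eq_iff)
  then show ?thesis
    using bij_betw_trans[OF tw_bij[OF assms(1,3)] bij_betw_inv_into[OF tw_bij[OF assms(2,4)]]] by simp
qed

lemma star_pairs_tw: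
  assumes g: "g2 \<in> carrier G"
  shows "(a, b) \<in> star_pairs g1 g2 \<longleftrightarrow> a \<in> odd_part \<and> b \<in> odd_part \<and> tw g1 a = tw g2 b"
proof -
  have "b \<otimes> conj_by G b (inv g2) = tw g2 b" if "b \<in> odd_part"
    using M_comm[of b "conj_by G b (inv g2)"] M_conj[of b "inv g2"] odd_subset_M[OF that] g by (simp add: tw_def)
  then show ?thesis by (auto simp: star_pairs_def tw_def)
qed

lemma star_pairs_partner:
  assumes "g1 \<in> carrier G" "g2 \<in> carrier G" "ord g1 = 3" "ord g2 = 3"
  shows "(a, b) \<in> star_pairs g1 g2 \<longleftrightarrow> a \<in> odd_part \<and> b = partner g1 g2 a"
proof -
  note b = tw_bij[OF assms(2,4)]
  have "tw g1 a = tw g2 b \<longleftrightarrow> b = partner g1 g2 a" if "a \<in> odd_part" "b \<in> odd_part"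
    using bij_betw_inv_into_left[OF b that(2)] bij_betw_inv_into_right[OF b tw_even[OF that(1) assms(1)]]
    unfolding partner_def by metis
  moreover have "partner g1 g2 a \<in> odd_part" if "a \<in> odd_part"
    using bij_betwE[OF partner_bij[OF assms]] that by blast
  ultimately show ?thesis unfolding star_pairs_tw[OF assms(2)] by blast
qed

lemma inj_M5: "inj_on (\<lambda>i. m {i}) X"
proof (rule inj_onI)
  fix i j assume ij: "i \<in> X" "j \<in> X" "m {i} = m {j}"
  then have d: "{j} = {i} \<or> {j} = X - {i}" using m_eq[of "{i}" "{j}"] by simp
  have "card (X - {i}) = 5" using card_compl[of "{i}"] ij by simp
  moreover have "card {j} = 1" by simp
  ultimately have "{j} \<noteq> X - {i}" by (metis numeral_eq_one_iff semiring_norm(86))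
  then show "i = j" using d by simp
qed

lemma M5_image: "M5 = (\<lambda>i. m {i}) ` X" using M5_iff by auto

lemma card_M5: "card M5 = 6"
  using card_image[OF inj_M5] card_X M5_image by simp

lemma card_M3: "card M3 = 10"
proof -
  obtain x where x: "x \<in> X" using card_X by fastforce
  let ?T = "{T. T \<subseteq> X - {x} \<and> card T = 2}" and ?f = "\<lambda>T. m (insert x T)"
  have c: "card (X - {x}) = 5" using card_compl[of "{x}"] x by simp
  have "card ?T = 5 choose 2" using n_subsets[of "X - {x}" 2] fin_X c by simp
  moreover have "inj_on ?f ?T"
  proof (rule inj_onI)
    fix S T assume ST: "S \<in> ?T" "T \<in> ?T" "m (insert x S) = m (insert x T)"
    then have "insert x T = insert x S \<or> insert x T = X - insert x S"
      using x m_eq[of "insert x S" "insert x T"] by blast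
    then show "S = T" using ST by blast
  qed
  moreover have "?f ` ?T = M3"
  proof (intro equalityI subsetI)
    fix y assume "y \<in> ?f ` ?T"
    then obtain T where T: "T \<subseteq> X - {x}" "card T = 2" "y = m (insert x T)" by blast
    then have "finite T" "x \<notin> T" using fin_X finite_subset by blast+
    then show "y \<in> M3" using T x by (auto simp: M3_def intro!: exI[of _ "insert x T"])
  next
    fix y assume "y \<in> M3"
    then obtain S where S: "S \<subseteq> X" "card S = 3" "y = m S" by (auto simp: M3_def)
    obtain S' where S': "S' \<subseteq> X" "card S' = 3" "y = m S'" "x \<in> S'"
      using S m_compl[OF S(1)] card_compl[OF S(1)] x that by (cases "x \<in> S") (auto 0 3 intro: that[of "X - S"])
    then have "y = ?f (S' - {x})" "S' - {x} \<in> ?T" using fin_sub[OF S'(1)] by (auto simp: insert_absorb)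
    then show "y \<in> ?f ` ?T" by blast
  qed
  ultimately show ?thesis using card_image by (fastforce simp: numeral_eq_Suc)
qed

text \<open>The map \<open>tw\<close> sends \<open>m {i}\<close> to the class of the edge from \<open>i\<close> to its image. So a singleton has a singleton
  as partner exactly when its edge under \<open>g\<^sub>1\<close> lies within one of the two triangles of \<open>g\<^sub>2\<close>. No triangle
  is common to both elements, as it would be invariant under the whole group.\<close>

lemma card_two_edges:
  assumes hm: "HM_rep G g1 g2"
  shows "card {a \<in> M5. partner g1 g2 a \<in> M5} = 2"
proof -
  note g = HM_repD[OF hm]
  let ?f = "act (inv g1)" and ?h = "act (inv g2)"
  interpret F: two_three_cycles X ?f using ord3_cycles[OF inv_closed[OF g(1)] ord_inv3[OF g(1,3)]] .
  interpret H: two_three_cycles X ?h using ord3_cycles[OF inv_closed[OF g(2)] ord_inv3[OF g(2,4)]] .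
  obtain x where x: "x \<in> X" using card_X by fastforce
  let ?B = "H.cyc x"
  have BX: "?B \<subseteq> X" using H.cyc_subset[OF x] .
  obtain x' where x': "x' \<in> X" "X - ?B = H.cyc x'" using H.compl_cyc[OF x] .
  have ginv: "generate G {inv g1, inv g2} = carrier G"
  proof (rule generate_eq_carrierI[OF g(5)])
    have "inv (inv g1) \<in> generate G {inv g1, inv g2}" "inv (inv g2) \<in> generate G {inv g1, inv g2}"
      by (rule generate.inv, simp)+
    then show "{g1, g2} \<subseteq> generate G {inv g1, inv g2}" using g by simp
  qed (use g in auto)
  have B: "F.cyc y \<noteq> ?B" if y: "y \<in> X" for y
  proof
    assume e: "F.cyc y = ?B"
    have "?B = {} \<or> ?B = X"
      using invariant_set_trivial[OF _ _ ginv BX] F.image_cyc[OF y] H.image_cyc[OF x] g e by simp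
    then show False using H.card_cyc[OF x] card_X by auto
  qed
  have count: "card {i \<in> X. i \<in> ?B \<longleftrightarrow> ?f i \<in> ?B} = 2"
    by (rule F.cut_count[OF BX B H.card_cyc[OF x]])
  have same: "(i \<in> ?B \<longleftrightarrow> j \<in> ?B) \<longleftrightarrow> j \<in> H.cyc i" if i: "i \<in> X" "j \<in> X" for i j
  proof (cases "i \<in> ?B")
    case True then show ?thesis using H.cyc_eq[OF x] by simp
  next
    case False
    then have "i \<in> H.cyc x'" using x' i by blast
    then have "H.cyc i = X - ?B" using H.cyc_eq[OF x'(1)] x'(2) by simp
    then show ?thesis using False i by blast
  qed
  have twi: "tw k (m {i}) = m {act (inv k) i, i}" if "k \<in> carrier G" "ord k = 3" "i \<in> X" for k i
  proof -
    interpret K: two_three_cycles X "act (inv k)" using ord3_cycles[OF inv_closed[OF that(1)] ord_inv3[OF that(1,2)]] .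
    have "sym_diff {act (inv k) i} {i} = {act (inv k) i, i}" using K.free[OF that(3)] by auto
    then show ?thesis
      using that conj_m[of "{i}" "inv k"] m_add[of "{act (inv k) i}" "{i}"] K.closed[OF that(3)] by (simp add: tw_def)
  qed
  have edge: "(\<exists>j\<in>X. m {?f i, i} = m {?h j, j}) \<longleftrightarrow> (i \<in> ?B \<longleftrightarrow> ?f i \<in> ?B)" if i: "i \<in> X" for i
  proof -
    have fi: "?f i \<in> X" "?f i \<noteq> i" using F.closed F.free i by auto
    have "m {?f i, i} = m {?h j, j} \<longleftrightarrow> {?h j, j} = {?f i, i}" if j: "j \<in> X" for j
    proof -
      have hj: "?h j \<in> X" "?h j \<noteq> j" using H.closed H.free j by auto
      have "card (X - {?f i, i}) = 4" using card_compl[of "{?f i, i}"] fi i by simp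
      moreover have "card {?h j, j} = 2" using hj by simp
      ultimately have "card {?h j, j} \<noteq> card (X - {?f i, i})" by linarith
      then have "{?h j, j} \<noteq> X - {?f i, i}" by metis
      then show ?thesis using m_eq[of "{?f i, i}" "{?h j, j}"] fi hj i j by auto
    qed
    then have "(\<exists>j\<in>X. m {?f i, i} = m {?h j, j}) \<longleftrightarrow> (\<exists>j\<in>X. {?h j, j} = {?f i, i})" by blast
    also have "\<dots> \<longleftrightarrow> ?f i \<in> H.cyc i"
    proof
      assume "\<exists>j\<in>X. {?h j, j} = {?f i, i}"
      then obtain j where j: "j \<in> X" "{?h j, j} = {?f i, i}" by blast
      then have "i \<in> H.cyc j" "?f i \<in> H.cyc j" by (auto simp: H.cyc_def doubleton_eq_iff)
      then show "?f i \<in> H.cyc i" using H.cyc_eq[OF j(1)] by simp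
    next
      assume "?f i \<in> H.cyc i"
      then consider "?f i = ?h i" | "?f i = ?h (?h i)" using fi by (auto simp: H.cyc_def)
      then show "\<exists>j\<in>X. {?h j, j} = {?f i, i}"
      proof cases
        case 1 then show ?thesis using i by auto
      next
        case 2 then show ?thesis using fi(1) H.cube[OF i] by (intro bexI[of _ "?f i"]) auto
      qed
    qed
    also have "\<dots> \<longleftrightarrow> (i \<in> ?B \<longleftrightarrow> ?f i \<in> ?B)" using same[OF i fi(1)] by simp
    finally show ?thesis .
  qed
  have M5o: "m {i} \<in> odd_part" if "i \<in> X" for i using odd_part_iff[of "{i}"] that by simp
  have "partner g1 g2 (m {i}) \<in> M5 \<longleftrightarrow> (i \<in> ?B \<longleftrightarrow> ?f i \<in> ?B)" if i: "i \<in> X" for i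
  proof -
    have "partner g1 g2 (m {i}) \<in> M5 \<longleftrightarrow> (\<exists>j\<in>X. (m {i}, m {j}) \<in> star_pairs g1 g2)"
      using star_pairs_partner[OF g(1-4), of "m {i}"] M5_iff[of "partner g1 g2 (m {i})"] M5o[OF i] by metis
    also have "\<dots> \<longleftrightarrow> (\<exists>j\<in>X. m {?f i, i} = m {?h j, j})"
      using star_pairs_tw[OF g(2)] M5o i twi[OF g(1,3) i] twi[OF g(2,4)] by auto
    finally show ?thesis using edge[OF i] by simp
  qed
  then have "{i \<in> X. partner g1 g2 (m {i}) \<in> M5} = {i \<in> X. i \<in> ?B \<longleftrightarrow> ?f i \<in> ?B}" 
    by (rule Collect_cong[OF conj_cong[OF refl]])
  moreover have "{a \<in> M5. partner g1 g2 a \<in> M5} = (\<lambda>i. m {i}) ` {i \<in> X. partner g1 g2 (m {i}) \<in> M5}"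
    using M5_image by auto
  moreover have "inj_on (\<lambda>i. m {i}) {i \<in> X. partner g1 g2 (m {i}) \<in> M5}" by (rule inj_on_subset[OF inj_M5]) simp
  ultimately show ?thesis using count by (simp only: card_image)
qed

text \<open>Of the six singletons two have a singleton as partner, by \<open>card_two_edges\<close>. As \<open>partner\<close> is bijective, this
  leaves four pairs of each mixed kind and six pairs of three-sets.\<close>

lemma card_star_pairs:
  assumes hm: "HM_rep G g1 g2"
  shows "card {(a, b) \<in> star_pairs g1 g2. a \<in> M3 \<longleftrightarrow> b \<in> M3} = 8"
    and "card {(a, b) \<in> star_pairs g1 g2. \<not> (a \<in> M3 \<longleftrightarrow> b \<in> M3)} = 8"
proof -
  note g = HM_repD[OF hm]
  let ?p = "partner g1 g2"
  have bij: "bij_betw ?p odd_part odd_part" using partner_bij g by blast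
  have M5': "a \<in> M5 \<longleftrightarrow> a \<notin> M3" if "a \<in> odd_part" for a
    using that odd_part_split M5_M3_disjoint by blast
  have p: "?p a \<in> odd_part" if "a \<in> odd_part" for a using bij_betwE[OF bij] that by blast
  have fin: "finite A" if "A \<subseteq> odd_part" for A using that fin_odd finite_subset by blast
  have sub: "M5 \<subseteq> odd_part" "M3 \<subseteq> odd_part" using odd_part_split by auto
  let ?c55 = "{a \<in> M5. ?p a \<in> M5}" and ?c53 = "{a \<in> M5. ?p a \<in> M3}"
    and ?c35 = "{a \<in> M3. ?p a \<in> M5}" and ?c33 = "{a \<in> M3. ?p a \<in> M3}"
  have f: "finite ?c55" "finite ?c53" "finite ?c35" "finite ?c33" using sub by (auto intro!: fin)
  have "M5 = ?c55 \<union> ?c53" "?c55 \<inter> ?c53 = {}" using sub p M5' by blast+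
  then have 1: "card ?c55 + card ?c53 = 6" using card_Un_disjoint[OF f(1,2)] card_M5 by simp
  have "M3 = ?c35 \<union> ?c33" "?c35 \<inter> ?c33 = {}" using sub p M5' by blast+
  then have 2: "card ?c35 + card ?c33 = 10" using card_Un_disjoint[OF f(3,4)] card_M3 by simp
  have 3: "card ?c55 + card ?c35 = 6"
  proof -
    have "?p ` (?c55 \<union> ?c35) = M5"
    proof (intro equalityI subsetI)
      fix y assume y: "y \<in> M5"
      then obtain a where a: "a \<in> odd_part" "y = ?p a" using bij sub by (metis (no_types, lifting) bij_betw_imp_surj_on image_iff subsetD)
      then show "y \<in> ?p ` (?c55 \<union> ?c35)" using y odd_part_split by blast
    qed auto
    moreover have "inj_on ?p (?c55 \<union> ?c35)" 
      by (rule inj_on_subset[OF bij_betw_imp_inj_on[OF bij]]) (rule Un_least; use sub in blast)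
    ultimately have "card (?c55 \<union> ?c35) = 6" using card_image[of ?p "?c55 \<union> ?c35"] card_M5 by (simp only:)
    moreover have "?c55 \<inter> ?c35 = {}" using M5_M3_disjoint by blast
    ultimately show ?thesis using card_Un_disjoint[OF f(1,3)] by simp
  qed
  have 4: "card ?c55 = 2" by (rule card_two_edges[OF hm])
  have pr: "inj_on (\<lambda>a. (a, ?p a)) A" for A by (simp add: inj_on_def)
  have SP: "star_pairs g1 g2 = (\<lambda>a. (a, ?p a)) ` odd_part"
    using star_pairs_partner[OF g(1-4)] by auto
  have "{(a, b) \<in> star_pairs g1 g2. a \<in> M3 \<longleftrightarrow> b \<in> M3} = (\<lambda>a. (a, ?p a)) ` (?c55 \<union> ?c33)"
    unfolding SP using sub p M5' odd_part_split by auto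
  then have "card {(a, b) \<in> star_pairs g1 g2. a \<in> M3 \<longleftrightarrow> b \<in> M3} = card (?c55 \<union> ?c33)"
    using card_image[OF pr] by simp
  also have "\<dots> = card ?c55 + card ?c33" using f M5_M3_disjoint by (intro card_Un_disjoint) auto
  finally show "card {(a, b) \<in> star_pairs g1 g2. a \<in> M3 \<longleftrightarrow> b \<in> M3} = 8" using 1 2 3 4 by linarith
  have "{(a, b) \<in> star_pairs g1 g2. \<not> (a \<in> M3 \<longleftrightarrow> b \<in> M3)} = (\<lambda>a. (a, ?p a)) ` (?c53 \<union> ?c35)"
    unfolding SP using sub p M5' odd_part_split by auto
  then have "card {(a, b) \<in> star_pairs g1 g2. \<not> (a \<in> M3 \<longleftrightarrow> b \<in> M3)} = card (?c53 \<union> ?c35)"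
    using card_image[OF pr] by simp
  also have "\<dots> = card ?c53 + card ?c35" using f M5_M3_disjoint by (intro card_Un_disjoint) auto
  finally show "card {(a, b) \<in> star_pairs g1 g2. \<not> (a \<in> M3 \<longleftrightarrow> b \<in> M3)} = 8" using 1 2 3 4 by linarith
qed

end

context six_point_cover begin

section \<open>Coincidences between reduced classes\<close>

lemma inv_eq_iff: "x \<in> carrier G \<Longrightarrow> y \<in> carrier G \<Longrightarrow> inv x = inv y \<longleftrightarrow> x = y"
  by (metis inv_inv)

lemma pow5: "g \<in> carrier G \<Longrightarrow> g [^] (5::nat) = g \<otimes> (g \<otimes> (g \<otimes> (g \<otimes> g)))"
  by (simp add: numeral_eq_Suc m_assoc)

lemma act_pow5:
  assumes "g \<in> carrier G" "g [^] (5::nat) \<in> M" and w: "w \<in> X"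
  shows "act g (act g (act g (act g (act g w)))) = w"
proof -
  have "act (g [^] (5::nat)) w = act g (act g (act g (act g (act g w))))"
    unfolding pow5[OF assms(1)] using w assms(1) by (simp add: act_mult act_closed)
  then show ?thesis using act_M[OF assms(2) w] by simp
qed

lemma fifth_power_unique_fixed_point:
  assumes g: "g \<in> carrier G" "g \<notin> M" "g [^] (5::nat) \<in> M"
    and ij: "i \<in> X" "j \<in> X" "act g i = i" "act g j = j"
  shows "i = j"
proof (rule ccontr)
  assume "i \<noteq> j"
  then have c: "card (X - {i, j}) = 4" using card_compl[of "{i, j}"] ij by simp
  obtain x where x: "x \<in> X" "act g x \<noteq> x" using act_trivial g by blast
  have "5 \<le> card (X - {i, j})"
  proof (rule fifth_power_orbit[where f = "act g" and x = x])
    show "finite (X - {i, j})" using fin_X by simp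
    show "act g y \<in> X - {i, j}" if "y \<in> X - {i, j}" for y
      using that act_closed[OF g(1)] inj_onD[OF act_inj[OF g(1)]] ij by (metis DiffD1 DiffD2 DiffI insert_iff singletonD)
    show "act g (act g (act g (act g (act g y)))) = y" if "y \<in> X - {i, j}" for y
      using act_pow5[OF g(1,3)] that by blast
    show "x \<in> X - {i, j}" "act g x \<noteq> x" using x ij by auto
  qed
  then show False using c by simp
qed

text \<open>The set \<open>S\<close> is invariant under \<open>g\<close>, which moves five points in a cycle and fixes one. So \<open>S\<close>
  is the fixed point or its complement.\<close>

lemma fifth_power_singleton:
  assumes g: "g \<in> carrier G" "g \<notin> M" and S: "S \<subseteq> X" "odd (card S)" "g [^] (5::nat) = m S"
  shows "\<exists>i\<in>X. g [^] (5::nat) = m {i} \<and> act g i = i"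
proof -
  have g5: "act g (act g (act g (act g (act g w)))) = w" if w: "w \<in> X" for w
    using act_pow5[OF g(1) _ w] S by simp
  have "conj_by G (m S) g = m S"
  proof -
    have "g [^] (5::nat) \<otimes> g = g \<otimes> g [^] (5::nat)" unfolding pow5[OF g(1)] using g(1) by (simp add: m_assoc)
    then show ?thesis using conj_by_commute[of "m S" g] m_closed[OF S(1)] g(1) S(3) by simp
  qed
  then have "m S = m (act g ` S)" using conj_m[OF S(1) g(1)] by simp
  then have c: "act g ` S = S \<or> act g ` S = X - S" using m_eq[OF S(1) act_image[OF g(1) S(1)]] by blast
  have gS: "act g ` S = S"
  proof (rule ccontr)
    assume "act g ` S \<noteq> S"
    then have e: "act g ` S = X - S" using c by blast
    then have e': "act g ` (X - S) = S" using act_compl[OF g(1) S(1)] S(1) by (simp add: double_diff)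
    have "S = (\<lambda>w. w) ` S" by simp
    also have "\<dots> = act g ` act g ` act g ` act g ` act g ` S"
      unfolding image_image using g5 S(1) by (intro image_cong) auto
    also have "\<dots> = X - S" by (simp only: e e')
    finally have "x \<notin> X" for x by blast
    then have "X = {}" by blast
    then show False using card_X by simp
  qed
  have "card S \<noteq> 3"
  proof
    assume c3: "card S = 3"
    have fix3: "act g w = w" if T: "T \<subseteq> X" "card T = 3" "act g ` T = T" "w \<in> T" for T w
    proof (rule ccontr)
      assume n: "act g w \<noteq> w"
      have "5 \<le> card T"
      proof (rule fifth_power_orbit[where f = "act g" and x = w])
        show "finite T" "w \<in> T" "act g w \<noteq> w" using fin_sub[OF T(1)] T(4) n by auto
        show "act g x \<in> T" if "x \<in> T" for x using T(3) that by blast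
        show "act g (act g (act g (act g (act g x)))) = x" if "x \<in> T" for x using g5 T(1) that by blast
      qed
      then show False using T(2) by simp
    qed
    have "act g ` (X - S) = X - S" using act_compl[OF g(1) S(1)] gS by simp
    then have "act g w = w" if "w \<in> X" for w
      using fix3[OF S(1) c3 gS, of w] fix3[of "X - S" w] card_compl[OF S(1)] c3 that by (cases "w \<in> S") auto
    then show False using act_trivial g by blast
  qed
  then have c15: "card S = 1 \<or> card (X - S) = 1"
    using S(2) card_le[OF S(1)] card_compl[OF S(1)] by presburger
  have "act g ` (X - S) = X - S" using act_compl[OF g(1) S(1)] gS by simp
  then show ?thesis
    using c15 gS S m_compl[OF S(1)] by (auto simp: card_1_singleton_iff) (metis insertI1 DiffD1 S(1))
qed

lemma generating_ratio:
  assumes hm: "HM_rep G g1 g2"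
  shows "inv g2 \<otimes> g1 \<notin> M" "\<exists>i\<in>X. (inv g2 \<otimes> g1) [^] (5::nat) = m {i} \<and> act (inv g2 \<otimes> g1) i = i"
proof -
  note g = HM_repD[OF hm]
  obtain S where "inv g2 \<otimes> g1 \<notin> M" "S \<subseteq> X" "odd (card S)" "(inv g2 \<otimes> g1) [^] (5::nat) = m S"
    using generating_pair[OF g] by blast
  then show "inv g2 \<otimes> g1 \<notin> M" "\<exists>i\<in>X. (inv g2 \<otimes> g1) [^] (5::nat) = m {i} \<and> act (inv g2 \<otimes> g1) i = i"
    using fifth_power_singleton[of "inv g2 \<otimes> g1"] g by auto
qed

lemma HM_rep_inv: "HM_rep G g1 g2 \<Longrightarrow> HM_rep G g1 (inv g2)"
proof -
  assume hm: "HM_rep G g1 g2"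
  note g = HM_repD[OF hm]
  have "generate G {g1, inv g2} = carrier G"
  proof (rule generate_eq_carrierI[OF g(5)])
    have "inv (inv g2) \<in> generate G {g1, inv g2}" by (rule generate.inv) simp
    then show "{g1, g2} \<subseteq> generate G {g1, inv g2}" using g(2) by (auto intro: generate.incl)
  qed (use g in auto)
  then show ?thesis using g ord_inv3 by (intro HM_repI) auto
qed

text \<open>Modulo \<open>M\<close> the element \<open>k\<close> commutes with all of \<open>G\<close>, hence its action commutes with that of \<open>G\<close>. It fixes the
  only fixed point of \<open>1/g\<^sub>2 g\<^sub>1\<close>, and then by transitivity every point.\<close>

lemma centralizer_mod_M:
  assumes hm: "HM_rep G g1 g2" and k: "k \<in> carrier G"
    and n: "n1 \<in> M" "n2 \<in> M" "conj_by G g1 k = g1 \<otimes> n1" "conj_by G g2 k = g2 \<otimes> n2"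
  shows "k \<in> M"
proof -
  note g = HM_repD[OF hm]
  let ?H = "{l \<in> carrier G. \<forall>w\<in>X. act k (act l w) = act l (act k w)}"
  have kX: "act k w \<in> X" if "w \<in> X" for w using act_closed k that by blast
  have in_H: "h \<in> ?H" if h: "h \<in> carrier G" "x \<in> M" "conj_by G h k = h \<otimes> x" for h x
  proof -
    have "act k (act h w) = act h (act k w)" if w: "w \<in> X" for w
    proof -
      have "h \<otimes> k = k \<otimes> (h \<otimes> x)" using h k unfolding h(3)[symmetric] by (simp add: conj_by_def m_assoc)
      then have "act (h \<otimes> k) w = act (k \<otimes> (h \<otimes> x)) w" by simp
      then show ?thesis
        using w h(1) k M_closed[OF h(2)] act_M[OF h(2)] by (simp add: act_mult act_closed)
    qed
    then show ?thesis using h by blast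
  qed
  have "subgroup ?H G"
  proof (rule subgroupI)
    show "?H \<noteq> {}" using in_H[OF g(1) n(1,3)] by blast
    fix l assume l: "l \<in> ?H"
    have "act k (act (inv l) w) = act (inv l) (act k w)" if w: "w \<in> X" for w
    proof -
      have v: "act (inv l) w \<in> X" using l w by (simp add: act_closed)
      have "act l (act k (act (inv l) w)) = act k w" 
      proof -
        have "act l (act k (act (inv l) w)) = act k (act l (act (inv l) w))" using l v by simp
        then show ?thesis using act_inv'[of l w] l w by simp
      qed
      then have "act (inv l) (act k w) = act (inv l) (act l (act k (act (inv l) w)))" by simp
      then show ?thesis using act_inv[of l "act k (act (inv l) w)"] l kX[OF v] by simp
    qed
    then show "inv l \<in> ?H" using l by simp
    fix h assume h: "h \<in> ?H"
    show "l \<otimes> h \<in> ?H" using l h kX by (simp add: act_mult act_closed)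
  qed auto
  moreover have "{g1, g2} \<subseteq> ?H" using in_H g n by blast
  ultimately have "carrier G \<subseteq> ?H" using generate_subgroup_incl[of "{g1, g2}" ?H] g(5) by auto
  then have comm: "act k (act l w) = act l (act k w)" if "l \<in> carrier G" "w \<in> X" for l w using that by blast
  let ?w = "inv g2 \<otimes> g1"
  have wc: "?w \<in> carrier G" using g by simp
  obtain i where i: "i \<in> X" "?w [^] (5::nat) = m {i}" "act ?w i = i" using generating_ratio[OF hm] by blast
  have w5: "?w [^] (5::nat) \<in> M" using i by auto
  have "act ?w (act k i) = act k i" using comm[OF wc i(1)] i(3) by simp
  then have ki: "act k i = i"
    using fifth_power_unique_fixed_point[OF wc generating_ratio(1)[OF hm] w5 i(1) kX[OF i(1)] i(3)] by simp
  have "act k w = w" if w: "w \<in> X" for w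
  proof -
    obtain l where l: "l \<in> carrier G" "act l i = w" using act_trans[OF i(1) w] by blast
    then show ?thesis using comm[OF l(1) i(1)] ki by simp
  qed
  then show ?thesis using act_trivial k by blast
qed

lemma centralizer_trivial:
  assumes hm: "HM_rep G g1 g2" and h: "h \<in> carrier G" "conj_by G g1 h = g1" "conj_by G g2 h = g2"
  shows "h = \<one>"
proof -
  note g = HM_repD[OF hm]
  have "h \<in> M" using centralizer_mod_M[OF hm h(1) M_one M_one] h g by simp
  then obtain D where D: "D \<subseteq> X" "h = m D" by blast
  have "conj_by G (m D) g1 = m D" "conj_by G (m D) g2 = m D"
    using g h D conj_by_commute by metis+
  then have "D = {} \<or> D = X"
    using invariant_set_trivial[OF g(1,2,5) D(1)] fixed_by_ord3[OF D(1) g(1,3)] fixed_by_ord3[OF D(1) g(2,4)] by blast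
  then show ?thesis using D m_empty m_X by auto
qed

text \<open>Let \<open>w\<close> be the product of the lifts. If \<open>k\<close> conjugates \<open>w\<close> to \<open>s/w\<close>, then it conjugates \<open>w\<^sup>5\<close>, which lies over a
  basis vector \<open>m {i}\<close>, to \<open>s/w\<^sup>5 = s z w\<^sup>5\<close>. But \<open>k\<close> fixes the point \<open>i\<close> and therefore the lift.\<close>

lemma inverted_ratio_value:
  assumes hm: "HM_rep G g1 g2" and k: "k \<in> carrier R" and s: "s \<in> {\<one>\<^bsub>R\<^esub>, z}"
    and rel: "(inv\<^bsub>R\<^esub> (lft g2) \<cdot> lft g1) \<cdot> conj_by R (inv\<^bsub>R\<^esub> (lft g2) \<cdot> lft g1) k = s"
  shows "s = z"
proof -
  note g = HM_repD[OF hm]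
  note l = lft[OF g(1,3)] lft[OF g(2,4)]
  define w where "w = inv\<^bsub>R\<^esub> (lft g2) \<cdot> lft g1"
  have w [simp]: "w \<in> carrier R" "\<pi> w = inv g2 \<otimes> g1" using l by (auto simp: w_def)
  obtain i where i: "i \<in> X" "\<pi> w [^] (5::nat) = m {i}" using generating_ratio[OF hm] by auto
  let ?y = "w [^]\<^bsub>R\<^esub> (5::nat)"
  have y: "?y \<in> carrier R" "\<pi> ?y = m {i}" using i by auto
  have sc [simp]: "s \<in> carrier R" and ss: "s \<cdot> s = \<one>\<^bsub>R\<^esub>" and scomm: "s \<cdot> x = x \<cdot> s" if "x \<in> carrier R" for x
    using s z_central that by auto
  have sc [simp]: "s \<in> carrier R" and ss: "s \<cdot> s = \<one>\<^bsub>R\<^esub>" and s\<pi>: "\<pi> s = \<one>" using s by auto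
  have wk: "conj_by R w k = inv\<^bsub>R\<^esub> w \<cdot> s"
    using rel k unfolding w_def[symmetric] by (metis R.conj_by_closed R.inv_mult_cancel(1) w(1))
  have "conj_by R ?y k = (inv\<^bsub>R\<^esub> w \<cdot> s) [^]\<^bsub>R\<^esub> (5::nat)" using k wk by (simp add: R.conj_by_pow)
  also have "\<dots> = (inv\<^bsub>R\<^esub> w) [^]\<^bsub>R\<^esub> (5::nat) \<cdot> s [^]\<^bsub>R\<^esub> (5::nat)"
    using scomm[of "inv\<^bsub>R\<^esub> w"] by (intro R.pow_mult_distrib) auto
  also have "s [^]\<^bsub>R\<^esub> (5::nat) = s" using s zp_parity[of 5] by auto
  also have "(inv\<^bsub>R\<^esub> w) [^]\<^bsub>R\<^esub> (5::nat) = inv\<^bsub>R\<^esub> ?y" by (simp add: R.nat_pow_inv)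
  finally have yk: "conj_by R ?y k = inv\<^bsub>R\<^esub> ?y \<cdot> s" .
  have iX: "{i} \<subseteq> X" using i by simp
  have "conj_by G (m {i}) (\<pi> k) = m {i}"
  proof -
    have "conj_by G (m {i}) (\<pi> k) = \<pi> (conj_by R ?y k)" using y k by simp
    also have "\<dots> = inv (m {i})" unfolding yk using y s\<pi> m_closed[OF iX] by simp
    also have "\<dots> = m {i}" using M_inv iX by blast
    finally show ?thesis .
  qed
  then have "act (\<pi> k) i = i"
    using conj_m[OF iX, of "\<pi> k"] k inj_onD[OF inj_M5, of "act (\<pi> k) i" i] act_closed[OF _ i(1), of "\<pi> k"] i(1) by simp
  then have "conj_by R ?y k = ?y" using stabilizer_fixes_lift[OF y i(1) k] by simp
  then have "?y = inv\<^bsub>R\<^esub> ?y \<cdot> s" using yk by simp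
  then have "?y \<cdot> ?y = s" using y by (metis R.inv_mult_cancel(2) sc)
  moreover have "?y \<cdot> ?y = z" using lift_odd[OF y(1) iX y(2)] by simp
  ultimately show ?thesis by simp
qed

lemma conj_quad_simp: "conj_quad G h (a, b, c, d) = (conj_by G a h, conj_by G b h, conj_by G c h, conj_by G d h)"
  by (simp add: conj_quad_def)

lemma star_odd: "(a, b) \<in> star_pairs g1 g2 \<Longrightarrow> a \<in> odd_part \<and> b \<in> odd_part"
  by (simp add: star_pairs_def)

text \<open>Two values that give the same entry differ by an element of \<open>V\<close> that commutes with an element of order three.\<close>

lemma g_star_inject:
  assumes hm: "HM_rep G g1 g2" and ab: "a \<in> odd_part" "b \<in> odd_part" "a' \<in> odd_part" "b' \<in> odd_part"
    and eq: "g_star G g1 g2 a b = g_star G g1 g2 a' b'"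
  shows "a = a' \<and> b = b'"
proof -
  note g = HM_repD[OF hm]
  have *: "x = x'" if x: "x \<in> odd_part" "x' \<in> odd_part" and k: "k \<in> carrier G" "ord k = 3"
    and e: "conj_by G k x = conj_by G k x'" for x x' k
  proof -
    have xM: "x \<in> M" "x' \<in> M" using x odd_subset_M by auto
    have [simp]: "x \<in> carrier G" "x' \<in> carrier G" using xM M_closed by auto
    have "conj_by G k (x \<otimes> x') = conj_by G (conj_by G k x') x'" using e k by (simp flip: conj_by_conj_by)
    also have "\<dots> = k" using k M_square[OF xM(2)] by (simp add: conj_by_conj_by)
    finally have "conj_by G (x \<otimes> x') k = x \<otimes> x'" using k by (simp add: conj_by_commute)
    moreover have "x \<otimes> x' \<notin> odd_part" using odd_mult[OF xM] x by simp
    ultimately have "x \<otimes> x' = \<one>" using even_fixed_by_ord3[OF M_mult[OF xM] _ k] by simp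
    then show ?thesis using M_inv[OF xM(2)] inv_equality[of x x'] by simp
  qed
  have M: "a \<in> M" "b \<in> M" "a' \<in> M" "b' \<in> M" using ab odd_subset_M by auto
  have "conj_by G (inv g1) a = conj_by G (inv g1) a'" "conj_by G g2 b = conj_by G g2 b'"
    using eq g_star_conj[OF g(1,2) M(1,2)] g_star_conj[OF g(1,2) M(3,4)] by auto
  then show ?thesis
    using *[OF ab(1,3) inv_closed[OF g(1)] ord_inv3[OF g(1,3)]] *[OF ab(2,4) g(2,4)] by blast
qed

lemma g_star_conj_inject:
  assumes hm: "HM_rep G g1 g2" and ab: "a \<in> odd_part" "b \<in> odd_part" "a' \<in> odd_part" "b' \<in> odd_part"
    and h: "h \<in> carrier G" and eq: "g_star G g1 g2 a' b' = conj_quad G h (g_star G g1 g2 a b)"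
  shows "a = a' \<and> b = b'"
proof -
  note g = HM_repD[OF hm]
  have M: "a \<in> M" "b \<in> M" "a' \<in> M" "b' \<in> M" using ab odd_subset_M by auto
  have e: "conj_by G g1 h = g1" "conj_by G (inv g2) h = inv g2"
    using eq unfolding g_star_conj[OF g(1,2) M(1,2)] g_star_conj[OF g(1,2) M(3,4)] conj_quad_simp by auto
  have "inv (conj_by G g2 h) = inv g2" using e(2) g h by (simp add: conj_by_inv)
  then have "conj_by G g2 h = g2" using g h by (metis conj_by_closed inv_inv)
  then have "h = \<one>" using centralizer_trivial[OF hm h e(1)] by blast
  then have "g_star G g1 g2 a b = g_star G g1 g2 a' b'"
    using eq g M_closed[OF M(1)] M_closed[OF M(2)] by (simp add: g_star_conj[OF g(1,2) M(1,2)] conj_quad_simp)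
  then show ?thesis using g_star_inject[OF hm ab] by blast
qed

text \<open>Suppose that a nontrivial element of the Klein group relates the tuples, by conjugation with \<open>h\<close>. For
  \<open>half_turn\<close> and \<open>double_twist\<close>, invariant \<open>1\<close> would make the lift of \<open>1/g\<^sub>2 g\<^sub>1\<close> conjugate to its inverse, contrary
  to \<open>inverted_ratio_value\<close>. Their product would interchange \<open>g\<^sub>1\<close> and \<open>1/g\<^sub>2\<close>, so \<open>h\<^sup>2\<close> is in the trivial
  centralizer. Then \<open>h\<close> is in \<open>M\<close>, and so is \<open>g\<^sub>2 g\<^sub>1\<close>, which is impossible.\<close>

lemma reduced_class_injective:
  assumes hm: "HM_rep G g1 g2"
    and ab: "(a, b) \<in> star_pairs g1 g2" and ab': "(a', b') \<in> star_pairs g1 g2"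
    and eq: "reduced_class G (g_star G g1 g2 a' b') = reduced_class G (g_star G g1 g2 a b)"
    and s: "lift_invariant R \<pi> (g_star G g1 g2 a' b') = \<one>\<^bsub>R\<^esub>"
  shows "a = a' \<and> b = b'"
proof -
  note g = HM_repD[OF hm]
  have o: "a \<in> odd_part" "b \<in> odd_part" "a' \<in> odd_part" "b' \<in> odd_part" using ab ab' star_odd by auto
  have M: "a \<in> M" "b \<in> M" "a' \<in> M" "b' \<in> M" using o odd_subset_M by auto
  note [simp] = g(1,2) M[THEN M_closed]
  let ?c2 = "conj_by G (inv g1) a" and ?c3 = "conj_by G g2 b"
  let ?d2 = "conj_by G (inv g1) a'" and ?d3 = "conj_by G g2 b'"
  have x: "g_star G g1 g2 a b = (g1, ?c2, ?c3, inv g2)" by (rule g_star_conj[OF g(1,2) M(1,2)])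
  have y: "g_star G g1 g2 a' b' = (g1, ?d2, ?d3, inv g2)" by (rule g_star_conj[OF g(1,2) M(3,4)])
  have xn: "g_star G g1 g2 a b \<in> nielsen_C3_4 G" and yn: "g_star G g1 g2 a' b' \<in> nielsen_C3_4 G"
    using ab ab' g_star_in_Ni_iff[OF hm] by (auto simp: g_star_in_Ni_def)
  let ?u = "lft g1" and ?v = "lft g2"
  note lu = lft[OF g(1,3)] and lv = lft[OF g(2,4)]
  note [simp] = lu(1) lv(1)
  have li: "lft (inv g2) = inv\<^bsub>R\<^esub> ?v" by (rule lft_inv[OF g(2,4)])
  have False if d2: "?d2 = conj_by G p h" and d3: "?d3 = conj_by G q h" and h: "h \<in> carrier G"
      and pq: "(p, q) = (inv g2, g1) \<or> (p, q) = (g1, inv g2)" for p q h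
  proof -
    obtain hh where hh: "hh \<in> carrier R" "\<pi> hh = h" using lift_exists[OF h] by blast
    have "p \<in> carrier G \<and> ord p = 3 \<and> q \<in> carrier G \<and> ord q = 3"
      using pq by (elim disjE) (simp_all add: g ord_inv3)
    then have pq3: "p \<in> carrier G" "ord p = 3" "q \<in> carrier G" "ord q = 3" by blast+
    have l2: "lft ?d2 = conj_by R (lft p) hh" "lft ?d3 = conj_by R (lft q) hh"
      unfolding d2 d3 hh(2)[symmetric] by (intro lft_conj pq3 hh(1))+
    have pc: "lft p \<in> carrier R" "lft q \<in> carrier R" using lft pq3 by auto
    have e: "?u \<cdot> conj_by R (lft p) hh \<cdot> conj_by R (lft q) hh \<cdot> inv\<^bsub>R\<^esub> ?v = \<one>\<^bsub>R\<^esub>"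
      using s unfolding y lift_invariant_def prod.case li l2 .
    then have "inv\<^bsub>R\<^esub> ?v \<cdot> (?u \<cdot> conj_by R (lft p \<cdot> lft q) hh) = \<one>\<^bsub>R\<^esub>"
      using hh pc R.inv_comm[of "?u \<cdot> conj_by R (lft p \<cdot> lft q) hh" "inv\<^bsub>R\<^esub> ?v"]
      by (simp add: R.conj_by_mult R.m_assoc)
    then have e': "(inv\<^bsub>R\<^esub> ?v \<cdot> ?u) \<cdot> conj_by R (lft p \<cdot> lft q) hh = \<one>\<^bsub>R\<^esub>"
      using hh pc by (simp add: R.m_assoc)
    from pq show False
    proof
      assume "(p, q) = (inv g2, g1)"
      then have "(inv\<^bsub>R\<^esub> ?v \<cdot> ?u) \<cdot> conj_by R (inv\<^bsub>R\<^esub> ?v \<cdot> ?u) hh = \<one>\<^bsub>R\<^esub>" using e' li by simp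
      from inverted_ratio_value[OF hm hh(1) _ this] show False using z_neq by simp
    next
      assume pq': "(p, q) = (g1, inv g2)"
      have "conj_by R (inv\<^bsub>R\<^esub> ?v \<cdot> ?u) (inv\<^bsub>R\<^esub> ?v) = ?u \<cdot> inv\<^bsub>R\<^esub> ?v" by (simp add: conj_by_def R.m_assoc)
      then have "conj_by R (lft p \<cdot> lft q) hh = conj_by R (inv\<^bsub>R\<^esub> ?v \<cdot> ?u) (inv\<^bsub>R\<^esub> ?v \<cdot> hh)"
        using pq' li hh by (simp flip: R.conj_by_conj_by)
      then have "(inv\<^bsub>R\<^esub> ?v \<cdot> ?u) \<cdot> conj_by R (inv\<^bsub>R\<^esub> ?v \<cdot> ?u) (inv\<^bsub>R\<^esub> ?v \<cdot> hh) = \<one>\<^bsub>R\<^esub>"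
        using e' by simp
      from inverted_ratio_value[OF hm _ _ this] show False using z_neq hh by simp
    qed
  qed
  note no = this
  show ?thesis
  proof (rule reduced_class_eq_cases[OF fin_G xn yn eq])
    fix h assume "h \<in> carrier G" "g_star G g1 g2 a' b' = conj_quad G h (g_star G g1 g2 a b)"
    then show ?thesis using g_star_conj_inject[OF hm o] by blast
  next
    fix h assume h: "h \<in> carrier G" "g_star G g1 g2 a' b' = conj_quad G h (half_turn (g_star G g1 g2 a b))"
    then have "?d2 = conj_by G (inv g2) h" "?d3 = conj_by G g1 h"
      unfolding x y half_turn_def prod.case conj_quad_simp prod.inject by blast+
    then show ?thesis using no[of "inv g2" h g1] h(1) by blast
  next
    fix h assume h: "h \<in> carrier G" "g_star G g1 g2 a' b' = conj_quad G h (double_twist (g_star G g1 g2 a b))"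
    then have "?d2 = conj_by G g1 h" "?d3 = conj_by G (inv g2) h"
      unfolding x y double_twist_def prod.case conj_quad_simp prod.inject by blast+
    then show ?thesis using no[of g1 h "inv g2"] h(1) by blast
  next
    fix h assume h: "h \<in> carrier G"
      "g_star G g1 g2 a' b' = conj_quad G h (half_turn (double_twist (g_star G g1 g2 a b)))"
    then have e: "g1 = conj_by G (inv g2) h" "inv g2 = conj_by G g1 h"
      unfolding x y double_twist_def half_turn_def prod.case conj_quad_simp prod.inject by blast+
    have "conj_by G g1 (h \<otimes> h) = g1" using e h g by (metis conj_by_conj_by inv_closed)
    moreover have "conj_by G g2 (h \<otimes> h) = g2"
    proof -
      have "conj_by G (inv g2) (h \<otimes> h) = inv g2" using e h g by (metis conj_by_conj_by inv_closed)
      then have "inv (conj_by G g2 (h \<otimes> h)) = inv g2" using h by (simp add: conj_by_inv)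
      then show ?thesis using inv_eq_iff[of "conj_by G g2 (h \<otimes> h)" g2] h(1) g(2) by simp
    qed
    ultimately have hh: "h \<otimes> h = \<one>" using centralizer_trivial[OF hm] h by simp
    have "h \<in> M"
    proof (rule ccontr)
      assume "h \<notin> M"
      then show False using square_odd[OF h(1), of "{}"] hh m_empty by simp
    qed
    then obtain D where D: "D \<subseteq> X" "h = m D" by blast
    have "g2 \<otimes> g1 = g2 \<otimes> (inv h \<otimes> inv g2 \<otimes> h)" using e(1) by (simp add: conj_by_def)
    also have "\<dots> = conj_by G h (inv g2) \<otimes> h"
      using h(1) M_inv[OF \<open>h \<in> M\<close>] by (simp add: conj_by_def m_assoc)
    also have "\<dots> \<in> M" using M_mult[OF M_conj[OF \<open>h \<in> M\<close>] \<open>h \<in> M\<close>] by simp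
    finally show ?thesis using generating_ratio(1)[OF HM_rep_inv[OF hm]] by simp
  qed
qed

end

context six_point_cover begin

section \<open>The two orbits\<close>

lemma lift_invariant_central:
  assumes "(a, b, c, d) \<in> nielsen_C3_4 G"
  shows "lift_invariant R \<pi> (a, b, c, d) \<in> {\<one>\<^bsub>R\<^esub>, z}"
proof -
  have x: "a \<in> carrier G" "ord a = 3" "b \<in> carrier G" "ord b = 3" "c \<in> carrier G" "ord c = 3"
    "d \<in> carrier G" "ord d = 3" and p: "a \<otimes> b \<otimes> c \<otimes> d = \<one>"
    using assms by (auto simp: nielsen_C3_4_def)
  note l = lft[OF x(1,2)] lft[OF x(3,4)] lft[OF x(5,6)] lft[OF x(7,8)]
  have "\<pi> (lft a \<cdot> lft b \<cdot> lft c \<cdot> lft d) = \<one>" using l p by simp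
  then show ?thesis using ker_cases l by (simp add: lift_invariant_def)
qed

text \<open>Lifting to elements of order three commutes with conjugation, and the invariant is central.\<close>

lemma lift_invariant_braid: "braid_invariant (lift_invariant R \<pi>)"
  unfolding braid_invariant_def
proof (intro ballI conjI)
  fix x assume x: "x \<in> nielsen_C3_4 G"
  obtain a b c d where [simp]: "x = (a, b, c, d)" by (cases x)
  have o: "a \<in> carrier G" "ord a = 3" "b \<in> carrier G" "ord b = 3" "c \<in> carrier G" "ord c = 3"
    "d \<in> carrier G" "ord d = 3"
    using x by (auto simp: nielsen_C3_4_def)
  note l [simp] = lft(1,2)[OF o(1,2)] lft(1,2)[OF o(3,4)] lft(1,2)[OF o(5,6)] lft(1,2)[OF o(7,8)]
  have tw: "lft (u \<otimes> v \<otimes> inv u) = lft u \<cdot> lft v \<cdot> inv\<^bsub>R\<^esub> (lft u)"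
    if uv: "u \<in> carrier G" "ord u = 3" "v \<in> carrier G" "ord v = 3" for u v
  proof -
    have "lft (conj_by G v (\<pi> (inv\<^bsub>R\<^esub> (lft u)))) = conj_by R (lft v) (inv\<^bsub>R\<^esub> (lft u))"
      using lft[OF uv(1,2)] by (intro lft_conj uv) simp
    then show ?thesis using lft[OF uv(1,2)] uv by (simp add: conj_by_def)
  qed
  show "lift_invariant R \<pi> (twist1 G x) = lift_invariant R \<pi> x"
    by (simp add: lift_invariant_def twist1_def tw[OF o(1-4)] R.m_assoc)
  show "lift_invariant R \<pi> (twist2 G x) = lift_invariant R \<pi> x"
    by (simp add: lift_invariant_def twist2_def tw[OF o(3-6)] R.m_assoc)
  show "lift_invariant R \<pi> (twist3 G x) = lift_invariant R \<pi> x"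
    by (simp add: lift_invariant_def twist3_def tw[OF o(5-8)] R.m_assoc)
  fix h assume h: "h \<in> carrier G"
  obtain y where y: "y \<in> carrier R" "\<pi> y = h" using lift_exists[OF h] by blast
  have "lift_invariant R \<pi> (conj_quad G h x) = conj_by R (lift_invariant R \<pi> x) y"
    using y by (simp add: lift_invariant_def conj_quad_simp flip: y(2))
       (simp add: lft_conj o R.conj_by_mult)
  also have "\<dots> = lift_invariant R \<pi> x"
  proof -
    have "conj_by R z y = z" using z_central[OF y(1)] R.conj_by_commute[of z y] y by simp
    moreover have "lift_invariant R \<pi> x = \<one>\<^bsub>R\<^esub> \<or> lift_invariant R \<pi> x = z"
      using lift_invariant_central[of a b c d] x by simp
    ultimately show ?thesis using y(1) by (elim disjE) (simp_all only: R.conj_by_one_left)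
  qed
  finally show "lift_invariant R \<pi> (conj_quad G h x) = lift_invariant R \<pi> x" .
qed

lemma lift_invariant_HM:
  assumes "HM_rep G g1 g2" shows "lift_invariant R \<pi> (HM_tuple G g1 g2) = \<one>\<^bsub>R\<^esub>"
proof -
  note g = HM_repD[OF assms]
  show ?thesis
    using lft[OF g(1,3)] lft[OF g(2,4)] lft_inv[OF g(1,3)] lft_inv[OF g(2,4)]
    by (simp add: lift_invariant_def HM_tuple_def)
qed

lemma fin_nielsen: "finite (nielsen_C3_4 G)"
  using fin_G by (intro finite_subset[of "nielsen_C3_4 G" "carrier G \<times> carrier G \<times> carrier G \<times> carrier G"])
    (auto dest: nielsen_quad)

text \<open>The two elements generate \<open>G\<close> modulo \<open>M\<close>, hence \<open>G\<close> by the Frattini property.\<close>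

lemma HM_rep_conj_M:
  assumes hm: "HM_rep G g1 g2" and n: "n \<in> M"
  shows "HM_rep G g1 (conj_by G g2 n)"
proof -
  note g = HM_repD[OF hm]
  let ?k = "conj_by G g2 n"
  have nc: "n \<in> carrier G" using n M_closed by blast
  let ?H = "generate G {g1, ?k}"
  have sub: "subgroup ?H G" using g nc by (intro generate_is_subgroup) auto
  have HG: "h \<in> carrier G" if "h \<in> ?H" for h using subgroup.subset[OF sub] that by blast
  let ?L = "{l \<in> carrier G. \<exists>h\<in>?H. \<exists>x\<in>M. l = h \<otimes> x}"
  have "subgroup ?L G"
  proof (rule subgroupI)
    have "\<one> = \<one> \<otimes> \<one>" by simp
    then show "?L \<noteq> {}" using subgroup.one_closed[OF sub] M_one by blast
    fix l assume "l \<in> ?L"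
    then obtain h x where h: "h \<in> ?H" "x \<in> M" "l = h \<otimes> x" by blast
    have hx: "h \<in> carrier G" "x \<in> carrier G" using h HG M_closed by auto
    have "inv l = inv h \<otimes> conj_by G x (inv h)"
      using hx M_inv[OF h(2)] by (simp add: h(3) conj_by_def inv_mult_group m_assoc)
    then show "inv l \<in> ?L"
      using hx h(3) subgroup.m_inv_closed[OF sub h(1)] M_conj[OF h(2), of "inv h"]
      by (intro CollectI conjI bexI[of _ "inv h"] bexI[of _ "conj_by G x (inv h)"]) simp_all
    fix k assume "k \<in> ?L"
    then obtain h' x' where h': "h' \<in> ?H" "x' \<in> M" "k = h' \<otimes> x'" by blast
    have hx': "h' \<in> carrier G" "x' \<in> carrier G" using h' HG M_closed by auto
    have "l \<otimes> k = (h \<otimes> h') \<otimes> (conj_by G x h' \<otimes> x')"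
      using hx hx' by (simp add: h(3) h'(3) conj_by_def m_assoc)
    then show "l \<otimes> k \<in> ?L"
      using hx hx' h(3) h'(3) subgroup.m_closed[OF sub h(1) h'(1)] M_mult[OF M_conj[OF h(2) hx'(1)] h'(2)]
      by (intro CollectI conjI bexI[of _ "h \<otimes> h'"] bexI[of _ "conj_by G x h' \<otimes> x'"]) simp_all
  qed auto
  moreover have "g1 \<in> ?L"
    using g(1) M_one by (intro CollectI conjI bexI[of _ g1] bexI[of _ \<one>] generate.incl) simp_all
  moreover have "g2 \<in> ?L"
  proof -
    have "n \<otimes> (n \<otimes> x) = x" if "x \<in> carrier G" for x
      using that nc M_square[OF n] by (simp flip: m_assoc)
    then have "g2 = ?k \<otimes> (conj_by G n ?k \<otimes> n)"
      using g(2) nc M_inv[OF n] M_square[OF n] by (simp add: conj_by_def m_assoc inv_mult_group)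
    moreover have "?k \<in> ?H" by (auto intro: generate.incl)
    moreover have "conj_by G n ?k \<otimes> n \<in> M" using n g nc by (intro M_mult M_conj) auto
    ultimately show ?thesis using g(2) by blast
  qed
  ultimately have "carrier G \<subseteq> ?L" using generate_subgroup_incl[of "{g1, g2}" ?L] g(5) by auto
  then have "?H = carrier G" by (intro frattini[OF sub]) blast
  then show ?thesis using g nc by (intro HM_repI) (auto simp: ord_conj_by)
qed

definition matched_pairs :: "'g \<Rightarrow> 'g \<Rightarrow> ('g \<times> 'g) set" where
  "matched_pairs g1 g2 = {(a, b) \<in> star_pairs g1 g2. a \<in> M3 \<longleftrightarrow> b \<in> M3}"

definition mixed_pairs :: "'g \<Rightarrow> 'g \<Rightarrow> ('g \<times> 'g) set" where
  "mixed_pairs g1 g2 = {(a, b) \<in> star_pairs g1 g2. \<not> (a \<in> M3 \<longleftrightarrow> b \<in> M3)}"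

lemma card_centralizing_M:
  assumes "g \<in> carrier G" "ord g = 3"
  shows "\<exists>d. {x \<in> M. conj_by G g x = g} \<subseteq> {\<one>, d}"
proof -
  obtain d where d: "d \<in> odd_part" "conj_by G d g = d" using odd_fixed_by_ord3[OF assms] by blast
  have dM: "d \<in> M" using d odd_subset_M by blast
  have "x = \<one> \<or> x = d" if x: "x \<in> M" "conj_by G g x = g" for x
  proof -
    have xc: "conj_by G x g = x" using x(2) M_closed[OF x(1)] assms(1) conj_by_commute by metis
    show ?thesis
    proof (cases "x \<in> odd_part")
      case False
      then show ?thesis using even_fixed_by_ord3[OF x(1) False assms xc] by simp
    next
      case True
      have "conj_by G (x \<otimes> d) g = x \<otimes> d" using xc d(2) M_closed[OF x(1)] M_closed[OF dM] assms by (simp add: conj_by_mult)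
      moreover have "x \<otimes> d \<notin> odd_part" using odd_mult[OF x(1) dM] True d by simp
      ultimately have "x \<otimes> d = \<one>" using even_fixed_by_ord3[OF M_mult[OF x(1) dM] _ assms] by simp
      then show ?thesis using M_inv[OF dM] inv_equality[of x d] M_closed[OF x(1)] M_closed[OF dM] by simp
    qed
  qed
  then show ?thesis by blast
qed

text \<open>The element \<open>g\<^sub>2\<close> is replaced by its sixteen conjugates under \<open>V\<close>, each of which has eight mixed pairs. The first
  entry \<open>g\<^sub>1\<close> stays the same, so two of these tuples in one inner class differ by an element that centralizes \<open>g\<^sub>1\<close>
  and, modulo \<open>M\<close>, also \<open>g\<^sub>2\<close>. There are at most two such elements, and a reduced class consists of at most four
  inner classes. Thus each reduced class contains at most eight of the 128 tuples.\<close>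

lemma many_mixed_classes:
  assumes hm: "HM_rep G g1 g2"
  shows "8 \<le> card {reduced_class G (g_star G g1 h a b) | h a b. HM_rep G g1 h \<and> (a, b) \<in> mixed_pairs g1 h}"
proof -
  note g = HM_repD[OF hm]
  let ?k = "\<lambda>n. conj_by G g2 n"
  let ?I = "Sigma (M - odd_part) (\<lambda>n. mixed_pairs g1 (?k n))"
  define t where "t = (\<lambda>(n, a, b). g_star G g1 (?k n) a b)"
  let ?F = "\<lambda>i. reduced_class G (t i)"
  have hmk: "HM_rep G g1 (?k n)" if "n \<in> M - odd_part" for n using HM_rep_conj_M[OF hm] that by blast
  have c8: "card (mixed_pairs g1 (?k n)) = 8" if "n \<in> M - odd_part" for n
    unfolding mixed_pairs_def by (rule card_star_pairs(2)[OF hmk[OF that]])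
  have finI: "finite ?I" using fin_M c8 by (intro finite_SigmaI) (auto intro: card_ge_0_finite)
  have "card odd_part = 16"
    using card_Un_disjoint[of M5 M3] fin_odd odd_part_split M5_M3_disjoint card_M5 card_M3 by simp
  then have "card ?I = 128" using card_SigmaI[of "M - odd_part" "\<lambda>n. mixed_pairs g1 (?k n)"] fin_M c8 card_even_part
    by (simp add: card_ge_0_finite)
  have I: "n \<in> M" "n \<notin> odd_part" "a \<in> odd_part" "b \<in> odd_part" "a \<in> M" "b \<in> M" "HM_rep G g1 (?k n)"
      "t (n, a, b) \<in> nielsen_C3_4 G" "t (n, a, b) = (g1, conj_by G (inv g1) a, conj_by G (?k n) b, inv (?k n))"
    if i: "(n, a, b) \<in> ?I" for n a b
  proof -
    show n: "n \<in> M" "n \<notin> odd_part" and ab: "a \<in> odd_part" "b \<in> odd_part" using i star_odd by (auto simp: mixed_pairs_def)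
    show abM: "a \<in> M" "b \<in> M" using ab odd_subset_M by auto
    show hk: "HM_rep G g1 (?k n)" using hmk n by blast
    have "(a, b) \<in> star_pairs g1 (?k n)" using i by (auto simp: mixed_pairs_def)
    then show "t (n, a, b) \<in> nielsen_C3_4 G" 
      using g_star_in_Ni_iff[OF hk, of a b] unfolding g_star_in_Ni_def t_def prod.case by blast
    show "t (n, a, b) = (g1, conj_by G (inv g1) a, conj_by G (?k n) b, inv (?k n))"
      unfolding t_def prod.case by (rule g_star_conj[OF HM_repD(1,2)[OF hk] abM])
  qed
  have inj: "inj_on t ?I"
  proof (rule inj_onI)
    fix j j' assume jj: "j \<in> ?I" "j' \<in> ?I" "t j = t j'"
    obtain n a b where j: "j = (n, a, b)" by (cases j)
    obtain n' a' b' where j': "j' = (n', a', b')" by (cases j')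
    have i: "(n, a, b) \<in> ?I" "(n', a', b') \<in> ?I" and e: "t (n, a, b) = t (n', a', b')"
      using jj unfolding j j' by blast+
    note J = I[OF i(1)] and J' = I[OF i(2)]
    note [simp] = M_closed[OF J(1)] M_closed[OF J'(1)] g(2)
    have "inv (?k n) = inv (?k n')" using e unfolding J(9) J'(9) by simp
    then have "?k n = ?k n'" by (simp only: inv_eq_iff conj_by_closed M_closed[OF J(1)] M_closed[OF J'(1)] g(2))
    then have "conj_by G g2 (n \<otimes> n') = conj_by G (?k n') n'" by (simp flip: conj_by_conj_by)
    then have "conj_by G g2 (n \<otimes> n') = g2" using M_square[OF J'(1)] by (simp add: conj_by_conj_by)
    then have "conj_by G (n \<otimes> n') g2 = n \<otimes> n'" by (simp add: conj_by_commute)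
    moreover have "n \<otimes> n' \<notin> odd_part" using odd_mult[OF J(1) J'(1)] J J' by simp
    ultimately have "n \<otimes> n' = \<one>" using even_fixed_by_ord3[OF M_mult[OF J(1) J'(1)] _ g(2,4)] by simp
    then have nn: "n = n'" using M_inv[OF J'(1)] inv_equality[of n n'] by simp
    then show "j = j'"
      using g_star_inject[OF J(7) J(3,4) J'(3,4)] e by (simp add: t_def j j')
  qed
  have two: "card {i \<in> ?I. \<exists>h\<in>carrier G. t i = conj_quad G h q} \<le> 2" (is "card ?J \<le> 2")
    if q: "q \<in> nielsen_C3_4 G" for q
  proof (cases "?J = {}")
    case False
    then obtain i0 h0 where i0: "i0 \<in> ?I" "h0 \<in> carrier G" "t i0 = conj_quad G h0 q" by blast
    obtain n0 a0 b0 where i0': "i0 = (n0, a0, b0)" by (cases i0)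
    note J0 = I[OF i0(1)[unfolded i0']]
    obtain d where d: "{x \<in> M. conj_by G g1 x = g1} \<subseteq> {\<one>, d}" using card_centralizing_M[OF g(1,3)] by blast
    have "t i \<in> {conj_quad G \<one> (t i0), conj_quad G d (t i0)}" if iJ: "i \<in> ?J" for i
    proof -
      obtain n a b where i': "i = (n, a, b)" by (cases i)
      obtain h where ih: "(n, a, b) \<in> ?I" "h \<in> carrier G" "t (n, a, b) = conj_quad G h q" using iJ unfolding i' by blast
      note J = I[OF ih(1)]
      let ?l = "inv h0 \<otimes> h"
      have l: "?l \<in> carrier G" using i0 ih by simp
      have tl: "t i = conj_quad G ?l (t i0)"
        unfolding i' ih(3) i0(3) using i0(2) ih(2) nielsen_quad[OF q]
        by (simp add: conj_quad_conj_quad)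
      have e1: "conj_by G g1 ?l = g1" and e2: "inv (conj_by G (?k n0) ?l) = inv (?k n)"
        using tl M_closed[OF J0(1)] l g(2) unfolding i' i0' J(9) J0(9) conj_quad_simp by (simp_all add: conj_by_inv)
      note [simp] = M_closed[OF J(1)] M_closed[OF J0(1)] g(1,2) l
      have e3: "conj_by G (?k n0) ?l = ?k n"
        using e2 by (simp only: inv_eq_iff conj_by_closed M_closed[OF J(1)] M_closed[OF J0(1)] g(2) l)
      have kn: "?k n = ?k n0 \<otimes> (conj_by G n0 (?k n0) \<otimes> n0 \<otimes> (conj_by G n g2 \<otimes> n))"
      proof -
        have a: "?k x = g2 \<otimes> (conj_by G x g2 \<otimes> x)" if "x \<in> M" for x
          using M_closed[OF that] M_inv[OF that] by (simp add: conj_by_def m_assoc)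
        have b: "?k n0 \<otimes> (conj_by G n0 (?k n0) \<otimes> n0) = g2"
        proof -
          have "n0 \<otimes> (n0 \<otimes> x) = x" if "x \<in> carrier G" for x
            using that M_square[OF J0(1)] by (simp flip: m_assoc)
          then show ?thesis
            using M_inv[OF J0(1)] M_square[OF J0(1)] by (simp add: conj_by_def m_assoc inv_mult_group)
        qed
        have "?k n0 \<otimes> (conj_by G n0 (?k n0) \<otimes> n0 \<otimes> (conj_by G n g2 \<otimes> n)) =
          ?k n0 \<otimes> (conj_by G n0 (?k n0) \<otimes> n0) \<otimes> (conj_by G n g2 \<otimes> n)" by (simp add: m_assoc)
        then show ?thesis unfolding b using a[OF J(1)] by simp
      qed
      have "?l \<in> M"
      proof (rule centralizer_mod_M[OF J0(7) l M_one])
        show "conj_by G n0 (?k n0) \<otimes> n0 \<otimes> (conj_by G n g2 \<otimes> n) \<in> M"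
          using J(1) J0(1) by (intro M_mult M_conj) auto
        show "conj_by G g1 ?l = g1 \<otimes> \<one>" using e1 by simp
        show "conj_by G (?k n0) ?l = ?k n0 \<otimes> (conj_by G n0 (?k n0) \<otimes> n0 \<otimes> (conj_by G n g2 \<otimes> n))"
          using e3 kn by simp
      qed
      then have "?l \<in> {\<one>, d}" using d e1 by blast
      then show ?thesis using tl by auto
    qed
    then have sub: "t ` ?J \<subseteq> {conj_quad G \<one> (t i0), conj_quad G d (t i0)}" by blast
    have "inj_on t ?J" by (rule inj_on_subset[OF inj]) blast
    then have "card ?J = card (t ` ?J)" by (rule card_image[symmetric])
    also have "\<dots> \<le> card {conj_quad G \<one> (t i0), conj_quad G d (t i0)}" by (rule card_mono[OF _ sub]) simp
    also have "\<dots> \<le> 2" by (simp add: card_insert_if)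
    finally show ?thesis .
  next
    case True
    show ?thesis unfolding True by simp
  qed
  have fib: "card {i \<in> ?I. ?F i = c} \<le> 8" (is "card ?C \<le> 8") for c
  proof (cases "?C = {}")
    case False
    then obtain i0 where i0: "i0 \<in> ?I" "?F i0 = c" by blast
    let ?x = "t i0"
    have xn: "?x \<in> nielsen_C3_4 G" using I(8) i0(1) by (cases i0) auto
    have qn: "half_turn ?x \<in> nielsen_C3_4 G" "double_twist ?x \<in> nielsen_C3_4 G" "half_turn (double_twist ?x) \<in> nielsen_C3_4 G"
      using xn braid_move_half_turn braid_move_double_twist by (simp_all add: braid_move_def)
    let ?J = "\<lambda>q. {i \<in> ?I. \<exists>h\<in>carrier G. t i = conj_quad G h q}"
    have "?C \<subseteq> ?J ?x \<union> ?J (half_turn ?x) \<union> ?J (double_twist ?x) \<union> ?J (half_turn (double_twist ?x))" (is "_ \<subseteq> ?W")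
    proof
      fix i assume i: "i \<in> ?C"
      then have ii: "i \<in> ?I" "reduced_class G (t i) = reduced_class G ?x" using i0 by auto
      have tn: "t i \<in> nielsen_C3_4 G" using I(8) ii(1) by (cases i) auto
      show "i \<in> ?W"
        by (rule reduced_class_eq_cases[OF fin_G xn tn ii(2)]) (use ii(1) in blast)+
    qed
    then have "card ?C \<le> card ?W" using finI by (intro card_mono) auto
    also have "\<dots> \<le> card (?J ?x) + card (?J (half_turn ?x)) + card (?J (double_twist ?x)) + card (?J (half_turn (double_twist ?x)))"
      by (intro order_trans[OF card_Un_le] add_mono order_refl)
    also have "\<dots> \<le> 8" using two[OF xn] two[OF qn(1)] two[OF qn(2)] two[OF qn(3)] by linarith
    finally show ?thesis .
  next
    case True
    show ?thesis unfolding True by simp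
  qed
  have "128 = (\<Sum>c\<in>?F ` ?I. card {i \<in> ?I. ?F i = c})"
    using sum.image_gen[OF finI, of "\<lambda>_. 1::nat" ?F] \<open>card ?I = 128\<close> by simp
  also have "\<dots> \<le> (\<Sum>c\<in>?F ` ?I. 8)" by (intro sum_mono fib)
  finally have "8 \<le> card (?F ` ?I)" by simp
  also have "\<dots> \<le> card {reduced_class G (g_star G g1 h a b) | h a b. HM_rep G g1 h \<and> (a, b) \<in> mixed_pairs g1 h}"
  proof (rule card_mono)
    show "finite {reduced_class G (g_star G g1 h a b) | h a b. HM_rep G g1 h \<and> (a, b) \<in> mixed_pairs g1 h}"
    proof (rule finite_subset)
      show "{reduced_class G (g_star G g1 h a b) | h a b. HM_rep G g1 h \<and> (a, b) \<in> mixed_pairs g1 h} \<subseteq> reduced_class G ` nielsen_C3_4 G"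
      proof (intro subsetI, elim CollectE exE conjE)
        fix c h a b assume c: "c = reduced_class G (g_star G g1 h a b)" "HM_rep G g1 h" "(a, b) \<in> mixed_pairs g1 h"
        then have "g_star_in_Ni G odd_part g1 h a b" using g_star_in_Ni_iff[OF c(2)] by (simp add: mixed_pairs_def)
        then show "c \<in> reduced_class G ` nielsen_C3_4 G" using c(1) by (simp add: g_star_in_Ni_def)
      qed
    qed (simp add: fin_nielsen)
    show "?F ` ?I \<subseteq> {reduced_class G (g_star G g1 h a b) | h a b. HM_rep G g1 h \<and> (a, b) \<in> mixed_pairs g1 h}"
    proof
      fix c assume "c \<in> ?F ` ?I"
      then obtain n a b where i: "(n, a, b) \<in> ?I" "c = ?F (n, a, b)" by auto
      then show "c \<in> {reduced_class G (g_star G g1 h a b) | h a b. HM_rep G g1 h \<and> (a, b) \<in> mixed_pairs g1 h}"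
        using I(7)[OF i(1)] by (auto simp: t_def)
    qed
  qed
  finally show ?thesis .
qed

text \<open>An element of \<open>V\<close> can be multiplied by the element of \<open>M - V\<close> that commutes with \<open>g\<^sub>1\<close> or \<open>g\<^sub>2\<close>.\<close>

lemma g_star_representatives:
  assumes hm: "HM_rep G g1 g2" and ab: "a \<in> M" "b \<in> M"
  shows "\<exists>a'\<in>odd_part. \<exists>b'\<in>odd_part. g_star G g1 g2 a' b' = g_star G g1 g2 a b"
proof -
  note g = HM_repD[OF hm]
  have *: "\<exists>x'\<in>odd_part. conj_by G k x' = conj_by G k x" if x: "x \<in> M" and k: "k \<in> carrier G" "ord k = 3" for x k
  proof (cases "x \<in> odd_part")
    case False
    obtain d where d: "d \<in> odd_part" "conj_by G d k = d" using odd_fixed_by_ord3[OF k] by blast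
    have dM: "d \<in> M" using d odd_subset_M by blast
    have [simp]: "d \<in> carrier G" "x \<in> carrier G" using dM x M_closed by auto
    have "conj_by G k d = k" using d(2) k(1) by (simp add: conj_by_commute)
    then have "conj_by G k (d \<otimes> x) = conj_by G k x" using k(1) by (simp flip: conj_by_conj_by)
    moreover have "d \<otimes> x \<in> odd_part" using odd_mult[OF dM x] d(1) False by simp
    ultimately show ?thesis by blast
  qed blast
  obtain a' where a': "a' \<in> odd_part" "conj_by G (inv g1) a' = conj_by G (inv g1) a"
    using *[OF ab(1) inv_closed[OF g(1)] ord_inv3[OF g(1,3)]] by blast
  obtain b' where b': "b' \<in> odd_part" "conj_by G g2 b' = conj_by G g2 b" using *[OF ab(2) g(2,4)] by blast
  have "g_star G g1 g2 a' b' = g_star G g1 g2 a b"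
    using a' b' odd_subset_M ab g_star_conj[OF g(1,2)] by simp
  then show ?thesis using a' b' by blast
qed

text \<open>The invariant is constant on orbits, takes the value \<open>1\<close> on the orbit of the given tuple and takes the value \<open>z\<close> on
  tuples of mixed pairs; so it separates the two orbits.\<close>

lemma two_orbits:
  assumes orb: "M4_orbits G = {Op, Om}" "Op \<noteq> Om"
    and HM: "\<exists>g1 g2. HM_rep G g1 g2 \<and> reduced_class G (HM_tuple G g1 g2) \<in> Op"
  shows "x \<in> nielsen_C3_4 G \<Longrightarrow> reduced_class G x \<in> Op \<longleftrightarrow> lift_invariant R \<pi> x = \<one>\<^bsub>R\<^esub>"
    and "x \<in> nielsen_C3_4 G \<Longrightarrow> reduced_class G x \<in> Om \<longleftrightarrow> lift_invariant R \<pi> x = z"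
proof -
  let ?s = "lift_invariant R \<pi>"
  obtain g1 g2 where hm: "HM_rep G g1 g2" "reduced_class G (HM_tuple G g1 g2) \<in> Op" using HM by blast
  have hn: "HM_tuple G g1 g2 \<in> nielsen_C3_4 G" using hm(1) by (simp add: HM_rep_def)
  have p: "?s x = \<one>\<^bsub>R\<^esub>" if "x \<in> nielsen_C3_4 G" "reduced_class G x \<in> Op" for x
    using orbit_invariant[OF fin_G lift_invariant_braid _ that hn hm(2)] orb lift_invariant_HM[OF hm(1)] by simp
  have ex: "reduced_class G x \<in> Op \<or> reduced_class G x \<in> Om" if "x \<in> nielsen_C3_4 G" for x
    using reduced_class_in_orbit[OF fin_G that] orb by simp
  have "card (mixed_pairs g1 g2) = 8" unfolding mixed_pairs_def by (rule card_star_pairs(2)[OF hm(1)])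
  then have "mixed_pairs g1 g2 \<noteq> {}" by auto
  then obtain a b where ab: "(a, b) \<in> mixed_pairs g1 g2" by (metis equals0I surj_pair)
  then have sp: "(a, b) \<in> star_pairs g1 g2" "\<not> (a \<in> M3 \<longleftrightarrow> b \<in> M3)" by (auto simp: mixed_pairs_def)
  have yn: "g_star G g1 g2 a b \<in> nielsen_C3_4 G"
    using g_star_in_Ni_iff[OF hm(1), of a b] sp(1) by (simp add: g_star_in_Ni_def)
  have ys: "?s (g_star G g1 g2 a b) = z" using lift_invariant_value[OF hm(1) sp(1)] sp(2) by simp
  then have yO: "reduced_class G (g_star G g1 g2 a b) \<in> Om" using p[OF yn] ex[OF yn] z_neq by auto
  have n: "?s x = z" if "x \<in> nielsen_C3_4 G" "reduced_class G x \<in> Om" for x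
    using orbit_invariant[OF fin_G lift_invariant_braid _ that yn yO] orb ys by simp
  show "reduced_class G x \<in> Op \<longleftrightarrow> ?s x = \<one>\<^bsub>R\<^esub>" if "x \<in> nielsen_C3_4 G"
    using p[OF that] n[OF that] ex[OF that] z_neq by metis
  show "reduced_class G x \<in> Om \<longleftrightarrow> ?s x = z" if "x \<in> nielsen_C3_4 G"
    using p[OF that] n[OF that] ex[OF that] z_neq by metis
qed

lemma card_matched_classes:
  assumes hm: "HM_rep G g1 g2"
  shows "card ((\<lambda>(a, b). reduced_class G (g_star G g1 g2 a b)) ` matched_pairs g1 g2) = 8"
proof -
  have "inj_on (\<lambda>(a, b). reduced_class G (g_star G g1 g2 a b)) (matched_pairs g1 g2)"
  proof (rule inj_onI)
    fix p q assume pq: "p \<in> matched_pairs g1 g2" "q \<in> matched_pairs g1 g2"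
      "(\<lambda>(a, b). reduced_class G (g_star G g1 g2 a b)) p = (\<lambda>(a, b). reduced_class G (g_star G g1 g2 a b)) q"
    obtain a b a' b' where [simp]: "p = (a', b')" "q = (a, b)" by (cases p, cases q)
    have sp: "(a', b') \<in> star_pairs g1 g2" "(a, b) \<in> star_pairs g1 g2" "a' \<in> M3 \<longleftrightarrow> b' \<in> M3"
      using pq by (auto simp: matched_pairs_def)
    have "lift_invariant R \<pi> (g_star G g1 g2 a' b') = \<one>\<^bsub>R\<^esub>" using lift_invariant_value[OF hm sp(1)] sp(3) by simp
    then show "p = q" using reduced_class_injective[OF hm sp(2,1)] pq(3) by simp
  qed
  then show ?thesis using card_star_pairs(1)[OF hm] by (simp add: card_image matched_pairs_def)
qed

lemma card_inner_classes:
  assumes hm: "HM_rep G g1 g2" and S: "S \<subseteq> star_pairs g1 g2"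
  shows "card ((\<lambda>(a, b). inner_class G (g_star G g1 g2 a b)) ` S) = card S"
proof (rule card_image, rule inj_onI)
  fix p q assume pq: "p \<in> S" "q \<in> S"
    "(\<lambda>(a, b). inner_class G (g_star G g1 g2 a b)) p = (\<lambda>(a, b). inner_class G (g_star G g1 g2 a b)) q"
  obtain a b a' b' where [simp]: "p = (a', b')" "q = (a, b)" by (cases p, cases q)
  have sp: "(a', b') \<in> star_pairs g1 g2" "(a, b) \<in> star_pairs g1 g2" using pq S by auto
  have "g_star G g1 g2 a' b' \<in> nielsen_C3_4 G"
    using g_star_in_Ni_iff[OF hm, of a' b'] sp(1) by (simp add: g_star_in_Ni_def)
  from inner_class_self[OF this] have "g_star G g1 g2 a' b' \<in> inner_class G (g_star G g1 g2 a b)" using pq(3) by simp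
  then obtain h where "h \<in> carrier G" "g_star G g1 g2 a' b' = conj_quad G h (g_star G g1 g2 a b)"
    by (subst (asm) inner_class_conj_quad) blast
  then show "p = q" using g_star_conj_inject[OF hm, of a b a' b' h] star_odd[OF sp(1)] star_odd[OF sp(2)] by simp
qed

end

context six_point_cover begin

theorem two_orbits_described:
  assumes orb: "M4_orbits G = {Op, Om}" "Op \<noteq> Om"
    and HM: "\<exists>g1 g2. HM_rep G g1 g2 \<and> reduced_class G (HM_tuple G g1 g2) \<in> Op"
  shows "\<forall>x\<in>carrier G. ord x = 3 \<longrightarrow> (\<exists>!y. y \<in> lifts R \<pi> x \<and> group.ord R y = 3)" (is ?c1)
    and "\<forall>g1 g2. \<forall>a\<in>M. \<forall>b\<in>M. HM_rep G g1 g2 \<longrightarrow>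
        (\<exists>a'\<in>odd_part. \<exists>b'\<in>odd_part. g_star G g1 g2 a' b' = g_star G g1 g2 a b)" (is ?c2)
    and "\<forall>g1 g2 a b. g_star_in_Ni G odd_part g1 g2 a b \<longrightarrow>
        lift_products R \<pi> G g1 g2 a b = {lift_invariant R \<pi> (g_star G g1 g2 a b)}" (is ?c3)
    and "\<forall>Ob\<in>{Op, Om}. \<exists>g1 g2 a b. g_star_in_Ni G odd_part g1 g2 a b \<and>
        reduced_class G (g_star G g1 g2 a b) \<in> Ob" (is ?c4)
    and "\<forall>g1 g2 a b. g_star_in_Ni G odd_part g1 g2 a b \<and>
        reduced_class G (g_star G g1 g2 a b) \<in> Op \<longrightarrow>
          lift_invariant R \<pi> (g_star G g1 g2 a b) = \<one>\<^bsub>R\<^esub> \<and>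
          lift_products R \<pi> G g1 g2 a b = {\<one>\<^bsub>R\<^esub>} \<and>
          (a, b) \<in> M3 \<times> M3 \<union> M5 \<times> M5" (is ?c5)
    and "\<forall>g1 g2 a b. g_star_in_Ni G odd_part g1 g2 a b \<and>
        reduced_class G (g_star G g1 g2 a b) \<in> Om \<longrightarrow>
          lift_invariant R \<pi> (g_star G g1 g2 a b) = z \<and>
          lift_products R \<pi> G g1 g2 a b = {z} \<and>
          (a, b) \<in> M3 \<times> M5 \<union> M5 \<times> M3" (is ?c6)
    and "\<forall>Ob\<in>{Op, Om}.
        8 \<le> card {X \<in> Ob. \<exists>g1 g2 a b. g_star_in_Ni G odd_part g1 g2 a b \<and>
                     X = reduced_class G (g_star G g1 g2 a b)}" (is ?c7)
    and "\<forall>g1 g2. HM_rep G g1 g2 \<longrightarrow>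
        card {X \<in> Op. \<exists>a b. g_star_in_Ni G odd_part g1 g2 a b \<and>
                X = reduced_class G (g_star G g1 g2 a b)} = 8" (is ?c8)
    and "\<forall>Ob\<in>{Op, Om}. \<forall>g1 g2. HM_rep G g1 g2 \<longrightarrow>
        card {inner_class G (g_star G g1 g2 a b) | a b. g_star_in_Ni G odd_part g1 g2 a b \<and>
                reduced_class G (g_star G g1 g2 a b) \<in> Ob} = 8" (is ?c9)
proof -
  note Or = two_orbits[OF orb HM]
  have star: "HM_rep G g1 g2" "g_star G g1 g2 a b \<in> nielsen_C3_4 G" "(a, b) \<in> star_pairs g1 g2"
      "a \<in> odd_part" "b \<in> odd_part" if "g_star_in_Ni G odd_part g1 g2 a b" for g1 g2 a b
    using that g_star_in_Ni_iff[of g1 g2 a b] by (simp_all add: g_star_in_Ni_def)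
  have inNi: "g_star_in_Ni G odd_part g1 g2 a b" if "HM_rep G g1 g2" "(a, b) \<in> star_pairs g1 g2" for g1 g2 a b
    using g_star_in_Ni_iff[OF that(1)] that(2) by blast
  have Op_iff: "reduced_class G (g_star G g1 g2 a b) \<in> Op \<longleftrightarrow> (a \<in> M3 \<longleftrightarrow> b \<in> M3)"
    and Om_iff: "reduced_class G (g_star G g1 g2 a b) \<in> Om \<longleftrightarrow> \<not> (a \<in> M3 \<longleftrightarrow> b \<in> M3)"
    if "g_star_in_Ni G odd_part g1 g2 a b" for g1 g2 a b
    using Or[OF star(2)[OF that]] lift_invariant_value[OF star(1)[OF that] star(3)[OF that]] z_neq by auto
  have split: "x \<in> M5 \<longleftrightarrow> x \<notin> M3" if "x \<in> odd_part" for x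
    using that odd_part_split M5_M3_disjoint by blast
  obtain h1 h2 where hm: "HM_rep G h1 h2" using HM by blast
  have ne: "matched_pairs h1 h2 \<noteq> {}" "mixed_pairs h1 h2 \<noteq> {}"
    using card_star_pairs[OF hm] unfolding matched_pairs_def[symmetric] mixed_pairs_def[symmetric] by auto
  have prods: "lift_products R \<pi> G g1 g2 a b = {lift_invariant R \<pi> (g_star G g1 g2 a b)}"
    if "g_star_in_Ni G odd_part g1 g2 a b" for g1 g2 a b
    using lift_products_eq[OF star(1)[OF that] star(4)[OF that] star(5)[OF that]] .
  show ?c1 using unique_lift3 by blast
  show ?c2 using g_star_representatives by blast
  show ?c3 using prods by blast
  show ?c4
  proof
    fix Ob assume "Ob \<in> {Op, Om}"
    then consider "Ob = Op" | "Ob = Om" by blast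
    then show "\<exists>g1 g2 a b. g_star_in_Ni G odd_part g1 g2 a b \<and> reduced_class G (g_star G g1 g2 a b) \<in> Ob"
    proof cases
      case 1
      obtain a b where "(a, b) \<in> matched_pairs h1 h2" using ne(1) by (metis equals0I surj_pair)
      then have "g_star_in_Ni G odd_part h1 h2 a b" "a \<in> M3 \<longleftrightarrow> b \<in> M3" using inNi[OF hm] by (simp_all add: matched_pairs_def)
      then show ?thesis using Op_iff 1 by metis
    next
      case 2
      obtain a b where "(a, b) \<in> mixed_pairs h1 h2" using ne(2) by (metis equals0I surj_pair)
      then have "g_star_in_Ni G odd_part h1 h2 a b" "\<not> (a \<in> M3 \<longleftrightarrow> b \<in> M3)" using inNi[OF hm] by (simp_all add: mixed_pairs_def)
      then show ?thesis using Om_iff 2 by metis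
    qed
  qed
  show ?c5
  proof (intro allI impI, elim conjE)
    fix g1 g2 a b
    assume n: "g_star_in_Ni G odd_part g1 g2 a b" and o: "reduced_class G (g_star G g1 g2 a b) \<in> Op"
    have s: "lift_invariant R \<pi> (g_star G g1 g2 a b) = \<one>\<^bsub>R\<^esub>" using Or(1)[OF star(2)[OF n]] o by simp
    then show "lift_invariant R \<pi> (g_star G g1 g2 a b) = \<one>\<^bsub>R\<^esub> \<and>
          lift_products R \<pi> G g1 g2 a b = {\<one>\<^bsub>R\<^esub>} \<and> (a, b) \<in> M3 \<times> M3 \<union> M5 \<times> M5"
      using prods[OF n] Op_iff[OF n] o split[OF star(4)[OF n]] split[OF star(5)[OF n]] by simp
  qed
  show ?c6
  proof (intro allI impI, elim conjE)
    fix g1 g2 a b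
    assume n: "g_star_in_Ni G odd_part g1 g2 a b" and o: "reduced_class G (g_star G g1 g2 a b) \<in> Om"
    have s: "lift_invariant R \<pi> (g_star G g1 g2 a b) = z" using Or(2)[OF star(2)[OF n]] o by simp
    then show "lift_invariant R \<pi> (g_star G g1 g2 a b) = z \<and>
          lift_products R \<pi> G g1 g2 a b = {z} \<and> (a, b) \<in> M3 \<times> M5 \<union> M5 \<times> M3"
      using prods[OF n] Om_iff[OF n] o split[OF star(4)[OF n]] split[OF star(5)[OF n]] by auto
  qed
  have eight: "card {X \<in> Op. \<exists>a b. g_star_in_Ni G odd_part g1 g2 a b \<and>
                X = reduced_class G (g_star G g1 g2 a b)} = 8" if h: "HM_rep G g1 g2" for g1 g2
  proof -
    have "{X \<in> Op. \<exists>a b. g_star_in_Ni G odd_part g1 g2 a b \<and> X = reduced_class G (g_star G g1 g2 a b)} =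
      (\<lambda>(a, b). reduced_class G (g_star G g1 g2 a b)) ` matched_pairs g1 g2" (is "?L = ?R")
    proof (intro equalityI subsetI)
      fix c assume "c \<in> ?L"
      then obtain a b where ab: "g_star_in_Ni G odd_part g1 g2 a b" "c = reduced_class G (g_star G g1 g2 a b)" "c \<in> Op" by blast
      then have "(a, b) \<in> matched_pairs g1 g2" using star(3)[OF ab(1)] Op_iff[OF ab(1)] by (simp add: matched_pairs_def)
      then show "c \<in> ?R" using ab(2) by force
    next
      fix c assume "c \<in> ?R"
      then obtain a b where ab: "(a, b) \<in> matched_pairs g1 g2" "c = reduced_class G (g_star G g1 g2 a b)" by auto
      then have sp: "(a, b) \<in> star_pairs g1 g2" "a \<in> M3 \<longleftrightarrow> b \<in> M3" by (simp_all add: matched_pairs_def)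
      then show "c \<in> ?L" using inNi[OF h sp(1)] Op_iff[OF inNi[OF h sp(1)]] ab(2) by blast
    qed
    then show ?thesis using card_matched_classes[OF h] by simp
  qed
  then show ?c8 by blast
  have finOb: "finite {X \<in> Ob. \<exists>g1 g2 a b. g_star_in_Ni G odd_part g1 g2 a b \<and>
                     X = reduced_class G (g_star G g1 g2 a b)}" (is "finite ?W") for Ob
  proof (rule finite_subset)
    show "?W \<subseteq> reduced_class G ` nielsen_C3_4 G"
    proof
      fix c assume "c \<in> ?W"
      then obtain g1 g2 a b where "g_star_in_Ni G odd_part g1 g2 a b" "c = reduced_class G (g_star G g1 g2 a b)" by blast
      then show "c \<in> reduced_class G ` nielsen_C3_4 G" using star(2) by blast
    qed
  qed (simp add: fin_nielsen)
  show ?c7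
  proof
    fix Ob assume "Ob \<in> {Op, Om}"
    then consider "Ob = Op" | "Ob = Om" by blast
    then show "8 \<le> card {X \<in> Ob. \<exists>g1 g2 a b. g_star_in_Ni G odd_part g1 g2 a b \<and> X = reduced_class G (g_star G g1 g2 a b)}"
    proof cases
      case 1
      have "card {X \<in> Op. \<exists>a b. g_star_in_Ni G odd_part h1 h2 a b \<and> X = reduced_class G (g_star G h1 h2 a b)} \<le>
        card {X \<in> Op. \<exists>g1 g2 a b. g_star_in_Ni G odd_part g1 g2 a b \<and> X = reduced_class G (g_star G g1 g2 a b)}"
        by (rule card_mono[OF finOb]) blast
      then show ?thesis using eight[OF hm] 1 by simp
    next
      case 2
      have "card {reduced_class G (g_star G h1 h a b) | h a b. HM_rep G h1 h \<and> (a, b) \<in> mixed_pairs h1 h} \<le>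
        card {X \<in> Om. \<exists>g1 g2 a b. g_star_in_Ni G odd_part g1 g2 a b \<and> X = reduced_class G (g_star G g1 g2 a b)}"
      proof (rule card_mono[OF finOb], rule subsetI)
        fix c assume "c \<in> {reduced_class G (g_star G h1 h a b) | h a b. HM_rep G h1 h \<and> (a, b) \<in> mixed_pairs h1 h}"
        then obtain h a b where c: "c = reduced_class G (g_star G h1 h a b)" "HM_rep G h1 h" "(a, b) \<in> mixed_pairs h1 h" by blast
        then have sp: "(a, b) \<in> star_pairs h1 h" "\<not> (a \<in> M3 \<longleftrightarrow> b \<in> M3)" by (simp_all add: mixed_pairs_def)
        then show "c \<in> {X \<in> Om. \<exists>g1 g2 a b. g_star_in_Ni G odd_part g1 g2 a b \<and> X = reduced_class G (g_star G g1 g2 a b)}"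
          using inNi[OF c(2) sp(1)] Om_iff[OF inNi[OF c(2) sp(1)]] c(1) by blast
      qed
      then show ?thesis using many_mixed_classes[OF hm] 2 by simp
    qed
  qed
  show ?c9
  proof (intro ballI allI impI)
    fix Ob g1 g2 assume Ob: "Ob \<in> {Op, Om}" and h: "HM_rep G g1 g2"
    have eq: "{inner_class G (g_star G g1 g2 a b) | a b. g_star_in_Ni G odd_part g1 g2 a b \<and>
          reduced_class G (g_star G g1 g2 a b) \<in> Ob} = (\<lambda>(a, b). inner_class G (g_star G g1 g2 a b)) ` S" (is "?L = ?R")
      if S: "\<And>a b. (a, b) \<in> S \<longleftrightarrow> g_star_in_Ni G odd_part g1 g2 a b \<and> reduced_class G (g_star G g1 g2 a b) \<in> Ob" for S
    proof (intro equalityI subsetI)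
      fix c assume "c \<in> ?L"
      then obtain a b where ab: "(a, b) \<in> S" "c = inner_class G (g_star G g1 g2 a b)" using S by blast
      then show "c \<in> ?R" by force
    next
      fix c assume "c \<in> ?R"
      then obtain a b where "(a, b) \<in> S" "c = inner_class G (g_star G g1 g2 a b)" by auto
      then show "c \<in> ?L" using S by blast
    qed
    consider "Ob = Op" | "Ob = Om" using Ob by blast
    then show "card {inner_class G (g_star G g1 g2 a b) | a b. g_star_in_Ni G odd_part g1 g2 a b \<and>
                reduced_class G (g_star G g1 g2 a b) \<in> Ob} = 8"
    proof cases
      case 1
      have "(a, b) \<in> matched_pairs g1 g2 \<longleftrightarrow> g_star_in_Ni G odd_part g1 g2 a b \<and> reduced_class G (g_star G g1 g2 a b) \<in> Ob" for a b
        using Op_iff[of g1 g2 a b] g_star_in_Ni_iff[OF h, of a b] 1 unfolding matched_pairs_def by auto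
      moreover have "matched_pairs g1 g2 \<subseteq> star_pairs g1 g2" by (auto simp: matched_pairs_def)
      ultimately show ?thesis
        using eq[of "matched_pairs g1 g2"] card_inner_classes[OF h, of "matched_pairs g1 g2"] card_star_pairs(1)[OF h]
        by (simp add: matched_pairs_def)
    next
      case 2
      have "(a, b) \<in> mixed_pairs g1 g2 \<longleftrightarrow> g_star_in_Ni G odd_part g1 g2 a b \<and> reduced_class G (g_star G g1 g2 a b) \<in> Ob" for a b
        using Om_iff[of g1 g2 a b] g_star_in_Ni_iff[OF h, of a b] 2 unfolding mixed_pairs_def by auto
      moreover have "mixed_pairs g1 g2 \<subseteq> star_pairs g1 g2" by (auto simp: mixed_pairs_def)
      ultimately show ?thesis
        using eq[of "mixed_pairs g1 g2"] card_inner_classes[OF h, of "mixed_pairs g1 g2"] card_star_pairs(2)[OF h]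
        by (simp add: mixed_pairs_def)
    qed
  qed
qed

end

context group
begin

section \<open>Pairs of elements of order three that generate a solvable group\<close>

lemma centralizer_subgroup:
  assumes "h \<in> carrier G" shows "subgroup {k \<in> carrier G. k \<otimes> h = h \<otimes> k} G"
proof (rule subgroupI)
  show "{k \<in> carrier G. k \<otimes> h = h \<otimes> k} \<noteq> {}" using assms by blast
  fix k assume k: "k \<in> {k \<in> carrier G. k \<otimes> h = h \<otimes> k}"
  then have "conj_by G k h = k" using assms conj_by_commute by blast
  then have "conj_by G (inv k) h = inv k" using k assms by (simp add: conj_by_inv)
  then show "inv k \<in> {k \<in> carrier G. k \<otimes> h = h \<otimes> k}" using k assms conj_by_commute by simp
  fix l assume l: "l \<in> {k \<in> carrier G. k \<otimes> h = h \<otimes> k}"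
  have "k \<otimes> l \<otimes> h = k \<otimes> (h \<otimes> l)" using k l assms by (simp add: m_assoc)
  also have "\<dots> = h \<otimes> (k \<otimes> l)" using k l assms by (simp flip: m_assoc)
  finally show "k \<otimes> l \<in> {k \<in> carrier G. k \<otimes> h = h \<otimes> k}" using k l by simp
qed auto

lemma generate_commute:
  assumes S: "S \<subseteq> carrier G" "\<And>a b. a \<in> S \<Longrightarrow> b \<in> S \<Longrightarrow> a \<otimes> b = b \<otimes> a"
    and xy: "x \<in> generate G S" "y \<in> generate G S"
  shows "x \<otimes> y = y \<otimes> x"
proof -
  have 1: "x \<otimes> b = b \<otimes> x" if b: "b \<in> S" for b
  proof -
    have "S \<subseteq> {k \<in> carrier G. k \<otimes> b = b \<otimes> k}" using S b by blast
    then have "generate G S \<subseteq> {k \<in> carrier G. k \<otimes> b = b \<otimes> k}"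
      using b S(1) by (intro generate_subgroup_incl centralizer_subgroup) auto
    then show ?thesis using xy by blast
  qed
  have x: "x \<in> carrier G" using generate_in_carrier[OF S(1) xy(1)] .
  have "S \<subseteq> {k \<in> carrier G. k \<otimes> x = x \<otimes> k}" using S(1) 1 by auto
  then have "generate G S \<subseteq> {k \<in> carrier G. k \<otimes> x = x \<otimes> k}"
    using x by (intro generate_subgroup_incl centralizer_subgroup) auto
  then show ?thesis using xy by auto
qed

text \<open>Let \<open>p = x y\<close> and \<open>q = y x\<close>. Conjugation by \<open>x\<close> permutes \<open>p\<close>, \<open>q\<close> and a third element of the abelian group that
  they generate. This group is therefore normal, with abelian quotient.\<close>

lemma solvable_of_commuting_products:
  assumes x: "x \<in> carrier G" "x \<otimes> (x \<otimes> x) = \<one>" and y: "y \<in> carrier G" "y \<otimes> (y \<otimes> y) = \<one>"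
    and comm: "(x \<otimes> y) \<otimes> (y \<otimes> x) = (y \<otimes> x) \<otimes> (x \<otimes> y)" and gen: "generate G {x, y} = carrier G"
  shows "solvable G"
proof -
  note [simp] = x(1) y(1)
  have ix: "inv x = x \<otimes> x" using x inv_equality[of "x \<otimes> x" x] by (simp add: m_assoc)
  have iy: "inv y = y \<otimes> y" using y inv_equality[of "y \<otimes> y" y] by (simp add: m_assoc)
  let ?p = "x \<otimes> y" and ?q = "y \<otimes> x"
  define N where "N = generate G {?p, ?q}"
  have subN: "subgroup N G" unfolding N_def by (intro generate_is_subgroup) auto
  have N: "h \<in> carrier G" if "h \<in> N" for h using subgroup.subset[OF subN] that by blast
  have pq: "?p \<in> N" "?q \<in> N" unfolding N_def by (auto intro: generate.incl)
  have abN: "a \<otimes> b = b \<otimes> a" if "a \<in> N" "b \<in> N" for a b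
    by (rule generate_commute[of "{?p, ?q}"]) (use that comm in \<open>auto simp: N_def\<close>)
  have conj_x: "inv x \<otimes> h \<otimes> x \<in> N" if h: "h \<in> N" for h
  proof -
    let ?H = "{h \<in> carrier G. inv x \<otimes> h \<otimes> x \<in> N}"
    have "subgroup ?H G"
    proof (rule subgroupI)
      show "?H \<noteq> {}" using subgroup.one_closed[OF subN] by (auto intro!: exI[of _ \<one>])
      fix a assume a: "a \<in> ?H"
      have "inv x \<otimes> inv a \<otimes> x = inv (inv x \<otimes> a \<otimes> x)" using a by (simp add: inv_mult_group m_assoc)
      then show "inv a \<in> ?H" using a subgroup.m_inv_closed[OF subN] by simp
      fix b assume b: "b \<in> ?H"
      have "inv x \<otimes> (a \<otimes> b) \<otimes> x = (inv x \<otimes> a \<otimes> x) \<otimes> (inv x \<otimes> b \<otimes> x)" using a b by (simp add: m_assoc)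
      then show "a \<otimes> b \<in> ?H" using a b subgroup.m_closed[OF subN] by simp
    qed auto
    moreover have "?p \<in> ?H" using pq by (simp add: m_assoc)
    moreover have "?q \<in> ?H"
    proof -
      have "inv ?p \<otimes> inv ?q = inv (?q \<otimes> ?p)" by (simp add: inv_mult_group)
      have "inv x \<otimes> ?q \<otimes> x = x \<otimes> x \<otimes> (y \<otimes> (x \<otimes> x))" by (simp add: ix m_assoc)
      moreover have "x \<otimes> x \<otimes> (y \<otimes> (x \<otimes> x)) = inv (?p \<otimes> ?q)"
      proof -
        have "inv (?p \<otimes> ?q) = inv x \<otimes> (inv y \<otimes> (inv y \<otimes> inv x))" by (simp add: inv_mult_group m_assoc)
        also have "inv y \<otimes> (inv y \<otimes> inv x) = y \<otimes> inv x"
        proof -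
          have "inv y \<otimes> inv y = y" using y iy by (metis inv_inv inv_mult_group)
          then show ?thesis by (simp flip: m_assoc)
        qed
        finally show ?thesis by (simp add: ix)
      qed
      ultimately show ?thesis using subgroup.m_inv_closed[OF subN subgroup.m_closed[OF subN pq]] by simp
    qed
    ultimately have "N \<subseteq> ?H" unfolding N_def by (intro generate_subgroup_incl) auto
    then show ?thesis using h by blast
  qed
  let ?L = "{g \<in> carrier G. \<forall>h\<in>N. inv g \<otimes> h \<otimes> g \<in> N \<and> g \<otimes> h \<otimes> inv g \<in> N}"
  have subL: "subgroup ?L G"
  proof (rule subgroupI)
    show "?L \<noteq> {}" using N by (auto intro!: exI[of _ \<one>])
    fix a assume a: "a \<in> ?L" then show "inv a \<in> ?L" by simp
    fix b assume b: "b \<in> ?L"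
    have "inv (a \<otimes> b) \<otimes> h \<otimes> (a \<otimes> b) = inv b \<otimes> (inv a \<otimes> h \<otimes> a) \<otimes> b"
      "(a \<otimes> b) \<otimes> h \<otimes> inv (a \<otimes> b) = a \<otimes> (b \<otimes> h \<otimes> inv b) \<otimes> inv a" if "h \<in> N" for h
      using a b N[OF that] by (simp_all add: inv_mult_group m_assoc)
    then show "a \<otimes> b \<in> ?L" using a b by simp
  qed auto
  have xL: "x \<in> ?L"
  proof -
    have "x \<otimes> h \<otimes> inv x = inv x \<otimes> (inv x \<otimes> h \<otimes> x) \<otimes> x" if "h \<in> N" for h
    proof -
      have "x \<otimes> (x \<otimes> (x \<otimes> u)) = u" if "u \<in> carrier G" for u
        using that x(2) by (simp flip: m_assoc)
      then show ?thesis using N[OF that] by (simp add: m_assoc ix)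
    qed
    then show ?thesis using conj_x by simp
  qed
  have pL: "?p \<in> ?L"
    using pq(1) subgroup.m_closed[OF subN] subgroup.m_inv_closed[OF subN] by simp
  have "inv x \<otimes> ?p \<in> ?L" using subgroup.m_closed[OF subL subgroup.m_inv_closed[OF subL xL] pL] .
  then have yL: "y \<in> ?L" by simp
  have "generate G {x, y} \<subseteq> ?L" using xL yL by (intro generate_subgroup_incl[OF _ subL]) auto
  then have "carrier G \<subseteq> ?L" unfolding gen .
  then have norm: "N \<lhd> G"
    using subN by (intro normal_invI) auto
  interpret Nn: normal N G by (rule norm)
  interpret Q: group "G Mod N" by (rule Nn.factorgroup_is_group)
  let ?f = "\<lambda>g. N #> g"
  have hom: "group_hom G (G Mod N) ?f"
    by (intro group_hom.intro group_hom_axioms.intro is_group Q.is_group Nn.r_coset_hom_Mod)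
  have Qgen: "carrier (G Mod N) = generate (G Mod N) {?f x, ?f y}"
  proof -
    have "carrier (G Mod N) = ?f ` carrier G" by (auto simp: FactGroup_def RCOSETS_def)
    then show ?thesis using group_hom.generate_img[OF hom, of "{x, y}"] gen by simp
  qed
  have fc: "?f x \<in> carrier (G Mod N)" "?f y \<in> carrier (G Mod N)"
    by (auto simp: FactGroup_def RCOSETS_def)
  have fxy: "?f x \<otimes>\<^bsub>G Mod N\<^esub> ?f y = ?f y \<otimes>\<^bsub>G Mod N\<^esub> ?f x"
  proof -
    have "?f ?p = N" "?f ?q = N" using coset_join2[OF _ subN] pq N by auto
    then show ?thesis using group_hom.hom_mult[OF hom, of x y] group_hom.hom_mult[OF hom, of y x] by simp
  qed
  have comm: "u \<otimes>\<^bsub>G Mod N\<^esub> v = v \<otimes>\<^bsub>G Mod N\<^esub> u" if "u \<in> carrier (G Mod N)" "v \<in> carrier (G Mod N)" for u v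
  proof (rule Q.generate_commute[of "{?f x, ?f y}"])
    show "u \<in> generate (G Mod N) {?f x, ?f y}" "v \<in> generate (G Mod N) {?f x, ?f y}" using that Qgen by auto
    show "{?f x, ?f y} \<subseteq> carrier (G Mod N)" using fc by simp
    show "a \<otimes>\<^bsub>G Mod N\<^esub> b = b \<otimes>\<^bsub>G Mod N\<^esub> a" if "a \<in> {?f x, ?f y}" "b \<in> {?f x, ?f y}" for a b
      using that fxy by (elim insertE emptyE) (simp_all only: fxy)
  qed
  have "comm_group (G Mod N)" using comm by (rule Q.group_comm_groupI)
  then have d1: "derived G (carrier G) \<subseteq> N" by (rule derived_minimal[OF norm])
  have "derived G N = {\<one>}"
  proof -
    have "derived_set G N \<subseteq> {\<one>}"
    proof
      fix c assume "c \<in> derived_set G N"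
      then obtain a b where ab: "a \<in> N" "b \<in> N" "c = a \<otimes> b \<otimes> inv a \<otimes> inv b" by blast
      then have "c = b \<otimes> a \<otimes> inv a \<otimes> inv b" using abN by simp
      then show "c \<in> {\<one>}" using ab N by (simp add: m_assoc)
    qed
    then have "derived G N \<subseteq> {\<one>}"
      unfolding derived_def by (intro generate_subgroup_incl triv_subgroup)
    then show ?thesis using generate.one unfolding derived_def by blast
  qed
  then have "derived G (derived G (carrier G)) \<subseteq> {\<one>}" using mono_derived[OF d1] by simp
  moreover have "\<one> \<in> derived G (derived G (carrier G))" unfolding derived_def by (rule generate.one)
  ultimately have "(derived G ^^ 2) (carrier G) = {\<one>}" by (auto simp: numeral_2_eq_2)
  then show ?thesis unfolding solvable_def by (rule trivial_derived_seq_imp_solvable[OF subgroup_self])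
qed

lemma conj_hom_group: "x \<in> carrier G \<Longrightarrow> group_hom G G (\<lambda>g. x \<otimes> g \<otimes> inv x)"
proof -
  assume x: "x \<in> carrier G"
  have "inv x \<otimes> (x \<otimes> u) = u" if "u \<in> carrier G" for u using x that by (simp flip: m_assoc)
  then have "(\<lambda>g. x \<otimes> g \<otimes> inv x) \<in> hom G G" using x by (intro homI) (simp_all add: m_assoc)
  then show ?thesis by (intro group_hom.intro group_hom_axioms.intro is_group)
qed

section \<open>Dihedral subgroups of order ten\<close>

lemma dihedral_relation:
  assumes r: "r \<in> carrier G" and s: "s \<in> carrier G" "s \<otimes> r \<otimes> inv s = inv r"
  shows "s \<otimes> r [^] (i::int) = r [^] (- i) \<otimes> s"
proof -
  have "conj_by G r (inv s) = inv r" using r s by (simp add: conj_by_def)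
  have hom: "group_hom G G (\<lambda>x. s \<otimes> x \<otimes> inv s)"
    using s by unfold_locales (auto simp: hom_def m_assoc)
  have "s \<otimes> r [^] i \<otimes> inv s = (s \<otimes> r \<otimes> inv s) [^] i" using group_hom.hom_int_pow[OF hom r] .
  also have "\<dots> = r [^] (- i)" using s(2) r by (simp add: int_pow_inv int_pow_neg)
  finally show ?thesis using r s(1) by (metis inv_solve_right int_pow_closed m_closed)
qed

lemma dihedral_elements:
  assumes r: "r \<in> carrier G" and s: "s \<in> carrier G" "s \<otimes> s = \<one>" "s \<otimes> r \<otimes> inv s = inv r"
    and d: "d \<in> generate G {r, s}"
  shows "(\<exists>i::int. d = r [^] i) \<or> (\<exists>i::int. d = r [^] i \<otimes> s)"
proof -
  note [simp] = r s(1)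
  let ?T = "{d. (\<exists>i::int. d = r [^] i) \<or> (\<exists>i::int. d = r [^] i \<otimes> s)}"
  have sr: "s \<otimes> r [^] (i::int) = r [^] (- i) \<otimes> s" for i by (rule dihedral_relation[OF r s(1,3)])
  have sr': "s \<otimes> (r [^] (i::int) \<otimes> y) = r [^] (- i) \<otimes> (s \<otimes> y)" if "y \<in> carrier G" for i y
    using that sr[of i] by (simp flip: m_assoc)
  have is': "inv s = s" using s inv_equality by blast
  have "subgroup ?T G"
  proof (rule subgroupI)
    show "?T \<noteq> {}" by blast
    fix a assume a: "a \<in> ?T"
    then show "inv a \<in> ?T"
    proof (elim CollectE disjE exE)
      fix i :: int assume "a = r [^] i"
      then have "inv a = r [^] (- i)" by (simp add: int_pow_neg)
      then show ?thesis by blast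
    next
      fix i :: int assume "a = r [^] i \<otimes> s"
      then have "inv a = s \<otimes> r [^] (- i)" by (simp add: int_pow_neg inv_mult_group is')
      then have "inv a = r [^] i \<otimes> s" using sr[of "- i"] by simp
      then show ?thesis by blast
    qed
    fix b assume b: "b \<in> ?T"
    have ss: "s \<otimes> (s \<otimes> y) = y" if "y \<in> carrier G" for y using that s(2) by (simp flip: m_assoc)
    from a b show "a \<otimes> b \<in> ?T"
    proof (elim CollectE disjE exE)
      fix i j :: int assume "a = r [^] i" "b = r [^] j"
      then have "a \<otimes> b = r [^] (i + j)" by (simp add: int_pow_mult)
      then show ?thesis by blast
    next
      fix i j :: int assume "a = r [^] i" "b = r [^] j \<otimes> s"
      then have "a \<otimes> b = r [^] (i + j) \<otimes> s" by (simp add: int_pow_mult m_assoc)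
      then show ?thesis by blast
    next
      fix i j :: int assume "a = r [^] i \<otimes> s" "b = r [^] j"
      then have "a \<otimes> b = r [^] (i + - j) \<otimes> s" using sr[of j] by (simp only: int_pow_mult r m_assoc int_pow_closed s(1))
      then show ?thesis by blast
    next
      fix i j :: int assume "a = r [^] i \<otimes> s" "b = r [^] j \<otimes> s"
      then have "a \<otimes> b = r [^] i \<otimes> (r [^] (- j) \<otimes> (s \<otimes> s))" using sr'[of s j] by (simp add: m_assoc)
      then have "a \<otimes> b = r [^] (i + - j)" using s(2) by (simp only: int_pow_mult r r_one int_pow_closed)
      then show ?thesis by blast
    qed
  qed auto
  moreover have "r \<in> ?T"
  proof -
    have "r = r [^] (1::int)" by (simp add: int_pow_1)
    then show ?thesis by blast
  qed
  moreover have "s \<in> ?T"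
  proof -
    have "s = r [^] (0::int) \<otimes> s" by simp
    then show ?thesis by blast
  qed
  ultimately have "generate G {r, s} \<subseteq> ?T" by (intro generate_subgroup_incl) auto
  then show ?thesis using d by blast
qed

lemma dihedral_involution:
  assumes "r \<in> carrier G" "s \<in> carrier G" "s \<otimes> s = \<one>" "s \<otimes> r \<otimes> inv s = inv r"
  shows "(r [^] (i::int) \<otimes> s) \<otimes> (r [^] i \<otimes> s) = \<one>"
proof -
  have "(r [^] i \<otimes> s) \<otimes> (r [^] i \<otimes> s) = r [^] i \<otimes> ((s \<otimes> r [^] i) \<otimes> s)" using assms by (simp add: m_assoc)
  also have "\<dots> = r [^] i \<otimes> (r [^] (- i) \<otimes> (s \<otimes> s))"
    unfolding dihedral_relation[OF assms(1,2,4)] using assms by (simp add: m_assoc)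
  also have "\<dots> = \<one>" using assms by (simp add: int_pow_neg)
  finally show ?thesis .
qed

lemma int_pow_five:
  assumes r: "r \<in> carrier G" "ord r = 5"
  shows "r [^] (i::int) = \<one> \<longleftrightarrow> 5 dvd i" "(r [^] (i::int)) [^] (5::nat) = \<one>"
proof -
  show "r [^] i = \<one> \<longleftrightarrow> 5 dvd i" using int_pow_eq_id[OF r(1), of i] r(2) by simp
  have "(r [^] i) [^] (5::nat) = r [^] (i * int 5)" using r(1) int_pow_pow[of r i 5] by (metis int_pow_int of_nat_numeral)
  also have "\<dots> = \<one>" using int_pow_eq_id[OF r(1), of "i * int 5"] r(2) by simp
  finally show "(r [^] i) [^] (5::nat) = \<one>" .
qed

text \<open>The rotations form a subgroup of order five and index two.\<close>

lemma card_dihedral: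
  assumes r: "r \<in> carrier G" "ord r = 5"
    and s: "s \<in> carrier G" "s \<otimes> s = \<one>" "s \<noteq> \<one>" "s \<otimes> r \<otimes> inv s = inv r"
  shows "card (generate G {r, s}) = 10"
proof -
  let ?C = "generate G {r}" and ?D = "generate G {r, s}"
  have C: "?C = {r [^] (k::int) | k. k \<in> UNIV}" by (rule generate_pow[OF r(1)])
  have subC: "subgroup ?C G" using r by (intro generate_is_subgroup) auto
  have subD: "subgroup ?D G" using r s by (intro generate_is_subgroup) auto
  have cC: "card ?C = 5" using generate_pow_card[OF r(1)] r(2) by simp
  have CD: "?C \<subseteq> ?D" by (rule mono_generate) simp
  have sD: "s \<in> ?D" by (auto intro: generate.incl)
  have D: "?D = ?C \<union> (?C #> s)"
  proof (intro equalityI subsetI)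
    fix d assume "d \<in> ?D"
    then show "d \<in> ?C \<union> (?C #> s)" using dihedral_elements[OF r(1) s(1,2,4)] unfolding C r_coset_def by blast
  next
    fix d assume "d \<in> ?C \<union> (?C #> s)"
    then show "d \<in> ?D" using CD subgroup.m_closed[OF subD _ sD] by (auto simp: r_coset_def)
  qed
  have "s \<notin> ?C"
  proof
    assume "s \<in> ?C"
    then obtain i :: int where i: "s = r [^] i" unfolding C by blast
    have "s [^] (5::nat) = \<one>" unfolding i using int_pow_five(2)[OF r] .
    moreover have "s [^] (5::nat) = s" using s(1,2) by (simp add: numeral_eq_Suc m_assoc)
    ultimately show False using s(3) by simp
  qed
  have "?C \<inter> (?C #> s) = {}"
  proof (rule ccontr)
    assume "?C \<inter> (?C #> s) \<noteq> {}"
    then obtain c c' where c: "c \<in> ?C" "c' \<in> ?C" "c = c' \<otimes> s" by (auto simp: r_coset_def)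
    have cc: "c \<in> carrier G" "c' \<in> carrier G" using c subgroup.subset[OF subC] by auto
    have "s = inv c' \<otimes> c" using c(3) cc s(1) by simp
    then show False using subgroup.m_closed[OF subC subgroup.m_inv_closed[OF subC c(2)] c(1)] \<open>s \<notin> ?C\<close> by simp
  qed
  moreover have "card (?C #> s) = 5"
    using card_rcosets_equal[OF rcosetsI[OF subgroup.subset[OF subC] s(1)] subgroup.subset[OF subC]] cC by simp
  ultimately show ?thesis unfolding D using cC by (subst card_Un_disjoint) (auto intro: card_ge_0_finite)
qed

end

section \<open>The alternating group of degree five\<close>

abbreviation A5 :: "(nat \<Rightarrow> nat) monoid" where "A5 \<equiv> alt_group 5"

lemma A5_group: "group A5" by (rule alt_group_is_group)

interpretation A5: group "alt_group 5" by (rule A5_group)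

lemma A5_simps: "x \<otimes>\<^bsub>A5\<^esub> y = x \<circ> y" "\<one>\<^bsub>A5\<^esub> = id"
  by (simp_all add: alt_group_mult alt_group_one)

lemma finite_A5: "finite (carrier A5)"
  by (rule finite_subset[OF _ finite_permutations[of "{1..5}"]]) (auto simp: alt_group_carrier)

lemma order_A5: "order A5 = 60"
  using alt_group_card_carrier[of 5] by (simp add: order_def fact_numeral)

lemma A5_not_generated:
  assumes "x \<in> carrier A5" "x \<otimes>\<^bsub>A5\<^esub> (x \<otimes>\<^bsub>A5\<^esub> x) = \<one>\<^bsub>A5\<^esub>" "y \<in> carrier A5" "y \<otimes>\<^bsub>A5\<^esub> (y \<otimes>\<^bsub>A5\<^esub> y) = \<one>\<^bsub>A5\<^esub>"
    "(x \<otimes>\<^bsub>A5\<^esub> y) \<otimes>\<^bsub>A5\<^esub> (y \<otimes>\<^bsub>A5\<^esub> x) = (y \<otimes>\<^bsub>A5\<^esub> x) \<otimes>\<^bsub>A5\<^esub> (x \<otimes>\<^bsub>A5\<^esub> y)"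
  shows "generate A5 {x, y} \<noteq> carrier A5"
  using A5.solvable_of_commuting_products[OF assms] alt_group_is_unsolvable[of 5] by auto

lemma three_cycle_A5:
  assumes "distinct [a, b, c]" "{a, b, c} \<subseteq> {1..5}"
  shows "cycle_of_list [a, b, c] \<in> carrier A5"
proof -
  have "cycle [a, b, c]" "length [a, b, c] = 3" "set [a, b, c] \<subseteq> {1..5}" using assms by auto
  then have "cycle_of_list [a, b, c] \<in> three_cycles 5" by blast
  then show ?thesis using three_cycles_incl[of 5] by blast
qed

lemma three_cycle_apply:
  assumes "distinct [a, b, c::nat]"
  shows "cycle_of_list [a, b, c] a = b" "cycle_of_list [a, b, c] b = c" "cycle_of_list [a, b, c] c = a"
    "v \<noteq> a \<Longrightarrow> v \<noteq> b \<Longrightarrow> v \<noteq> c \<Longrightarrow> cycle_of_list [a, b, c] v = v"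
  using assms by (simp_all add: transpose_apply_other)

lemma three_cycle_cube:
  assumes d: "distinct [a, b, c::nat]"
  shows "cycle_of_list [a, b, c] \<circ> (cycle_of_list [a, b, c] \<circ> cycle_of_list [a, b, c]) = id"
proof
  fix v
  consider "v = a" | "v = b" | "v = c" | "v \<noteq> a" "v \<noteq> b" "v \<noteq> c" by blast
  then show "(cycle_of_list [a, b, c] \<circ> (cycle_of_list [a, b, c] \<circ> cycle_of_list [a, b, c])) v = id v"
    by cases (simp_all only: comp_apply id_apply three_cycle_apply[OF d] not_False_eq_True)
qed

lemma three_cycle_fixes:
  assumes d: "distinct [a, b, c::nat]"
  shows "cycle_of_list [a, b, c] v = v \<longleftrightarrow> v \<notin> {a, b, c}"
proof -
  have "a \<noteq> b" "b \<noteq> c" "c \<noteq> a" using d by auto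
  then show ?thesis using three_cycle_apply(4)[OF d, of v] three_cycle_apply(1-3)[OF d] by (metis insert_iff empty_iff)
qed

lemma commutes_fixes:
  assumes "distinct [a, b, c::nat]" "g \<circ> cycle_of_list [a, b, c] = cycle_of_list [a, b, c] \<circ> g" "v \<notin> {a, b, c}"
  shows "g v \<notin> {a, b, c}"
proof -
  have "cycle_of_list [a, b, c] (g v) = g v"
    using assms(2,3) three_cycle_fixes[OF assms(1), of v] by (metis comp_apply)
  then show ?thesis using three_cycle_fixes[OF assms(1)] by blast
qed

text \<open>A permutation commuting with a three-cycle preserves the set of its fixed points. Two three-cycles among the other
  four points pin down the image of a point.\<close>

lemma central_A5:
  assumes g: "g \<in> carrier A5"
    and comm: "\<And>a b c. distinct [a, b, c] \<Longrightarrow> {a, b, c} \<subseteq> {1..5} \<Longrightarrow>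
      g \<circ> cycle_of_list [a, b, c] = cycle_of_list [a, b, c] \<circ> g"
  shows "g = id"
proof -
  have p: "g permutes {1..5}" using g by (simp add: alt_group_carrier)
  have fx: "g v = v" if d: "distinct [v, a, b, c, d]" "{1..5} = {v, a, b, c, d}" for v a b c d
  proof -
    have "g v \<in> {v, a, b, c, d}" using p d(2) by (metis insertI1 permutes_in_image)
    moreover have "g v \<notin> {a, b, c}" using d by (intro commutes_fixes[where v = v and g = g, OF _ comm]) auto
    moreover have "g v \<notin> {b, c, d}" using d by (intro commutes_fixes[where v = v and g = g, OF _ comm]) auto
    ultimately show ?thesis by blast
  qed
  have u: "{1..5} = {1, 2, 3, 4, 5::nat}" by auto
  have "g 1 = 1" by (rule fx[of 1 2 3 4 5]) (auto simp: u)
  moreover have "g 2 = 2" by (rule fx[of 2 1 3 4 5]) (auto simp: u)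
  moreover have "g 3 = 3" by (rule fx[of 3 1 2 4 5]) (auto simp: u)
  moreover have "g 4 = 4" by (rule fx[of 4 1 2 3 5]) (auto simp: u)
  moreover have "g 5 = 5" by (rule fx[of 5 1 2 3 4]) (auto simp: u)
  moreover have "g v = v" if "v \<notin> {1, 2, 3, 4, 5}" for v
    using p u permutes_not_in that by metis
  ultimately have "g v = v" for v by (cases "v \<in> {1, 2, 3, 4, 5}") blast+
  then show ?thesis by (simp add: fun_eq_iff)
qed

lemma four_distinct:
  assumes "distinct [a, b, c, d]"
  shows "a \<noteq> b" "b \<noteq> a" "a \<noteq> c" "c \<noteq> a" "a \<noteq> d" "d \<noteq> a" "b \<noteq> c" "c \<noteq> b" "b \<noteq> d" "d \<noteq> b" "c \<noteq> d" "d \<noteq> c"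
  using assms by auto

lemma A5_involution:
  assumes s: "s \<in> carrier A5" "s \<circ> s = id" "s \<noteq> id"
  obtains a b c d where "distinct [a, b, c, d]" "{a, b, c, d} \<subseteq> {1..5}" "s = Transposition.transpose a b \<circ> Transposition.transpose c d"
proof -
  have p: "s permutes {1..5}" and ev: "evenperm s" using s by (auto simp: alt_group_carrier)
  have ss: "s (s v) = v" for v using s(2) by (metis comp_apply id_apply)
  have pr: "s v \<in> {1..5}" if "v \<in> {1..5}" for v using p that by (metis permutes_in_image)
  have inj: "s u = s v \<Longrightarrow> u = v" for u v using ss by metis
  obtain a where a: "s a \<noteq> a" using s(3) by (auto simp: fun_eq_iff)
  have a5: "a \<in> {1..5}" using a p by (meson permutes_not_in)
  have "\<exists>c. c \<noteq> a \<and> c \<noteq> s a \<and> s c \<noteq> c"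
  proof (rule ccontr)
    assume "\<not> ?thesis"
    then have fix_other: "s v = v" if "v \<noteq> a" "v \<noteq> s a" for v using that by metis
    have "s v = Transposition.transpose a (s a) v" for v
    proof -
      consider "v = a" | "v = s a" | "v \<noteq> a" "v \<noteq> s a" by blast
      then show ?thesis using fix_other[of v] ss[of a]
        by cases (simp_all only: transpose_apply_first transpose_apply_second transpose_apply_other not_False_eq_True)
    qed
    then have "s = Transposition.transpose a (s a)" by (rule HOL.ext)
    then show False using ev a evenperm_swap[of a "s a"] by metis
  qed
  then obtain c where c: "c \<noteq> a" "c \<noteq> s a" "s c \<noteq> c" by blast
  have c5: "c \<in> {1..5}" using c p by (meson permutes_not_in)
  have d: "distinct [a, s a, c, s c]" proof -
    have "s a \<noteq> c" "a \<noteq> s c" "s a \<noteq> s c" using c inj ss[of a] ss[of c] by metis+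
    then show ?thesis using a c by auto
  qed
  have sub: "{a, s a, c, s c} \<subseteq> {1..5}" using a5 c5 pr by auto
  have "card ({1..5} - {a, s a, c, s c}) = 1"
    using d sub by (subst card_Diff_subset) auto
  then obtain e where e: "{1..5} - {a, s a, c, s c} = {e}" by (meson card_1_singletonE)
  have se: "s e = e"
  proof -
    have "e \<in> {1..5}" "e \<notin> {a, s a, c, s c}" using e by blast+
    then have "s e \<in> {1..5}" "s e \<notin> {a, s a, c, s c}" using pr inj ss by (blast, metis insertE insertI1 insert_commute singletonD)
    then show ?thesis using e by blast
  qed
  have "s v = (Transposition.transpose a (s a) \<circ> Transposition.transpose c (s c)) v" for v
  proof (cases "v \<in> {a, s a, c, s c}")
    case True
    note ne = four_distinct[OF d]
    show ?thesis using True
      by (elim insertE emptyE; simp_all only: comp_apply; simp add: ne ss transpose_apply_other)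
  next
    case False
    have "s v = v"
    proof (cases "v \<in> {1..5}")
      case True
      then have "v = e" using e False by blast
      then show ?thesis using se by simp
    qed (use p permutes_not_in in metis)
    moreover have "v \<noteq> a" "v \<noteq> s a" "v \<noteq> c" "v \<noteq> s c" using False by blast+
    ultimately show ?thesis by (metis comp_apply transpose_apply_other)
  qed
  then have "s = Transposition.transpose a (s a) \<circ> Transposition.transpose c (s c)" by (rule HOL.ext)
  then show ?thesis using that[OF d sub] by simp
qed

text \<open>The double transpositions on four letters form, with the identity, a four-group, and a three-cycle permutes them.\<close>

lemma A5_commuting_conjugate:
  assumes s: "s \<in> carrier A5" "s \<circ> s = id" "s \<noteq> id"
  shows "\<exists>u t. u \<in> carrier A5 \<and> t \<in> carrier A5 \<and> u \<circ> s = t \<circ> u \<and> t \<noteq> s \<and> s \<circ> t = t \<circ> s \<and> t \<circ> t = id"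
proof -
  obtain a b c d where d: "distinct [a, b, c, d]" "{a, b, c, d} \<subseteq> {1..5}" and seq: "s = Transposition.transpose a b \<circ> Transposition.transpose c d"
    using A5_involution[OF s] .
  let ?u = "cycle_of_list [b, c, d]" and ?t = "Transposition.transpose a c \<circ> Transposition.transpose d b"
  have u: "?u \<in> carrier A5" using d by (intro three_cycle_A5) auto
  note ne = four_distinct[OF d(1)]
  have ext: "f = h" if "f a = h a" "f b = h b" "f c = h c" "f d = h d"
    "\<And>v. v \<noteq> a \<Longrightarrow> v \<noteq> b \<Longrightarrow> v \<noteq> c \<Longrightarrow> v \<noteq> d \<Longrightarrow> f v = h v" for f h :: "nat \<Rightarrow> nat"
    using that by (metis ext)
  have us: "?u \<circ> s = ?t \<circ> ?u"
    unfolding seq by (rule ext) (simp_all add: ne transpose_apply_other)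
  have "bij ?u" using u by (auto simp: alt_group_carrier dest: permutes_bij)
  then have "?t = ?u \<circ> s \<circ> inv' ?u" proof -
    have e: "?u \<circ> inv' ?u = id" using \<open>bij ?u\<close> surj_iff[of ?u] bij_is_surj by blast
    have "?u \<circ> s \<circ> inv' ?u = ?t \<circ> (?u \<circ> inv' ?u)" unfolding us comp_assoc ..
    then show ?thesis unfolding e by simp
  qed
  then have t: "?t \<in> carrier A5"
    using A5.m_closed[OF A5.m_closed[OF u s(1)] A5.inv_closed[OF u]] alt_group_inv_equality[OF u] by (simp add: alt_group_mult)
  show ?thesis
  proof (intro exI conjI)
    show "?u \<in> carrier A5" "?t \<in> carrier A5" "?u \<circ> s = ?t \<circ> ?u" by (fact u t us)+
    have "?t a = c" "s a = b" unfolding seq by (simp_all add: ne transpose_apply_other)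
    then show "?t \<noteq> s" using ne by metis
    show "s \<circ> ?t = ?t \<circ> s" unfolding seq by (rule ext) (simp_all add: ne transpose_apply_other)
    show "?t \<circ> ?t = id" by (rule ext) (simp_all add: ne transpose_apply_other)
  qed
qed

section \<open>The action on the cosets of a dihedral subgroup\<close>

lemma int_inverse_mod_five: "\<not> 5 dvd (i::int) \<Longrightarrow> \<exists>m. 5 dvd i * m - 1"
proof -
  assume "\<not> 5 dvd i"
  then have "i mod 5 = 1 \<or> i mod 5 = 2 \<or> i mod 5 = 3 \<or> i mod 5 = 4" by presburger
  then consider "i mod 5 = 1" | "i mod 5 = 2" | "i mod 5 = 3" | "i mod 5 = 4" by blast
  then show ?thesis
  proof cases
    case 1 then have "5 dvd i * 1 - 1" by presburger
    then show ?thesis by blast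
  next
    case 2 then have "5 dvd i * 3 - 1" by presburger
    then show ?thesis by blast
  next
    case 3 then have "5 dvd i * 2 - 1" by presburger
    then show ?thesis by blast
  next
    case 4 then have "5 dvd i * 4 - 1" by presburger
    then show ?thesis by blast
  qed
qed

lemma int_cube_mod_five:
  assumes "5 dvd k * k * k - (1::int)"
  shows "5 dvd k - 1"
proof -
  have e: "(k * k * k) mod 5 = (((k mod 5) * (k mod 5)) mod 5 * (k mod 5)) mod 5"
    by (simp only: mod_mult_eq)
  have "(k * k * k) mod 5 = 1" using assms by presburger
  then have "(((k mod 5) * (k mod 5)) mod 5 * (k mod 5)) mod 5 = 1" using e by (simp only:)
  moreover have "k mod 5 = 0 \<or> k mod 5 = 1 \<or> k mod 5 = 2 \<or> k mod 5 = 3 \<or> k mod 5 = 4" by presburger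
  ultimately have "k mod 5 = 1" by (elim disjE) simp_all
  then show ?thesis by presburger
qed

text \<open>The two last assumptions hold in \<open>A\<^sub>5\<close>: no nontrivial element commutes with all elements of order three, and an
  involution commutes with some other conjugate of itself.\<close>

locale dihedral_coset_action = group G for G (structure) +
  fixes r s
  assumes fin_G: "finite (carrier G)" and order_G: "order G = 60"
    and r: "r \<in> carrier G" "ord r = 5"
    and s: "s \<in> carrier G" "s \<otimes> s = \<one>" "s \<noteq> \<one>" "s \<otimes> r \<otimes> inv s = inv r"
    and centralizer_three: "g \<in> carrier G \<Longrightarrow>
      (\<And>c. c \<in> carrier G \<Longrightarrow> c \<otimes> (c \<otimes> c) = \<one> \<Longrightarrow> c \<otimes> g = g \<otimes> c) \<Longrightarrow> g = \<one>"
    and commuting_conjugate: "\<exists>u\<in>carrier G. \<exists>t\<in>carrier G.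
      u \<otimes> s = t \<otimes> u \<and> t \<noteq> s \<and> s \<otimes> t = t \<otimes> s \<and> t \<otimes> t = \<one>"
begin

abbreviation D where "D \<equiv> generate G {r, s}"

lemma subgroup_D: "subgroup D G" using r s by (intro generate_is_subgroup) auto

lemma D_closed [simp]: "d \<in> D \<Longrightarrow> d \<in> carrier G" using subgroup.mem_carrier[OF subgroup_D] .

lemma card_cosets: "card (rcosets D) = 6"
  using lagrange_finite[OF fin_G subgroup_D] card_dihedral[OF r s] order_G by simp

lemma fin_cosets: "finite (rcosets D)" using card_cosets by (metis card.infinite zero_neq_numeral)

lemma coset_sub: "\<omega> \<in> rcosets D \<Longrightarrow> \<omega> \<subseteq> carrier G" using rcosets_part_G[OF subgroup_D] by blast

lemma coset_rep: "\<omega> \<in> rcosets D \<Longrightarrow> \<exists>x\<in>carrier G. \<omega> = D #> x" by (auto simp: RCOSETS_def)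

lemma D_sub: "D \<subseteq> carrier G" by auto

lemma translate: "\<omega> \<in> rcosets D \<Longrightarrow> g \<in> carrier G \<Longrightarrow> h \<in> carrier G \<Longrightarrow> (\<omega> #> g) #> h = \<omega> #> (g \<otimes> h)"
  by (rule coset_mult_assoc[OF coset_sub])

lemma translate_closed: "\<omega> \<in> rcosets D \<Longrightarrow> g \<in> carrier G \<Longrightarrow> \<omega> #> g \<in> rcosets D"
  using coset_mult_assoc[OF D_sub] by (auto simp: RCOSETS_def)

lemma translate_one: "\<omega> \<in> rcosets D \<Longrightarrow> \<omega> #> \<one> = \<omega>" using coset_mult_one[OF coset_sub] .

lemma translate_eq_iff:
  assumes "\<omega> \<in> rcosets D" "\<omega>' \<in> rcosets D" "g \<in> carrier G"
  shows "\<omega> #> g = \<omega>' \<longleftrightarrow> \<omega> = \<omega>' #> inv g"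
  using assms translate[of \<omega> g "inv g"] translate[of \<omega>' "inv g" g] translate_one by auto

lemma transitive:
  assumes "\<omega> \<in> rcosets D" "\<omega>' \<in> rcosets D"
  shows "\<exists>g\<in>carrier G. \<omega> #> g = \<omega>'"
proof -
  obtain x y where xy: "x \<in> carrier G" "\<omega> = D #> x" "y \<in> carrier G" "\<omega>' = D #> y"
    using assms coset_rep by metis
  have "\<omega> #> (inv x \<otimes> y) = D #> (x \<otimes> (inv x \<otimes> y))" using xy by (simp add: coset_mult_assoc[OF D_sub])
  also have "x \<otimes> (inv x \<otimes> y) = y" using xy by (simp flip: m_assoc)
  finally show ?thesis using xy by (metis inv_closed m_closed)
qed

lemma fixes_iff:
  assumes "x \<in> carrier G" "g \<in> carrier G"
  shows "(D #> x) #> g = D #> x \<longleftrightarrow> x \<otimes> g \<otimes> inv x \<in> D"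
proof
  assume "(D #> x) #> g = D #> x"
  then have "D #> (x \<otimes> g) = D #> x" using assms by (simp add: coset_mult_assoc[OF D_sub])
  then have "D #> (x \<otimes> g \<otimes> inv x) = D" using assms by (intro coset_mult_inv2[OF _ _ _ D_sub]) auto
  then show "x \<otimes> g \<otimes> inv x \<in> D" using assms by (intro coset_join1[OF _ _ subgroup_D]) auto
next
  assume "x \<otimes> g \<otimes> inv x \<in> D"
  then have "D #> (x \<otimes> g \<otimes> inv x) = D" using assms by (intro coset_join2[OF _ subgroup_D]) auto
  then have "D #> (x \<otimes> g) = D #> x" using assms by (intro coset_mult_inv1[OF _ _ _ D_sub]) auto
  then show "(D #> x) #> g = D #> x" using assms by (simp add: coset_mult_assoc[OF D_sub])
qed

lemma conj_eq_one: "x \<in> carrier G \<Longrightarrow> g \<in> carrier G \<Longrightarrow> x \<otimes> g \<otimes> inv x = \<one> \<longleftrightarrow> g = \<one>"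
  by (metis inv_solve_right m_closed one_closed l_one l_cancel_one)

lemma conj_sq: "x \<in> carrier G \<Longrightarrow> g \<in> carrier G \<Longrightarrow> (x \<otimes> g \<otimes> inv x) \<otimes> (x \<otimes> g \<otimes> inv x) = x \<otimes> (g \<otimes> g) \<otimes> inv x"
  using group_hom.hom_mult[OF conj_hom_group, of x g g] by simp

lemma r_pow: "r [^] (i::int) = \<one> \<longleftrightarrow> 5 dvd i" "(r [^] (i::int)) [^] (5::nat) = \<one>"
  using int_pow_five[OF r] by auto

lemma r_pow_eq: "r [^] (i::int) = r [^] j \<longleftrightarrow> 5 dvd i - j"
proof -
  have "r [^] (i - j) = r [^] i \<otimes> inv (r [^] j)" using r by (simp add: int_pow_diff)
  then have "r [^] i = r [^] j \<longleftrightarrow> r [^] (i - j) = \<one>"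
    using r by (metis int_pow_closed inv_solve_right l_one one_closed)
  then show ?thesis using r_pow by simp
qed

lemma r_double: "r [^] (i::int) \<otimes> r [^] i = \<one> \<Longrightarrow> 5 dvd i"
proof -
  assume "r [^] i \<otimes> r [^] i = \<one>"
  then have "r [^] (i + i) = \<one>" by (simp only: int_pow_mult[OF r(1)])
  then have "5 dvd i + i" using r_pow by blast
  then show "5 dvd i" by presburger
qed

lemma D_cases:
  assumes "d \<in> D"
  obtains (rotation) i :: int where "d = r [^] i" | (reflection) i :: int where "d = r [^] i \<otimes> s" "d \<otimes> d = \<one>"
  using dihedral_elements[OF r(1) s(1,2,4) assms] dihedral_involution[OF r(1) s(1,2,4)] by blast

lemma D_involution:
  assumes "d \<in> D" "d \<otimes> d = \<one>" "d \<noteq> \<one>"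
  shows "\<exists>i::int. d = r [^] i \<otimes> s"
  using assms(1)
proof (cases rule: D_cases)
  case (rotation i)
  then have "5 dvd i" using assms(2) r_double by blast
  then show ?thesis using rotation assms(3) r_pow by blast
qed blast

lemma stabilizer_order:
  assumes "\<omega> \<in> rcosets D" "g \<in> carrier G" "\<omega> #> g = \<omega>"
  shows "g \<otimes> g = \<one> \<or> g [^] (5::nat) = \<one>"
proof -
  obtain x where x: "x \<in> carrier G" "\<omega> = D #> x" using coset_rep assms(1) by blast
  let ?d = "x \<otimes> g \<otimes> inv x"
  have "?d \<in> D" using fixes_iff[OF x(1) assms(2)] assms(3) x by simp
  then have "?d \<otimes> ?d = \<one> \<or> ?d [^] (5::nat) = \<one>" by (cases rule: D_cases) (use r_pow(2) in metis)+
  then show ?thesis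
  proof
    assume "?d \<otimes> ?d = \<one>"
    then have "x \<otimes> (g \<otimes> g) \<otimes> inv x = \<one>" using conj_sq x assms by simp
    then show ?thesis using conj_eq_one[of x "g \<otimes> g"] x assms by simp
  next
    assume "?d [^] (5::nat) = \<one>"
    then have "x \<otimes> (g [^] (5::nat)) \<otimes> inv x = \<one>"
      using group_hom.hom_nat_pow[OF conj_hom_group[OF x(1)] assms(2), of 5] by simp
    then show ?thesis using conj_eq_one[of x "g [^] (5::nat)"] x assms by simp
  qed
qed

text \<open>An element of order three that normalizes a group of order five centralizes it, because
  the automorphism group of the latter has order four.\<close>

lemma rotation_normalizer:
  assumes c: "c \<in> carrier G" "c \<otimes> (c \<otimes> c) = \<one>" and k: "c \<otimes> r \<otimes> inv c = r [^] (k::int)"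
  shows "c \<otimes> r = r \<otimes> c"
proof -
  have pw: "c \<otimes> r [^] (j::int) \<otimes> inv c = r [^] (k * j)" for j
    using group_hom.hom_int_pow[OF conj_hom_group[OF c(1)] r(1), of j] k r by (simp add: int_pow_pow)
  have "r = (c \<otimes> (c \<otimes> c)) \<otimes> r \<otimes> inv (c \<otimes> (c \<otimes> c))" using c r by simp
  also have "\<dots> = c \<otimes> (c \<otimes> (c \<otimes> r \<otimes> inv c) \<otimes> inv c) \<otimes> inv c" using c(1) r by (simp add: m_assoc inv_mult_group)
  also have "\<dots> = r [^] (k * (k * k))" unfolding k pw ..
  finally have "r [^] (k * k * k) = r [^] (1::int)" using r by (simp add: int_pow_1 mult.assoc)
  then have "5 dvd k - 1" using int_cube_mod_five r_pow_eq by blast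
  then have "r [^] k = r" using r_pow_eq[of k 1] r by (simp add: int_pow_1)
  then show ?thesis using k c r by (metis inv_solve_right m_closed)
qed

text \<open>A rotation all of whose conjugates are in \<open>D\<close> would generate a group of order five that is normalized, hence
  centralized, by all elements of order three.\<close>

lemma rotation_core:
  assumes h: "\<And>x. x \<in> carrier G \<Longrightarrow> x \<otimes> r [^] (i::int) \<otimes> inv x \<in> D"
  shows "5 dvd i"
proof (rule ccontr)
  assume n: "\<not> 5 dvd i"
  then obtain m where m: "5 dvd i * m - 1" using int_inverse_mod_five by blast
  have rm: "(r [^] i) [^] m = r" using m r_pow_eq[of "i * m" 1] r by (simp add: int_pow_pow int_pow_1)
  have "r = \<one>"
  proof (rule centralizer_three[OF r(1)])
    fix c assume c: "c \<in> carrier G" "c \<otimes> (c \<otimes> c) = \<one>"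
    show "c \<otimes> r = r \<otimes> c" using h[OF c(1)]
    proof (cases rule: D_cases)
      case (rotation j)
      have "c \<otimes> r \<otimes> inv c = (c \<otimes> r [^] i \<otimes> inv c) [^] m"
        using group_hom.hom_int_pow[OF conj_hom_group[OF c(1)], of "r [^] i" m] r rm by simp
      then have "c \<otimes> r \<otimes> inv c = r [^] (j * m)" using rotation r by (simp add: int_pow_pow)
      then show ?thesis using rotation_normalizer[OF c] by blast
    next
      case (reflection j)
      then have "c \<otimes> (r [^] i \<otimes> r [^] i) \<otimes> inv c = \<one>" using conj_sq[OF c(1), of "r [^] i"] r by simp
      then have "r [^] i \<otimes> r [^] i = \<one>" using conj_eq_one[OF c(1), of "r [^] i \<otimes> r [^] i"] r by simp
      then show ?thesis using n r_double by blast
    qed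
  qed
  then show False using r by simp
qed

text \<open>If a reflection has all its conjugates in \<open>D\<close>, so does its commutator with \<open>r\<close>, which is \<open>r\<^sup>2\<close>.\<close>

lemma faithful:
  assumes g: "g \<in> carrier G" and fx: "\<And>\<omega>. \<omega> \<in> rcosets D \<Longrightarrow> \<omega> #> g = \<omega>"
  shows "g = \<one>"
proof -
  note [simp] = r(1) s(1)
  have core: "x \<otimes> g \<otimes> inv x \<in> D" if "x \<in> carrier G" for x
    using fixes_iff[OF that g] fx rcosetsI[OF D_sub that] by blast
  have "g \<in> D" using core[of \<one>] g by simp
  then show ?thesis
  proof (cases rule: D_cases)
    case (rotation i)
    then show ?thesis using rotation_core[of i] core r_pow by blast
  next
    case (reflection i)
    have sr: "s \<otimes> r [^] (i::int) = r [^] (- i) \<otimes> s" for i by (rule dihedral_relation[OF r(1) s(1,4)])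
    have is': "inv s = s" using s inv_equality by blast
    have e: "r \<otimes> g \<otimes> inv r \<otimes> inv g = r [^] (2::int)"
    proof -
      have sir: "s \<otimes> inv r = r \<otimes> s" using sr[of "-1"] by (simp add: int_pow_neg int_pow_1)
      have "r \<otimes> g \<otimes> inv r \<otimes> inv g = r \<otimes> r [^] i \<otimes> (s \<otimes> inv r) \<otimes> (s \<otimes> r [^] (- i))"
        unfolding reflection(1) by (simp add: m_assoc inv_mult_group is' int_pow_neg)
      also have "\<dots> = r \<otimes> r [^] i \<otimes> r \<otimes> (s \<otimes> s) \<otimes> r [^] (- i)" unfolding sir by (simp add: m_assoc)
      also have "\<dots> = r [^] (1 + i + 1 + - i)" using s(2) by (simp only: int_pow_mult[OF r(1)] int_pow_1) (simp add: m_assoc)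
      finally show ?thesis by simp
    qed
    have "x \<otimes> r [^] (2::int) \<otimes> inv x \<in> D" if x: "x \<in> carrier G" for x
    proof -
      have "x \<otimes> r [^] (2::int) \<otimes> inv x = ((x \<otimes> r) \<otimes> g \<otimes> inv (x \<otimes> r)) \<otimes> inv (x \<otimes> g \<otimes> inv x)"
      proof -
        have "(x \<otimes> r \<otimes> g \<otimes> inv (x \<otimes> r)) \<otimes> inv (x \<otimes> g \<otimes> inv x)
            = x \<otimes> (r \<otimes> g \<otimes> inv r) \<otimes> (inv x \<otimes> x) \<otimes> inv g \<otimes> inv x"
          using x g by (simp add: m_assoc inv_mult_group del: l_inv)
        also have "\<dots> = x \<otimes> (r \<otimes> g \<otimes> inv r \<otimes> inv g) \<otimes> inv x" using x g by (simp add: m_assoc)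
        finally show ?thesis unfolding e by simp
      qed
      then show ?thesis using core[of "x \<otimes> r"] core[OF x] x subgroup.m_closed[OF subgroup_D] subgroup.m_inv_closed[OF subgroup_D]
        by simp
    qed
    then have "5 dvd (2::int)" by (rule rotation_core)
    then show ?thesis by simp
  qed
qed

text \<open>A rotation about a coset moves the other five in a cycle, and an involution that fixes that
  coset reverses this cycle; so it fixes only one of the five.\<close>

lemma involution_fixes:
  assumes g: "g \<in> carrier G" "g \<otimes> g = \<one>" "g \<noteq> \<one>"
    and uvw: "u \<in> rcosets D" "v \<in> rcosets D" "w \<in> rcosets D" "u #> g = u" "v #> g = v" "w #> g = w" "u \<noteq> v" "u \<noteq> w"
  shows "v = w"
proof -
  obtain x where x: "x \<in> carrier G" "u = D #> x" using coset_rep uvw(1) by blast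
  note [simp] = x(1) g(1) r(1) s(1)
  let ?c = "\<lambda>h. inv x \<otimes> h \<otimes> inv (inv x)"
  have ch: "group_hom G G ?c" by (intro conj_hom_group) simp
  define q where "q = ?c r"
  have qc [simp]: "q \<in> carrier G" unfolding q_def by simp
  have qp: "q [^] (i::int) = ?c (r [^] i)" for i
    unfolding q_def using group_hom.hom_int_pow[OF ch, of r i] by simp
  have q5: "q [^] (i::int) = \<one> \<longleftrightarrow> 5 dvd i" for i
    unfolding qp using conj_eq_one[of "inv x" "r [^] i"] r_pow by simp
  have "x \<otimes> g \<otimes> inv x \<in> D" using fixes_iff[OF x(1) g(1)] uvw(4) x by simp
  moreover have "(x \<otimes> g \<otimes> inv x) \<otimes> (x \<otimes> g \<otimes> inv x) = \<one>" using conj_sq g by simp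
  moreover have "x \<otimes> g \<otimes> inv x \<noteq> \<one>" using conj_eq_one g by simp
  ultimately obtain i :: int where i: "x \<otimes> g \<otimes> inv x = r [^] i \<otimes> s" using D_involution by blast
  have sr: "s \<otimes> r [^] (i::int) = r [^] (- i) \<otimes> s" for i by (rule dihedral_relation[OF r(1) s(1,4)])
  have gq: "q [^] (k::int) \<otimes> g = g \<otimes> q [^] (- k)" for k
  proof -
    have "r [^] k \<otimes> (r [^] i \<otimes> s) = (r [^] i \<otimes> s) \<otimes> r [^] (- k)"
    proof -
      have "(r [^] i \<otimes> s) \<otimes> r [^] (- k) = r [^] i \<otimes> (r [^] k \<otimes> s)" using sr[of "- k"] by (simp add: m_assoc)
      also have "\<dots> = r [^] (i + k) \<otimes> s" by (simp add: int_pow_mult m_assoc)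
      also have "\<dots> = r [^] (k + i) \<otimes> s" by (simp add: add.commute)
      also have "\<dots> = r [^] k \<otimes> (r [^] i \<otimes> s)" by (simp add: int_pow_mult m_assoc)
      finally show ?thesis by simp
    qed
    then have e: "?c (r [^] k \<otimes> (x \<otimes> g \<otimes> inv x)) = ?c ((x \<otimes> g \<otimes> inv x) \<otimes> r [^] (- k))" unfolding i by (rule arg_cong)
    have cc: "?c (x \<otimes> g \<otimes> inv x) = g"
    proof -
      have "?c (x \<otimes> g \<otimes> inv x) = (inv x \<otimes> x) \<otimes> g \<otimes> (inv x \<otimes> x)" by (simp add: m_assoc del: l_inv)
      then show ?thesis by simp
    qed
    have "?c (r [^] k) \<otimes> ?c (x \<otimes> g \<otimes> inv x) = ?c (x \<otimes> g \<otimes> inv x) \<otimes> ?c (r [^] (- k))"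
      using e group_hom.hom_mult[OF ch, of "r [^] k" "x \<otimes> g \<otimes> inv x"]
        group_hom.hom_mult[OF ch, of "x \<otimes> g \<otimes> inv x" "r [^] (- k)"] by (metis g(1) int_pow_closed inv_closed m_closed r(1) x(1))
    then show ?thesis unfolding qp cc .
  qed
  have uq: "u #> q = u"
  proof -
    have "r \<in> D" by (intro generate.incl) simp
    moreover have "x \<otimes> q \<otimes> inv x = (x \<otimes> inv x) \<otimes> r \<otimes> (x \<otimes> inv x)"
      unfolding q_def by (simp add: m_assoc del: r_inv)
    ultimately show ?thesis using fixes_iff[OF x(1) qc] x by simp
  qed
  have pow_fix: "\<omega> #> q [^] (k::int) = \<omega>" if "\<omega> \<in> rcosets D" "h \<in> carrier G" "\<omega> #> h = \<omega>" "q [^] k = h [^] (m::int)" for \<omega> h k m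
  proof -
    have sub: "subgroup {h \<in> carrier G. \<omega> #> h = \<omega>} G"
    proof (rule subgroupI)
      show "{h \<in> carrier G. \<omega> #> h = \<omega>} \<noteq> {}" using translate_one that(1) by blast
      fix a assume a: "a \<in> {h \<in> carrier G. \<omega> #> h = \<omega>}"
      then show "inv a \<in> {h \<in> carrier G. \<omega> #> h = \<omega>}" using translate_eq_iff[OF that(1,1), of a] by simp
      fix b assume "b \<in> {h \<in> carrier G. \<omega> #> h = \<omega>}"
      then show "a \<otimes> b \<in> {h \<in> carrier G. \<omega> #> h = \<omega>}" using a translate[OF that(1), of a b] by simp
    qed auto
    have "h [^] m \<in> {h \<in> carrier G. \<omega> #> h = \<omega>}"
      using subgroup_int_pow_closed[OF sub] that by blast
    then show ?thesis using that(4) by simp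
  qed
  have uqk: "u #> q [^] (k::int) = u" for k using pow_fix[OF uvw(1) qc uq] by blast
  have vq: "v #> q \<noteq> v"
  proof
    assume v: "v #> q = v"
    let ?S = "rcosets D - {u, v}"
    have cS: "card ?S = 4" using card_cosets uvw fin_cosets by (simp add: card_Diff_subset)
    have closed: "\<omega> #> q \<in> ?S" if "\<omega> \<in> ?S" for \<omega>
    proof -
      have "u #> inv q = u" "v #> inv q = v"
        using uq v translate_eq_iff[OF uvw(1,1) qc] translate_eq_iff[OF uvw(2,2) qc] by simp_all
      then show ?thesis
        using that translate_closed[of \<omega> q] translate_eq_iff[of \<omega> _ q] uvw by auto
    qed
    have "\<omega> #> q = \<omega>" if w: "\<omega> \<in> ?S" for \<omega>
    proof (rule ccontr)
      assume "\<omega> #> q \<noteq> \<omega>"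
      moreover have five: "\<omega> #> q #> q #> q #> q #> q = \<omega>" if "\<omega> \<in> ?S" for \<omega>
      proof -
        have "q [^] (5::nat) = \<one>" using q5[of 5] by (metis dvd_refl int_pow_int of_nat_numeral)
        then have "q \<otimes> q \<otimes> q \<otimes> q \<otimes> q = \<one>" by (simp add: numeral_nat)
        moreover have "\<omega> \<in> rcosets D" using that by blast
        ultimately show ?thesis using translate translate_one by (simp add: m_closed)
      qed
      ultimately have "5 \<le> card ?S"
        using fifth_power_orbit[of ?S "\<lambda>\<omega>. \<omega> #> q" \<omega>] closed w fin_cosets five by blast
      then show False using cS by simp
    qed
    then have "q = \<one>" using faithful[OF qc] uq v by blast
    then show False using q5[of 1] by (simp add: int_pow_1)
  qed
  have vqk: "5 dvd k" if "v #> q [^] (k::int) = v" for k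
  proof (rule ccontr)
    assume "\<not> 5 dvd k"
    then obtain m where "5 dvd k * m - 1" using int_inverse_mod_five by blast
    then have "q [^] (k * m - 1) = \<one>" using q5 by blast
    then have "q [^] (1::int) = (q [^] k) [^] m"
      by (simp add: int_pow_diff int_pow_pow int_pow_1) (metis inv_solve_right int_pow_closed l_one one_closed qc)
    then have "v #> q [^] (1::int) = v" using pow_fix[OF uvw(2) _ that] int_pow_closed[OF qc] by blast
    then show False using vq by (simp add: int_pow_1)
  qed
  have inj: "inj_on (\<lambda>k::int. v #> q [^] k) {0..<5}"
  proof (rule inj_onI)
    fix a b :: int assume ab: "a \<in> {0..<5}" "b \<in> {0..<5}" "v #> q [^] a = v #> q [^] b"
    then have "v = v #> q [^] b #> inv (q [^] a)"
      using translate_eq_iff[OF uvw(2) translate_closed[OF uvw(2)], of "q [^] b" "q [^] a"] by simp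
    also have "\<dots> = v #> q [^] (b - a)" using translate[OF uvw(2)] by (simp add: int_pow_diff)
    finally have "5 dvd b - a" using vqk by metis
    moreover have "- 5 < b - a" "b - a < 5" using ab by auto
    ultimately show "a = b" by presburger
  qed
  have "(\<lambda>k::int. v #> q [^] k) ` {0..<5} = rcosets D - {u}"
  proof (rule card_subset_eq)
    show "card ((\<lambda>k::int. v #> q [^] k) ` {0..<5}) = card (rcosets D - {u})"
      using card_image[OF inj] card_cosets uvw(1) fin_cosets by simp
    have "v #> q [^] (k::int) \<noteq> u" for k
    proof
      assume "v #> q [^] k = u"
      then have "v = u #> q [^] (- k)"
        using translate_eq_iff[OF uvw(2,1), of "q [^] k"] by (simp add: int_pow_neg)
      then show False using uqk uvw by simp
    qed
    then show "(\<lambda>k::int. v #> q [^] k) ` {0..<5} \<subseteq> rcosets D - {u}" using translate_closed[OF uvw(2)] by auto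
  qed (use fin_cosets in simp)
  then obtain k :: int where k: "w = v #> q [^] k" using uvw by (metis (no_types, lifting) DiffI imageE singletonD)
  have "v #> q [^] k = (v #> q [^] k) #> g" using uvw(6) k by simp
  also have "\<dots> = v #> g #> q [^] (- k)" using translate[OF uvw(2)] gq by simp
  also have "\<dots> = v #> inv (q [^] k)" using uvw(5) by (simp add: int_pow_neg)
  finally have "v #> q [^] k #> q [^] k = v"
    using translate_eq_iff[OF translate_closed[OF uvw(2)] uvw(2), of "q [^] k" "q [^] k"] by simp
  then have "v #> q [^] (k + k) = v" using translate[OF uvw(2)] by (simp only: int_pow_mult[OF qc] int_pow_closed[OF qc])
  then have "5 dvd k + k" by (rule vqk)
  then have "5 dvd k" by presburger
  then have "q [^] k = \<one>" using q5 by blast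
  then show ?thesis using k translate_one uvw by simp
qed

text \<open>Involutions of a dihedral group of order ten do not commute with one another, so commuting involutions have no common
  fixed coset.\<close>

lemma four_group:
  "\<exists>a\<in>carrier G. \<exists>b\<in>carrier G. \<exists>v\<in>rcosets D. \<exists>w\<in>rcosets D.
     a \<otimes> a = \<one> \<and> b \<otimes> b = \<one> \<and> v #> a = v \<and> w #> b = w \<and> a \<otimes> b = b \<otimes> a \<and>
     (\<forall>\<omega>\<in>rcosets D. \<not> (\<omega> #> a = \<omega> \<and> \<omega> #> b = \<omega>))"
proof -
  obtain u t where ut: "u \<in> carrier G" "t \<in> carrier G" "u \<otimes> s = t \<otimes> u" "t \<noteq> s" "s \<otimes> t = t \<otimes> s" "t \<otimes> t = \<one>"
    using commuting_conjugate by blast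
  note [simp] = ut(1,2) r(1) s(1)
  have sD: "s \<in> D" by (intro generate.incl) simp
  have v: "D #> \<one> \<in> rcosets D" "D #> inv u \<in> rcosets D" by (auto intro!: rcosetsI[OF D_sub])
  have "(D #> \<one>) #> s = D #> \<one>" using fixes_iff[of \<one> s] sD by simp
  moreover have "(D #> inv u) #> t = D #> inv u"
  proof -
    have "inv u \<otimes> t \<otimes> inv (inv u) = inv u \<otimes> (u \<otimes> s)" using ut(3) by (simp add: m_assoc)
    also have "\<dots> = s" by (simp flip: m_assoc)
    finally show ?thesis using fixes_iff[of "inv u" t] sD by simp
  qed
  moreover have "t \<noteq> \<one>"
  proof
    assume "t = \<one>"
    then have "u \<otimes> s = u" using ut(3) by simp
    then show False using s(3) l_cancel_one[of u s] by simp
  qed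
  moreover have False if w: "\<omega> \<in> rcosets D" "\<omega> #> s = \<omega>" "\<omega> #> t = \<omega>" and "t \<noteq> \<one>" for \<omega>
  proof -
    obtain x where x: "x \<in> carrier G" "\<omega> = D #> x" using coset_rep w by blast
    note [simp] = x(1)
    let ?p = "x \<otimes> s \<otimes> inv x" and ?q = "x \<otimes> t \<otimes> inv x"
    have "\<exists>i::int. ?p = r [^] i \<otimes> s" "\<exists>i::int. ?q = r [^] i \<otimes> s"
      using fixes_iff[of x s] fixes_iff[of x t] w x conj_sq[of x s] conj_sq[of x t] conj_eq_one[of x s] conj_eq_one[of x t] s ut \<open>t \<noteq> \<one>\<close>
      by (intro D_involution; simp)+
    then obtain i j :: int where ij: "?p = r [^] i \<otimes> s" "?q = r [^] j \<otimes> s" by blast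
    have "x \<otimes> (s \<otimes> t) \<otimes> inv x = ?p \<otimes> ?q" using group_hom.hom_mult[OF conj_hom_group[of x], of s t] by simp
    also have "\<dots> = r [^] i \<otimes> (s \<otimes> r [^] j) \<otimes> s" unfolding ij by (simp add: m_assoc)
    also have "\<dots> = r [^] i \<otimes> r [^] (- j) \<otimes> (s \<otimes> s)"
      unfolding dihedral_relation[OF r(1) s(1,4)] by (simp add: m_assoc)
    also have "\<dots> = r [^] (i + - j)" using s(2) by (simp only: int_pow_mult[OF r(1)]) simp
    finally have pq: "x \<otimes> (s \<otimes> t) \<otimes> inv x = r [^] (i - j)" by simp
    have "(s \<otimes> t) \<otimes> (s \<otimes> t) = (s \<otimes> t) \<otimes> (t \<otimes> s)" using ut by simp
    also have "\<dots> = s \<otimes> (t \<otimes> t) \<otimes> s" by (simp add: m_assoc)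
    also have "\<dots> = \<one>" using ut s by simp
    finally have "r [^] (i - j) \<otimes> r [^] (i - j) = \<one>" using conj_sq[of x "s \<otimes> t"] pq by simp
    then have "r [^] ((i - j) + (i - j)) = \<one>" by (simp only: int_pow_mult[OF r(1)])
    then have "5 dvd (i - j) + (i - j)" using r_pow by blast
    then have "5 dvd i - j" by presburger
    then have "s \<otimes> t = \<one>" using pq r_pow conj_eq_one[of x "s \<otimes> t"] by simp
    then have "inv t = s" by (simp add: inv_equality)
    moreover have "inv t = t" using inv_equality[of t t] ut by simp
    ultimately show False using ut(4) by simp
  qed
  ultimately have "\<forall>\<omega>\<in>rcosets D. \<not> (\<omega> #> s = \<omega> \<and> \<omega> #> t = \<omega>)" "(D #> \<one>) #> s = D #> \<one>" "(D #> inv u) #> t = D #> inv u"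
    by blast+
  then show ?thesis
    by (intro bexI[of _ s] bexI[of _ t] bexI[of _ "D #> \<one>"] bexI[of _ "D #> inv u"] conjI v ut s) assumption+
qed

end

lemma dihedral_D5_coset_action:
  assumes "dihedral_D5 D"
  obtains r s where "dihedral_coset_action (alt_group 5) r s" "D = generate (alt_group 5) {r, s}"
proof -
  obtain r s where rs: "r \<in> carrier A5" "s \<in> carrier A5" "A5.ord r = 5" "A5.ord s = 2"
    "s \<otimes>\<^bsub>A5\<^esub> r \<otimes>\<^bsub>A5\<^esub> inv\<^bsub>A5\<^esub> s = inv\<^bsub>A5\<^esub> r" "D = generate A5 {r, s}"
    using assms unfolding dihedral_D5_def by blast
  have s2: "s \<otimes>\<^bsub>A5\<^esub> s = \<one>\<^bsub>A5\<^esub>" using A5.pow_ord_eq_1[OF rs(2)] rs(2,4) by (simp add: numeral_2_eq_2)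
  have s1: "s \<noteq> \<one>\<^bsub>A5\<^esub>" using rs(2,4) A5.ord_eq_1[OF rs(2)] by auto
  have "dihedral_coset_action A5 r s"
  proof (intro dihedral_coset_action.intro dihedral_coset_action_axioms.intro)
    show "group A5" by (rule A5_group)
    show "finite (carrier A5)" "order A5 = 60" by (rule finite_A5 order_A5)+
    show "r \<in> carrier A5" "A5.ord r = 5" "s \<in> carrier A5" "s \<otimes>\<^bsub>A5\<^esub> s = \<one>\<^bsub>A5\<^esub>" "s \<noteq> \<one>\<^bsub>A5\<^esub>"
      "s \<otimes>\<^bsub>A5\<^esub> r \<otimes>\<^bsub>A5\<^esub> inv\<^bsub>A5\<^esub> s = inv\<^bsub>A5\<^esub> r" by (fact rs s2 s1)+
    show "g = \<one>\<^bsub>A5\<^esub>" if g: "g \<in> carrier A5"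
      and c: "\<And>c. c \<in> carrier A5 \<Longrightarrow> c \<otimes>\<^bsub>A5\<^esub> (c \<otimes>\<^bsub>A5\<^esub> c) = \<one>\<^bsub>A5\<^esub> \<Longrightarrow> c \<otimes>\<^bsub>A5\<^esub> g = g \<otimes>\<^bsub>A5\<^esub> c" for g
    proof -
      have "g = id"
      proof (rule central_A5[OF g])
        fix x y w :: nat assume d: "distinct [x, y, w]" "{x, y, w} \<subseteq> {1..5}"
        show "g \<circ> cycle_of_list [x, y, w] = cycle_of_list [x, y, w] \<circ> g"
          using c[OF three_cycle_A5[OF d]] three_cycle_cube[OF d(1)] unfolding A5_simps by metis
      qed
      then show ?thesis unfolding A5_simps .
    qed
    have "s \<circ> s = id" "s \<noteq> id" using s1 s2 unfolding A5_simps by simp_all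
    then show "\<exists>u\<in>carrier A5. \<exists>t\<in>carrier A5. u \<otimes>\<^bsub>A5\<^esub> s = t \<otimes>\<^bsub>A5\<^esub> u \<and> t \<noteq> s \<and>
        s \<otimes>\<^bsub>A5\<^esub> t = t \<otimes>\<^bsub>A5\<^esub> s \<and> t \<otimes>\<^bsub>A5\<^esub> t = \<one>\<^bsub>A5\<^esub>"
      using A5_commuting_conjugate[OF rs(2)] unfolding A5_simps by blast
  qed
  then show ?thesis using that rs(6) by blast
qed

section \<open>Two-by-two matrices over \<open>\<int>/5\<close>\<close>

lemma z5_cases: "(x::5) = 0 \<or> x = 1 \<or> x = 2 \<or> x = 3 \<or> x = 4"
proof (cases x rule: bit1_cases)
  case (of_int z)
  then have "z = 0 \<or> z = 1 \<or> z = 2 \<or> z = 3 \<or> z = 4" by (simp, arith)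
  then show ?thesis using of_int(1) by auto
qed

lemma z5_inverse: "(x::5) \<noteq> 0 \<Longrightarrow> \<exists>y. x * y = 1"
  using z5_cases[of x]
proof (elim disjE)
  assume "x = 1" then show ?thesis by (intro exI[of _ 1]) simp
next
  assume "x = 2" then show ?thesis by (intro exI[of _ 3]) simp
next
  assume "x = 3" then show ?thesis by (intro exI[of _ 2]) simp
next
  assume "x = 4" then show ?thesis by (intro exI[of _ 4]) simp
qed simp

lemma z5_mult_eq_0: "(x::5) * y = 0 \<Longrightarrow> x = 0 \<or> y = 0"
proof (rule disjCI)
  assume xy: "x * y = 0" and "y \<noteq> 0"
  then obtain k where "y * k = 1" using z5_inverse by blast
  then have "x = x * y * k" by (simp add: mult.assoc)
  then show "x = 0" using xy by simp
qed

definition mat2 :: "'a \<Rightarrow> 'a \<Rightarrow> 'a \<Rightarrow> 'a \<Rightarrow> 'a ^ 2 ^ 2" where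
  "mat2 a b c d = (\<chi> i j. if i = 1 then (if j = 1 then a else b) else (if j = 1 then c else d))"

lemma two_neq_one: "(2::2) \<noteq> 1" by simp

lemma mat2_nth [simp]: "mat2 a b c d $ 1 $ 1 = a" "mat2 a b c d $ 1 $ 2 = b"
  "mat2 a b c d $ 2 $ 1 = c" "mat2 a b c d $ 2 $ 2 = d"
  by (simp_all add: mat2_def two_neq_one)

lemma mat2_eq: "A = mat2 (A $ 1 $ 1) (A $ 1 $ 2) (A $ 2 $ 1) (A $ 2 $ 2)"
  by (simp add: vec_eq_iff forall_2)

lemma mat2_inject [simp]: "mat2 a b c d = mat2 a' b' c' d' \<longleftrightarrow> a = a' \<and> b = b' \<and> c = c' \<and> d = d'"
  by (auto simp: vec_eq_iff forall_2)

lemma mat2_mult [simp]: "mat2 a b c d ** mat2 a' b' c' d' =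
    mat2 (a * a' + b * c') (a * b' + b * d') (c * a' + d * c') (c * b' + d * (d'::'a::semiring_1))"
  by (simp add: vec_eq_iff forall_2 matrix_matrix_mult_def sum_2)

lemma mat2_one: "mat 1 = mat2 1 0 0 (1::'a::zero_neq_one)"
  by (simp add: vec_eq_iff forall_2 mat_def)

lemma mat2_uminus [simp]: "- mat2 a b c d = mat2 (- a) (- b) (- c) (- (d::'a::group_add))"
  by (simp add: vec_eq_iff forall_2)

lemma det_mat2 [simp]: "det (mat2 a b c (d::'a::comm_ring_1)) = a * d - b * c"
  by (simp add: det_2)

type_synonym mat5 = "5 ^ 2 ^ 2"

lemma mat2_cases:
  fixes A :: mat5
  assumes "det A = 1" obtains a b c d where "A = mat2 a b c d" "a * d - b * c = 1"
  using that[OF mat2_eq[of A]] assms mat2_eq[of A] by (metis det_mat2)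

definition tr :: "mat5 \<Rightarrow> 5" where "tr A = A $ 1 $ 1 + A $ 2 $ 2"

lemma tr_mat2 [simp]: "tr (mat2 a b c d) = a + d" by (simp add: tr_def)

text \<open>By the theorem of Cayley and Hamilton all powers of a matrix of determinant one are of this form.\<close>

definition lin :: "5 \<Rightarrow> 5 \<Rightarrow> mat5 \<Rightarrow> mat5" where
  "lin s t A = mat2 (s * A $ 1 $ 1 + t) (s * A $ 1 $ 2) (s * A $ 2 $ 1) (s * A $ 2 $ 2 + t)"

lemma mat5_square:
  assumes "det (A::mat5) = 1" shows "A ** A = lin (tr A) (- 1) A"
proof -
  obtain a b c d where A: "A = mat2 a b c d" "a * d - b * c = 1" using mat2_cases[OF assms] .
  then have "a * d = 1 + b * c" by (simp add: algebra_simps)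
  then show ?thesis by (simp add: A(1) lin_def algebra_simps)
qed

lemma lin_mult:
  assumes "det (A::mat5) = 1" shows "lin s t A ** A = lin (s * tr A + t) (- s) A"
proof -
  obtain a b c d where A: "A = mat2 a b c d" "a * d - b * c = 1" using mat2_cases[OF assms] .
  then have "b * c = a * d - 1" by (simp add: algebra_simps)
  then have "s * (b * c) = s * (a * d - 1)" by simp
  then have "b * (c * s) + s = a * (d * s)" by (simp add: algebra_simps)
  then show ?thesis by (simp add: A(1) lin_def algebra_simps)
qed

lemma lin_const: "lin 0 t A = mat2 t 0 0 t" "lin 1 0 A = A"
  by (simp_all add: lin_def mat2_eq[symmetric])

lemma mat5_square_one:
  assumes "det (A::mat5) = 1" "A ** A = mat 1" shows "A = mat 1 \<or> A = - mat 1"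
proof -
  obtain a b c d where A: "A = mat2 a b c d" "a * d - b * c = 1" using mat2_cases[OF assms(1)] .
  have e: "a * a + b * c = 1" "b * (a + d) = 0" "c * (a + d) = 0" "c * b + d * d = 1"
    using assms(2) by (auto simp: A(1) mat2_one algebra_simps)
  have "a + d \<noteq> 0"
  proof
    assume "a + d = 0"
    then have "d = - a" by (simp add: eq_neg_iff_add_eq_0 add.commute)
    then have "- (a * a + b * c) = 1" using A(2) by simp
    then have "- (1::5) = 1" unfolding e(1) .
    then show False by simp
  qed
  then have bc: "b = 0" "c = 0" using z5_mult_eq_0 e(2,3) by blast+
  have ad: "a * d = 1" "a * a = 1" using A(2) e(1) bc by auto
  have "a = 1 \<or> a = - 1" using ad(2) z5_cases[of a] by auto
  moreover have "d = a * a * d" using ad(2) by simp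
  then have "d = a" using ad(1) by (simp add: mult.assoc)
  ultimately show ?thesis using bc by (elim disjE) (simp_all add: A(1) mat2_one)
qed

text \<open>A matrix of order three has the characteristic polynomial \<open>t\<^sup>2 + t + 1\<close>.\<close>

lemma mat5_cube_trace:
  assumes "det (A::mat5) = 1" "A ** A ** A = mat 1" "A \<noteq> mat 1" shows "tr A = - 1"
proof -
  define t where "t = tr A"
  have e: "lin (t * t - 1) (- t) A = mat 1"
    using assms(2) mat5_square[OF assms(1)] lin_mult[OF assms(1)] by (simp add: t_def)
  obtain a b c d where A: "A = mat2 a b c d" "a * d - b * c = 1" using mat2_cases[OF assms(1)] .
  define u where "u = t * t - 1"
  have e': "u * a - t = 1" "u * b = 0" "u * c = 0" "u * d - t = 1"
    using e unfolding u_def[symmetric] by (simp_all add: A(1) lin_def mat2_one)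
  show "tr A = - 1"
  proof (cases "u = 0")
    case True
    then have "- t = 1" using e'(1) by simp
    then have "t = - 1" by (metis minus_minus)
    then show ?thesis by (simp add: t_def)
  next
    case False
    then have bc: "b = 0" "c = 0" using e' z5_mult_eq_0 by blast+
    have "u * (a - d) = 0" using e'(1,4) by (simp add: algebra_simps)
    then have "a - d = 0" using False z5_mult_eq_0 by blast
    then have "a = d" by simp
    moreover have "a * d = 1" using A(2) bc by simp
    ultimately have aa: "a * a = 1" and Aa: "A = mat2 a 0 0 a" using A bc by auto
    have "a * a * a = 1" using assms(2) by (simp add: Aa mat2_one)
    then have "a = 1" using aa by simp
    then show ?thesis using assms(3) Aa by (simp add: mat2_one)
  qed
qed

lemma tr_lin: "tr (lin s t B ** A) = s * tr (B ** A) + t * tr A"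
  by (subst (1 2) mat2_eq[of A], subst (2) mat2_eq[of B]) (simp add: tr_def lin_def algebra_simps matrix_matrix_mult_def sum_2)

lemma mat5_trace_relation:
  assumes "det (A::mat5) = 1" "det (B::mat5) = 1" "tr A = - 1" "tr B = - 1"
  shows "tr (B ** B ** A) = 1 - tr (B ** A)"
proof -
  have "B ** B = lin (- 1) (- 1) B" using mat5_square[OF assms(2)] assms(4) by simp
  then show ?thesis using tr_lin[of "- 1" "- 1" B A] assms(3) by simp
qed

text \<open>The trace of \<open>W\<close> decides its order: the values \<open>0\<close>, \<open>-1\<close>, \<open>1\<close> and \<open>-2\<close> give \<open>W\<^sup>2 = -1\<close>, \<open>W\<^sup>3 = 1\<close>,
  \<open>W\<^sup>3 = -1\<close> and \<open>W\<^sup>5 = -1\<close>. The remaining value \<open>2\<close> means that \<open>B A\<close> has trace \<open>-1\<close>.\<close>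

lemma mat5_ratio:
  assumes A: "det (A::mat5) = 1" "A ** A ** A = mat 1" "A \<noteq> mat 1"
    and B: "det (B::mat5) = 1" "B ** B ** B = mat 1" "B \<noteq> mat 1"
  defines "W \<equiv> B ** B ** A"
  shows "W ** W = - mat 1 \<or> W ** W ** W = mat 1 \<or> W ** W ** W = - mat 1 \<or>
    (B ** A) ** (B ** A) ** (B ** A) = mat 1 \<or> W ** W ** W ** W ** W = - mat 1"
proof -
  have dW: "det W = 1" and dBA: "det (B ** A) = 1" using A(1) B(1) by (simp_all add: W_def det_mul)
  have t: "tr W = 1 - tr (B ** A)"
    unfolding W_def using mat5_trace_relation[OF A(1) B(1)] mat5_cube_trace[OF A] mat5_cube_trace[OF B] by simp
  note sq = mat5_square[OF dW] and lm = lin_mult[OF dW]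
  have n1: "- mat 1 = mat2 (- 1) 0 0 (- 1 :: 5)" by (simp add: mat2_one)
  consider "tr W = 0" | "tr W = 1" | "tr W = 2" | "tr W = 3" | "tr W = 4" using z5_cases by blast
  then show ?thesis
  proof cases
    case 1 then show ?thesis using sq by (simp add: lin_const n1)
  next
    case 2 then show ?thesis using sq lm by (simp add: lin_const n1)
  next
    case 3
    then have "tr (B ** A) = 1 - 2" using t by (metis add_diff_cancel_left' diff_add_cancel diff_diff_eq2)
    then have "tr (B ** A) = - 1" by simp
    then have "(B ** A) ** (B ** A) ** (B ** A) = mat2 1 0 0 1"
      unfolding mat5_square[OF dBA] lin_mult[OF dBA] by (simp add: lin_const)
    then show ?thesis by (simp add: mat2_one)
  next
    case 4
    have "lin 55 (- 21) W = lin 0 (- 1) W" by (intro arg_cong2[of _ _ _ _ "\<lambda>s t. lin s t W"]) simp_all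
    with 4 show ?thesis using sq lm by (simp add: lin_const n1)
  next
    case 5
    have "lin 15 (- 4) W = lin 0 1 W" by (intro arg_cong2[of _ _ _ _ "\<lambda>s t. lin s t W"]) simp_all
    with 5 show ?thesis using sq lm by (simp add: lin_const mat2_one)
  qed
qed

lemma mat5_fifth_power:
  assumes "det (A::mat5) = 1" "tr A = 2" shows "A ** A ** A ** A ** A = mat 1"
proof -
  have "lin 5 (- 4) A = lin 0 1 A" by (intro arg_cong2[of _ _ _ _ "\<lambda>s t. lin s t A"]) simp_all
  then show ?thesis
    using mat5_square[OF assms(1)] lin_mult[OF assms(1)] assms(2) by (simp add: lin_const mat2_one)
qed

text \<open>Conjugating by an elementary matrix chosen with a nonzero off-diagonal entry of \<open>A\<close> produces trace two. A diagonal
  square root of \<open>-1\<close> is treated separately.\<close>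

lemma mat5_root_conjugate:
  assumes "det (A::mat5) = 1" "A ** A = - mat 1"
  shows "\<exists>U V. det U = 1 \<and> det V = 1 \<and> U ** V = mat 1 \<and> V ** U = mat 1 \<and>
    tr (U ** A ** V ** A) = 2 \<and> U ** A ** V ** A \<noteq> mat 1"
proof -
  obtain a b c d where A: "A = mat2 a b c d" "a * d - b * c = 1" using mat2_cases[OF assms(1)] .
  have e: "a * a + b * c = - 1" "b * (a + d) = 0" "c * (a + d) = 0" "c * b + d * d = - 1"
    using assms(2) by (auto simp: A(1) mat2_one algebra_simps)
  have "a + d = 0"
  proof (rule ccontr)
    assume "a + d \<noteq> 0"
    then have bc: "b = 0" "c = 0" using z5_mult_eq_0 e(2,3) by blast+
    have "a * a = 4" "d * d = 4" "a * d = 1" using A(2) e(1,4) bc by auto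
    then show False using z5_cases[of a] z5_cases[of d] \<open>a + d \<noteq> 0\<close> by auto
  qed
  then have d: "d = - a" by (simp add: eq_neg_iff_add_eq_0 add.commute)
  have bc: "b * c = - 1 - a * a" using e(1) by (metis add_diff_cancel_left')
  consider "c \<noteq> 0" | "b \<noteq> 0" | "b = 0" "c = 0" by blast
  then show ?thesis
  proof cases
    case 1
    then obtain k where k: "c * k = 1" using z5_inverse by blast
    let ?U = "mat2 1 k 0 1" and ?V = "mat2 1 (- k) 0 1"
    define w where "w = b - 2 * (k * a) - k"
    have p: "?U ** A ** ?V ** A = mat2 ((a + 1) * a + w * c) ((a + 1) * b - w * a) (c * a + (- 1 - a) * c) (c * b - (- 1 - a) * a)"
    proof -
      have kc: "k * c = 1" using k by (simp add: mult.commute)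
      have "?U ** A = mat2 (a + 1) (b - k * a) c (- a)" by (simp add: A(1) d kc)
      moreover have "mat2 (a + 1) (b - k * a) c (- a) ** ?V = mat2 (a + 1) w c (- 1 - a)"
        using k by (simp add: w_def algebra_simps)
      ultimately show ?thesis by (simp add: A(1) d)
    qed
    have wc: "w * c = b * c - 2 * a - 1"
    proof -
      have "w * c = b * c - 2 * (a * (c * k)) - c * k" by (simp add: w_def algebra_simps)
      then show ?thesis using k by simp
    qed
    show ?thesis
    proof (rule exI[of _ ?U], rule exI[of _ ?V], intro conjI)
      have "tr (?U ** A ** ?V ** A) = 2 * (a * a + b * c) - 1"
        unfolding p tr_mat2 wc by (simp add: algebra_simps)
      then have "tr (?U ** A ** ?V ** A) = - 3" unfolding e(1) by simp
      then show "tr (?U ** A ** ?V ** A) = 2" by simp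
      show "?U ** A ** ?V ** A \<noteq> mat 1"
        unfolding p using 1 by (simp add: mat2_one algebra_simps)
    qed (simp_all add: mat2_one)
  next
    case 2
    then obtain k where k: "b * k = 1" using z5_inverse by blast
    let ?U = "mat2 1 0 k 1" and ?V = "mat2 1 0 (- k) 1"
    define w where "w = c + 2 * (k * a) - k"
    have p: "?U ** A ** ?V ** A = mat2 ((a - 1) * a + b * c) ((a - 1) * b - b * a) (w * a + (1 - a) * c) (w * b - (1 - a) * a)"
    proof -
      have kb: "k * b = 1" using k by (simp add: mult.commute)
      have "?U ** A = mat2 a b (k * a + c) (1 - a)" by (simp add: A(1) d kb)
      moreover have "mat2 a b (k * a + c) (1 - a) ** ?V = mat2 (a - 1) b w (1 - a)"
        using k by (simp add: w_def algebra_simps)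
      ultimately show ?thesis by (simp add: A(1) d)
    qed
    have wb: "w * b = b * c + 2 * a - 1"
    proof -
      have "w * b = b * c + 2 * (a * (b * k)) - b * k" by (simp add: w_def algebra_simps)
      then show ?thesis using k by simp
    qed
    show ?thesis
    proof (rule exI[of _ ?U], rule exI[of _ ?V], intro conjI)
      have "tr (?U ** A ** ?V ** A) = 2 * (a * a + b * c) - 1"
        unfolding p tr_mat2 wb by (simp add: algebra_simps)
      then have "tr (?U ** A ** ?V ** A) = - 3" unfolding e(1) by simp
      then show "tr (?U ** A ** ?V ** A) = 2" by simp
      show "?U ** A ** ?V ** A \<noteq> mat 1"
        unfolding p using 2 by (simp add: mat2_one algebra_simps)
    qed (simp_all add: mat2_one)
  next
    case 3
    then have aa: "a * a = - 1" using e(1) by simp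
    let ?U = "mat2 1 1 (- 1) 0" and ?V = "mat2 0 (- 1) 1 (1::5)"
    have p: "?U ** A ** ?V ** A = mat2 1 (- 2) 0 1"
    proof -
      have "2 * a * a = - 2" using aa by (simp add: mult.assoc)
      then show ?thesis using aa 3 by (simp add: A(1) d)
    qed
    show ?thesis
      by (rule exI[of _ ?U], rule exI[of _ ?V], unfold p) (simp add: mat2_one)
  qed
qed

section \<open>Closed subgroups generated by commutators and squares\<close>

definition comm_sq :: "('a, 'b) monoid_scheme \<Rightarrow> 'a set \<Rightarrow> 'a set \<Rightarrow> 'a set" where
  "comm_sq G K L =
     {inv\<^bsub>G\<^esub> k \<otimes>\<^bsub>G\<^esub> inv\<^bsub>G\<^esub> l \<otimes>\<^bsub>G\<^esub> k \<otimes>\<^bsub>G\<^esub> l | k l. k \<in> K \<and> l \<in> L} \<union> {l \<otimes>\<^bsub>G\<^esub> l | l. l \<in> L}"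

context
  fixes G :: "('a, 'b) monoid_scheme" (structure) and T :: "'a topology"
  assumes top: "topological_group G T"
begin

interpretation group G using top by (simp add: topological_group_def)

lemma topspace_group: "topspace T = carrier G" using top by (simp add: topological_group_def)

lemma continuous_group_mult:
  assumes "continuous_map X T f" "continuous_map X T g"
  shows "continuous_map X T (\<lambda>x. f x \<otimes> g x)"
proof -
  have "continuous_map X (prod_topology T T) (\<lambda>x. (f x, g x))" using assms by (simp add: continuous_map_paired)
  from continuous_map_compose[OF this, of T "\<lambda>(x, y). x \<otimes> y"] top
  show ?thesis by (simp add: topological_group_def o_def)
qed

lemma continuous_const: "g \<in> carrier G \<Longrightarrow> continuous_map T T (\<lambda>x. g)"
  using topspace_group by simp

lemma continuous_conj: "g \<in> carrier G \<Longrightarrow> continuous_map T T (\<lambda>x. g \<otimes> x \<otimes> inv g)"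
  by (intro continuous_group_mult continuous_const) auto

lemma continuous_right: "g \<in> carrier G \<Longrightarrow> continuous_map T T (\<lambda>x. x \<otimes> g)"
  by (intro continuous_group_mult continuous_const) auto

lemma closedin_coset:
  assumes "closedin T H" "g \<in> carrier G"
  shows "closedin T (H #> g)"
proof -
  have H: "H \<subseteq> carrier G" using closedin_subset[OF assms(1)] topspace_group by simp
  have "H #> g = {x \<in> topspace T. x \<otimes> inv g \<in> H}"
  proof
    show "H #> g \<subseteq> {x \<in> topspace T. x \<otimes> inv g \<in> H}"
      using H assms(2) by (auto simp: r_coset_def topspace_group m_assoc)
    show "{x \<in> topspace T. x \<otimes> inv g \<in> H} \<subseteq> H #> g"
    proof
      fix x assume x: "x \<in> {x \<in> topspace T. x \<otimes> inv g \<in> H}"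
      then have "x = (x \<otimes> inv g) \<otimes> g" using assms(2) by (simp add: topspace_group m_assoc)
      then show "x \<in> H #> g" using x unfolding r_coset_def by blast
    qed
  qed
  then show ?thesis using closedin_continuous_map_preimage[OF continuous_right assms(1), of "inv g"] assms(2) by simp
qed

lemma closure_subgroup:
  assumes H: "subgroup H G"
  shows "subgroup (T closure_of H) G"
proof (rule subgroupI)
  show sub: "T closure_of H \<subseteq> carrier G" using closure_of_subset_topspace[of T H] topspace_group by simp
  have Hsub: "H \<subseteq> T closure_of H" using closure_of_subset[of H T] subgroup.subset[OF H] topspace_group by simp
  then show "T closure_of H \<noteq> {}" using subgroup.one_closed[OF H] by blast
  fix a assume a: "a \<in> T closure_of H"
  have "(\<lambda>x. inv x) ` (T closure_of H) \<subseteq> T closure_of ((\<lambda>x. inv x) ` H)"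
    using top by (intro continuous_map_image_closure_subset) (simp add: topological_group_def)
  also have "\<dots> \<subseteq> T closure_of H" using subgroup.m_inv_closed[OF H] by (intro closure_of_mono) auto
  finally show "inv a \<in> T closure_of H" using a by blast
  fix b assume b: "b \<in> T closure_of H"
  have "(\<lambda>(x, y). x \<otimes> y) ` (prod_topology T T closure_of (H \<times> H)) \<subseteq> T closure_of ((\<lambda>(x, y). x \<otimes> y) ` (H \<times> H))"
    using top by (intro continuous_map_image_closure_subset) (simp add: topological_group_def)
  also have "\<dots> \<subseteq> T closure_of H" using subgroup.m_closed[OF H] by (intro closure_of_mono) auto
  finally have "(\<lambda>(x, y). x \<otimes> y) ` ((T closure_of H) \<times> (T closure_of H)) \<subseteq> T closure_of H"
    by (simp add: closure_of_Times)
  then show "a \<otimes> b \<in> T closure_of H" using a b by blast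
qed

lemma closure_normal:
  assumes H: "H \<lhd> G"
  shows "T closure_of H \<lhd> G"
proof -
  have sub: "subgroup (T closure_of H) G" using closure_subgroup normal_imp_subgroup[OF H] by blast
  have "g \<otimes> h \<otimes> inv g \<in> T closure_of H" if g: "g \<in> carrier G" and h: "h \<in> T closure_of H" for g h
  proof -
    have "(\<lambda>x. g \<otimes> x \<otimes> inv g) ` (T closure_of H) \<subseteq> T closure_of ((\<lambda>x. g \<otimes> x \<otimes> inv g) ` H)"
      using continuous_conj[OF g] by (rule continuous_map_image_closure_subset)
    also have "\<dots> \<subseteq> T closure_of H" using normal.inv_op_closed2[OF H g] by (intro closure_of_mono) auto
    finally show ?thesis using h by blast
  qed
  then show ?thesis using sub normal_inv_iff by blast
qed

lemma comm_sq_closure_eq: "comm_sq_closure G T K L = T closure_of (generate G (comm_sq G K L))"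
  by (simp add: comm_sq_closure_def comm_sq_def)

lemma comm_sq_subset: "K \<subseteq> carrier G \<Longrightarrow> L \<subseteq> carrier G \<Longrightarrow> comm_sq G K L \<subseteq> carrier G"
  by (auto simp: comm_sq_def subset_iff)

lemma comm_sq_in_closure:
  assumes "K \<subseteq> carrier G" "L \<subseteq> carrier G"
  shows "comm_sq G K L \<subseteq> comm_sq_closure G T K L"
proof -
  have "comm_sq G K L \<subseteq> generate G (comm_sq G K L)" by (blast intro: generate.incl)
  moreover have "generate G (comm_sq G K L) \<subseteq> topspace T"
    using generate_incl[OF comm_sq_subset[OF assms]] topspace_group by simp
  ultimately show ?thesis using closure_of_subset unfolding comm_sq_closure_eq by blast
qed

lemma comm_sq_closure_closed: "closedin T (comm_sq_closure G T K L)"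
  unfolding comm_sq_closure_eq by simp

lemma comm_sq_closure_least:
  assumes "subgroup H G" "closedin T H" "comm_sq G K L \<subseteq> H"
  shows "comm_sq_closure G T K L \<subseteq> H"
  unfolding comm_sq_closure_eq
  using generate_subgroup_incl[OF assms(3,1)] assms(2) by (rule closure_of_minimal)

lemma comm_sq_closure_normal:
  assumes K: "K \<lhd> G" and L: "L \<lhd> G"
  shows "comm_sq_closure G T K L \<lhd> G"
  unfolding comm_sq_closure_eq
proof (intro closure_normal normal_generateI)
  have KL: "K \<subseteq> carrier G" "L \<subseteq> carrier G"
    using subgroup.subset normal_imp_subgroup K L by blast+
  then show "comm_sq G K L \<subseteq> carrier G" by (rule comm_sq_subset)
  fix h g assume h: "h \<in> comm_sq G K L" and g: "g \<in> carrier G"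
  let ?c = "\<lambda>x. g \<otimes> x \<otimes> inv g"
  have hom: "group_hom G G ?c" using g by (rule conj_hom_group)
  from h consider (comm) k l where "k \<in> K" "l \<in> L" "h = inv k \<otimes> inv l \<otimes> k \<otimes> l" | (sq) l where "l \<in> L" "h = l \<otimes> l"
    unfolding comm_sq_def by blast
  then show "g \<otimes> h \<otimes> inv g \<in> comm_sq G K L"
  proof cases
    case comm
    have kl: "k \<in> carrier G" "l \<in> carrier G" using comm KL by auto
    have "?c h = inv (?c k) \<otimes> inv (?c l) \<otimes> ?c k \<otimes> ?c l"
      unfolding comm(3) using group_hom.hom_mult[OF hom] group_hom.hom_inv[OF hom] kl by simp
    moreover have "?c k \<in> K" "?c l \<in> L" using normal.inv_op_closed2 K L g comm by metis+
    ultimately show ?thesis unfolding comm_sq_def by blast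
  next
    case sq
    have l: "l \<in> carrier G" using sq KL by auto
    have "?c h = ?c l \<otimes> ?c l" unfolding sq(2) using group_hom.hom_mult[OF hom l l] .
    moreover have "?c l \<in> L" using normal.inv_op_closed2 L g sq by metis
    ultimately show ?thesis unfolding comm_sq_def by blast
  qed
qed

end

lemma kernel_clopen:
  assumes "topological_group G T" "continuous_map T (discrete_topology (carrier A)) f" "group A"
  shows "openin T (kernel G A f)" "closedin T (kernel G A f)"
proof -
  have e: "kernel G A f = {x \<in> topspace T. f x \<in> {\<one>\<^bsub>A\<^esub>}}"
    using assms(1) by (auto simp: kernel_def topological_group_def)
  have "{\<one>\<^bsub>A\<^esub>} \<subseteq> carrier A" using assms(3) by (simp add: group.is_monoid)
  then have "openin (discrete_topology (carrier A)) {\<one>\<^bsub>A\<^esub>}" "closedin (discrete_topology (carrier A)) {\<one>\<^bsub>A\<^esub>}" by simp_all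
  then show "openin T (kernel G A f)" "closedin T (kernel G A f)" unfolding e
    using openin_continuous_map_preimage[OF assms(2)] closedin_continuous_map_preimage[OF assms(2)] by blast+
qed

text \<open>Both sides count the image of \<open>P\<close> in the product \<open>A \<times> B\<close> under \<open>(f, g)\<close>, fibred over \<open>B\<close> and over \<open>A\<close>.\<close>

lemma card_two_quotients:
  assumes f: "group_hom P A f" and g: "group_hom P B g"
    and fs: "f ` carrier P = carrier A" and gs: "g ` carrier P = carrier B"
    and fin: "finite (carrier A)" "finite (carrier B)"
  shows "card (carrier B) * card (f ` kernel P B g) \<le> card (carrier A) * card (g ` kernel P A f)"
proof -
  interpret f: group_hom P A f by (rule f)
  interpret g: group_hom P B g by (rule g)
  let ?I = "(\<lambda>p. (f p, g p)) ` carrier P"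
  let ?Nf = "f ` kernel P B g" and ?Ng = "g ` kernel P A f"
  have finI: "finite ?I" by (rule finite_subset[of _ "carrier A \<times> carrier B"]) (use fin in auto)
  have Nf: "?Nf \<subseteq> carrier A" and Ng: "?Ng \<subseteq> carrier B" by (auto simp: kernel_def)
  define p where "p = inv_into (carrier P) g"
  define q where "q = inv_into (carrier P) f"
  have p: "p y \<in> carrier P" "g (p y) = y" if "y \<in> carrier B" for y
    unfolding p_def using that inv_into_into[of y g "carrier P"] f_inv_into_f[of y g "carrier P"] gs by simp_all
  have q: "q x \<in> carrier P" "f (q x) = x" if "x \<in> carrier A" for x
    unfolding q_def using that inv_into_into[of x f "carrier P"] f_inv_into_f[of x f "carrier P"] fs by simp_all
  have "inj_on (\<lambda>(y, n). (f (p y) \<otimes>\<^bsub>A\<^esub> n, y)) (carrier B \<times> ?Nf)"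
  proof (rule inj_onI)
    fix u v assume u: "u \<in> carrier B \<times> ?Nf" and v: "v \<in> carrier B \<times> ?Nf"
      and e: "(\<lambda>(y, n). (f (p y) \<otimes>\<^bsub>A\<^esub> n, y)) u = (\<lambda>(y, n). (f (p y) \<otimes>\<^bsub>A\<^esub> n, y)) v"
    obtain y n y' n' where uv: "u = (y, n)" "v = (y', n')" by fastforce
    then have "y' = y" "f (p y) \<otimes>\<^bsub>A\<^esub> n = f (p y) \<otimes>\<^bsub>A\<^esub> n'" using e by auto
    moreover have "y \<in> carrier B" "n \<in> carrier A" "n' \<in> carrier A" using u v uv Nf by auto
    ultimately show "u = v" using uv p f.hom_closed by simp
  qed
  then have "card (carrier B) * card ?Nf = card ((\<lambda>(y, n). (f (p y) \<otimes>\<^bsub>A\<^esub> n, y)) ` (carrier B \<times> ?Nf))"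
    by (simp add: card_image card_cartesian_product)
  also have "\<dots> \<le> card ?I"
  proof (rule card_mono[OF finI], clarify)
    fix y k assume a: "y \<in> carrier B" "k \<in> kernel P B g"
    then have "(f (p y \<otimes>\<^bsub>P\<^esub> k), g (p y \<otimes>\<^bsub>P\<^esub> k)) = (f (p y) \<otimes>\<^bsub>A\<^esub> f k, y)" "p y \<otimes>\<^bsub>P\<^esub> k \<in> carrier P"
      using p by (simp_all add: kernel_def)
    then show "(f (p y) \<otimes>\<^bsub>A\<^esub> f k, y) \<in> ?I" by (metis (no_types, lifting) imageI)
  qed
  also have "\<dots> \<le> card ((\<lambda>(x, n). (x, g (q x) \<otimes>\<^bsub>B\<^esub> n)) ` (carrier A \<times> ?Ng))"
  proof (rule card_mono)
    have "finite ?Ng" using Ng fin(2) finite_subset by blast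
    then show "finite ((\<lambda>(x, n). (x, g (q x) \<otimes>\<^bsub>B\<^esub> n)) ` (carrier A \<times> ?Ng))" using fin by simp
    show "?I \<subseteq> (\<lambda>(x, n). (x, g (q x) \<otimes>\<^bsub>B\<^esub> n)) ` (carrier A \<times> ?Ng)"
    proof clarify
      fix u assume u: "u \<in> carrier P"
      let ?k = "inv\<^bsub>P\<^esub> (q (f u)) \<otimes>\<^bsub>P\<^esub> u"
      have qu: "q (f u) \<in> carrier P" "f (q (f u)) = f u" using q u by simp_all
      then have k: "?k \<in> kernel P A f" using u by (simp add: kernel_def)
      have "g (q (f u) \<otimes>\<^bsub>P\<^esub> ?k) = g (q (f u)) \<otimes>\<^bsub>B\<^esub> g ?k" using k by (intro g.hom_mult[OF qu(1)]) (simp add: kernel_def)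
      moreover have "q (f u) \<otimes>\<^bsub>P\<^esub> ?k = u" using qu u by (simp flip: f.m_assoc)
      ultimately have "(f u, g u) = (\<lambda>(x, n). (x, g (q x) \<otimes>\<^bsub>B\<^esub> n)) (f u, g ?k)" by simp
      moreover have "(f u, g ?k) \<in> carrier A \<times> ?Ng" using u k by auto
      ultimately show "(f u, g u) \<in> (\<lambda>(x, n). (x, g (q x) \<otimes>\<^bsub>B\<^esub> n)) ` (carrier A \<times> ?Ng)" by (rule image_eqI)
    qed
  qed
  also have "\<dots> \<le> card (carrier A \<times> ?Ng)"
    using finite_subset[OF Ng fin(2)] fin(1) by (intro card_image_le) simp
  finally show ?thesis by (simp add: card_cartesian_product)
qed

section \<open>Normal two-subgroups of \<open>SL\<^sub>2(\<int>/5)\<close>\<close>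

lemma SL2_simps:
  "carrier SL2_Z5 = {A. det A = 1}" "A \<otimes>\<^bsub>SL2_Z5\<^esub> B = A ** B" "\<one>\<^bsub>SL2_Z5\<^esub> = mat 1"
  by (simp_all add: SL2_Z5_def)

lemma group_SL2: "group SL2_Z5"
proof (rule groupI)
  fix A assume "A \<in> carrier SL2_Z5"
  then have "det A = 1" by (simp add: SL2_simps)
  then obtain a b c d where A: "A = mat2 a b c d" "a * d - b * c = 1" by (rule mat2_cases)
  have "mat2 d (- b) (- c) a \<otimes>\<^bsub>SL2_Z5\<^esub> A = \<one>\<^bsub>SL2_Z5\<^esub>"
    using A by (simp add: SL2_simps mat2_one algebra_simps)
  moreover have "mat2 d (- b) (- c) a \<in> carrier SL2_Z5" using A(2) by (simp add: SL2_simps algebra_simps)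
  ultimately show "\<exists>B\<in>carrier SL2_Z5. B \<otimes>\<^bsub>SL2_Z5\<^esub> A = \<one>\<^bsub>SL2_Z5\<^esub>" by blast
qed (simp_all add: SL2_simps det_mul matrix_mul_assoc)

interpretation SL2: group SL2_Z5 by (rule group_SL2)

lemma finite_SL2: "finite (carrier SL2_Z5)" by (rule finite_subset[OF subset_UNIV]) simp

text \<open>The estimate counts the matrices with nonzero upper left entry; it is enough for the comparison with the order 60 of
  \<open>A\<^sub>5\<close>.\<close>

lemma card_SL2_ge: "100 \<le> card (carrier SL2_Z5)"
proof -
  obtain i where i: "\<And>x::5. x \<noteq> 0 \<Longrightarrow> x * i x = 1" using z5_inverse by metis
  let ?f = "\<lambda>(a, b, c). mat2 a b c (i a * (1 + b * c))"
  let ?S = "(UNIV - {0::5}) \<times> (UNIV :: 5 set) \<times> (UNIV :: 5 set)"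
  have card: "card ?S = 100" by (simp add: card_cartesian_product card_Diff_subset)
  have inj: "inj_on ?f ?S" by (auto simp: inj_on_def)
  have sub: "?f ` ?S \<subseteq> carrier SL2_Z5"
  proof
    fix A assume "A \<in> ?f ` ?S"
    then obtain u where u: "u \<in> ?S" "A = ?f u" by (rule imageE) simp
    obtain a b c where abc: "u = (a, b, c)" by (rule prod_cases3)
    have "a \<noteq> 0" and A: "A = mat2 a b c (i a * (1 + b * c))" using u unfolding abc by simp_all
    then have "a * (i a * (1 + b * c)) = 1 + b * c" using i[of a] by (simp flip: mult.assoc)
    then show "A \<in> carrier SL2_Z5" unfolding A by (simp add: SL2_simps)
  qed
  show ?thesis using card_inj_on_le[OF inj sub finite_SL2] unfolding card .
qed

lemma subgroup_pow_closed:
  assumes "group G" "subgroup H G" "x \<in> H"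
  shows "x [^]\<^bsub>G\<^esub> (n::nat) \<in> H"
proof -
  interpret group G by (rule assms(1))
  show ?thesis
    using subgroup.one_closed[OF assms(2)] subgroup.m_closed[OF assms(2) _ assms(3)] by (induction n) simp_all
qed

text \<open>An element outside \<open>\<plusminus>1\<close> whose order is a power of two has a power \<open>y\<close> with \<open>y\<^sup>2 = -1\<close>. Some
  product of \<open>y\<close> with a conjugate is a transvection, of order five.\<close>

lemma normal_two_subgroup_SL2:
  assumes N: "N \<lhd> SL2_Z5" and two: "\<And>x. x \<in> N \<Longrightarrow> \<exists>k. x [^]\<^bsub>SL2_Z5\<^esub> ((2::nat) ^ k) = mat 1"
  shows "N \<subseteq> {mat 1, - mat 1}"
proof (rule ccontr)
  assume "\<not> ?thesis"
  then obtain x where x: "x \<in> N" "x \<noteq> mat 1" "x \<noteq> - mat 1" by blast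
  have subN: "subgroup N SL2_Z5" using N by (rule normal_imp_subgroup)
  have Nc: "y \<in> carrier SL2_Z5" if "y \<in> N" for y using subgroup.mem_carrier[OF subN that] .
  obtain k0 where k0: "x [^]\<^bsub>SL2_Z5\<^esub> ((2::nat) ^ k0) = mat 1" using two x(1) by blast
  define pw where "pw n = x [^]\<^bsub>SL2_Z5\<^esub> ((2::nat) ^ n)" for n
  define n where "n = (LEAST n. pw n \<in> {mat 1, - mat 1})"
  have n: "pw n \<in> {mat 1, - mat 1}" unfolding n_def by (rule LeastI[of _ k0]) (simp add: pw_def k0)
  have pw0: "pw 0 = x" unfolding pw_def using Nc[OF x(1)] by simp
  then have "n \<noteq> 0" using n x by (metis empty_iff insert_iff)
  then obtain j where j: "n = Suc j" using not0_implies_Suc by blast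
  define y where "y = pw j"
  have yN: "y \<in> N" unfolding y_def pw_def
    using subgroup_pow_closed[OF group_SL2 subN x(1)] .
  have y: "y \<notin> {mat 1, - mat 1}" unfolding y_def using not_less_Least[of j "\<lambda>n. pw n \<in> {mat 1, - mat 1}"] j n_def by auto
  have dety: "det y = 1" using Nc[OF yN] by (simp add: SL2_simps)
  have "pw n = y ** y"
  proof -
    have "(2::nat) ^ n = 2 ^ j + 2 ^ j" using j by simp
    then show ?thesis unfolding pw_def y_def using SL2.nat_pow_mult[OF Nc[OF x(1)], of "2 ^ j" "2 ^ j"] by (simp add: SL2_simps)
  qed
  then have yy: "y ** y = - mat 1" using n y mat5_square_one[OF dety] by auto
  obtain U V where UV: "det U = 1" "det V = 1" "U ** V = mat 1" "V ** U = mat 1"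
    "tr (U ** y ** V ** y) = 2" "U ** y ** V ** y \<noteq> mat 1" using mat5_root_conjugate[OF dety yy] by blast
  define w where "w = U ** y ** V ** y"
  have V: "V = inv\<^bsub>SL2_Z5\<^esub> U" using SL2.inv_equality[of V U] UV by (simp add: SL2_simps)
  have "U \<otimes>\<^bsub>SL2_Z5\<^esub> y \<otimes>\<^bsub>SL2_Z5\<^esub> inv\<^bsub>SL2_Z5\<^esub> U \<otimes>\<^bsub>SL2_Z5\<^esub> y \<in> N"
    using normal.inv_op_closed2[OF N] UV(1) yN subgroup.m_closed[OF subN] by (simp add: SL2_simps)
  then have wN: "w \<in> N" unfolding w_def V[symmetric] by (simp add: SL2_simps)
  have wc: "w \<in> carrier SL2_Z5" using Nc[OF wN] .
  have "w ** w ** w ** w ** w = mat 1"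
    using mat5_fifth_power[of w] UV(5) wc unfolding w_def[symmetric] by (simp add: SL2_simps)
  then have "w [^]\<^bsub>SL2_Z5\<^esub> (5::nat) = \<one>\<^bsub>SL2_Z5\<^esub>"
    using wc SL2.nat_pow_Suc by (simp add: numeral_nat SL2_simps)
  then have "SL2.ord w dvd 5" using SL2.pow_eq_id[OF wc] by blast
  moreover obtain k where "w [^]\<^bsub>SL2_Z5\<^esub> ((2::nat) ^ k) = \<one>\<^bsub>SL2_Z5\<^esub>" using two[OF wN] by (auto simp: SL2_simps)
  then have "SL2.ord w dvd 2 ^ k" using SL2.pow_eq_id[OF wc] by blast
  moreover have "coprime (5::nat) (2 ^ k)" by simp
  ultimately have "SL2.ord w = 1" by (metis coprime_common_divisor_nat nat_dvd_1_iff_1)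
  then have "w = mat 1" using SL2.ord_eq_1[OF wc] by (simp add: SL2_simps)
  then show False using UV(6) unfolding w_def by blast
qed

section \<open>The quotients of the universal cover\<close>

lemma (in group) three_three_three:
  assumes a: "a \<in> carrier G" "a \<otimes> (a \<otimes> a) = \<one>" and b: "b \<in> carrier G" "b \<otimes> (b \<otimes> b) = \<one>"
    and ab: "(a \<otimes> inv b) \<otimes> ((a \<otimes> inv b) \<otimes> (a \<otimes> inv b)) = \<one>"
  shows "(a \<otimes> b) \<otimes> (b \<otimes> a) = (b \<otimes> a) \<otimes> (a \<otimes> b)"
proof -
  note [simp] = a(1) b(1)
  have "(b \<otimes> b) \<otimes> b = \<one>" "(a \<otimes> a) \<otimes> a = \<one>" using a b by (simp_all add: m_assoc)
  then have i: "inv b = b \<otimes> b" "inv a = a \<otimes> a" by (simp_all add: inv_equality)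
  have "(a \<otimes> inv b \<otimes> a) \<otimes> (inv b \<otimes> a \<otimes> inv b) = \<one>" using ab by (simp add: m_assoc)
  then have "a \<otimes> inv b \<otimes> a = inv (inv b \<otimes> a \<otimes> inv b)" by (simp add: inv_equality)
  also have "\<dots> = b \<otimes> inv a \<otimes> b" by (simp add: inv_mult_group m_assoc)
  finally have "a \<otimes> (b \<otimes> b) \<otimes> a = b \<otimes> (a \<otimes> a) \<otimes> b" unfolding i .
  then show ?thesis by (simp add: m_assoc)
qed

text \<open>Two elements of order three whose quotient has order three generate a quotient of the triangle
  group \<open>\<Delta>(3,3,3)\<close>, which is solvable.\<close>

lemma A5_not_generated_333:
  assumes "x \<in> carrier A5" "x \<otimes>\<^bsub>A5\<^esub> (x \<otimes>\<^bsub>A5\<^esub> x) = \<one>\<^bsub>A5\<^esub>" "y \<in> carrier A5" "y \<otimes>\<^bsub>A5\<^esub> (y \<otimes>\<^bsub>A5\<^esub> y) = \<one>\<^bsub>A5\<^esub>"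
    "(x \<otimes>\<^bsub>A5\<^esub> inv\<^bsub>A5\<^esub> y) \<otimes>\<^bsub>A5\<^esub> ((x \<otimes>\<^bsub>A5\<^esub> inv\<^bsub>A5\<^esub> y) \<otimes>\<^bsub>A5\<^esub> (x \<otimes>\<^bsub>A5\<^esub> inv\<^bsub>A5\<^esub> y)) = \<one>\<^bsub>A5\<^esub>"
  shows "generate A5 {x, y} \<noteq> carrier A5"
  by (rule A5_not_generated[OF assms(1-4) A5.three_three_three[OF assms]])

context group
begin

lemma cube_conj:
  assumes "a \<in> carrier G" "b \<in> carrier G" "(a \<otimes> b) \<otimes> ((a \<otimes> b) \<otimes> (a \<otimes> b)) = \<one>"
  shows "(b \<otimes> a) \<otimes> ((b \<otimes> a) \<otimes> (b \<otimes> a)) = \<one>"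
proof -
  have "a \<otimes> ((b \<otimes> a) \<otimes> ((b \<otimes> a) \<otimes> b)) = \<one>" using assms by (simp add: m_assoc)
  then have "((b \<otimes> a) \<otimes> ((b \<otimes> a) \<otimes> b)) \<otimes> a = \<one>" using assms(1,2) by (auto intro: inv_comm[of "a"])
  then show ?thesis using assms(1,2) by (simp add: m_assoc)
qed

lemma cube_inv:
  assumes "a \<in> carrier G" "a \<otimes> (a \<otimes> a) = \<one>"
  shows "inv a \<otimes> (inv a \<otimes> inv a) = \<one>"
proof -
  have "inv (a \<otimes> (a \<otimes> a)) = \<one>" using assms by simp
  then show ?thesis using assms(1) by (simp add: inv_mult_group m_assoc)
qed

text \<open>In the triangle group \<open>\<Delta>(3,3,2)\<close>, the alternating group of degree four, the product of \<open>b\<close> with the inverse of \<open>a\<close> is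
  conjugate to the inverse of \<open>b\<close>.\<close>

lemma cube_of_square:
  assumes a: "a \<in> carrier G" "a \<otimes> (a \<otimes> a) = \<one>" and b: "b \<in> carrier G" "b \<otimes> (b \<otimes> b) = \<one>"
    and ab: "(a \<otimes> b) \<otimes> (a \<otimes> b) = \<one>"
  shows "(b \<otimes> inv a) \<otimes> ((b \<otimes> inv a) \<otimes> (b \<otimes> inv a)) = \<one>"
proof -
  note [simp] = a(1) b(1)
  have "(a \<otimes> b \<otimes> a) \<otimes> b = \<one>" using ab by (simp add: m_assoc)
  then have "inv b = a \<otimes> b \<otimes> a" by (simp add: inv_equality)
  then have "inv a \<otimes> inv b = inv a \<otimes> (a \<otimes> b \<otimes> a)" by simp
  also have "\<dots> = (inv a \<otimes> a) \<otimes> (b \<otimes> a)" by (simp add: m_assoc del: l_inv)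
  finally have e: "b \<otimes> a = inv a \<otimes> inv b" by simp
  have aa: "inv a = a \<otimes> a" using a by (intro inv_equality) (simp_all add: m_assoc)
  have "b \<otimes> inv a = (b \<otimes> a) \<otimes> a" unfolding aa by (simp add: m_assoc)
  then have "b \<otimes> inv a = inv a \<otimes> inv b \<otimes> inv (inv a)" unfolding e by simp
  moreover have "group_hom G G (\<lambda>x. inv a \<otimes> x \<otimes> inv (inv a))" by (rule conj_hom_group) simp
  ultimately have "(b \<otimes> inv a) \<otimes> ((b \<otimes> inv a) \<otimes> (b \<otimes> inv a)) = inv a \<otimes> (inv b \<otimes> (inv b \<otimes> inv b)) \<otimes> inv (inv a)"
    using group_hom.hom_mult[of G G "\<lambda>x. inv a \<otimes> x \<otimes> inv (inv a)"] by simp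
  then show ?thesis using cube_inv[OF b] by simp
qed

end

locale frattini_SL2 =
  fixes P :: "'p monoid" and T :: "'p topology" and \<phi> :: "'p \<Rightarrow> nat \<Rightarrow> nat" and \<sigma> :: "'p \<Rightarrow> mat5"
  assumes cover: "p_frattini_cover 2 (alt_group 5) P T \<phi>"
    and to_SL2: "continuous_epi P T SL2_Z5 (discrete_topology (carrier SL2_Z5)) \<sigma>"
begin

abbreviation "K \<equiv> kernel P A5 \<phi>"
abbreviation "L \<equiv> kernel P SL2_Z5 \<sigma>"

lemma top: "topological_group P T" using cover by (simp add: p_frattini_cover_def profinite_group_def)

sublocale group P using top by (simp add: topological_group_def)

sublocale \<phi>: group_hom P "alt_group 5" \<phi>
  using cover by (intro group_hom.intro group_hom_axioms.intro is_group A5_group)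
    (simp add: p_frattini_cover_def continuous_epi_def)

sublocale \<sigma>: group_hom P SL2_Z5 \<sigma>
  using to_SL2 by (intro group_hom.intro group_hom_axioms.intro is_group group_SL2)
    (simp add: continuous_epi_def)

lemma surj: "\<phi> ` carrier P = carrier A5" "\<sigma> ` carrier P = carrier SL2_Z5"
  using cover to_SL2 by (simp_all add: p_frattini_cover_def continuous_epi_def)

lemma clopen: "openin T K" "closedin T K" "openin T L" "closedin T L"
proof -
  have "continuous_map T (discrete_topology (carrier A5)) \<phi>" "continuous_map T (discrete_topology (carrier SL2_Z5)) \<sigma>"
    using cover to_SL2 by (simp_all add: p_frattini_cover_def continuous_epi_def)
  then show "openin T K" "closedin T K" "openin T L" "closedin T L"
    using kernel_clopen[OF top _ A5_group] kernel_clopen[OF top _ group_SL2] by blast+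
qed

lemma normal: "K \<lhd> P" "L \<lhd> P" by (rule \<phi>.normal_kernel \<sigma>.normal_kernel)+

lemma sub: "subgroup K P" "subgroup L P" using normal normal_imp_subgroup by blast+

declare SL2_simps(2) [simp]

lemma K_iff: "p \<in> K \<longleftrightarrow> p \<in> carrier P \<and> \<phi> p = \<one>\<^bsub>A5\<^esub>" by (simp add: kernel_def)
lemma L_iff: "p \<in> L \<longleftrightarrow> p \<in> carrier P \<and> \<sigma> p = mat 1" by (simp add: kernel_def SL2_simps)

lemma \<sigma>_mult: "p \<in> carrier P \<Longrightarrow> q \<in> carrier P \<Longrightarrow> \<sigma> (p \<otimes>\<^bsub>P\<^esub> q) = \<sigma> p ** \<sigma> q"
  by (simp add: SL2_simps)

lemma det_\<sigma>: "p \<in> carrier P \<Longrightarrow> det (\<sigma> p) = 1" using \<sigma>.hom_closed by (simp add: SL2_simps)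

text \<open>As the kernel of the cover is a pro-2 group, its image in \<open>SL\<^sub>2(\<int>/5)\<close> is a 2-group.\<close>

lemma two_power: "p \<in> K \<Longrightarrow> \<exists>k. \<sigma> p [^]\<^bsub>SL2_Z5\<^esub> ((2::nat) ^ k) = mat 1"
proof -
  assume p: "p \<in> K"
  let ?K = "P\<lparr>carrier := K\<rparr>" and ?N = "K \<inter> L"
  interpret K: group ?K using subgroup.subgroup_is_group[OF sub(1) is_group] .
  have sN: "subgroup ?N ?K"
    using subgroups_Inter_pair[OF sub] by (intro subgroup_incl sub) auto
  have N: "?N \<lhd> ?K"
  proof -
    have "x \<otimes>\<^bsub>?K\<^esub> h \<otimes>\<^bsub>?K\<^esub> inv\<^bsub>?K\<^esub> x \<in> ?N" if "x \<in> carrier ?K" "h \<in> ?N" for x h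
    proof -
      have x: "x \<in> K" "x \<in> carrier P" using that(1) by (auto simp: kernel_def)
      have "inv\<^bsub>?K\<^esub> x = inv\<^bsub>P\<^esub> x" using m_inv_consistent[OF sub(1) x(1)] by simp
      then show ?thesis
        using normal.inv_op_closed2[OF normal(1) x(2)] normal.inv_op_closed2[OF normal(2) x(2)] that(2) by simp
    qed
    then show ?thesis using sN K.normal_inv_iff by blast
  qed
  have "openin (subtopology T K) ?N"
    using clopen(3) by (auto simp: openin_subtopology)
  moreover have "pro_p_group 2 ?K (subtopology T K)" using cover by (simp add: p_frattini_cover_def)
  ultimately obtain k where k: "card (rcosets\<^bsub>?K\<^esub> ?N) = 2 ^ k" using N unfolding pro_p_group_def by blast
  interpret Q: group "?K Mod ?N" by (rule normal.factorgroup_is_group[OF N])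
  have oQ: "order (?K Mod ?N) = 2 ^ k" using k by (simp add: order_def FactGroup_def)
  have hom: "group_hom ?K (?K Mod ?N) (\<lambda>x. ?N #>\<^bsub>?K\<^esub> x)"
    by (intro group_hom.intro group_hom_axioms.intro K.is_group Q.is_group normal.r_coset_hom_Mod[OF N])
  have pK: "p \<in> carrier ?K" using p by simp
  have "?N #>\<^bsub>?K\<^esub> (p [^]\<^bsub>?K\<^esub> ((2::nat) ^ k)) = (?N #>\<^bsub>?K\<^esub> p) [^]\<^bsub>?K Mod ?N\<^esub> ((2::nat) ^ k)"
    using group_hom.hom_nat_pow[OF hom pK] .
  also have "\<dots> = \<one>\<^bsub>?K Mod ?N\<^esub>"
    using Q.pow_order_eq_1[of "?N #>\<^bsub>?K\<^esub> p"] group_hom.hom_closed[OF hom pK] unfolding oQ by simp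
  finally have "?N #>\<^bsub>?K\<^esub> (p [^]\<^bsub>?K\<^esub> ((2::nat) ^ k)) = ?N" by simp
  then have "p [^]\<^bsub>?K\<^esub> ((2::nat) ^ k) \<in> ?N" using K.coset_join1[OF _ _ sN] K.nat_pow_closed[OF pK] by blast
  then have "p [^]\<^bsub>P\<^esub> ((2::nat) ^ k) \<in> L" by (simp add: nat_pow_consistent[symmetric])
  then have "\<sigma> (p [^]\<^bsub>P\<^esub> ((2::nat) ^ k)) = mat 1" using L_iff by blast
  then show ?thesis using p by (metis K_iff \<sigma>.hom_nat_pow)
qed

lemma \<sigma>_K: "\<sigma> ` K \<subseteq> {mat 1, - mat 1}"
proof (rule normal_two_subgroup_SL2)
  show "\<sigma> ` K \<lhd> SL2_Z5"
  proof -
    have s: "subgroup (\<sigma> ` K) SL2_Z5" by (rule \<sigma>.subgroup_img_is_subgroup[OF sub(1)])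
    have "x \<otimes>\<^bsub>SL2_Z5\<^esub> h \<otimes>\<^bsub>SL2_Z5\<^esub> inv\<^bsub>SL2_Z5\<^esub> x \<in> \<sigma> ` K" if x: "x \<in> carrier SL2_Z5" and h: "h \<in> \<sigma> ` K" for x h
    proof -
      obtain p where p: "p \<in> carrier P" "x = \<sigma> p" using x surj(2) by blast
      obtain q where q: "q \<in> K" "h = \<sigma> q" using h by blast
      have "\<sigma> (p \<otimes>\<^bsub>P\<^esub> q \<otimes>\<^bsub>P\<^esub> inv\<^bsub>P\<^esub> p) = x \<otimes>\<^bsub>SL2_Z5\<^esub> h \<otimes>\<^bsub>SL2_Z5\<^esub> inv\<^bsub>SL2_Z5\<^esub> x"
        using p q by (simp add: K_iff)
      then show ?thesis using normal.inv_op_closed2[OF normal(1) p(1) q(1)] by (metis imageI)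
    qed
    then show ?thesis using s SL2.normal_inv_iff by blast
  qed
qed (use two_power in blast)

lemma mat5_one_neq: "(mat 1 :: mat5) \<noteq> - mat 1" by (simp add: mat2_one)

text \<open>Let \<open>n\<close> be the order of \<open>SL\<^sub>2(\<int>/5)\<close>. By \<open>card_two_quotients\<close>, \<open>n |\<phi>(L)| \<le> 60 |\<sigma>(K)| \<le> 120\<close>, while \<open>n \<ge> 100\<close>. So
  \<open>|\<phi>(L)| = 1\<close> and \<open>|\<sigma>(K)| = 2\<close>.\<close>

lemma \<phi>_L: "\<phi> ` L = {\<one>\<^bsub>A5\<^esub>}" and \<sigma>_K_eq: "\<sigma> ` K = {mat 1, - mat 1}"
proof -
  have le: "card (carrier SL2_Z5) * card (\<phi> ` L) \<le> 60 * card (\<sigma> ` K)"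
    using card_two_quotients[OF \<phi>.group_hom_axioms \<sigma>.group_hom_axioms surj finite_A5 finite_SL2] order_A5
    by (simp add: order_def)
  have oneL: "\<one>\<^bsub>A5\<^esub> \<in> \<phi> ` L" using subgroup.one_closed[OF sub(2)] \<phi>.hom_one by (metis imageI)
  have one: "mat 1 \<in> \<sigma> ` K" using subgroup.one_closed[OF sub(1)] \<sigma>.hom_one by (metis SL2_simps(3) imageI)
  have finL: "finite (\<phi> ` L)"
    by (rule finite_subset[OF _ finite_A5]) (auto simp: kernel_def)
  have c1: "card (\<phi> ` L) \<ge> 1" using oneL finL by (metis One_nat_def Suc_leI card_gt_0_iff empty_iff)
  have c2: "card (\<sigma> ` K) \<le> 2" using card_mono[OF _ \<sigma>_K] by (simp add: mat5_one_neq)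
  have "100 * card (\<phi> ` L) \<le> card (carrier SL2_Z5) * card (\<phi> ` L)" using card_SL2_ge by simp
  then have "100 * card (\<phi> ` L) \<le> 60 * card (\<sigma> ` K)" using le by linarith
  then have c: "card (\<phi> ` L) = 1" "card (\<sigma> ` K) = 2" using c1 c2 by linarith+
  show "\<phi> ` L = {\<one>\<^bsub>A5\<^esub>}" using c(1) oneL by (metis card_1_singletonE singletonD)
  show "\<sigma> ` K = {mat 1, - mat 1}"
    using \<sigma>_K c(2) by (intro card_subset_eq) (auto simp: mat5_one_neq)
qed

lemma L_sub_K: "L \<subseteq> K"
proof
  fix p assume p: "p \<in> L"
  then have "\<phi> p \<in> {\<one>\<^bsub>A5\<^esub>}" unfolding \<phi>_L[symmetric] by (rule imageI)
  then show "p \<in> K" using p by (simp add: K_iff L_iff)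
qed

lemma K_sign: "p \<in> K \<Longrightarrow> \<sigma> p = mat 1 \<or> \<sigma> p = - mat 1" using \<sigma>_K by blast

lemma K_iff_sign: "p \<in> K \<longleftrightarrow> p \<in> carrier P \<and> (\<sigma> p = mat 1 \<or> \<sigma> p = - mat 1)"
proof
  assume "p \<in> carrier P \<and> (\<sigma> p = mat 1 \<or> \<sigma> p = - mat 1)"
  then have p: "p \<in> carrier P" "\<sigma> p \<in> \<sigma> ` K" unfolding \<sigma>_K_eq by auto
  then obtain k where k: "k \<in> K" "\<sigma> p = \<sigma> k" by blast
  have kc: "k \<in> carrier P" using k by (simp add: K_iff)
  have "\<sigma> (p \<otimes>\<^bsub>P\<^esub> inv\<^bsub>P\<^esub> k) = \<one>\<^bsub>SL2_Z5\<^esub>" using p(1) kc k(2) by (simp del: SL2_simps(2))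
  then have "p \<otimes>\<^bsub>P\<^esub> inv\<^bsub>P\<^esub> k \<in> K" using L_sub_K p(1) kc by (auto simp: L_iff SL2_simps)
  then have "(p \<otimes>\<^bsub>P\<^esub> inv\<^bsub>P\<^esub> k) \<otimes>\<^bsub>P\<^esub> k \<in> K" using subgroup.m_closed[OF sub(1)] k(1) by blast
  then show "p \<in> K" using p(1) kc by (simp add: m_assoc)
qed (use K_sign K_iff in blast)

lemma exists_minus: "\<exists>k\<in>K. \<sigma> k = - mat 1"
proof -
  have "- mat 1 \<in> \<sigma> ` K" unfolding \<sigma>_K_eq by simp
  then obtain k where "- mat 1 = \<sigma> k" "k \<in> K" by (rule imageE)
  then show ?thesis by (intro bexI[of _ k]) simp_all
qed

lemma mat5_minus_mult: "(A::mat5) ** (- mat 1) = - A" "(- mat 1) ** A = - A"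
  by (subst (1 2) mat2_eq[of A], simp add: mat2_one)+

lemma K_mult_L: "k \<in> K \<Longrightarrow> k' \<in> K \<Longrightarrow> k \<otimes>\<^bsub>P\<^esub> k' \<in> L \<longleftrightarrow> (k \<in> L \<longleftrightarrow> k' \<in> L)"
  using K_sign[of k] K_sign[of k'] mat5_one_neq
  by (auto simp: L_iff K_iff \<sigma>_mult mat5_minus_mult)

text \<open>An element whose square is sent to \<open>1\<close> is sent to \<open>\<plusminus>1\<close>, because \<open>-1\<close> is the only involution of
  \<open>SL\<^sub>2(\<int>/5)\<close>.\<close>

lemma square_in_L: "p \<in> carrier P \<Longrightarrow> p \<otimes>\<^bsub>P\<^esub> p \<in> L \<Longrightarrow> p \<in> K"
  using mat5_square_one[OF det_\<sigma>[of p]] by (auto simp: K_iff_sign L_iff \<sigma>_mult)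

text \<open>In the cases of \<open>mat5_ratio\<close> other than \<open>W\<^sup>5 = -1\<close> the images \<open>x\<close>, \<open>y\<close> of \<open>p\<close>, \<open>q\<close> in \<open>A\<^sub>5\<close>, with \<open>y\<close> replaced by
  its inverse where necessary, satisfy \<open>(x/y)\<^sup>3 = 1\<close>, and \<open>A\<^sub>5\<close> has no such generators.\<close>

lemma generating_ratio:
  assumes p: "p \<in> carrier P" "p \<otimes>\<^bsub>P\<^esub> p \<otimes>\<^bsub>P\<^esub> p \<in> L" and q: "q \<in> carrier P" "q \<otimes>\<^bsub>P\<^esub> q \<otimes>\<^bsub>P\<^esub> q \<in> L"
    and gen: "generate A5 {\<phi> p, \<phi> q} = carrier A5"
  shows "inv\<^bsub>P\<^esub> q \<otimes>\<^bsub>P\<^esub> p \<notin> K" and "(inv\<^bsub>P\<^esub> q \<otimes>\<^bsub>P\<^esub> p) [^]\<^bsub>P\<^esub> (5::nat) \<in> K - L"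
proof -
  note [simp] = p(1) q(1)
  let ?x = "\<phi> p" and ?y = "\<phi> q" and ?w = "inv\<^bsub>P\<^esub> q \<otimes>\<^bsub>P\<^esub> p"
  have xy: "?x \<in> carrier A5" "?y \<in> carrier A5" by simp_all
  have \<phi>3: "\<phi> a \<otimes>\<^bsub>A5\<^esub> (\<phi> a \<otimes>\<^bsub>A5\<^esub> \<phi> a) = \<one>\<^bsub>A5\<^esub>" if "a \<in> carrier P" "a \<otimes>\<^bsub>P\<^esub> a \<otimes>\<^bsub>P\<^esub> a \<in> K" for a
    using that by (simp add: K_iff A5.m_assoc)
  have x3: "?x \<otimes>\<^bsub>A5\<^esub> (?x \<otimes>\<^bsub>A5\<^esub> ?x) = \<one>\<^bsub>A5\<^esub>" and y3: "?y \<otimes>\<^bsub>A5\<^esub> (?y \<otimes>\<^bsub>A5\<^esub> ?y) = \<one>\<^bsub>A5\<^esub>"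
    using \<phi>3 p(2) q(2) L_sub_K by auto
  have no: False if "(?x \<otimes>\<^bsub>A5\<^esub> inv\<^bsub>A5\<^esub> ?y) \<otimes>\<^bsub>A5\<^esub> ((?x \<otimes>\<^bsub>A5\<^esub> inv\<^bsub>A5\<^esub> ?y) \<otimes>\<^bsub>A5\<^esub> (?x \<otimes>\<^bsub>A5\<^esub> inv\<^bsub>A5\<^esub> ?y)) = \<one>\<^bsub>A5\<^esub>"
    using A5_not_generated_333[OF xy(1) x3 xy(2) y3 that] gen by blast
  have gen': "generate A5 {?x, inv\<^bsub>A5\<^esub> ?y} = carrier A5"
  proof -
    have s: "subgroup (generate A5 {?x, inv\<^bsub>A5\<^esub> ?y}) A5" by (intro A5.generate_is_subgroup) (use xy in auto)
    have "inv\<^bsub>A5\<^esub> (inv\<^bsub>A5\<^esub> ?y) \<in> generate A5 {?x, inv\<^bsub>A5\<^esub> ?y}"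
      by (intro subgroup.m_inv_closed[OF s] generate.incl) simp
    then have "{?x, ?y} \<subseteq> generate A5 {?x, inv\<^bsub>A5\<^esub> ?y}" using generate.incl[of ?x "{?x, inv\<^bsub>A5\<^esub> ?y}" A5] xy by auto
    from A5.generate_subgroup_incl[OF this s] show ?thesis
      using gen subgroup.subset[OF s] by blast
  qed
  have no': False if "(?x \<otimes>\<^bsub>A5\<^esub> ?y) \<otimes>\<^bsub>A5\<^esub> ((?x \<otimes>\<^bsub>A5\<^esub> ?y) \<otimes>\<^bsub>A5\<^esub> (?x \<otimes>\<^bsub>A5\<^esub> ?y)) = \<one>\<^bsub>A5\<^esub>"
    using A5_not_generated_333[OF xy(1) x3 A5.inv_closed[OF xy(2)] A5.cube_inv[OF xy(2) y3]] that gen' xy by simp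
  have nq: False if "?x = ?y"
    using no xy that by simp
  have \<phi>w: "\<phi> ?w = inv\<^bsub>A5\<^esub> ?y \<otimes>\<^bsub>A5\<^esub> ?x" by simp
  show wK: "?w \<notin> K"
  proof
    assume "?w \<in> K"
    then have "inv\<^bsub>A5\<^esub> ?y \<otimes>\<^bsub>A5\<^esub> ?x = \<one>\<^bsub>A5\<^esub>" using \<phi>w by (simp add: K_iff)
    then have "inv\<^bsub>A5\<^esub> ?x = inv\<^bsub>A5\<^esub> ?y" using A5.inv_equality[of "inv\<^bsub>A5\<^esub> ?y" ?x] xy by simp
    then have "?x = ?y" using A5.inv_inv[OF xy(1)] A5.inv_inv[OF xy(2)] by metis
    then show False by (rule nq)
  qed
  have pK: "p \<notin> K"
  proof
    assume "p \<in> K"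
    then have "?x = \<one>\<^bsub>A5\<^esub>" by (simp add: K_iff)
    then show False using no' y3 xy by simp
  qed
  have qK: "q \<notin> K"
  proof
    assume "q \<in> K"
    then have "?y = \<one>\<^bsub>A5\<^esub>" by (simp add: K_iff)
    then show False using no' x3 xy by simp
  qed
  let ?A = "\<sigma> p" and ?B = "\<sigma> q" and ?W = "\<sigma> ?w"
  have A: "det ?A = 1" "?A ** ?A ** ?A = mat 1" "?A \<noteq> mat 1"
    using det_\<sigma> p(2) pK by (simp_all add: L_iff \<sigma>_mult K_iff_sign)
  have B: "det ?B = 1" "?B ** ?B ** ?B = mat 1" "?B \<noteq> mat 1"
    using det_\<sigma> q(2) qK by (simp_all add: L_iff \<sigma>_mult K_iff_sign)
  have W: "?W = ?B ** ?B ** ?A"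
  proof -
    have "(?B ** ?B) \<otimes>\<^bsub>SL2_Z5\<^esub> ?B = \<one>\<^bsub>SL2_Z5\<^esub>" using B(2) by (simp add: SL2_simps)
    then have "inv\<^bsub>SL2_Z5\<^esub> ?B = ?B ** ?B" using B(1) by (intro SL2.inv_equality) (simp_all add: SL2_simps det_mul)
    then have "\<sigma> (inv\<^bsub>P\<^esub> q) = ?B ** ?B" by simp
    then show ?thesis by (simp add: \<sigma>_mult)
  qed
  consider "?W ** ?W = - mat 1" | "?W ** ?W ** ?W = mat 1 \<or> ?W ** ?W ** ?W = - mat 1"
    | "(?B ** ?A) ** (?B ** ?A) ** (?B ** ?A) = mat 1" | "?W ** ?W ** ?W ** ?W ** ?W = - mat 1"
    using mat5_ratio[OF A B] unfolding W by blast
  then show "?w [^]\<^bsub>P\<^esub> (5::nat) \<in> K - L"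
  proof cases
    case 1
    then have "?w \<otimes>\<^bsub>P\<^esub> ?w \<in> K" by (simp add: K_iff_sign \<sigma>_mult)
    then have "(inv\<^bsub>A5\<^esub> ?y \<otimes>\<^bsub>A5\<^esub> ?x) \<otimes>\<^bsub>A5\<^esub> (inv\<^bsub>A5\<^esub> ?y \<otimes>\<^bsub>A5\<^esub> ?x) = \<one>\<^bsub>A5\<^esub>" by (simp add: K_iff)
    then show ?thesis
      using A5.cube_of_square[OF A5.inv_closed[OF xy(2)] A5.cube_inv[OF xy(2) y3] xy(1) x3] no' xy by simp
  next
    case 2
    then have "?w \<otimes>\<^bsub>P\<^esub> ?w \<otimes>\<^bsub>P\<^esub> ?w \<in> K" by (auto simp: K_iff_sign \<sigma>_mult)
    then have "\<phi> ?w \<otimes>\<^bsub>A5\<^esub> (\<phi> ?w \<otimes>\<^bsub>A5\<^esub> \<phi> ?w) = \<one>\<^bsub>A5\<^esub>" by (intro \<phi>3) simp_all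
    then show ?thesis using A5.cube_conj[OF A5.inv_closed[OF xy(2)] xy(1)] no unfolding \<phi>w by blast
  next
    case 3
    then have "(q \<otimes>\<^bsub>P\<^esub> p) \<otimes>\<^bsub>P\<^esub> (q \<otimes>\<^bsub>P\<^esub> p) \<otimes>\<^bsub>P\<^esub> (q \<otimes>\<^bsub>P\<^esub> p) \<in> K" by (simp add: K_iff_sign \<sigma>_mult)
    then have "\<phi> (q \<otimes>\<^bsub>P\<^esub> p) \<otimes>\<^bsub>A5\<^esub> (\<phi> (q \<otimes>\<^bsub>P\<^esub> p) \<otimes>\<^bsub>A5\<^esub> \<phi> (q \<otimes>\<^bsub>P\<^esub> p)) = \<one>\<^bsub>A5\<^esub>" by (intro \<phi>3) simp_all
    then have "(?y \<otimes>\<^bsub>A5\<^esub> ?x) \<otimes>\<^bsub>A5\<^esub> ((?y \<otimes>\<^bsub>A5\<^esub> ?x) \<otimes>\<^bsub>A5\<^esub> (?y \<otimes>\<^bsub>A5\<^esub> ?x)) = \<one>\<^bsub>A5\<^esub>" by simp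
    then show ?thesis using A5.cube_conj[OF xy(2,1)] no' by blast
  next
    case 4
    have w5: "?w [^]\<^bsub>P\<^esub> (5::nat) = ?w \<otimes>\<^bsub>P\<^esub> ?w \<otimes>\<^bsub>P\<^esub> ?w \<otimes>\<^bsub>P\<^esub> ?w \<otimes>\<^bsub>P\<^esub> ?w"
      by (simp add: numeral_nat)
    have "\<sigma> (?w [^]\<^bsub>P\<^esub> (5::nat)) = - mat 1" unfolding w5 using 4 by (simp only: \<sigma>_mult m_closed inv_closed p(1) q(1))
    then show ?thesis using mat5_one_neq by (simp add: K_iff_sign L_iff)
  qed
qed

end

lemma (in group) rcoset_eq_iff:
  assumes N: "subgroup N G" and p: "p \<in> carrier G" and q: "q \<in> carrier G"
  shows "N #> p = N #> q \<longleftrightarrow> p \<otimes> inv q \<in> N"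
proof
  assume "N #> p = N #> q"
  then have "N #> (p \<otimes> inv q) = N" using coset_mult_inv2[OF _ p q subgroup.subset[OF N]] by blast
  then show "p \<otimes> inv q \<in> N" using coset_join1[OF _ _ N] p q by blast
next
  assume "p \<otimes> inv q \<in> N"
  then have "N #> (p \<otimes> inv q) = N" using coset_join2[OF _ N, of "p \<otimes> inv q"] p q by simp
  then show "N #> p = N #> q" using coset_mult_inv1[OF _ p q subgroup.subset[OF N]] by blast
qed

section \<open>Vectors on the six cosets\<close>

lemma coset_vectors_simps:
  "carrier (coset_vectors D) = (rcosets\<^bsub>A5\<^esub> D \<rightarrow>\<^sub>E {0..<2})"
  "u \<otimes>\<^bsub>coset_vectors D\<^esub> v = (\<lambda>\<omega>\<in>rcosets\<^bsub>A5\<^esub> D. (u \<omega> + v \<omega>) mod 2)"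
  "\<one>\<^bsub>coset_vectors D\<^esub> = (\<lambda>\<omega>\<in>rcosets\<^bsub>A5\<^esub> D. 0)"
  by (simp_all add: coset_vectors_def carrier_integer_mod_group)

definition indic :: "(nat \<Rightarrow> nat) set \<Rightarrow> (nat \<Rightarrow> nat) set set \<Rightarrow> (nat \<Rightarrow> nat) set \<Rightarrow> int" where
  "indic D S = (\<lambda>\<omega>\<in>rcosets\<^bsub>A5\<^esub> D. if \<omega> \<in> S then 1 else 0)"

lemma group_coset_vectors: "group (coset_vectors D)" by (simp add: coset_vectors_def)

lemma comm_group_coset_vectors: "comm_group (coset_vectors D)"
proof -
  interpret group "coset_vectors D" by (rule group_coset_vectors)
  show ?thesis by (rule group_comm_groupI) (simp add: coset_vectors_simps add.commute)
qed

lemma indic_closed: "indic D S \<in> carrier (coset_vectors D)"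
  by (auto simp: indic_def coset_vectors_simps)

lemma indic_mult: "indic D S \<otimes>\<^bsub>coset_vectors D\<^esub> indic D T = indic D (sym_diff S T)"
  by (auto simp: indic_def coset_vectors_simps intro!: restrict_ext)

lemma indic_empty: "indic D {} = \<one>\<^bsub>coset_vectors D\<^esub>" by (simp add: indic_def coset_vectors_simps)

lemma indic_inv: "inv\<^bsub>coset_vectors D\<^esub> indic D S = indic D S"
proof -
  interpret group "coset_vectors D" by (rule group_coset_vectors)
  show ?thesis by (intro inv_equality indic_closed) (simp add: indic_mult indic_empty)
qed

lemma indic_inject:
  assumes "S \<subseteq> rcosets\<^bsub>A5\<^esub> D" "T \<subseteq> rcosets\<^bsub>A5\<^esub> D" "indic D S = indic D T"
  shows "S = T"
proof -
  have "\<omega> \<in> S \<longleftrightarrow> \<omega> \<in> T" if "\<omega> \<in> rcosets\<^bsub>A5\<^esub> D" for \<omega>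
    using fun_cong[OF assms(3), of \<omega>] that by (simp add: indic_def split: if_splits)
  then show ?thesis using assms(1,2) by blast
qed

text \<open>Coordinates are \<open>0\<close> or \<open>1\<close>, so a vector is determined by its support.\<close>

lemma vector_indic:
  assumes v: "v \<in> carrier (coset_vectors D)"
  shows "v = indic D {\<omega> \<in> rcosets\<^bsub>A5\<^esub> D. v \<omega> \<noteq> 0}"
proof
  fix \<omega>
  show "v \<omega> = indic D {\<omega> \<in> rcosets\<^bsub>A5\<^esub> D. v \<omega> \<noteq> 0} \<omega>"
  proof (cases "\<omega> \<in> rcosets\<^bsub>A5\<^esub> D")
    case True
    then have "v \<omega> \<in> {0..<2}" using v unfolding coset_vectors_simps by (rule PiE_mem[rotated])
    then show ?thesis using True by (auto simp: indic_def)
  next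
    case False
    then show ?thesis using v PiE_arb[of v _ _ \<omega>] by (simp add: indic_def coset_vectors_simps)
  qed
qed

lemma weight_indic: "S \<subseteq> rcosets\<^bsub>A5\<^esub> D \<Longrightarrow> weight D (indic D S) = card S"
  unfolding weight_def by (intro arg_cong[of _ _ card]) (auto simp: indic_def)

lemma constant_vectors_eq: "constant_vectors D = {indic D {}, indic D (rcosets\<^bsub>A5\<^esub> D)}"
proof -
  interpret group "coset_vectors D" by (rule group_coset_vectors)
  let ?X = "rcosets\<^bsub>A5\<^esub> D"
  have e: "(\<lambda>\<omega>\<in>?X. 1) = indic D ?X" by (auto simp: indic_def intro!: restrict_ext)
  have "subgroup {indic D {}, indic D ?X} (coset_vectors D)"
    by (rule subgroupI) (auto simp: indic_closed indic_inv indic_mult)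
  then have "generate (coset_vectors D) {indic D ?X} \<subseteq> {indic D {}, indic D ?X}"
    by (intro generate_subgroup_incl) auto
  moreover have "{indic D {}, indic D ?X} \<subseteq> generate (coset_vectors D) {indic D ?X}"
    using generate.one[of "coset_vectors D"] by (auto simp: indic_empty intro: generate.incl)
  ultimately show ?thesis unfolding constant_vectors_def e by blast
qed

lemma constant_vectors_normal: "constant_vectors D \<lhd> coset_vectors D"
proof -
  interpret comm_group "coset_vectors D" by (rule comm_group_coset_vectors)
  show ?thesis unfolding constant_vectors_def
    by (intro subgroup_imp_normal generate_is_subgroup) (auto simp: coset_vectors_simps)
qed

lemma vec_class_mult:
  "vec_class D (indic D S) \<otimes>\<^bsub>coset_vectors D Mod constant_vectors D\<^esub> vec_class D (indic D T) = vec_class D (indic D (sym_diff S T))"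
  unfolding vec_class_def using normal.rcos_sum[OF constant_vectors_normal indic_closed indic_closed]
  by (simp add: FactGroup_def indic_mult)

lemma vec_class_eq_iff:
  assumes "S \<subseteq> rcosets\<^bsub>A5\<^esub> D" "T \<subseteq> rcosets\<^bsub>A5\<^esub> D"
  shows "vec_class D (indic D S) = vec_class D (indic D T) \<longleftrightarrow> T = S \<or> T = rcosets\<^bsub>A5\<^esub> D - S"
proof -
  interpret group "coset_vectors D" by (rule group_coset_vectors)
  have "vec_class D (indic D S) = vec_class D (indic D T) \<longleftrightarrow> indic D (sym_diff S T) \<in> constant_vectors D"
    unfolding vec_class_def
    using rcoset_eq_iff[OF normal_imp_subgroup[OF constant_vectors_normal] indic_closed indic_closed]
    by (simp add: indic_inv indic_mult)
  also have "\<dots> \<longleftrightarrow> sym_diff S T = {} \<or> sym_diff S T = rcosets\<^bsub>A5\<^esub> D"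
  proof -
    have s: "sym_diff S T \<subseteq> rcosets\<^bsub>A5\<^esub> D" using assms by blast
    have "indic D (sym_diff S T) = indic D U \<longleftrightarrow> sym_diff S T = U" if "U \<subseteq> rcosets\<^bsub>A5\<^esub> D" for U
      using indic_inject[OF s that] by metis
    then show ?thesis unfolding constant_vectors_eq by simp
  qed
  also have "\<dots> \<longleftrightarrow> T = S \<or> T = rcosets\<^bsub>A5\<^esub> D - S" using assms by blast
  finally show ?thesis .
qed

section \<open>The extensions \<open>G\<^sub>1\<close> and \<open>R\<close>\<close>

context frattini_SL2
begin

declare mult_FactGroup [simp del] one_FactGroup [simp del]

abbreviation "K1 \<equiv> comm_sq_closure P T K K"
abbreviation "K1' \<equiv> comm_sq_closure P T K L"
abbreviation "G1 \<equiv> P Mod K1"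
abbreviation "R \<equiv> P Mod K1'"
abbreviation "pr \<equiv> \<lambda>Y. the_elem (\<phi> ` Y)"
abbreviation "\<pi> \<equiv> \<lambda>Y. K1 <#>\<^bsub>P\<^esub> Y"
abbreviation "M \<equiv> kernel G1 A5 pr"
abbreviation "q1 \<equiv> \<lambda>p. K1 #>\<^bsub>P\<^esub> p"
abbreviation "q2 \<equiv> \<lambda>p. K1' #>\<^bsub>P\<^esub> p"

lemma K_carrier: "p \<in> K \<Longrightarrow> p \<in> carrier P" by (simp add: kernel_def)
lemma KL_sub: "K \<subseteq> carrier P" "L \<subseteq> carrier P" by (auto simp: kernel_def)

lemma K1_normal: "K1 \<lhd> P" and K1'_normal: "K1' \<lhd> P"
  using comm_sq_closure_normal[OF top] normal by blast+

lemma sub1: "subgroup K1 P" "subgroup K1' P" using K1_normal K1'_normal normal_imp_subgroup by blast+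

lemma comm_sq_KK_L: "comm_sq P K K \<subseteq> L"
proof
  have iL: "inv\<^bsub>P\<^esub> k \<in> L \<longleftrightarrow> k \<in> L" if "k \<in> K" for k
    using subgroup.m_inv_closed[OF sub(2)] that by (metis K_carrier inv_inv)
  fix x assume "x \<in> comm_sq P K K"
  then consider (a) k l where "k \<in> K" "l \<in> K" "x = inv\<^bsub>P\<^esub> k \<otimes>\<^bsub>P\<^esub> inv\<^bsub>P\<^esub> l \<otimes>\<^bsub>P\<^esub> k \<otimes>\<^bsub>P\<^esub> l"
    | (b) l where "l \<in> K" "x = l \<otimes>\<^bsub>P\<^esub> l" unfolding comm_sq_def by blast
  then show "x \<in> L"
  proof cases
    case a
    have c: "inv\<^bsub>P\<^esub> k \<in> K" "inv\<^bsub>P\<^esub> l \<in> K" "inv\<^bsub>P\<^esub> k \<otimes>\<^bsub>P\<^esub> inv\<^bsub>P\<^esub> l \<in> K" "inv\<^bsub>P\<^esub> k \<otimes>\<^bsub>P\<^esub> inv\<^bsub>P\<^esub> l \<otimes>\<^bsub>P\<^esub> k \<in> K"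
      using a subgroup.m_closed[OF sub(1)] subgroup.m_inv_closed[OF sub(1)] by simp_all
    show ?thesis unfolding a(3) K_mult_L[OF c(4) a(2)] K_mult_L[OF c(3) a(1)] K_mult_L[OF c(1,2)] iL[OF a(1)] iL[OF a(2)]
      by blast
  next
    case b
    then show ?thesis using K_mult_L by blast
  qed
qed

lemma K1_sub_L: "K1 \<subseteq> L" by (rule comm_sq_closure_least[OF top sub(2) clopen(4) comm_sq_KK_L])

lemma K1'_sub_K1: "K1' \<subseteq> K1"
proof (rule comm_sq_closure_least[OF top sub1(1)])
  show "closedin T K1" by (rule comm_sq_closure_closed[OF top])
  have "comm_sq P K L \<subseteq> comm_sq P K K" using L_sub_K unfolding comm_sq_def by blast
  then show "comm_sq P K L \<subseteq> K1" using comm_sq_in_closure[OF top KL_sub(1,1)] by blast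
qed

sublocale G1: group "P Mod K1" by (rule normal.factorgroup_is_group[OF K1_normal])
sublocale R: group "P Mod K1'" by (rule normal.factorgroup_is_group[OF K1'_normal])
sublocale q1: group_hom P "P Mod K1" q1
  by (intro group_hom.intro group_hom_axioms.intro is_group G1.is_group normal.r_coset_hom_Mod[OF K1_normal])
sublocale q2: group_hom P "P Mod K1'" q2
  by (intro group_hom.intro group_hom_axioms.intro is_group R.is_group normal.r_coset_hom_Mod[OF K1'_normal])

lemma G1_elem: "Y \<in> carrier G1 \<longleftrightarrow> (\<exists>p\<in>carrier P. Y = q1 p)" and R_elem: "Y \<in> carrier R \<longleftrightarrow> (\<exists>p\<in>carrier P. Y = q2 p)"
  by (auto simp: FactGroup_def RCOSETS_def)

lemma q_mult: "p \<in> carrier P \<Longrightarrow> q \<in> carrier P \<Longrightarrow> q1 p \<otimes>\<^bsub>G1\<^esub> q1 q = q1 (p \<otimes>\<^bsub>P\<^esub> q)"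
  "p \<in> carrier P \<Longrightarrow> q \<in> carrier P \<Longrightarrow> q2 p \<otimes>\<^bsub>R\<^esub> q2 q = q2 (p \<otimes>\<^bsub>P\<^esub> q)"
  using q1.hom_mult q2.hom_mult by metis+

lemma q_one: "q1 \<one>\<^bsub>P\<^esub> = \<one>\<^bsub>G1\<^esub>" "q2 \<one>\<^bsub>P\<^esub> = \<one>\<^bsub>R\<^esub>" using q1.hom_one q2.hom_one .

lemma q1_eq_iff: "p \<in> carrier P \<Longrightarrow> q \<in> carrier P \<Longrightarrow> q1 p = q1 q \<longleftrightarrow> p \<otimes>\<^bsub>P\<^esub> inv\<^bsub>P\<^esub> q \<in> K1"
  and q2_eq_iff: "p \<in> carrier P \<Longrightarrow> q \<in> carrier P \<Longrightarrow> q2 p = q2 q \<longleftrightarrow> p \<otimes>\<^bsub>P\<^esub> inv\<^bsub>P\<^esub> q \<in> K1'"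
  by (rule rcoset_eq_iff[OF sub1(1)], assumption+) (rule rcoset_eq_iff[OF sub1(2)])

lemma q2_one_iff: "p \<in> carrier P \<Longrightarrow> q2 p = \<one>\<^bsub>R\<^esub> \<longleftrightarrow> p \<in> K1'"
  using q2_eq_iff[of p "\<one>\<^bsub>P\<^esub>"] q_one by simp

lemma pr_q1: "p \<in> carrier P \<Longrightarrow> pr (q1 p) = \<phi> p"
proof -
  assume p: "p \<in> carrier P"
  have "\<phi> ` (q1 p) = {\<phi> p}"
  proof
    show "\<phi> ` (q1 p) \<subseteq> {\<phi> p}"
    proof
      fix y assume "y \<in> \<phi> ` (q1 p)"
      then obtain h where h: "h \<in> K1" "y = \<phi> (h \<otimes>\<^bsub>P\<^esub> p)" by (auto simp: r_coset_def)
      then have "h \<in> K" using K1_sub_L L_sub_K by blast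
      then show "y \<in> {\<phi> p}" using h(2) p by (simp add: K_iff)
    qed
    have "p \<in> q1 p" using rcos_self[OF p sub1(1)] .
    then show "{\<phi> p} \<subseteq> \<phi> ` (q1 p)" by blast
  qed
  then show ?thesis by simp
qed

lemma pr_hom: "group_hom G1 A5 pr"
proof (intro group_hom.intro group_hom_axioms.intro homI G1.is_group A5_group)
  fix x assume x: "x \<in> carrier G1"
  then obtain p where p: "p \<in> carrier P" "x = q1 p" using G1_elem by blast
  then show "pr x \<in> carrier A5" by (simp add: pr_q1)
  fix y assume "y \<in> carrier G1"
  then obtain q where q: "q \<in> carrier P" "y = q1 q" using G1_elem by blast
  have "pr (x \<otimes>\<^bsub>G1\<^esub> y) = pr (q1 (p \<otimes>\<^bsub>P\<^esub> q))" unfolding p(2) q(2) using q_mult(1)[OF p(1) q(1)] by (rule arg_cong)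
  also have "\<dots> = \<phi> (p \<otimes>\<^bsub>P\<^esub> q)" using p(1) q(1) by (intro pr_q1) simp
  also have "\<dots> = pr x \<otimes>\<^bsub>A5\<^esub> pr y" using p q by (simp add: pr_q1)
  finally show "pr (x \<otimes>\<^bsub>G1\<^esub> y) = pr x \<otimes>\<^bsub>A5\<^esub> pr y" .
qed

lemma M_iff: "Y \<in> M \<longleftrightarrow> Y \<in> carrier G1 \<and> pr Y = \<one>\<^bsub>A5\<^esub>"
  by (simp only: kernel_def mem_Collect_eq)

lemma q1_in_M: "p \<in> carrier P \<Longrightarrow> q1 p \<in> M \<longleftrightarrow> p \<in> K"
  unfolding M_iff K_iff using pr_q1 q1.hom_closed by simp

lemma M_elem: "Y \<in> M \<longleftrightarrow> (\<exists>p\<in>K. Y = q1 p)"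
proof
  assume Y: "Y \<in> M"
  then obtain p where "p \<in> carrier P" "Y = q1 p" using G1_elem M_iff by blast
  then show "\<exists>p\<in>K. Y = q1 p" using Y q1_in_M by blast
qed (use q1_in_M K_carrier in blast)

lemma pr_surj: "pr ` carrier G1 = carrier A5"
proof -
  have "pr ` carrier G1 = pr ` q1 ` carrier P" by (simp only: carrier_FactGroup)
  also have "\<dots> = \<phi> ` carrier P" by (simp add: image_image pr_q1)
  finally show ?thesis using surj(1) by simp
qed

lemma \<pi>_q2: "p \<in> carrier P \<Longrightarrow> \<pi> (q2 p) = q1 p"
proof -
  assume p: "p \<in> carrier P"
  have c: "h \<in> carrier P" if "h \<in> K1" for h using subgroup.mem_carrier[OF sub1(1) that] .
  show ?thesis
  proof
    show "\<pi> (q2 p) \<subseteq> q1 p"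
    proof
      fix y assume "y \<in> \<pi> (q2 p)"
      then obtain h h' where h: "h \<in> K1" "h' \<in> K1'" "y = h \<otimes>\<^bsub>P\<^esub> (h' \<otimes>\<^bsub>P\<^esub> p)" by (auto simp: set_mult_def r_coset_def)
      then have h': "h' \<in> K1" using K1'_sub_K1 by blast
      then have "y = (h \<otimes>\<^bsub>P\<^esub> h') \<otimes>\<^bsub>P\<^esub> p" using h c p by (simp add: m_assoc)
      then show "y \<in> q1 p" using subgroup.m_closed[OF sub1(1) h(1) h'] unfolding r_coset_def by blast
    qed
    show "q1 p \<subseteq> \<pi> (q2 p)"
    proof
      fix y assume "y \<in> q1 p"
      then obtain h where h: "h \<in> K1" "y = h \<otimes>\<^bsub>P\<^esub> p" by (auto simp: r_coset_def)
      moreover have "p \<in> q2 p" using rcos_self[OF p sub1(2)] .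
      ultimately show "y \<in> \<pi> (q2 p)" unfolding set_mult_def by blast
    qed
  qed
qed

lemma \<pi>_hom: "\<pi> \<in> hom R G1"
proof (rule homI)
  fix x assume x: "x \<in> carrier R"
  then obtain p where p: "p \<in> carrier P" "x = q2 p" using R_elem by blast
  then show "\<pi> x \<in> carrier G1" using G1_elem by (auto simp: \<pi>_q2)
  fix y assume "y \<in> carrier R"
  then obtain q where q: "q \<in> carrier P" "y = q2 q" using R_elem by blast
  have "\<pi> (x \<otimes>\<^bsub>R\<^esub> y) = \<pi> (q2 (p \<otimes>\<^bsub>P\<^esub> q))" unfolding p(2) q(2) using q_mult(2)[OF p(1) q(1)] by (rule arg_cong)
  also have "\<dots> = q1 (p \<otimes>\<^bsub>P\<^esub> q)" using p(1) q(1) by (intro \<pi>_q2) simp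
  also have "\<dots> = q1 p \<otimes>\<^bsub>G1\<^esub> q1 q" using q_mult(1)[OF p(1) q(1)] by (rule sym)
  also have "\<dots> = \<pi> x \<otimes>\<^bsub>G1\<^esub> \<pi> y" unfolding p(2) q(2) using p(1) q(1) \<pi>_q2 by simp
  finally show "\<pi> (x \<otimes>\<^bsub>R\<^esub> y) = \<pi> x \<otimes>\<^bsub>G1\<^esub> \<pi> y" .
qed

lemma \<pi>_surj: "\<pi> ` carrier R = carrier G1"
proof -
  have "\<pi> ` carrier R = \<pi> ` q2 ` carrier P" by (simp only: carrier_FactGroup)
  also have "\<dots> = q1 ` carrier P" by (simp add: image_image \<pi>_q2)
  finally show ?thesis by (simp only: carrier_FactGroup)
qed

lemma \<pi>_in_M:
  assumes "y \<in> carrier R" "\<pi> y \<in> M" obtains p where "p \<in> K" "y = q2 p" "\<pi> y = q1 p"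
proof -
  obtain p where p: "p \<in> carrier P" "y = q2 p" using R_elem assms(1) by blast
  then have "\<pi> y = q1 p" using \<pi>_q2 by simp
  then show ?thesis using that p q1_in_M assms(2) by simp
qed

text \<open>\<open>L/K1'\<close> is central of exponent two in \<open>K/K1'\<close> and has index two there.\<close>

lemma q2_comm_L: "k \<in> K \<Longrightarrow> l \<in> L \<Longrightarrow> q2 (k \<otimes>\<^bsub>P\<^esub> l) = q2 (l \<otimes>\<^bsub>P\<^esub> k)"
proof -
  assume kl: "k \<in> K" "l \<in> L"
  then have c: "k \<in> carrier P" "l \<in> carrier P" using KL_sub by auto
  note [simp] = c
  have i: "inv\<^bsub>P\<^esub> k \<in> K" "inv\<^bsub>P\<^esub> l \<in> L" using kl subgroup.m_inv_closed sub by metis+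
  then have "inv\<^bsub>P\<^esub> (inv\<^bsub>P\<^esub> k) \<otimes>\<^bsub>P\<^esub> inv\<^bsub>P\<^esub> (inv\<^bsub>P\<^esub> l) \<otimes>\<^bsub>P\<^esub> inv\<^bsub>P\<^esub> k \<otimes>\<^bsub>P\<^esub> inv\<^bsub>P\<^esub> l \<in> comm_sq P K L"
    unfolding comm_sq_def by blast
  then have "k \<otimes>\<^bsub>P\<^esub> l \<otimes>\<^bsub>P\<^esub> inv\<^bsub>P\<^esub> (l \<otimes>\<^bsub>P\<^esub> k) \<in> K1'"
    using comm_sq_in_closure[OF top KL_sub] by (auto simp: inv_mult_group m_assoc)
  then show ?thesis by (intro iffD2[OF q2_eq_iff]) simp_all
qed

lemma sq_L: "l \<in> L \<Longrightarrow> l \<otimes>\<^bsub>P\<^esub> l \<in> K1'"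
  by (rule subsetD[OF comm_sq_in_closure[OF top KL_sub]]) (auto simp: comm_sq_def)

lemma q2_sq_L: "l \<in> L \<Longrightarrow> q2 (l \<otimes>\<^bsub>P\<^esub> l) = \<one>\<^bsub>R\<^esub>"
  by (rule iffD2[OF q2_one_iff sq_L]) (auto simp: kernel_def)

lemma K_diff_L: "k \<in> K - L \<Longrightarrow> k' \<in> K - L \<Longrightarrow> \<exists>l\<in>L. k' = k \<otimes>\<^bsub>P\<^esub> l"
proof -
  assume k: "k \<in> K - L" "k' \<in> K - L"
  have c: "k \<in> carrier P" "k' \<in> carrier P" using k KL_sub by auto
  have "inv\<^bsub>P\<^esub> k \<notin> L" using k subgroup.m_inv_closed[OF sub(2), of "inv\<^bsub>P\<^esub> k"] c by auto
  then have "inv\<^bsub>P\<^esub> k \<otimes>\<^bsub>P\<^esub> k' \<in> L" using K_mult_L[of "inv\<^bsub>P\<^esub> k" k'] k subgroup.m_inv_closed[OF sub(1)] by blast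
  moreover have "k' = k \<otimes>\<^bsub>P\<^esub> (inv\<^bsub>P\<^esub> k \<otimes>\<^bsub>P\<^esub> k')" using c by (simp flip: m_assoc)
  ultimately show ?thesis by blast
qed

lemma q2_comm: "k \<in> K \<Longrightarrow> k' \<in> K \<Longrightarrow> q2 (k \<otimes>\<^bsub>P\<^esub> k') = q2 (k' \<otimes>\<^bsub>P\<^esub> k)"
proof -
  assume k: "k \<in> K" "k' \<in> K"
  consider "k \<in> L" | "k' \<in> L" | "k \<in> K - L" "k' \<in> K - L" using k by blast
  then show ?thesis
  proof cases
    case 3
    then obtain l where l: "l \<in> L" "k' = k \<otimes>\<^bsub>P\<^esub> l" using K_diff_L by blast
    have c: "k \<in> carrier P" "l \<in> carrier P" using k l KL_sub by auto
    have "q2 (k \<otimes>\<^bsub>P\<^esub> k') = q2 k \<otimes>\<^bsub>R\<^esub> q2 (k \<otimes>\<^bsub>P\<^esub> l)" unfolding l(2) using c q_mult(2) by simp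
    also have "\<dots> = q2 k \<otimes>\<^bsub>R\<^esub> q2 (l \<otimes>\<^bsub>P\<^esub> k)" unfolding q2_comm_L[OF k(1) l(1)] ..
    also have "\<dots> = q2 (k' \<otimes>\<^bsub>P\<^esub> k)" unfolding l(2) using c q_mult(2) by (simp add: m_assoc)
    finally show ?thesis .
  qed (use q2_comm_L k in metis)+
qed

text \<open>If one element of \<open>K - L\<close> had its square in \<open>K1'\<close>, all would, and \<open>K1' = K1\<close>.\<close>

lemma K1_sub_of_trivial_square:
  assumes k: "k \<in> K - L" and sq: "q2 (k \<otimes>\<^bsub>P\<^esub> k) = \<one>\<^bsub>R\<^esub>"
  shows "K1 \<subseteq> K1'"
proof (rule comm_sq_closure_least[OF top sub1(2)])
  show "closedin T K1'" by (rule comm_sq_closure_closed[OF top])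
  have sqK: "l \<otimes>\<^bsub>P\<^esub> l \<in> K1'" if l: "l \<in> K" for l
  proof (cases "l \<in> L")
    case True then show ?thesis by (rule sq_L)
  next
    case False
    then obtain n where n: "n \<in> L" "l = k \<otimes>\<^bsub>P\<^esub> n" using K_diff_L[OF k] l by blast
    have c: "k \<in> carrier P" "n \<in> carrier P" using k n KL_sub by auto
    have "q2 (l \<otimes>\<^bsub>P\<^esub> l) = q2 k \<otimes>\<^bsub>R\<^esub> q2 (n \<otimes>\<^bsub>P\<^esub> k) \<otimes>\<^bsub>R\<^esub> q2 n" unfolding n(2) using c by (simp add: R.m_assoc)
    also have "q2 (n \<otimes>\<^bsub>P\<^esub> k) = q2 (k \<otimes>\<^bsub>P\<^esub> n)" using q2_comm_L[of k n] k n(1) by simp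
    also have "q2 k \<otimes>\<^bsub>R\<^esub> q2 (k \<otimes>\<^bsub>P\<^esub> n) \<otimes>\<^bsub>R\<^esub> q2 n = q2 (k \<otimes>\<^bsub>P\<^esub> k) \<otimes>\<^bsub>R\<^esub> q2 (n \<otimes>\<^bsub>P\<^esub> n)"
      using c by (simp add: R.m_assoc)
    also have "\<dots> = \<one>\<^bsub>R\<^esub>" unfolding sq q2_sq_L[OF n(1)] by (simp only: R.r_one R.one_closed)
    finally have "q2 (l \<otimes>\<^bsub>P\<^esub> l) = \<one>\<^bsub>R\<^esub>" .
    then show ?thesis by (rule iffD1[OF q2_one_iff, rotated]) (simp add: n c)
  qed
  have "inv\<^bsub>P\<^esub> a \<otimes>\<^bsub>P\<^esub> inv\<^bsub>P\<^esub> b \<otimes>\<^bsub>P\<^esub> a \<otimes>\<^bsub>P\<^esub> b \<in> K1'" if ab: "a \<in> K" "b \<in> K" for a b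
  proof -
    have c: "a \<in> carrier P" "b \<in> carrier P" using ab KL_sub by auto
    have i: "inv\<^bsub>P\<^esub> a \<in> K" "inv\<^bsub>P\<^esub> b \<in> K" using ab subgroup.m_inv_closed[OF sub(1)] by auto
    have "inv\<^bsub>P\<^esub> a \<otimes>\<^bsub>P\<^esub> inv\<^bsub>P\<^esub> b \<otimes>\<^bsub>P\<^esub> inv\<^bsub>P\<^esub> (inv\<^bsub>P\<^esub> b \<otimes>\<^bsub>P\<^esub> inv\<^bsub>P\<^esub> a) \<in> K1'"
      using q2_comm[OF i] q2_eq_iff[of "inv\<^bsub>P\<^esub> a \<otimes>\<^bsub>P\<^esub> inv\<^bsub>P\<^esub> b" "inv\<^bsub>P\<^esub> b \<otimes>\<^bsub>P\<^esub> inv\<^bsub>P\<^esub> a"] c by simp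
    then show ?thesis using c by (simp add: inv_mult_group m_assoc)
  qed
  then show "comm_sq P K K \<subseteq> K1'" using sqK unfolding comm_sq_def by blast
qed

text \<open>The preimage of a subgroup of the finite quotient is a finite union of closed cosets.\<close>

lemma frattini_G1:
  assumes fin: "finite (carrier G1)" and H: "subgroup H G1"
    and cover_H: "\<And>g. g \<in> carrier G1 \<Longrightarrow> \<exists>h\<in>H. \<exists>n\<in>M. g = h \<otimes>\<^bsub>G1\<^esub> n"
  shows "H = carrier G1"
proof -
  let ?C = "{p \<in> carrier P. q1 p \<in> H}"
  have Hc: "H \<subseteq> carrier G1" by (rule subgroup.subset[OF H])
  have "subgroup ?C P"
  proof (rule subgroupI)
    show "?C \<noteq> {}" using subgroup.one_closed[OF H] q_one(1) by (metis (mono_tags, lifting) empty_iff mem_Collect_eq one_closed)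
    fix a assume a: "a \<in> ?C"
    then show "inv\<^bsub>P\<^esub> a \<in> ?C" using subgroup.m_inv_closed[OF H] q1.hom_inv by simp
    fix b assume "b \<in> ?C"
    then show "a \<otimes>\<^bsub>P\<^esub> b \<in> ?C" using a subgroup.m_closed[OF H] q_mult(1)[of a b] by simp
  qed auto
  moreover have "closedin T ?C"
  proof -
    have "?C = \<Union>H"
    proof
      show "?C \<subseteq> \<Union>H" using rcos_self[OF _ sub1(1)] by blast
      show "\<Union>H \<subseteq> ?C"
      proof
        fix x assume "x \<in> \<Union>H"
        then obtain Y where Y: "Y \<in> H" "x \<in> Y" by blast
        then obtain p where p: "p \<in> carrier P" "Y = q1 p" using Hc G1_elem by blast
        then have "q1 p = q1 x" using Y repr_independence[OF _ p(1) sub1(1)] by blast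
        moreover have "x \<in> carrier P" using r_coset_subset_G[OF subgroup.subset[OF sub1(1)] p(1)] Y p by blast
        ultimately show "x \<in> ?C" using Y p by simp
      qed
    qed
    moreover have "closedin T (\<Union>H)"
    proof (rule closedin_Union)
      show "finite H" using Hc fin finite_subset by blast
      show "closedin T Y" if "Y \<in> H" for Y
      proof -
        have "Y \<in> carrier G1" using that Hc by blast
        then obtain p where "p \<in> carrier P" "Y = q1 p" using G1_elem by blast
        then show ?thesis using closedin_coset[OF top comm_sq_closure_closed[OF top]] by simp
      qed
    qed
    ultimately show ?thesis by simp
  qed
  moreover have "\<phi> ` ?C = carrier A5"
  proof
    show "carrier A5 \<subseteq> \<phi> ` ?C"
    proof
      fix a assume "a \<in> carrier A5"
      then have "a \<in> \<phi> ` carrier P" using surj(1) by simp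
      then obtain p where p: "a = \<phi> p" "p \<in> carrier P" by (rule imageE)
      then obtain h n where hn: "h \<in> H" "n \<in> M" "q1 p = h \<otimes>\<^bsub>G1\<^esub> n" using cover_H[of "q1 p"] G1_elem by blast
      have c: "h \<in> carrier G1" "n \<in> carrier G1" "pr n = \<one>\<^bsub>A5\<^esub>" using hn Hc by (auto simp: kernel_def)
      obtain q where q: "q \<in> carrier P" "h = q1 q" using c(1) G1_elem by blast
      have "a = pr (q1 p)" using p pr_q1 by simp
      also have "\<dots> = pr h \<otimes>\<^bsub>A5\<^esub> pr n" unfolding hn(3) using group_hom.hom_mult[OF pr_hom c(1,2)] .
      also have "\<dots> = pr h" using c group_hom.hom_closed[OF pr_hom c(1)] by simp
      also have "\<dots> = \<phi> q" using q pr_q1 by simp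
      finally show "a \<in> \<phi> ` ?C" using q hn(1) by blast
    qed
  qed auto
  ultimately have "?C = carrier P" using cover unfolding p_frattini_cover_def by blast
  then have "q1 p \<in> H" if "p \<in> carrier P" for p using that by blast
  then have "carrier G1 \<subseteq> H" unfolding carrier_FactGroup by (rule image_subsetI)
  then show ?thesis using Hc by blast
qed

end

section \<open>The module of the cover\<close>

locale coset_module_cover = frattini_SL2 P T \<phi> \<sigma>
  for P :: "'p monoid" and T :: "'p topology" and \<phi> :: "'p \<Rightarrow> nat \<Rightarrow> nat" and \<sigma> :: "'p \<Rightarrow> mat5" +
  fixes D :: "(nat \<Rightarrow> nat) set" and \<iota> :: "((nat \<Rightarrow> nat) set \<Rightarrow> int) set \<Rightarrow> 'p set" and z :: "'p set"
  assumes minus_one: "kernel R G1 \<pi> = {\<one>\<^bsub>R\<^esub>, z}" "z \<noteq> \<one>\<^bsub>R\<^esub>"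
    and D5: "dihedral_D5 D"
    and M_module: "coset_module_iso D G1 pr M \<iota>"
begin

abbreviation "X \<equiv> rcosets\<^bsub>A5\<^esub> D"

definition act :: "'p set \<Rightarrow> (nat \<Rightarrow> nat) set \<Rightarrow> (nat \<Rightarrow> nat) set" where
  "act g \<omega> = \<omega> #>\<^bsub>A5\<^esub> pr g"

definition m :: "(nat \<Rightarrow> nat) set set \<Rightarrow> 'p set" where "m S = \<iota> (vec_class D (indic D S))"

sublocale pr: group_hom "P Mod comm_sq_closure P T K K" "alt_group 5" pr by (rule pr_hom)

lemma coset_action:
  obtains r s where "dihedral_coset_action A5 r s" "D = generate A5 {r, s}"
  using dihedral_D5_coset_action[OF D5] .

lemma iso: "\<iota> \<in> iso (coset_vectors D Mod constant_vectors D) (G1\<lparr>carrier := M\<rparr>)"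
  using M_module by (simp add: coset_module_iso_def)

lemma class_closed: "vec_class D (indic D S) \<in> carrier (coset_vectors D Mod constant_vectors D)"
  unfolding carrier_FactGroup vec_class_def using indic_closed by blast

lemma M_eq: "M = m ` Pow X"
proof
  have bij: "bij_betw \<iota> (carrier (coset_vectors D Mod constant_vectors D)) M" using iso by (simp add: iso_def)
  show "M \<subseteq> m ` Pow X"
  proof
    fix g assume "g \<in> M"
    then have "g \<in> \<iota> ` carrier (coset_vectors D Mod constant_vectors D)" using bij by (simp add: bij_betw_def)
    then obtain C where C: "g = \<iota> C" "C \<in> carrier (coset_vectors D Mod constant_vectors D)" by (rule imageE)
    then obtain v where v: "v \<in> carrier (coset_vectors D)" "C = vec_class D v"
      unfolding carrier_FactGroup vec_class_def by blast
    have "g = m {\<omega> \<in> X. v \<omega> \<noteq> 0}" unfolding m_def C(1) v(2) using vector_indic[OF v(1)] by (rule arg_cong)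
    then show "g \<in> m ` Pow X" by blast
  qed
  show "m ` Pow X \<subseteq> M" using class_closed bij by (auto simp: m_def bij_betw_def)
qed

lemma m_in_M: "S \<subseteq> X \<Longrightarrow> m S \<in> M" unfolding M_eq by blast

lemma m_closed: "S \<subseteq> X \<Longrightarrow> m S \<in> carrier G1" using m_in_M M_iff by blast

lemma m_add: "m S \<otimes>\<^bsub>G1\<^esub> m T' = m (sym_diff S T')"
proof -
  have "\<iota> \<in> hom (coset_vectors D Mod constant_vectors D) (G1\<lparr>carrier := M\<rparr>)" using iso by (simp add: iso_def)
  from hom_mult[OF this class_closed class_closed, of S T'] show ?thesis
    unfolding m_def vec_class_mult by simp
qed

lemma m_eq:
  assumes "S \<subseteq> X" "T' \<subseteq> X"
  shows "m S = m T' \<longleftrightarrow> T' = S \<or> T' = X - S"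
proof -
  have "inj_on \<iota> (carrier (coset_vectors D Mod constant_vectors D))" using iso by (simp add: iso_def bij_betw_def)
  then have "m S = m T' \<longleftrightarrow> vec_class D (indic D S) = vec_class D (indic D T')"
    unfolding m_def using inj_on_eq_iff class_closed by metis
  then show ?thesis using vec_class_eq_iff[OF assms] by simp
qed

lemma conj_m:
  assumes S: "S \<subseteq> X" and g: "g \<in> carrier G1"
  shows "conj_by G1 (m S) g = m (act g ` S)"
proof -
  obtain r s where rs: "dihedral_coset_action A5 r s" "D = generate A5 {r, s}" using coset_action .
  interpret c: dihedral_coset_action "alt_group 5" r s by (rule rs(1))
  have pg: "pr g \<in> carrier A5" using pr.hom_closed[OF g] .
  have "coset_act D (indic D S) (pr g) = indic D (act g ` S)"
    unfolding coset_act_def indic_def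
  proof (rule restrict_ext)
    fix \<omega> assume w: "\<omega> \<in> X"
    then have w': "\<omega> #>\<^bsub>A5\<^esub> inv\<^bsub>A5\<^esub> pr g \<in> X" using c.translate_closed pg unfolding rs(2) by simp
    have "\<omega> #>\<^bsub>A5\<^esub> inv\<^bsub>A5\<^esub> pr g \<in> S \<longleftrightarrow> \<omega> \<in> act g ` S"
    proof
      assume a: "\<omega> #>\<^bsub>A5\<^esub> inv\<^bsub>A5\<^esub> pr g \<in> S"
      have "(\<omega> #>\<^bsub>A5\<^esub> inv\<^bsub>A5\<^esub> pr g) #>\<^bsub>A5\<^esub> pr g = \<omega>"
        using c.translate_eq_iff[of "\<omega> #>\<^bsub>A5\<^esub> inv\<^bsub>A5\<^esub> pr g" \<omega> "pr g"] w w' pg unfolding rs(2) by blast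
      then show "\<omega> \<in> act g ` S" using a unfolding act_def by (metis image_eqI)
    next
      assume "\<omega> \<in> act g ` S"
      then obtain \<nu> where v: "\<nu> \<in> S" "\<omega> = \<nu> #>\<^bsub>A5\<^esub> pr g" unfolding act_def by blast
      then have "\<nu> = \<omega> #>\<^bsub>A5\<^esub> inv\<^bsub>A5\<^esub> pr g"
        using c.translate_eq_iff[of \<nu> \<omega> "pr g"] w S pg unfolding rs(2) by blast
      then show "\<omega> #>\<^bsub>A5\<^esub> inv\<^bsub>A5\<^esub> pr g \<in> S" using v by simp
    qed
    then show "(\<lambda>\<omega>\<in>X. if \<omega> \<in> S then 1 else 0) (\<omega> #>\<^bsub>A5\<^esub> inv\<^bsub>A5\<^esub> pr g) = (if \<omega> \<in> act g ` S then 1 else (0::int))"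
      using w' by simp
  qed
  then show ?thesis
    using M_module g indic_closed[of D S] unfolding coset_module_iso_def m_def by metis
qed

lemma finX: "finite X"
proof -
  obtain r s where rs: "dihedral_coset_action A5 r s" "D = generate A5 {r, s}" using coset_action .
  interpret c: dihedral_coset_action "alt_group 5" r s by (rule rs(1))
  show ?thesis using c.fin_cosets unfolding rs(2) .
qed

text \<open>The module is finite, being isomorphic to a quotient of the vectors, and \<open>G1\<close> is an extension of \<open>A\<^sub>5\<close> by it.\<close>

lemma fin_G1: "finite (carrier G1)"
proof -
  have finM: "finite M" unfolding M_eq using finX by simp
  define t where "t = inv_into (carrier G1) pr"
  have t: "t a \<in> carrier G1 \<and> pr (t a) = a" if "a \<in> carrier A5" for a
    unfolding t_def using inv_into_into[of a pr "carrier G1"] f_inv_into_f[of a pr "carrier G1"] that pr_surj by simp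
  have sub: "carrier G1 \<subseteq> (\<lambda>(a, n). t a \<otimes>\<^bsub>G1\<^esub> n) ` (carrier A5 \<times> M)"
  proof
    fix g assume g: "g \<in> carrier G1"
    let ?a = "pr g" and ?n = "inv\<^bsub>G1\<^esub> (t (pr g)) \<otimes>\<^bsub>G1\<^esub> g"
    have a: "?a \<in> carrier A5" using pr.hom_closed[OF g] .
    have ta: "t ?a \<in> carrier G1" "pr (t ?a) = ?a" using t[OF a] by auto
    have n: "?n \<in> carrier G1" using ta g by simp
    have "pr ?n = inv\<^bsub>A5\<^esub> pr (t ?a) \<otimes>\<^bsub>A5\<^esub> pr g" using ta(1) g pr.hom_mult pr.hom_inv by simp
    then have "?n \<in> M" using n a unfolding ta(2) M_iff by simp
    moreover have "g = t ?a \<otimes>\<^bsub>G1\<^esub> ?n" using ta g by (simp flip: G1.m_assoc)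
    ultimately show "g \<in> (\<lambda>(a, n). t a \<otimes>\<^bsub>G1\<^esub> n) ` (carrier A5 \<times> M)" using a by (intro image_eqI[of _ _ "(?a, ?n)"]) auto
  qed
  show ?thesis by (rule finite_subset[OF sub]) (intro finite_imageI finite_cartesian_product finite_A5 finM)
qed

lemma sign_conj: "p \<in> K \<Longrightarrow> g \<in> carrier P \<Longrightarrow> inv\<^bsub>P\<^esub> g \<otimes>\<^bsub>P\<^esub> p \<otimes>\<^bsub>P\<^esub> g \<in> L \<longleftrightarrow> p \<in> L"
proof -
  assume p: "p \<in> K" and g: "g \<in> carrier P"
  have pc: "p \<in> carrier P" using p K_carrier by blast
  have bk: "g \<otimes>\<^bsub>P\<^esub> (inv\<^bsub>P\<^esub> g \<otimes>\<^bsub>P\<^esub> p \<otimes>\<^bsub>P\<^esub> g) \<otimes>\<^bsub>P\<^esub> inv\<^bsub>P\<^esub> g = p"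
  proof -
    have "g \<otimes>\<^bsub>P\<^esub> (inv\<^bsub>P\<^esub> g \<otimes>\<^bsub>P\<^esub> p \<otimes>\<^bsub>P\<^esub> g) \<otimes>\<^bsub>P\<^esub> inv\<^bsub>P\<^esub> g = (g \<otimes>\<^bsub>P\<^esub> inv\<^bsub>P\<^esub> g) \<otimes>\<^bsub>P\<^esub> p \<otimes>\<^bsub>P\<^esub> (g \<otimes>\<^bsub>P\<^esub> inv\<^bsub>P\<^esub> g)"
      using g pc by (simp add: m_assoc del: r_inv)
    then show ?thesis using g pc by simp
  qed
  show ?thesis
    using normal.inv_op_closed1[OF normal(2) g, of p] normal.inv_op_closed2[OF normal(2) g, of "inv\<^bsub>P\<^esub> g \<otimes>\<^bsub>P\<^esub> p \<otimes>\<^bsub>P\<^esub> g"] bk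
    by auto
qed

lemma act_transitive:
  assumes "v \<in> X" "w \<in> X" shows "\<exists>g\<in>carrier G1. act g v = w"
proof -
  obtain r s where rs: "dihedral_coset_action A5 r s" "D = generate A5 {r, s}" using coset_action .
  interpret c: dihedral_coset_action "alt_group 5" r s by (rule rs(1))
  obtain a where a: "a \<in> carrier A5" "v #>\<^bsub>A5\<^esub> a = w" using c.transitive assms unfolding rs(2) by blast
  then have "a \<in> pr ` carrier G1" using pr_surj by simp
  then obtain g where "a = pr g" "g \<in> carrier G1" by (rule imageE)
  then show ?thesis using a unfolding act_def by blast
qed

text \<open>The homomorphism \<open>K/K1 \<rightarrow> K/L\<close> is invariant under conjugation and not trivial, so it takes the
  value \<open>-1\<close> on each basis vector.\<close>

lemma in_L_iff_even:
  assumes p: "p \<in> K" and S: "S \<subseteq> X" and e: "q1 p = m S"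
  shows "p \<in> L \<longleftrightarrow> even (card S)"
proof -
  have finX: "finite X" by (rule finX)
  have same: "a \<in> L \<longleftrightarrow> b \<in> L" if "a \<in> K" "b \<in> K" "q1 a = q1 b" for a b
  proof -
    have c: "a \<in> carrier P" "b \<in> carrier P" using that K_carrier by auto
    have "a \<otimes>\<^bsub>P\<^esub> inv\<^bsub>P\<^esub> b \<in> L" using q1_eq_iff[OF c] that(3) K1_sub_L by blast
    then have "(a \<in> L) = (inv\<^bsub>P\<^esub> b \<in> L)" using K_mult_L that(1,2) subgroup.m_inv_closed[OF sub(1)] by blast
    then show ?thesis using subgroup.m_inv_closed[OF sub(2)] inv_inv[OF c(2)] by metis
  qed
  define neg where "neg \<omega> \<longleftrightarrow> (\<exists>a\<in>K - L. q1 a = m {\<omega>})" for \<omega>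
  have ex: "\<exists>a\<in>K. q1 a = m S'" if "S' \<subseteq> X" for S' using m_in_M[OF that] M_elem by metis
  have step: "b \<in> L \<longleftrightarrow> (a \<in> L \<longleftrightarrow> \<not> neg \<omega>)"
    if "\<omega> \<in> X" "\<omega> \<notin> S'" "S' \<subseteq> X" "a \<in> K" "q1 a = m S'" "b \<in> K" "q1 b = m (insert \<omega> S')" for \<omega> S' a b
  proof -
    obtain c where c: "c \<in> K" "q1 c = m {\<omega>}" using ex[of "{\<omega>}"] \<open>\<omega> \<in> X\<close> by blast
    have n: "neg \<omega> \<longleftrightarrow> c \<notin> L" unfolding neg_def using c same by (metis Diff_iff)
    have s: "sym_diff S' {\<omega>} = insert \<omega> S'" using that by blast
    have "q1 (a \<otimes>\<^bsub>P\<^esub> c) = q1 a \<otimes>\<^bsub>G1\<^esub> q1 c" using K_carrier[OF that(4)] K_carrier[OF c(1)] by simp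
    also have "\<dots> = m (insert \<omega> S')" unfolding that(5) c(2) m_add s ..
    finally have "b \<in> L \<longleftrightarrow> a \<otimes>\<^bsub>P\<^esub> c \<in> L" using same that subgroup.m_closed[OF sub(1) that(4) c(1)] by metis
    then show ?thesis using K_mult_L[OF that(4) c(1)] n by blast
  qed
  have inv: "neg \<omega>'" if w: "neg \<omega>" "\<omega> \<in> X" "\<omega>' \<in> X" for \<omega> \<omega>'
  proof -
    obtain a where a: "a \<in> K" "a \<notin> L" "q1 a = m {\<omega>}" using w(1) unfolding neg_def by blast
    obtain g where g: "g \<in> carrier G1" "act g \<omega> = \<omega>'" using act_transitive[OF w(2,3)] by blast
    obtain h where h: "h \<in> carrier P" "g = q1 h" using g(1) G1_elem by blast
    have ac: "a \<in> carrier P" using a K_carrier by blast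
    have "m {\<omega>'} = conj_by G1 (q1 a) g" using conj_m[of "{\<omega>}" g] w(2) g a by simp
    also have "\<dots> = q1 (inv\<^bsub>P\<^esub> h \<otimes>\<^bsub>P\<^esub> a \<otimes>\<^bsub>P\<^esub> h)" unfolding conj_by_def h(2) using h(1) ac by simp
    finally have "q1 (inv\<^bsub>P\<^esub> h \<otimes>\<^bsub>P\<^esub> a \<otimes>\<^bsub>P\<^esub> h) = m {\<omega>'}" by simp
    moreover have "inv\<^bsub>P\<^esub> h \<otimes>\<^bsub>P\<^esub> a \<otimes>\<^bsub>P\<^esub> h \<in> K" using normal.inv_op_closed1[OF normal(1) h(1) a(1)] .
    ultimately show ?thesis using sign_conj[OF a(1) h(1)] a(2) unfolding neg_def by blast
  qed
  have base: "a \<in> L" if "a \<in> K" "q1 a = m {}" for a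
  proof -
    have "m {} \<otimes>\<^bsub>G1\<^esub> m {} = m {}" unfolding m_add by simp
    then have "m {} = \<one>\<^bsub>G1\<^esub>" using G1.l_cancel_one[OF m_closed m_closed, of "{}" "{}"] by simp
    then have "q1 a = q1 \<one>\<^bsub>P\<^esub>" using that q_one by simp
    then show ?thesis using same[of a "\<one>\<^bsub>P\<^esub>"] that subgroup.one_closed[OF sub(1)] subgroup.one_closed[OF sub(2)] by blast
  qed
  have count: "a \<in> L \<longleftrightarrow> even (card {\<omega> \<in> S'. neg \<omega>})" if "S' \<subseteq> X" "a \<in> K" "q1 a = m S'" for S' a
  proof -
    have "finite S'" using that finX finite_subset by blast
    then show ?thesis using that
    proof (induction S' arbitrary: a)
      case empty then show ?case using base by simp
    next
      case (insert \<omega> S')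
      obtain b where b: "b \<in> K" "q1 b = m S'" using ex insert.prems by blast
      have "a \<in> L \<longleftrightarrow> (b \<in> L \<longleftrightarrow> \<not> neg \<omega>)" using step[of \<omega> S' b a] insert b by blast
      moreover have "b \<in> L \<longleftrightarrow> even (card {\<omega> \<in> S'. neg \<omega>})" using insert b by blast
      moreover have "{\<nu> \<in> insert \<omega> S'. neg \<nu>} = (if neg \<omega> then insert \<omega> {\<nu> \<in> S'. neg \<nu>} else {\<nu> \<in> S'. neg \<nu>})" by auto
      ultimately show ?case using insert.hyps by auto
    qed
  qed
  obtain k where k: "k \<in> K" "k \<notin> L" using exists_minus mat5_one_neq by (metis L_iff)
  obtain S' where S': "S' \<subseteq> X" "q1 k = m S'" using q1_in_M[OF K_carrier[OF k(1)]] k(1) unfolding M_eq by blast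
  have "{\<omega> \<in> S'. neg \<omega>} \<noteq> {}" using count[OF S'(1) k(1) S'(2)] k(2) by (metis card.empty even_zero)
  then obtain \<omega> where "\<omega> \<in> X" "neg \<omega>" using S'(1) by blast
  then have "{\<omega> \<in> S. neg \<omega>} = S" using inv S by blast
  then show ?thesis using count[OF S p e] by simp
qed

end

context coset_module_cover
begin

section \<open>The cover as a group with a module on six points\<close>

lemma act_facts:
  shows card_X: "card X = 6"
    and act_closed: "g \<in> carrier G1 \<Longrightarrow> w \<in> X \<Longrightarrow> act g w \<in> X"
    and act_mult: "g \<in> carrier G1 \<Longrightarrow> h \<in> carrier G1 \<Longrightarrow> w \<in> X \<Longrightarrow> act (g \<otimes>\<^bsub>G1\<^esub> h) w = act h (act g w)"
    and act_trivial: "g \<in> carrier G1 \<Longrightarrow> (\<forall>w\<in>X. act g w = w) \<longleftrightarrow> g \<in> M"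
    and stabilizer_order: "g \<in> carrier G1 \<Longrightarrow> w \<in> X \<Longrightarrow> act g w = w \<Longrightarrow>
      g \<otimes>\<^bsub>G1\<^esub> g \<in> M \<or> g [^]\<^bsub>G1\<^esub> (5::nat) \<in> M"
    and involution_fixes: "g \<in> carrier G1 \<Longrightarrow> g \<notin> M \<Longrightarrow> g \<otimes>\<^bsub>G1\<^esub> g \<in> M \<Longrightarrow> u \<in> X \<Longrightarrow> v \<in> X \<Longrightarrow> w \<in> X \<Longrightarrow>
      u \<noteq> v \<Longrightarrow> u \<noteq> w \<Longrightarrow> act g u = u \<Longrightarrow> act g v = v \<Longrightarrow> act g w = w \<Longrightarrow> v = w"
    and four_group: "\<exists>s\<in>carrier G1. \<exists>t\<in>carrier G1. \<exists>v\<in>X. \<exists>w\<in>X.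
      s \<otimes>\<^bsub>G1\<^esub> s \<in> M \<and> t \<otimes>\<^bsub>G1\<^esub> t \<in> M \<and> act s v = v \<and> act t w = w \<and>
      (\<forall>u\<in>X. act (s \<otimes>\<^bsub>G1\<^esub> t) u = act (t \<otimes>\<^bsub>G1\<^esub> s) u \<and> \<not> (act s u = u \<and> act t u = u))"
proof -
  obtain r s where rs: "dihedral_coset_action A5 r s" "D = generate A5 {r, s}" using coset_action .
  interpret c: dihedral_coset_action "alt_group 5" r s by (rule rs(1))
  note D = rs(2)[symmetric]
  have prc: "pr g \<in> carrier A5" if "g \<in> carrier G1" for g using pr.hom_closed[OF that] .
  have sqM: "g \<otimes>\<^bsub>G1\<^esub> g \<in> M \<longleftrightarrow> pr g \<otimes>\<^bsub>A5\<^esub> pr g = \<one>\<^bsub>A5\<^esub>" if "g \<in> carrier G1" for g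
    unfolding M_iff pr.hom_mult[OF that that] using that by simp
  show "card X = 6" using c.card_cosets unfolding D .
  show "act g w \<in> X" if "g \<in> carrier G1" "w \<in> X" for g w
    unfolding act_def using c.translate_closed[unfolded D] that prc by blast
  show am: "act (g \<otimes>\<^bsub>G1\<^esub> h) w = act h (act g w)" if "g \<in> carrier G1" "h \<in> carrier G1" "w \<in> X" for g h w
    unfolding act_def pr.hom_mult[OF that(1,2)] using c.translate[unfolded D, OF that(3) prc[OF that(1)] prc[OF that(2)]] by simp
  show "(\<forall>w\<in>X. act g w = w) \<longleftrightarrow> g \<in> M" if g: "g \<in> carrier G1" for g
  proof
    assume "\<forall>w\<in>X. act g w = w"
    then have "pr g = \<one>\<^bsub>A5\<^esub>" using c.faithful[unfolded D, OF prc[OF g]] unfolding act_def by blast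
    then show "g \<in> M" using g M_iff by blast
  next
    assume "g \<in> M"
    then have "pr g = \<one>\<^bsub>A5\<^esub>" using M_iff by blast
    then show "\<forall>w\<in>X. act g w = w" unfolding act_def using c.translate_one[unfolded D] by simp
  qed
  show "g \<otimes>\<^bsub>G1\<^esub> g \<in> M \<or> g [^]\<^bsub>G1\<^esub> (5::nat) \<in> M" if g: "g \<in> carrier G1" and w: "w \<in> X" "act g w = w" for g w
  proof -
    have "pr g \<otimes>\<^bsub>A5\<^esub> pr g = \<one>\<^bsub>A5\<^esub> \<or> pr g [^]\<^bsub>A5\<^esub> (5::nat) = \<one>\<^bsub>A5\<^esub>"
      using c.stabilizer_order[unfolded D, OF w(1) prc[OF g]] w(2) unfolding act_def by blast
    moreover have "pr (g [^]\<^bsub>G1\<^esub> (5::nat)) = pr g [^]\<^bsub>A5\<^esub> (5::nat)" by (rule pr.hom_nat_pow[OF g])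
    ultimately show ?thesis using sqM[OF g] M_iff[of "g [^]\<^bsub>G1\<^esub> (5::nat)"] G1.nat_pow_closed[OF g] by metis
  qed
  show "v = w"
    if "g \<in> carrier G1" "g \<notin> M" "g \<otimes>\<^bsub>G1\<^esub> g \<in> M" "u \<in> X" "v \<in> X" "w \<in> X" "u \<noteq> v" "u \<noteq> w"
      "act g u = u" "act g v = v" "act g w = w" for g u v w
  proof (rule c.involution_fixes[unfolded D])
    show "pr g \<in> carrier A5" by (rule prc[OF that(1)])
    show "pr g \<otimes>\<^bsub>A5\<^esub> pr g = \<one>\<^bsub>A5\<^esub>" using sqM that by blast
    show "pr g \<noteq> \<one>\<^bsub>A5\<^esub>" using that(1,2) M_iff by blast
    show "u \<in> X" "v \<in> X" "w \<in> X" "u \<noteq> v" "u \<noteq> w" by (fact that)+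
    show "u #>\<^bsub>A5\<^esub> pr g = u" "v #>\<^bsub>A5\<^esub> pr g = v" "w #>\<^bsub>A5\<^esub> pr g = w" using that(9-11) unfolding act_def .
  qed
  obtain a where a: "a \<in> carrier A5" and ab1: "\<exists>b\<in>carrier A5. \<exists>v\<in>X. \<exists>w\<in>X.
      a \<otimes>\<^bsub>A5\<^esub> a = \<one>\<^bsub>A5\<^esub> \<and> b \<otimes>\<^bsub>A5\<^esub> b = \<one>\<^bsub>A5\<^esub> \<and> v #>\<^bsub>A5\<^esub> a = v \<and> w #>\<^bsub>A5\<^esub> b = w \<and> a \<otimes>\<^bsub>A5\<^esub> b = b \<otimes>\<^bsub>A5\<^esub> a \<and>
      (\<forall>\<omega>\<in>X. \<not> (\<omega> #>\<^bsub>A5\<^esub> a = \<omega> \<and> \<omega> #>\<^bsub>A5\<^esub> b = \<omega>))"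
    using c.four_group[unfolded D] by (rule bexE)
  from ab1 obtain b where b: "b \<in> carrier A5" and ab2: "\<exists>v\<in>X. \<exists>w\<in>X.
      a \<otimes>\<^bsub>A5\<^esub> a = \<one>\<^bsub>A5\<^esub> \<and> b \<otimes>\<^bsub>A5\<^esub> b = \<one>\<^bsub>A5\<^esub> \<and> v #>\<^bsub>A5\<^esub> a = v \<and> w #>\<^bsub>A5\<^esub> b = w \<and> a \<otimes>\<^bsub>A5\<^esub> b = b \<otimes>\<^bsub>A5\<^esub> a \<and>
      (\<forall>\<omega>\<in>X. \<not> (\<omega> #>\<^bsub>A5\<^esub> a = \<omega> \<and> \<omega> #>\<^bsub>A5\<^esub> b = \<omega>))" by (rule bexE)
  from ab2 obtain v w where vw: "v \<in> X" "w \<in> X" and ab3: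
      "a \<otimes>\<^bsub>A5\<^esub> a = \<one>\<^bsub>A5\<^esub> \<and> b \<otimes>\<^bsub>A5\<^esub> b = \<one>\<^bsub>A5\<^esub> \<and> v #>\<^bsub>A5\<^esub> a = v \<and> w #>\<^bsub>A5\<^esub> b = w \<and> a \<otimes>\<^bsub>A5\<^esub> b = b \<otimes>\<^bsub>A5\<^esub> a \<and>
      (\<forall>\<omega>\<in>X. \<not> (\<omega> #>\<^bsub>A5\<^esub> a = \<omega> \<and> \<omega> #>\<^bsub>A5\<^esub> b = \<omega>))" by (elim bexE)
  note ab = a b vw conjunct1[OF ab3] conjunct1[OF conjunct2[OF ab3]] conjunct1[OF conjunct2[OF conjunct2[OF ab3]]]
    conjunct1[OF conjunct2[OF conjunct2[OF conjunct2[OF ab3]]]] conjunct1[OF conjunct2[OF conjunct2[OF conjunct2[OF conjunct2[OF ab3]]]]]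
    conjunct2[OF conjunct2[OF conjunct2[OF conjunct2[OF conjunct2[OF ab3]]]]]
  have "a \<in> pr ` carrier G1" "b \<in> pr ` carrier G1" using ab pr_surj by simp_all
  then obtain g where g: "a = pr g" "g \<in> carrier G1" by (elim imageE)
  obtain h where h: "b = pr h" "h \<in> carrier G1" using \<open>b \<in> pr ` carrier G1\<close> by (rule imageE)
  note gh = g h
  show "\<exists>s\<in>carrier G1. \<exists>t\<in>carrier G1. \<exists>v\<in>X. \<exists>w\<in>X.
      s \<otimes>\<^bsub>G1\<^esub> s \<in> M \<and> t \<otimes>\<^bsub>G1\<^esub> t \<in> M \<and> act s v = v \<and> act t w = w \<and>
      (\<forall>u\<in>X. act (s \<otimes>\<^bsub>G1\<^esub> t) u = act (t \<otimes>\<^bsub>G1\<^esub> s) u \<and> \<not> (act s u = u \<and> act t u = u))"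
  proof (rule bexI[of _ g], rule bexI[of _ h], rule bexI[of _ v], rule bexI[of _ w], intro conjI ballI)
    show "g \<otimes>\<^bsub>G1\<^esub> g \<in> M" "h \<otimes>\<^bsub>G1\<^esub> h \<in> M" using sqM gh ab by auto
    show "act g v = v" "act h w = w" unfolding act_def using gh ab by auto
    fix u assume u: "u \<in> X"
    show "act (g \<otimes>\<^bsub>G1\<^esub> h) u = act (h \<otimes>\<^bsub>G1\<^esub> g) u"
      unfolding act_def pr.hom_mult[OF gh(2,4)] pr.hom_mult[OF gh(4,2)] using ab(9) gh by simp
    show "\<not> (act g u = u \<and> act h u = u)" unfolding act_def using ab(10) gh u by simp
  qed (fact gh ab)+
qed

lemma square_odd:
  assumes g: "g \<in> carrier G1" "g \<notin> M" and S: "S \<subseteq> X" and e: "g \<otimes>\<^bsub>G1\<^esub> g = m S"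
  shows "odd (card S)"
proof
  assume ev: "even (card S)"
  obtain p where p: "p \<in> carrier P" "g = q1 p" using g(1) G1_elem by blast
  have "q1 (p \<otimes>\<^bsub>P\<^esub> p) = q1 p \<otimes>\<^bsub>G1\<^esub> q1 p" using q_mult(1)[OF p(1) p(1)] by (rule sym)
  also have "\<dots> = m S" using e unfolding p(2) .
  finally have q: "q1 (p \<otimes>\<^bsub>P\<^esub> p) = m S" .
  then have K: "p \<otimes>\<^bsub>P\<^esub> p \<in> K" using q1_in_M[OF monoid.m_closed[OF is_monoid p(1) p(1)]] m_in_M[OF S] unfolding q by blast
  have "p \<otimes>\<^bsub>P\<^esub> p \<in> L" using in_L_iff_even[OF K S q] ev by blast
  then have "p \<in> K" by (rule square_in_L[OF p(1)])
  then show False using g(2) q1_in_M[OF p(1)] p(2) by simp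
qed

lemma lift_in_K:
  assumes "y \<in> carrier R" "S \<subseteq> X" "\<pi> y = m S"
  obtains p where "p \<in> K" "y = q2 p" "p \<in> L \<longleftrightarrow> even (card S)" "y \<otimes>\<^bsub>R\<^esub> y = q2 (p \<otimes>\<^bsub>P\<^esub> p)"
proof -
  have "\<pi> y \<in> M" using assms(2,3) m_in_M by simp
  then obtain p where p: "p \<in> K" "y = q2 p" "\<pi> y = q1 p" using \<pi>_in_M[OF assms(1)] by blast
  have "q1 p = m S" using p(3) assms(3) by simp
  then have "p \<in> L \<longleftrightarrow> even (card S)" by (rule in_L_iff_even[OF p(1) assms(2)])
  moreover have "y \<otimes>\<^bsub>R\<^esub> y = q2 (p \<otimes>\<^bsub>P\<^esub> p)" unfolding p(2) by (rule q_mult(2)) (use K_carrier[OF p(1)] in simp_all)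
  ultimately show ?thesis using that p(1,2) by blast
qed

lemma lift_even:
  assumes "y \<in> carrier R" "S \<subseteq> X" "\<pi> y = m S" "even (card S)" shows "y \<otimes>\<^bsub>R\<^esub> y = \<one>\<^bsub>R\<^esub>"
  using lift_in_K[OF assms(1-3)] q2_sq_L assms(4) by metis

text \<open>The square lies in the kernel of \<open>\<pi>\<close>. Were it trivial, \<open>K1\<close> and \<open>K1'\<close> would coincide and \<open>\<pi>\<close> would be injective.\<close>

lemma lift_odd:
  assumes "y \<in> carrier R" "S \<subseteq> X" "\<pi> y = m S" "odd (card S)" shows "y \<otimes>\<^bsub>R\<^esub> y = z"
proof -
  obtain p where p: "p \<in> K" "y = q2 p" "p \<in> L \<longleftrightarrow> even (card S)" "y \<otimes>\<^bsub>R\<^esub> y = q2 (p \<otimes>\<^bsub>P\<^esub> p)"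
    using lift_in_K[OF assms(1-3)] .
  have "\<pi> (y \<otimes>\<^bsub>R\<^esub> y) = m S \<otimes>\<^bsub>G1\<^esub> m S" using hom_mult[OF \<pi>_hom assms(1,1)] assms(3) by simp
  also have "\<dots> = \<one>\<^bsub>G1\<^esub>"
  proof -
    have "m S \<otimes>\<^bsub>G1\<^esub> m S = m {}" "m {} \<otimes>\<^bsub>G1\<^esub> m {} = m {}" unfolding m_add by simp_all
    then show ?thesis using G1.l_cancel_one[OF m_closed m_closed, of "{}" "{}"] by simp
  qed
  finally have "\<pi> (y \<otimes>\<^bsub>R\<^esub> y) = \<one>\<^bsub>G1\<^esub>" .
  then have "y \<otimes>\<^bsub>R\<^esub> y \<in> kernel R G1 \<pi>" unfolding kernel_def[of R] using R.m_closed[OF assms(1,1)] by blast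
  moreover have "y \<otimes>\<^bsub>R\<^esub> y \<noteq> \<one>\<^bsub>R\<^esub>"
  proof
    assume "y \<otimes>\<^bsub>R\<^esub> y = \<one>\<^bsub>R\<^esub>"
    then have sub: "K1 \<subseteq> K1'" using K1_sub_of_trivial_square[of p] p assms(4) by simp
    have "z \<in> kernel R G1 \<pi>" unfolding minus_one(1) by blast
    then have z: "z \<in> carrier R" "\<pi> z = \<one>\<^bsub>G1\<^esub>" unfolding kernel_def[of R] by blast+
    obtain k where k: "k \<in> carrier P" "z = q2 k" using z(1) R_elem by blast
    have "q1 k = q1 \<one>\<^bsub>P\<^esub>" using z(2) \<pi>_q2[OF k(1)] k(2) q_one by simp
    then have "k \<in> K1" using q1_eq_iff[OF k(1) one_closed] k(1) by simp
    then have "k \<in> K1'" using sub by blast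
    then show False using q2_one_iff[OF k(1)] k(2) minus_one(2) by blast
  qed
  ultimately show ?thesis using minus_one(1) by blast
qed

lemma lift_comm:
  assumes "x \<in> carrier R" "y \<in> carrier R" "\<pi> x \<in> M" "\<pi> y \<in> M" shows "x \<otimes>\<^bsub>R\<^esub> y = y \<otimes>\<^bsub>R\<^esub> x"
proof -
  obtain p where p: "p \<in> K" "x = q2 p" using \<pi>_in_M[OF assms(1,3)] by blast
  obtain q where q: "q \<in> K" "y = q2 q" using \<pi>_in_M[OF assms(2,4)] by blast
  show ?thesis
    unfolding p(2) q(2) using q2_comm[OF p(1) q(1)] q_mult(2)[OF K_carrier[OF p(1)] K_carrier[OF q(1)]]
      q_mult(2)[OF K_carrier[OF q(1)] K_carrier[OF p(1)]] by metis
qed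

lemma generating_pair:
  assumes gh: "g \<in> carrier G1" "h \<in> carrier G1" "G1.ord g = 3" "G1.ord h = 3" "generate G1 {g, h} = carrier G1"
  shows "inv\<^bsub>G1\<^esub> h \<otimes>\<^bsub>G1\<^esub> g \<notin> M \<and> (\<exists>S\<subseteq>X. odd (card S) \<and> (inv\<^bsub>G1\<^esub> h \<otimes>\<^bsub>G1\<^esub> g) [^]\<^bsub>G1\<^esub> (5::nat) = m S)"
proof -
  obtain p where p: "p \<in> carrier P" "g = q1 p" using gh(1) G1_elem by blast
  obtain q where q: "q \<in> carrier P" "h = q1 q" using gh(2) G1_elem by blast
  have cube: "a \<otimes>\<^bsub>P\<^esub> a \<otimes>\<^bsub>P\<^esub> a \<in> L" if a: "a \<in> carrier P" "G1.ord (q1 a) = 3" for a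
  proof -
    have qa: "q1 a \<in> carrier G1" using q1.hom_closed[OF a(1)] .
    have "q1 a [^]\<^bsub>G1\<^esub> (3::nat) = \<one>\<^bsub>G1\<^esub>" using G1.pow_ord_eq_1[OF qa] a(2) by simp
    then have "q1 (a \<otimes>\<^bsub>P\<^esub> a \<otimes>\<^bsub>P\<^esub> a) = \<one>\<^bsub>G1\<^esub>" using a(1) qa by (simp add: numeral_3_eq_3)
    then have "q1 (a \<otimes>\<^bsub>P\<^esub> a \<otimes>\<^bsub>P\<^esub> a) = q1 \<one>\<^bsub>P\<^esub>" using q_one by simp
    then have "a \<otimes>\<^bsub>P\<^esub> a \<otimes>\<^bsub>P\<^esub> a \<in> K1" using q1_eq_iff[of "a \<otimes>\<^bsub>P\<^esub> a \<otimes>\<^bsub>P\<^esub> a" "\<one>\<^bsub>P\<^esub>"] a(1) by simp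
    then show ?thesis using K1_sub_L by blast
  qed
  have "generate A5 (pr ` {g, h}) = pr ` generate G1 {g, h}" using gh by (intro pr.generate_img) simp
  then have gen: "generate A5 {\<phi> p, \<phi> q} = carrier A5"
    using gh(5) pr_surj pr_q1[OF p(1)] pr_q1[OF q(1)] unfolding p(2) q(2) by simp
  note r = generating_ratio[OF p(1) cube[OF p(1)] q(1) cube[OF q(1)] gen]
  have e: "q1 (inv\<^bsub>P\<^esub> q \<otimes>\<^bsub>P\<^esub> p) = inv\<^bsub>G1\<^esub> h \<otimes>\<^bsub>G1\<^esub> g" unfolding p(2) q(2) using p(1) q(1) by simp
  have c: "inv\<^bsub>P\<^esub> q \<otimes>\<^bsub>P\<^esub> p \<in> carrier P" using p(1) q(1) by simp
  have o: "G1.ord (q1 p) = 3" "G1.ord (q1 q) = 3" using gh(3,4) unfolding p(2) q(2) .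
  have "inv\<^bsub>G1\<^esub> h \<otimes>\<^bsub>G1\<^esub> g \<notin> M" using r(1)[OF o] q1_in_M[OF c] unfolding e by blast
  moreover have "\<exists>S\<subseteq>X. odd (card S) \<and> (inv\<^bsub>G1\<^esub> h \<otimes>\<^bsub>G1\<^esub> g) [^]\<^bsub>G1\<^esub> (5::nat) = m S"
  proof -
    let ?w = "(inv\<^bsub>P\<^esub> q \<otimes>\<^bsub>P\<^esub> p) [^]\<^bsub>P\<^esub> (5::nat)"
    have w: "?w \<in> K" "?w \<notin> L" using r(2)[OF o] by auto
    have ew: "q1 ?w = (inv\<^bsub>G1\<^esub> h \<otimes>\<^bsub>G1\<^esub> g) [^]\<^bsub>G1\<^esub> (5::nat)" unfolding e[symmetric] by (rule q1.hom_nat_pow[OF c])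
    have "q1 ?w \<in> M" using q1_in_M[OF K_carrier[OF w(1)]] w(1) by blast
    then obtain S where S: "S \<subseteq> X" "q1 ?w = m S" unfolding M_eq by blast
    then have "odd (card S)" using in_L_iff_even[OF w(1) S] w(2) by blast
    then show ?thesis using S ew by metis
  qed
  ultimately show ?thesis ..
qed

lemma six_point: "six_point_cover G1 R \<pi> z X act m"
proof (intro six_point_cover.intro six_point_cover_axioms.intro)
  show "group G1" "group R" by (rule G1.is_group R.is_group)+
  show "\<pi> \<in> hom R G1" "\<pi> ` carrier R = carrier G1" "kernel R G1 \<pi> = {\<one>\<^bsub>R\<^esub>, z}" "z \<noteq> \<one>\<^bsub>R\<^esub>"
    by (rule \<pi>_hom \<pi>_surj minus_one)+
  show "finite (carrier G1)" "card X = 6" by (rule fin_G1 card_X)+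
  show "H = carrier G1" if "subgroup H G1" "\<forall>g\<in>carrier G1. \<exists>h\<in>H. \<exists>n\<in>m ` Pow X. g = h \<otimes>\<^bsub>G1\<^esub> n" for H
    using frattini_G1[OF fin_G1 that(1)] that(2) unfolding M_eq by blast
  show "m S \<otimes>\<^bsub>G1\<^esub> m S' = m (sym_diff S S')" for S S' by (rule m_add)
qed (fact act_closed act_mult act_transitive m_closed m_eq conj_m act_trivial[unfolded M_eq]
  square_odd[unfolded M_eq] lift_even lift_odd lift_comm[unfolded M_eq] stabilizer_order[unfolded M_eq]
  involution_fixes[unfolded M_eq] four_group[unfolded M_eq] generating_pair[unfolded M_eq])+

lemma indic_weight:
  "{\<iota> (vec_class D v) | v. v \<in> carrier (coset_vectors D) \<and> Q (weight D v)} = {m S | S. S \<subseteq> X \<and> Q (card S)}"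
proof (intro equalityI subsetI)
  fix g assume "g \<in> {\<iota> (vec_class D v) | v. v \<in> carrier (coset_vectors D) \<and> Q (weight D v)}"
  then obtain v where v: "v \<in> carrier (coset_vectors D)" "Q (weight D v)" "g = \<iota> (vec_class D v)" by blast
  let ?S = "{\<omega> \<in> X. v \<omega> \<noteq> 0}"
  have "g = m ?S" unfolding m_def v(3) using vector_indic[OF v(1)] by (rule arg_cong)
  moreover have "Q (card ?S)" using v(2) by (simp add: weight_def)
  ultimately show "g \<in> {m S | S. S \<subseteq> X \<and> Q (card S)}" by blast
next
  fix g assume "g \<in> {m S | S. S \<subseteq> X \<and> Q (card S)}"
  then obtain S where "S \<subseteq> X" "Q (card S)" "g = \<iota> (vec_class D (indic D S))" unfolding m_def by blast
  then show "g \<in> {\<iota> (vec_class D v) | v. v \<in> carrier (coset_vectors D) \<and> Q (weight D v)}"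
    using indic_closed[of D S] weight_indic[of S D] by auto
qed

lemma M_minus_V:
  "M - {\<iota> (vec_class D v) | v. v \<in> carrier (coset_vectors D) \<and> even (weight D v)} = {m S | S. S \<subseteq> X \<and> odd (card S)}"
proof -
  have "odd (card S)" if "S \<subseteq> X" "m S \<notin> {m S | S. S \<subseteq> X \<and> even (card S)}" for S using that by blast
  moreover have "odd (card S) \<Longrightarrow> even (card S') \<Longrightarrow> S \<subseteq> X \<Longrightarrow> S' \<subseteq> X \<Longrightarrow> m S \<noteq> m S'" for S S'
    using m_eq[of S S'] card_Diff_subset[of S X] card_X finX by (auto simp: finite_subset)
  ultimately show ?thesis unfolding indic_weight M_eq by blast
qed

lemma odd_weight:
  assumes "odd n"
  shows "{a \<in> M - {\<iota> (vec_class D v) | v. v \<in> carrier (coset_vectors D) \<and> even (weight D v)}.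
      \<exists>v\<in>carrier (coset_vectors D). weight D v = n \<and> a = \<iota> (vec_class D v)} = {m S | S. S \<subseteq> X \<and> card S = n}"
proof -
  have "{a \<in> M - {\<iota> (vec_class D v) | v. v \<in> carrier (coset_vectors D) \<and> even (weight D v)}.
      \<exists>v\<in>carrier (coset_vectors D). weight D v = n \<and> a = \<iota> (vec_class D v)}
    = (M - {\<iota> (vec_class D v) | v. v \<in> carrier (coset_vectors D) \<and> even (weight D v)}) \<inter>
      {\<iota> (vec_class D v) | v. v \<in> carrier (coset_vectors D) \<and> weight D v = n}" by blast
  also have "\<dots> = {m S | S. S \<subseteq> X \<and> card S = n}"
    unfolding M_minus_V indic_weight[of "\<lambda>k. k = n"] using assms by blast
  finally show ?thesis .
qed

end

theorem proposition9p8: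
  fixes P :: "'p monoid" and T :: "'p topology" and \<phi> :: "'p \<Rightarrow> nat \<Rightarrow> nat"
    and \<sigma> :: "'p \<Rightarrow> 5 ^ 2 ^ 2" and D :: "(nat \<Rightarrow> nat) set"
    and \<iota> :: "((nat \<Rightarrow> nat) set \<Rightarrow> int) set \<Rightarrow> 'p set"
    and G1 R :: "'p set monoid" and pr :: "'p set \<Rightarrow> nat \<Rightarrow> nat" and \<pi> :: "'p set \<Rightarrow> 'p set"
    and K0 K0s K1 K1' :: "'p set" and M V M3' M5' :: "'p set set"
    and z :: "'p set" and Op Om :: "'p set quad set set set"
  assumes universal: "universal_p_frattini_cover 2 (alt_group 5) P T \<phi>"
    and K0: "K0 = kernel P (alt_group 5) \<phi>"
    and to_SL2: "continuous_epi P T SL2_Z5 (discrete_topology (carrier SL2_Z5)) \<sigma>"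
    and K0s: "K0s = kernel P SL2_Z5 \<sigma>"
    and G1: "K1 = comm_sq_closure P T K0 K0" "G1 = P Mod K1"
    and R: "K1' = comm_sq_closure P T K0 K0s" "R = P Mod K1'"
    and pr: "pr = (\<lambda>X. the_elem (\<phi> ` X))"
    and \<pi>: "\<pi> = (\<lambda>Y. K1 <#>\<^bsub>P\<^esub> Y)"
    and minus_one: "kernel R G1 \<pi> = {\<one>\<^bsub>R\<^esub>, z}" "z \<noteq> \<one>\<^bsub>R\<^esub>"
    and M: "M = kernel G1 (alt_group 5) pr"
    and D5: "dihedral_D5 D"
    and M_module: "coset_module_iso D G1 pr M \<iota>"
    and V: "V = {\<iota> (vec_class D v) | v. v \<in> carrier (coset_vectors D) \<and> even (weight D v)}"
    and M3': "M3' = {m \<in> M - V. \<exists>v\<in>carrier (coset_vectors D). weight D v = 3 \<and> m = \<iota> (vec_class D v)}"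
    and M5': "M5' = {m \<in> M - V. \<exists>v\<in>carrier (coset_vectors D). weight D v = 1 \<and> m = \<iota> (vec_class D v)}"
    and two_orbits: "M4_orbits G1 = {Op, Om}" "Op \<noteq> Om"
      "\<exists>g1 g2. HM_rep G1 g1 g2 \<and> reduced_class G1 (HM_tuple G1 g1 g2) \<in> Op"
  shows
    "(\<forall>x\<in>carrier G1. group.ord G1 x = 3 \<longrightarrow> (\<exists>!y. y \<in> lifts R \<pi> x \<and> group.ord R y = 3)) \<and>
     (\<forall>g1 g2. \<forall>a\<in>M. \<forall>b\<in>M. HM_rep G1 g1 g2 \<longrightarrow>
        (\<exists>a'\<in>M - V. \<exists>b'\<in>M - V. g_star G1 g1 g2 a' b' = g_star G1 g1 g2 a b)) \<and>
     (\<forall>g1 g2 a b. g_star_in_Ni G1 (M - V) g1 g2 a b \<longrightarrow>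
        lift_products R \<pi> G1 g1 g2 a b = {lift_invariant R \<pi> (g_star G1 g1 g2 a b)}) \<and>
     (\<forall>Ob\<in>{Op, Om}. \<exists>g1 g2 a b. g_star_in_Ni G1 (M - V) g1 g2 a b \<and>
        reduced_class G1 (g_star G1 g1 g2 a b) \<in> Ob) \<and>
     (\<forall>g1 g2 a b. g_star_in_Ni G1 (M - V) g1 g2 a b \<and>
        reduced_class G1 (g_star G1 g1 g2 a b) \<in> Op \<longrightarrow>
          lift_invariant R \<pi> (g_star G1 g1 g2 a b) = \<one>\<^bsub>R\<^esub> \<and>
          lift_products R \<pi> G1 g1 g2 a b = {\<one>\<^bsub>R\<^esub>} \<and>
          (a, b) \<in> M3' \<times> M3' \<union> M5' \<times> M5') \<and>
     (\<forall>g1 g2 a b. g_star_in_Ni G1 (M - V) g1 g2 a b \<and>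
        reduced_class G1 (g_star G1 g1 g2 a b) \<in> Om \<longrightarrow>
          lift_invariant R \<pi> (g_star G1 g1 g2 a b) = z \<and>
          lift_products R \<pi> G1 g1 g2 a b = {z} \<and>
          (a, b) \<in> M3' \<times> M5' \<union> M5' \<times> M3') \<and>
     (\<forall>Ob\<in>{Op, Om}.
        8 \<le> card {X \<in> Ob. \<exists>g1 g2 a b. g_star_in_Ni G1 (M - V) g1 g2 a b \<and>
                     X = reduced_class G1 (g_star G1 g1 g2 a b)}) \<and>
     (\<forall>g1 g2. HM_rep G1 g1 g2 \<longrightarrow>
        card {X \<in> Op. \<exists>a b. g_star_in_Ni G1 (M - V) g1 g2 a b \<and>
                X = reduced_class G1 (g_star G1 g1 g2 a b)} = 8) \<and>
     (\<forall>Ob\<in>{Op, Om}. \<forall>g1 g2. HM_rep G1 g1 g2 \<longrightarrow>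
        card {inner_class G1 (g_star G1 g1 g2 a b) | a b. g_star_in_Ni G1 (M - V) g1 g2 a b \<and>
                reduced_class G1 (g_star G1 g1 g2 a b) \<in> Ob} = 8)"
proof -
  interpret c: coset_module_cover P T \<phi> \<sigma> D \<iota> z
  proof (intro coset_module_cover.intro coset_module_cover_axioms.intro frattini_SL2.intro)
    show "p_frattini_cover 2 (alt_group 5) P T \<phi>" using universal by (simp add: universal_p_frattini_cover_def)
    show "continuous_epi P T SL2_Z5 (discrete_topology (carrier SL2_Z5)) \<sigma>" "dihedral_D5 D" by (fact to_SL2 D5)+
  qed (use minus_one M_module in \<open>unfold M pr \<pi> R G1 K0 K0s\<close>)
  interpret s: six_point_cover "c.G1" "c.R" "c.\<pi>" z "c.X" c.act c.m by (rule c.six_point)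
  have e: "c.G1 = G1" "c.R = R" "c.\<pi> = \<pi>" "kernel G1 A5 c.pr = M" by (simp_all only: K0 K0s G1 R pr \<pi> M)
  have V: "V = {\<iota> (vec_class D v) | v. v \<in> carrier (coset_vectors D) \<and> even (weight D v)}" by (rule V)
  have odd: "s.odd_part = M - V"
    unfolding s.odd_part_def V c.M_minus_V[unfolded e, symmetric] ..
  have M3: "s.M3 = M3'" unfolding s.M3_def M3' V using c.odd_weight[of 3, unfolded e] by simp
  have M5: "s.M5 = M5'" unfolding s.M5_def M5' V using c.odd_weight[of 1, unfolded e] by simp
  have MM: "c.m ` Pow c.X = M" using c.M_eq unfolding e by simp
  show ?thesis
    using s.two_orbits_described[unfolded e odd M3 M5 MM, OF two_orbits] by (intro conjI) assumption+
qed

end
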